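(* Let $\mathcal{S}$ be a small category admitting binary products and let $\mathbb{H}$ be an $\mathcal{S}$-fibered category. For each of the eight subsets $K\subseteq\{\text{associative},\text{symmetric},\text{unitary}\}$, the construction $E$ sends $K$-internal tensor structures on $\mathbb{H}$ to $K$-external tensor structures on $\mathbb{H}$, the construction $I$ sends $K$-external tensor structures on $\mathbb{H}$ to $K$-internal tensor structures on $\mathbb{H}$, both constructions are compatible with equivalence of $K$-tensor structures, and they induce mutually inverse bijections between equivalence classes of $K$-internal tensor structures on $\mathbb{H}$ and equivalence classes of $K$-external tensor structures on $\mathbb{H}$.
   Context: **Fibered categories.** An $\mathcal{S}$-fibered category $\mathbb{H}$ consists of a category $\mathbb{H}(S)$ for each object $S$, a functor $f^*:\mathbb{H}(S)\to\mathbb{H}(T)$ for each $f:T\to S$, and a natural isomorphism $\mathrm{conn}_{f,g}:(gf)^*A\to f^*g^*A$ (connection isomorphism) for each composable pair $f:T\to S$, $g:S\to V$, such that $\mathrm{id}_S^*=\mathrm{id}_{\mathbb{H}(S)}$; $\mathrm{conn}_{f,g}$ is the identity if $f$ or $g$ is an identity (strict unitality); and $f^*(\mathrm{conn}_{g,h})\circ\mathrm{conn}_{f,hg}=\mathrm{conn}_{f,g}\circ\mathrm{conn}_{gf,h}$ for composable $f,g,h$. Connection isomorphisms are written as equalities. A section $A$ of $\mathbb{H}$ consists of objects $A_S\in\mathbb{H}(S)$ and isomorphisms $A_f^*:f^*A_S\to A_T$ for $f:T\to S$ with $A^*_{gf}=A_f^*\circ f^*(A_g^* )$ (modulo connection isomorphisms).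 An isomorphism of sections $w:A\to B$ is a family of isomorphisms $w_S:A_S\to B_S$ with $B_f^*\circ f^*(w_S)=w_T\circ A_f^*$. **Products.** $pr^{12}_i:S_1\times S_2\to S_i$, $pr^{123}_{12}$, $pr^{123}_{i}$ etc. are the projections, $\Delta_S:S\to S\times S$ and $\Delta_S^{(3)}:S\to S\times S\times S$ the diagonals, $\tau:S_1\times S_2\to S_2\times S_1$ the permutation isomorphism. Iterated products are identified along the canonical associativity isomorphisms (inserting the corresponding inverse image functors and connection isomorphisms). **Internal tensor structures.** An internal tensor structure $(\otimes,m)$ on $\mathbb{H}$: functors $\otimes=\otimes_S:\mathbb{H}(S)\times\mathbb{H}(S)\to\mathbb{H}(S)$ and, for $f:T\to S$, natural isomorphisms $m_f:f^*A\otimes f^*B\to f^*(A\otimes B)$ such that for $f:T\to S$, $g:S\to V$ one has $m_{gf}=f^*(m_g)\circ m_f$ modulo connection isomorphisms, i.e. $m_{gf}$ equals $(gf)^*A\otimes(gf)^*B=f^*g^*A\otimes f^*g^*B\to f^*(g^*A\otimes g^*B)\to f^*g^*(A\otimes B)=(gf)^*(A\otimes B)$. - Associativity constraint: natural isomorphisms $a_S:(A\otimes B)\otimes C\to A\otimes(B\otimes C)$ satisfying the pentagon $a_{A,B,C\otimes D}\circ a_{A\otimes B,C,D}=(A\otimes a_{B,C,D})\circ a_{A,B\otimes C,D}\circ(a_{A,B,C}\otimes D)$, and, for $f:T\to S$, $f^*(a)\circ m_f\circ(m_f\otimes\mathrm{id})=m_f\circ(\mathrm{id}\otimes m_f)\circ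 a$ as maps $(f^*A\otimes f^*B)\otimes f^*C\to f^*(A\otimes(B\otimes C))$. - Commutativity constraint: natural isomorphisms $c_S:A\otimes B\to B\otimes A$ with $c_{B,A}\circ c_{A,B}=\mathrm{id}$ and $f^*(c)\circ m_f=m_f\circ c$. - Unit constraint $u$: a section $\mathbf{1}$ of $\mathbb{H}$ (unit section) and natural isomorphisms $u_r:A\otimes\mathbf{1}_S\to A$, $u_l:\mathbf{1}_S\otimes B\to B$ such that $u_r=u_l$ on $\mathbf{1}_S\otimes\mathbf{1}_S$, $f^*(u_r)\circ m_f=u_r\circ(\mathrm{id}\otimes\mathbf{1}_f^* ):f^*A\otimes f^*\mathbf{1}_S\to f^*A$, and $f^*(u_l)\circ m_f=u_l\circ(\mathbf{1}_f^*\otimes\mathrm{id})$. - Compatibility of $a,c$: $(B\otimes c_{A,C})\circ a_{B,A,C}\circ(c_{A,B}\otimes C)=a_{B,C,A}\circ c_{A,B\otimes C}\circ a_{A,B,C}$. Compatibility of $a,u$: $u_{l}\circ a_{\mathbf{1},B,C}=u_l\otimes C$, $(A\otimes u_l)\circ a_{A,\mathbf{1},C}=u_r\otimes C$, $(A\otimes u_r)\circ a_{A,B,\mathbf{1}}=u_r$. Compatibility of $c,u$: $u_r\circ c_{\mathbf{1},B}=u_l$. **External tensor structures.** An external tensor structure $(\boxtimes,m)$ on $\mathbb{H}$: functors $\boxtimes=\boxtimes_{S_1,S_2}:\mathbb{H}(S_1)\times\mathbb{H}(S_2)\to\mathbb{H}(S_1\times S_2)$ and, for $f_i:T_i\to S_i$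 ($i=1,2$), natural isomorphisms $m_{f_1,f_2}:f_1^*A_1\boxtimes f_2^*A_2\to(f_1\times f_2)^*(A_1\boxtimes A_2)$ such that, for $f_i:T_i\to S_i$, $g_i:S_i\to V_i$, $m_{g_1f_1,g_2f_2}=(f_1\times f_2)^*(m_{g_1,g_2})\circ m_{f_1,f_2}$ modulo connection isomorphisms. - Associativity constraint: natural isomorphisms $a_{S_1,S_2,S_3}:(A_1\boxtimes A_2)\boxtimes A_3\to A_1\boxtimes(A_2\boxtimes A_3)$ in $\mathbb{H}(S_1\times S_2\times S_3)$ satisfying the pentagon $a_{A_1,A_2,A_3\boxtimes A_4}\circ a_{A_1\boxtimes A_2,A_3,A_4}=(A_1\boxtimes a)\circ a_{A_1,A_2\boxtimes A_3,A_4}\circ(a\boxtimes A_4)$ and, for $f_i:T_i\to S_i$ ($i=1,2,3$), $(f_1\times f_2\times f_3)^*(a)\circ m_{f_1\times f_2,f_3}\circ(m_{f_1,f_2}\boxtimes\mathrm{id})=m_{f_1,f_2\times f_3}\circ(\mathrm{id}\boxtimes m_{f_2,f_3})\circ a$. - Commutativity constraint: natural isomorphisms $c_{S_1,S_2}:A_1\boxtimes A_2\to\tau^*(A_2\boxtimes A_1)$ such that $\tau^*(c_{S_2,S_1})\circ c_{S_1,S_2}$ is the identification $A_1\boxtimes A_2=\tau^*\tau^*(A_1\boxtimes A_2)$, and, for $f_i:T_i\to S_i$, $(f_1\times f_2)^*(c)\circ m_{f_1,f_2}$ equals $f_1^*A_1\boxtimes f_2^*A_2\xrightarrow{c}\tau^*(f_2^*A_2\boxtimes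 f_1^*A_1)\xrightarrow{m}\tau^*(f_2\times f_1)^*(A_2\boxtimes A_1)=(f_1\times f_2)^*\tau^*(A_2\boxtimes A_1)$. - Unit constraint $u$: a section $\mathbf{1}$ of $\mathbb{H}$ and natural isomorphisms $u_r:A_1\boxtimes\mathbf{1}_{S_2}\to pr^{12,*}_1A_1$, $u_l:\mathbf{1}_{S_1}\boxtimes A_2\to pr^{12,*}_2A_2$ such that $\mathbf{1}^*_{pr^{12}_1}\circ u_r=\mathbf{1}^*_{pr^{12}_2}\circ u_l:\mathbf{1}_{S_1}\boxtimes\mathbf{1}_{S_2}\to\mathbf{1}_{S_1\times S_2}$ and, for $f_i:T_i\to S_i$, $(f_1\times f_2)^*(u_r)\circ m_{f_1,f_2}=u_r\circ(\mathrm{id}\boxtimes\mathbf{1}^*_{f_2}):f_1^*A_1\boxtimes f_2^*\mathbf{1}_{S_2}\to pr^{12,*}_1f_1^*A_1=(f_1\times f_2)^*pr_1^{12,*}A_1$, and $(f_1\times f_2)^*(u_l)\circ m_{f_1,f_2}=u_l\circ(\mathbf{1}^*_{f_1}\boxtimes\mathrm{id}):f_1^*\mathbf{1}_{S_1}\boxtimes f_2^*A_2\to pr^{12,*}_2f_2^*A_2$. - Compatibility of $a,c$: writing $\tau_{1,23}:S_1\times(S_2\times S_3)\to(S_2\times S_3)\times S_1$ for the permutation isomorphism, the composites $(A_1\boxtimes A_2)\boxtimes A_3\xrightarrow{c}\tau^*(A_2\boxtimes A_1)\boxtimes A_3\xrightarrow{m}(\tau\times\mathrm{id})^*((A_2\boxtimes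 A_1)\boxtimes A_3)\xrightarrow{a}(\tau\times\mathrm{id})^*(A_2\boxtimes(A_1\boxtimes A_3))\xrightarrow{c}(\tau\times\mathrm{id})^*(A_2\boxtimes\tau^*(A_3\boxtimes A_1))\xrightarrow{m}(\tau\times\mathrm{id})^*(\mathrm{id}\times\tau)^*(A_2\boxtimes(A_3\boxtimes A_1))$ and $(A_1\boxtimes A_2)\boxtimes A_3\xrightarrow{a}A_1\boxtimes(A_2\boxtimes A_3)\xrightarrow{c}\tau_{1,23}^*((A_2\boxtimes A_3)\boxtimes A_1)\xrightarrow{a}\tau_{1,23}^*(A_2\boxtimes(A_3\boxtimes A_1))$ agree modulo the identification of targets. - Compatibility of $a,u$: (i) $u_l\circ a=m_{pr^{12}_2,\mathrm{id}}\circ(u_l\boxtimes\mathrm{id}):(\mathbf{1}_{S_1}\boxtimes A_2)\boxtimes A_3\to pr^{123,*}_{23}(A_2\boxtimes A_3)$; (ii) $m_{\mathrm{id},pr^{23}_3}\circ(\mathrm{id}\boxtimes u_l)\circ a=m_{pr^{12}_1,\mathrm{id}}\circ(u_r\boxtimes\mathrm{id}):(A_1\boxtimes\mathbf{1}_{S_2})\boxtimes A_3\to pr^{123,*}_{13}(A_1\boxtimes A_3)$; (iii) $m_{\mathrm{id},pr^{23}_2}\circ(\mathrm{id}\boxtimes u_r)\circ a=u_r:(A_1\boxtimes A_2)\boxtimes\mathbf{1}_{S_3}\to pr^{123,*}_{12}(A_1\boxtimes A_2)$. - Compatibility of $c,u$: $\mathbf{1}_{S_1}\boxtimes B_2\xrightarrow{c}\tau^*(B_2\boxtimes\mathbf{1}_{S_1})\xrightarrow{u_r}\tau^*pr^{21,*}_2B_2=pr^{12,*}_2B_2$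 equals $u_l$. **$K$-structures and equivalences.** For $K\subseteq\{\text{associative, symmetric, unitary}\}$, a $K$-internal (resp. $K$-external) tensor structure is an internal (resp. external) tensor structure equipped with an associativity, commutativity, unit constraint for each of the respective properties in $K$, any two of them being compatible. An equivalence $e:(\otimes,m)\to(\otimes',m')$ of internal tensor structures is a family of natural isomorphisms $e_S:A\otimes B\to A\otimes'B$ with $f^*(e_S)\circ m_f=m'_f\circ e_T$; an equivalence of external tensor structures $e:(\boxtimes,m)\to(\boxtimes',m')$ is a family of natural isomorphisms $e_{S_1,S_2}:A_1\boxtimes A_2\to A_1\boxtimes'A_2$ with $(f_1\times f_2)^*(e)\circ m_{f_1,f_2}=m'_{f_1,f_2}\circ e$. An equivalence of $K$-structures is required moreover to satisfy: (associative) $a'\circ e_{A\otimes'B,C}\circ(e_{A,B}\otimes\mathrm{id})=e_{A,B\otimes'C}\circ(\mathrm{id}\otimes e_{B,C})\circ a$ and the same with $\boxtimes$; (symmetric) $c'\circ e=e\circ c$, resp. $c'\circ e=\tau^*(e)\circ c$; (unitary) it comes with an isomorphism of unit sections $w:\mathbf{1}\to\mathbf{1}'$ such that $u_r=u'_r\circ e\circ(\mathrm{id}\otimes w)$ and $u_l=u'_l\circ e\circ(w\otimes\mathrm{id})$, and the same with $\boxtimes$. **Construction $E$** (internal to external): $A_1\boxtimes A_2:=pr^{12,*}_1A_1\otimes pr^{12,*}_2A_2$; $m^e_{f_1,f_2}$ is $pr_1^{12,*}f_1^*A_1\otimes pr_2^{12,*}f_2^*A_2=(f_1\times f_2)^*pr_1^{12,*}A_1\otimes(f_1\times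 f_2)^*pr_2^{12,*}A_2\xrightarrow{m_{f_1\times f_2}}(f_1\times f_2)^*(A_1\boxtimes A_2)$; $a^e$ is the composite of $(A_1\boxtimes A_2)\boxtimes A_3=pr^{123,*}_{12}(pr^{12,*}_1A_1\otimes pr^{12,*}_2A_2)\otimes pr^{123,*}_3A_3\xleftarrow{m}(pr^{123,*}_1A_1\otimes pr^{123,*}_2A_2)\otimes pr^{123,*}_3A_3$ (inverted), $a$, and $pr^{123,*}_1A_1\otimes(pr^{123,*}_2A_2\otimes pr^{123,*}_3A_3)\xrightarrow{m}pr^{123,*}_1A_1\otimes pr^{123,*}_{23}(pr^{23,*}_2A_2\otimes pr^{23,*}_3A_3)=A_1\boxtimes(A_2\boxtimes A_3)$; $c^e$ is $pr^{12,*}_1A_1\otimes pr^{12,*}_2A_2=\tau^*pr^{21,*}_1A_1\otimes\tau^*pr^{21,*}_2A_2\xrightarrow{c}\tau^*pr^{21,*}_2A_2\otimes\tau^*pr^{21,*}_1A_1\xrightarrow{m_\tau}\tau^*(A_2\boxtimes A_1)$; $u^e$ has the same unit section and $u_r^e:pr_1^{12,*}A_1\otimes pr_2^{12,*}\mathbf{1}_{S_2}\xrightarrow{\mathbf{1}^*}pr_1^{12,*}A_1\otimes\mathbf{1}_{S_1\times S_2}\xrightarrow{u_r}pr_1^{12,*}A_1$, $u_l^e:pr_1^{12,*}\mathbf{1}_{S_1}\otimes pr_2^{12,*}A_2\xrightarrow{\mathbf{1}^*}\mathbf{1}_{S_1\times S_2}\otimes pr_2^{12,*}A_2\xrightarrow{u_l}pr_2^{12,*}A_2$.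 **Construction $I$** (external to internal): $A\otimes B:=\Delta_S^*(A\boxtimes B)$; $m^i_f$ is $\Delta_T^*(f^*A\boxtimes f^*B)\xrightarrow{m_{f,f}}\Delta_T^*(f\times f)^*(A\boxtimes B)=f^*\Delta_S^*(A\boxtimes B)$; $a^i$ is $\Delta_S^*(\Delta_S^*(A\boxtimes B)\boxtimes C)\xrightarrow{m_{\Delta_S,\mathrm{id}}}\Delta_S^*(\Delta_S\times\mathrm{id}_S)^*((A\boxtimes B)\boxtimes C)=\Delta_S^{(3),*}((A\boxtimes B)\boxtimes C)\xrightarrow{a}\Delta_S^{(3),*}(A\boxtimes(B\boxtimes C))=\Delta_S^*(\mathrm{id}_S\times\Delta_S)^*(A\boxtimes(B\boxtimes C))\xrightarrow{m_{\mathrm{id},\Delta_S}^{-1}}\Delta_S^*(A\boxtimes\Delta_S^*(B\boxtimes C))$; $c^i$ is $\Delta_S^*(A\boxtimes B)\xrightarrow{c}\Delta_S^*\tau^*(B\boxtimes A)=\Delta_S^*(B\boxtimes A)$; $u^i$ has the same unit section and $u^i_r:\Delta_S^*(A\boxtimes\mathbf{1}_S)\xrightarrow{u_r}\Delta_S^*pr_1^{12,*}A=A$, $u^i_l:\Delta_S^*(\mathbf{1}_S\boxtimes B)\xrightarrow{u_l}\Delta_S^*pr_2^{12,*}B=B$. *)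

theory Defs
  imports Main
begin

section \<open>Categories, functors, natural isomorphisms\<close>

text \<open>Composition is written in applicative order: \<open>Cmp C g f\<close> is \<open>g\<close> after \<open>f\<close>.
  Values of the record fields outside \<open>Obj C\<close> and \<open>Arr C\<close> are never constrained.\<close>

record ('o, 'a) cat =
  Obj :: "'o set"
  Arr :: "'a set"
  Dom :: "'a \<Rightarrow> 'o"
  Cod :: "'a \<Rightarrow> 'o"
  Ide :: "'o \<Rightarrow> 'a"
  Cmp :: "'a \<Rightarrow> 'a \<Rightarrow> 'a"

definition Hom :: "('o, 'a, 'z) cat_scheme \<Rightarrow> 'o \<Rightarrow> 'o \<Rightarrow> 'a set" where
  "Hom C A B = {f \<in> Arr C. Dom C f = A \<and> Cod C f = B}"

locale category =
  fixes C :: "('o, 'a, 'z) cat_scheme"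
  assumes dom_obj: "f \<in> Arr C \<Longrightarrow> Dom C f \<in> Obj C"
    and cod_obj: "f \<in> Arr C \<Longrightarrow> Cod C f \<in> Obj C"
    and ide_hom: "A \<in> Obj C \<Longrightarrow> Ide C A \<in> Hom C A A"
    and cmp_hom: "f \<in> Hom C A B \<Longrightarrow> g \<in> Hom C B D \<Longrightarrow> Cmp C g f \<in> Hom C A D"
    and cmp_ide: "f \<in> Hom C A B \<Longrightarrow> Cmp C f (Ide C A) = f"
    and ide_cmp: "f \<in> Hom C A B \<Longrightarrow> Cmp C (Ide C B) f = f"
    and cmp_assoc: "f \<in> Hom C A B \<Longrightarrow> g \<in> Hom C B D \<Longrightarrow> h \<in> Hom C D E \<Longrightarrow>
      Cmp C h (Cmp C g f) = Cmp C (Cmp C h g) f"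

definition inverse_arrows :: "('o, 'a, 'z) cat_scheme \<Rightarrow> 'a \<Rightarrow> 'a \<Rightarrow> bool" where
  "inverse_arrows C u v \<longleftrightarrow> v \<in> Hom C (Cod C u) (Dom C u) \<and>
    Cmp C v u = Ide C (Dom C u) \<and> Cmp C u v = Ide C (Cod C u)"

definition Iso :: "('o, 'a, 'z) cat_scheme \<Rightarrow> 'o \<Rightarrow> 'o \<Rightarrow> 'a set" where
  "Iso C A B = {u \<in> Hom C A B. \<exists>v. inverse_arrows C u v}"

definition Inv :: "('o, 'a, 'z) cat_scheme \<Rightarrow> 'a \<Rightarrow> 'a" where
  "Inv C u = (THE v. inverse_arrows C u v)"

definition prod_cat :: "('o, 'a, 'y) cat_scheme \<Rightarrow> ('p, 'b, 'z) cat_scheme \<Rightarrow> ('o \<times> 'p, 'a \<times> 'b) cat" where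
  "prod_cat C D = \<lparr> Obj = Obj C \<times> Obj D, Arr = Arr C \<times> Arr D,
     Dom = map_prod (Dom C) (Dom D), Cod = map_prod (Cod C) (Cod D),
     Ide = map_prod (Ide C) (Ide D),
     Cmp = (\<lambda>(g, g') (f, f'). (Cmp C g f, Cmp D g' f')) \<rparr>"

definition is_functor :: "('o, 'a, 'y) cat_scheme \<Rightarrow> ('p, 'b, 'z) cat_scheme \<Rightarrow>
    ('o \<Rightarrow> 'p) \<Rightarrow> ('a \<Rightarrow> 'b) \<Rightarrow> bool" where
  "is_functor C D Fo Fa \<longleftrightarrow>
     (\<forall>A\<in>Obj C. Fo A \<in> Obj D) \<and>
     (\<forall>A B. \<forall>u\<in>Hom C A B. Fa u \<in> Hom D (Fo A) (Fo B)) \<and>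
     (\<forall>A\<in>Obj C. Fa (Ide C A) = Ide D (Fo A)) \<and>
     (\<forall>A B E. \<forall>u\<in>Hom C A B. \<forall>v\<in>Hom C B E. Fa (Cmp C v u) = Cmp D (Fa v) (Fa u))"

definition nat_iso :: "('o, 'a, 'y) cat_scheme \<Rightarrow> ('p, 'b, 'z) cat_scheme \<Rightarrow>
    ('o \<Rightarrow> 'p) \<Rightarrow> ('a \<Rightarrow> 'b) \<Rightarrow> ('o \<Rightarrow> 'p) \<Rightarrow> ('a \<Rightarrow> 'b) \<Rightarrow> ('o \<Rightarrow> 'b) \<Rightarrow> bool" where
  "nat_iso C D Fo Fa Go Ga \<eta> \<longleftrightarrow>
     (\<forall>A\<in>Obj C. \<eta> A \<in> Iso D (Fo A) (Go A)) \<and>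
     (\<forall>A B. \<forall>u\<in>Hom C A B. Cmp D (\<eta> B) (Fa u) = Cmp D (Ga u) (\<eta> A))"

section \<open>Base categories with binary products\<close>

text \<open>The products are an arbitrary but fixed choice; no compatibility between the choices for
  different pairs of objects is assumed.\<close>

record ('s, 'f) pcat = "('s, 'f) cat" +
  Prd :: "'s \<Rightarrow> 's \<Rightarrow> 's"
  Pr1 :: "'s \<Rightarrow> 's \<Rightarrow> 'f"
  Pr2 :: "'s \<Rightarrow> 's \<Rightarrow> 'f"

locale category_with_binary_products = category S
  for S :: "('s, 'f) pcat" +
  assumes prd_obj: "X \<in> Obj S \<Longrightarrow> Y \<in> Obj S \<Longrightarrow> Prd S X Y \<in> Obj S"
    and pr1_hom: "X \<in> Obj S \<Longrightarrow> Y \<in> Obj S \<Longrightarrow> Pr1 S X Y \<in> Hom S (Prd S X Y) X"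
    and pr2_hom: "X \<in> Obj S \<Longrightarrow> Y \<in> Obj S \<Longrightarrow> Pr2 S X Y \<in> Hom S (Prd S X Y) Y"
    and prd_universal: "f \<in> Hom S Z X \<Longrightarrow> g \<in> Hom S Z Y \<Longrightarrow>
      \<exists>!h. h \<in> Hom S Z (Prd S X Y) \<and> Cmp S (Pr1 S X Y) h = f \<and> Cmp S (Pr2 S X Y) h = g"

definition pair :: "('s, 'f) pcat \<Rightarrow> 'f \<Rightarrow> 'f \<Rightarrow> 'f" where
  "pair S f g = (THE h. h \<in> Hom S (Dom S f) (Prd S (Cod S f) (Cod S g)) \<and>
     Cmp S (Pr1 S (Cod S f) (Cod S g)) h = f \<and> Cmp S (Pr2 S (Cod S f) (Cod S g)) h = g)"

definition prd_arr :: "('s, 'f) pcat \<Rightarrow> 'f \<Rightarrow> 'f \<Rightarrow> 'f" where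
  "prd_arr S f g = pair S (Cmp S f (Pr1 S (Dom S f) (Dom S g))) (Cmp S g (Pr2 S (Dom S f) (Dom S g)))"

text \<open>\<open>passoc S X Y Z : (X \<times> Y) \<times> Z \<rightarrow> X \<times> (Y \<times> Z)\<close>. Iterated products are bracketed to the left
  wherever a choice is needed.\<close>

definition passoc :: "('s, 'f) pcat \<Rightarrow> 's \<Rightarrow> 's \<Rightarrow> 's \<Rightarrow> 'f" where
  "passoc S X Y Z =
     pair S (Cmp S (Pr1 S X Y) (Pr1 S (Prd S X Y) Z))
       (pair S (Cmp S (Pr2 S X Y) (Pr1 S (Prd S X Y) Z)) (Pr2 S (Prd S X Y) Z))"

definition pswap :: "('s, 'f) pcat \<Rightarrow> 's \<Rightarrow> 's \<Rightarrow> 'f" where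
  "pswap S X Y = pair S (Pr2 S X Y) (Pr1 S X Y)"

definition diag :: "('s, 'f) pcat \<Rightarrow> 's \<Rightarrow> 'f" where
  "diag S X = pair S (Ide S X) (Ide S X)"

definition diag3 :: "('s, 'f) pcat \<Rightarrow> 's \<Rightarrow> 'f" where
  "diag3 S X = pair S (diag S X) (Ide S X)"

section \<open>Fibered categories\<close>

text \<open>\<open>conn H f g A : (g f)\<^sup>* A \<rightarrow> f\<^sup>* (g\<^sup>* A)\<close>.\<close>

record ('s, 'f, 'o, 'a) fib =
  Fib :: "'s \<Rightarrow> ('o, 'a) cat"
  pbo :: "'f \<Rightarrow> 'o \<Rightarrow> 'o"
  pba :: "'f \<Rightarrow> 'a \<Rightarrow> 'a"
  conn :: "'f \<Rightarrow> 'f \<Rightarrow> 'o \<Rightarrow> 'a"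

locale fibered_category = base: category S
  for S :: "('s, 'f, 'z) cat_scheme" +
  fixes H :: "('s, 'f, 'o, 'a) fib"
  assumes fib_cat: "X \<in> Obj S \<Longrightarrow> category (Fib H X)"
    and pb_functor: "f \<in> Hom S Y X \<Longrightarrow> is_functor (Fib H X) (Fib H Y) (pbo H f) (pba H f)"
    and conn_iso: "f \<in> Hom S Z Y \<Longrightarrow> g \<in> Hom S Y X \<Longrightarrow>
      nat_iso (Fib H X) (Fib H Z) (pbo H (Cmp S g f)) (pba H (Cmp S g f))
        (pbo H f \<circ> pbo H g) (pba H f \<circ> pba H g) (conn H f g)"
    and pbo_ide: "X \<in> Obj S \<Longrightarrow> A \<in> Obj (Fib H X) \<Longrightarrow> pbo H (Ide S X) A = A"
    and pba_ide: "X \<in> Obj S \<Longrightarrow> u \<in> Arr (Fib H X) \<Longrightarrow> pba H (Ide S X) u = u"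
    and conn_ide_left: "f \<in> Hom S Y X \<Longrightarrow> A \<in> Obj (Fib H X) \<Longrightarrow>
      conn H (Ide S Y) f A = Ide (Fib H Y) (pbo H f A)"
    and conn_ide_right: "f \<in> Hom S Y X \<Longrightarrow> A \<in> Obj (Fib H X) \<Longrightarrow>
      conn H f (Ide S X) A = Ide (Fib H Y) (pbo H f A)"
    and conn_cocycle: "f \<in> Hom S W Z \<Longrightarrow> g \<in> Hom S Z Y \<Longrightarrow> h \<in> Hom S Y X \<Longrightarrow> A \<in> Obj (Fib H X) \<Longrightarrow>
      Cmp (Fib H W) (pba H f (conn H g h A)) (conn H f (Cmp S h g) A) =
      Cmp (Fib H W) (conn H f g (pbo H h A)) (conn H (Cmp S g f) h A)"

text \<open>A section: objects \<open>sob s X\<close> and isomorphisms \<open>sar s f : f\<^sup>* (sob s X) \<rightarrow> sob s Y\<close>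
  for \<open>f : Y \<rightarrow> X\<close>.\<close>

record ('s, 'f, 'o, 'a) sect =
  sob :: "'s \<Rightarrow> 'o"
  sar :: "'f \<Rightarrow> 'a"

section \<open>Tensor structures\<close>

datatype tensor_property = Associative | Symmetric | Unitary

text \<open>Internal structures: \<open>tob T X A B\<close> and \<open>tar T X u v\<close> are the tensor product of objects and
  arrows of the fiber over \<open>X\<close>, and \<open>tm T f A B : f\<^sup>*A \<otimes> f\<^sup>*B \<rightarrow> f\<^sup>*(A \<otimes> B)\<close>. A constraint is
  present in a \<open>K\<close>-structure exactly if the corresponding property belongs to \<open>K\<close>.\<close>

record ('s, 'f, 'o, 'a) int_tensor =
  tob :: "'s \<Rightarrow> 'o \<Rightarrow> 'o \<Rightarrow> 'o"
  tar :: "'s \<Rightarrow> 'a \<Rightarrow> 'a \<Rightarrow> 'a"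
  tm :: "'f \<Rightarrow> 'o \<Rightarrow> 'o \<Rightarrow> 'a"

type_synonym ('s, 'o, 'a) int_assoc = "'s \<Rightarrow> 'o \<Rightarrow> 'o \<Rightarrow> 'o \<Rightarrow> 'a"
type_synonym ('s, 'o, 'a) int_comm = "'s \<Rightarrow> 'o \<Rightarrow> 'o \<Rightarrow> 'a"
record ('s, 'f, 'o, 'a) int_unit = "('s, 'f, 'o, 'a) sect" +
  tur :: "'s \<Rightarrow> 'o \<Rightarrow> 'a"
  tul :: "'s \<Rightarrow> 'o \<Rightarrow> 'a"

record ('s, 'f, 'o, 'a) K_int = "('s, 'f, 'o, 'a) int_tensor" +
  tassoc :: "('s, 'o, 'a) int_assoc option"
  tcomm :: "('s, 'o, 'a) int_comm option"
  tunit :: "('s, 'f, 'o, 'a) int_unit option"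

text \<open>External structures: \<open>xob T X1 X2 A1 A2\<close> lies over \<open>X1 \<times> X2\<close>, and
  \<open>xm T f1 f2 A1 A2 : f1\<^sup>*A1 \<box> f2\<^sup>*A2 \<rightarrow> (f1 \<times> f2)\<^sup>*(A1 \<box> A2)\<close>.\<close>

record ('s, 'f, 'o, 'a) ext_tensor =
  xob :: "'s \<Rightarrow> 's \<Rightarrow> 'o \<Rightarrow> 'o \<Rightarrow> 'o"
  xar :: "'s \<Rightarrow> 's \<Rightarrow> 'a \<Rightarrow> 'a \<Rightarrow> 'a"
  xm :: "'f \<Rightarrow> 'f \<Rightarrow> 'o \<Rightarrow> 'o \<Rightarrow> 'a"

type_synonym ('s, 'o, 'a) ext_assoc = "'s \<Rightarrow> 's \<Rightarrow> 's \<Rightarrow> 'o \<Rightarrow> 'o \<Rightarrow> 'o \<Rightarrow> 'a"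
type_synonym ('s, 'o, 'a) ext_comm = "'s \<Rightarrow> 's \<Rightarrow> 'o \<Rightarrow> 'o \<Rightarrow> 'a"
record ('s, 'f, 'o, 'a) ext_unit = "('s, 'f, 'o, 'a) sect" +
  xur :: "'s \<Rightarrow> 's \<Rightarrow> 'o \<Rightarrow> 'a"
  xul :: "'s \<Rightarrow> 's \<Rightarrow> 'o \<Rightarrow> 'a"

record ('s, 'f, 'o, 'a) K_ext = "('s, 'f, 'o, 'a) ext_tensor" +
  xassoc :: "('s, 'o, 'a) ext_assoc option"
  xcomm :: "('s, 'o, 'a) ext_comm option"
  xunit :: "('s, 'f, 'o, 'a) ext_unit option"

context
  fixes S :: "('s, 'f) pcat" and H :: "('s, 'f, 'o, 'a) fib"
begin

abbreviation bcmp :: "'f \<Rightarrow> 'f \<Rightarrow> 'f" (infixr "\<odot>" 75) where "g \<odot> f \<equiv> Cmp S g f"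
abbreviation bprd :: "'s \<Rightarrow> 's \<Rightarrow> 's" (infixl "\<times>\<^sub>o" 76) where "X \<times>\<^sub>o Y \<equiv> Prd S X Y"
abbreviation bprda :: "'f \<Rightarrow> 'f \<Rightarrow> 'f" (infixl "\<times>\<^sub>a" 76) where "f \<times>\<^sub>a g \<equiv> prd_arr S f g"
abbreviation bide :: "'s \<Rightarrow> 'f" ("\<iota>") where "\<iota> X \<equiv> Ide S X"
abbreviation bp1 :: "'s \<Rightarrow> 's \<Rightarrow> 'f" ("\<pi>\<^sub>1") where "\<pi>\<^sub>1 X Y \<equiv> Pr1 S X Y"
abbreviation bp2 :: "'s \<Rightarrow> 's \<Rightarrow> 'f" ("\<pi>\<^sub>2") where "\<pi>\<^sub>2 X Y \<equiv> Pr2 S X Y"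
abbreviation bassoc :: "'s \<Rightarrow> 's \<Rightarrow> 's \<Rightarrow> 'f" ("\<alpha>") where "\<alpha> X Y Z \<equiv> passoc S X Y Z"
abbreviation bswap :: "'s \<Rightarrow> 's \<Rightarrow> 'f" ("\<tau>") where "\<tau> X Y \<equiv> pswap S X Y"
abbreviation bdiag :: "'s \<Rightarrow> 'f" ("\<Delta>") where "\<Delta> X \<equiv> diag S X"

abbreviation hob :: "'s \<Rightarrow> 'o set" ("Ob") where "Ob X \<equiv> Obj (Fib H X)"
abbreviation hide :: "'s \<Rightarrow> 'o \<Rightarrow> 'a" ("\<J>") where "\<J> X A \<equiv> Ide (Fib H X) A"
abbreviation hinv :: "'s \<Rightarrow> 'a \<Rightarrow> 'a" ("\<V>") where "\<V> X u \<equiv> Inv (Fib H X) u"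
abbreviation hcmp :: "'a \<Rightarrow> 's \<Rightarrow> 'a \<Rightarrow> 'a" ("(_ \<cdot>\<^bsub>_\<^esub>/ _)" [56, 0, 55] 55)
  where "v \<cdot>\<^bsub>X\<^esub> u \<equiv> Cmp (Fib H X) v u"
abbreviation hpbo :: "'f \<Rightarrow> 'o \<Rightarrow> 'o" (infixr "\<star>" 80) where "f \<star> A \<equiv> pbo H f A"
abbreviation hpba :: "'f \<Rightarrow> 'a \<Rightarrow> 'a" (infixr "\<star>\<^sub>a" 80) where "f \<star>\<^sub>a u \<equiv> pba H f u"
abbreviation hconn :: "'f \<Rightarrow> 'f \<Rightarrow> 'o \<Rightarrow> 'a" ("\<gamma>") where "\<gamma> f g A \<equiv> conn H f g A"

text \<open>\<open>conn3 f g h A : (h g f)\<^sup>*A \<rightarrow> f\<^sup>*g\<^sup>*h\<^sup>*A\<close>.\<close>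

definition conn3 :: "'f \<Rightarrow> 'f \<Rightarrow> 'f \<Rightarrow> 'o \<Rightarrow> 'a" where
  "conn3 f g h A = (f \<star>\<^sub>a \<gamma> g h A) \<cdot>\<^bsub>Dom S f\<^esub> \<gamma> f (h \<odot> g) A"

text \<open>If \<open>h g = h' g'\<close>, then \<open>ident g h g' h' A : g\<^sup>*h\<^sup>*A \<rightarrow> g'\<^sup>*h'\<^sup>*A\<close> is the identification through
  \<open>(h g)\<^sup>*A = (h' g')\<^sup>*A\<close>.\<close>

definition ident :: "'f \<Rightarrow> 'f \<Rightarrow> 'f \<Rightarrow> 'f \<Rightarrow> 'o \<Rightarrow> 'a" where
  "ident g h g' h' A = \<gamma> g' h' A \<cdot>\<^bsub>Dom S g\<^esub> \<V> (Dom S g) (\<gamma> g h A)"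

definition is_section :: "('s, 'f, 'o, 'a, 'z) sect_scheme \<Rightarrow> bool" where
  "is_section s \<longleftrightarrow>
     (\<forall>X\<in>Obj S. sob s X \<in> Ob X) \<and>
     (\<forall>X Y. \<forall>f\<in>Hom S Y X. sar s f \<in> Iso (Fib H Y) (f \<star> sob s X) (sob s Y)) \<and>
     (\<forall>X Y Z. \<forall>f\<in>Hom S Z Y. \<forall>g\<in>Hom S Y X.
        sar s (g \<odot> f) = sar s f \<cdot>\<^bsub>Z\<^esub> (f \<star>\<^sub>a sar s g) \<cdot>\<^bsub>Z\<^esub> \<gamma> f g (sob s X))"

definition is_section_iso ::
    "('s, 'f, 'o, 'a, 'y) sect_scheme \<Rightarrow> ('s, 'f, 'o, 'a, 'z) sect_scheme \<Rightarrow> ('s \<Rightarrow> 'a) \<Rightarrow> bool" where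
  "is_section_iso s s' w \<longleftrightarrow>
     (\<forall>X\<in>Obj S. w X \<in> Iso (Fib H X) (sob s X) (sob s' X)) \<and>
     (\<forall>X Y. \<forall>f\<in>Hom S Y X. sar s' f \<cdot>\<^bsub>Y\<^esub> (f \<star>\<^sub>a w X) = w Y \<cdot>\<^bsub>Y\<^esub> sar s f)"

subsection \<open>Internal tensor structures\<close>

context
  fixes T :: "('s, 'f, 'o, 'a) K_int"
begin

abbreviation iob :: "'o \<Rightarrow> 's \<Rightarrow> 'o \<Rightarrow> 'o" ("(_ \<otimes>\<^bsub>_\<^esub>/ _)" [71, 0, 71] 70)
  where "A \<otimes>\<^bsub>X\<^esub> B \<equiv> tob T X A B"
abbreviation iar :: "'a \<Rightarrow> 's \<Rightarrow> 'a \<Rightarrow> 'a" ("(_ \<oplus>\<^bsub>_\<^esub>/ _)" [71, 0, 71] 70)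
  where "u \<oplus>\<^bsub>X\<^esub> v \<equiv> tar T X u v"  \<comment> \<open>the tensor product of arrows\<close>
abbreviation im :: "'f \<Rightarrow> 'o \<Rightarrow> 'o \<Rightarrow> 'a" ("\<mu>") where "\<mu> f A B \<equiv> tm T f A B"

definition internal_tensor :: bool where
  "internal_tensor \<longleftrightarrow>
     (\<forall>X\<in>Obj S. is_functor (prod_cat (Fib H X) (Fib H X)) (Fib H X)
        (\<lambda>(A, B). A \<otimes>\<^bsub>X\<^esub> B) (\<lambda>(u, v). u \<oplus>\<^bsub>X\<^esub> v)) \<and>
     (\<forall>X Y. \<forall>f\<in>Hom S Y X. nat_iso (prod_cat (Fib H X) (Fib H X)) (Fib H Y)
        (\<lambda>(A, B). (f \<star> A) \<otimes>\<^bsub>Y\<^esub> (f \<star> B)) (\<lambda>(u, v). (f \<star>\<^sub>a u) \<oplus>\<^bsub>Y\<^esub> (f \<star>\<^sub>a v))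
        (\<lambda>(A, B). f \<star> (A \<otimes>\<^bsub>X\<^esub> B)) (\<lambda>(u, v). f \<star>\<^sub>a (u \<oplus>\<^bsub>X\<^esub> v))
        (\<lambda>(A, B). \<mu> f A B)) \<and>
     (\<forall>X Y Z. \<forall>f\<in>Hom S Z Y. \<forall>g\<in>Hom S Y X. \<forall>A\<in>Ob X. \<forall>B\<in>Ob X.
        \<gamma> f g (A \<otimes>\<^bsub>X\<^esub> B) \<cdot>\<^bsub>Z\<^esub> \<mu> (g \<odot> f) A B =
        (f \<star>\<^sub>a \<mu> g A B) \<cdot>\<^bsub>Z\<^esub> \<mu> f (g \<star> A) (g \<star> B) \<cdot>\<^bsub>Z\<^esub> (\<gamma> f g A \<oplus>\<^bsub>Z\<^esub> \<gamma> f g B))"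

definition internal_assoc :: "('s, 'o, 'a) int_assoc \<Rightarrow> bool" where
  "internal_assoc a \<longleftrightarrow>
     (\<forall>X\<in>Obj S. nat_iso (prod_cat (prod_cat (Fib H X) (Fib H X)) (Fib H X)) (Fib H X)
        (\<lambda>((A, B), C). (A \<otimes>\<^bsub>X\<^esub> B) \<otimes>\<^bsub>X\<^esub> C) (\<lambda>((u, v), w). (u \<oplus>\<^bsub>X\<^esub> v) \<oplus>\<^bsub>X\<^esub> w)
        (\<lambda>((A, B), C). A \<otimes>\<^bsub>X\<^esub> (B \<otimes>\<^bsub>X\<^esub> C)) (\<lambda>((u, v), w). u \<oplus>\<^bsub>X\<^esub> (v \<oplus>\<^bsub>X\<^esub> w))
        (\<lambda>((A, B), C). a X A B C)) \<and>
     (\<forall>X\<in>Obj S. \<forall>A\<in>Ob X. \<forall>B\<in>Ob X. \<forall>C\<in>Ob X. \<forall>D\<in>Ob X.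
        a X A B (C \<otimes>\<^bsub>X\<^esub> D) \<cdot>\<^bsub>X\<^esub> a X (A \<otimes>\<^bsub>X\<^esub> B) C D =
        (\<J> X A \<oplus>\<^bsub>X\<^esub> a X B C D) \<cdot>\<^bsub>X\<^esub> a X A (B \<otimes>\<^bsub>X\<^esub> C) D \<cdot>\<^bsub>X\<^esub> (a X A B C \<oplus>\<^bsub>X\<^esub> \<J> X D)) \<and>
     (\<forall>X Y. \<forall>f\<in>Hom S Y X. \<forall>A\<in>Ob X. \<forall>B\<in>Ob X. \<forall>C\<in>Ob X.
        (f \<star>\<^sub>a a X A B C) \<cdot>\<^bsub>Y\<^esub> \<mu> f (A \<otimes>\<^bsub>X\<^esub> B) C \<cdot>\<^bsub>Y\<^esub> (\<mu> f A B \<oplus>\<^bsub>Y\<^esub> \<J> Y (f \<star> C)) =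
        \<mu> f A (B \<otimes>\<^bsub>X\<^esub> C) \<cdot>\<^bsub>Y\<^esub> (\<J> Y (f \<star> A) \<oplus>\<^bsub>Y\<^esub> \<mu> f B C) \<cdot>\<^bsub>Y\<^esub> a Y (f \<star> A) (f \<star> B) (f \<star> C))"

definition internal_comm :: "('s, 'o, 'a) int_comm \<Rightarrow> bool" where
  "internal_comm c \<longleftrightarrow>
     (\<forall>X\<in>Obj S. nat_iso (prod_cat (Fib H X) (Fib H X)) (Fib H X)
        (\<lambda>(A, B). A \<otimes>\<^bsub>X\<^esub> B) (\<lambda>(u, v). u \<oplus>\<^bsub>X\<^esub> v)
        (\<lambda>(A, B). B \<otimes>\<^bsub>X\<^esub> A) (\<lambda>(u, v). v \<oplus>\<^bsub>X\<^esub> u)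
        (\<lambda>(A, B). c X A B)) \<and>
     (\<forall>X\<in>Obj S. \<forall>A\<in>Ob X. \<forall>B\<in>Ob X. c X B A \<cdot>\<^bsub>X\<^esub> c X A B = \<J> X (A \<otimes>\<^bsub>X\<^esub> B)) \<and>
     (\<forall>X Y. \<forall>f\<in>Hom S Y X. \<forall>A\<in>Ob X. \<forall>B\<in>Ob X.
        (f \<star>\<^sub>a c X A B) \<cdot>\<^bsub>Y\<^esub> \<mu> f A B = \<mu> f B A \<cdot>\<^bsub>Y\<^esub> c Y (f \<star> A) (f \<star> B))"

definition internal_unit :: "('s, 'f, 'o, 'a) int_unit \<Rightarrow> bool" where
  "internal_unit u \<longleftrightarrow>
     is_section u \<and>
     (\<forall>X\<in>Obj S. nat_iso (Fib H X) (Fib H X)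
        (\<lambda>A. A \<otimes>\<^bsub>X\<^esub> sob u X) (\<lambda>v. v \<oplus>\<^bsub>X\<^esub> \<J> X (sob u X)) (\<lambda>A. A) (\<lambda>v. v) (tur u X)) \<and>
     (\<forall>X\<in>Obj S. nat_iso (Fib H X) (Fib H X)
        (\<lambda>B. sob u X \<otimes>\<^bsub>X\<^esub> B) (\<lambda>v. \<J> X (sob u X) \<oplus>\<^bsub>X\<^esub> v) (\<lambda>B. B) (\<lambda>v. v) (tul u X)) \<and>
     (\<forall>X\<in>Obj S. tur u X (sob u X) = tul u X (sob u X)) \<and>
     (\<forall>X Y. \<forall>f\<in>Hom S Y X. \<forall>A\<in>Ob X.
        (f \<star>\<^sub>a tur u X A) \<cdot>\<^bsub>Y\<^esub> \<mu> f A (sob u X) =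
        tur u Y (f \<star> A) \<cdot>\<^bsub>Y\<^esub> (\<J> Y (f \<star> A) \<oplus>\<^bsub>Y\<^esub> sar u f)) \<and>
     (\<forall>X Y. \<forall>f\<in>Hom S Y X. \<forall>B\<in>Ob X.
        (f \<star>\<^sub>a tul u X B) \<cdot>\<^bsub>Y\<^esub> \<mu> f (sob u X) B =
        tul u Y (f \<star> B) \<cdot>\<^bsub>Y\<^esub> (sar u f \<oplus>\<^bsub>Y\<^esub> \<J> Y (f \<star> B)))"

definition internal_compat_ac :: "('s, 'o, 'a) int_assoc \<Rightarrow> ('s, 'o, 'a) int_comm \<Rightarrow> bool" where
  "internal_compat_ac a c \<longleftrightarrow>
     (\<forall>X\<in>Obj S. \<forall>A\<in>Ob X. \<forall>B\<in>Ob X. \<forall>C\<in>Ob X.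
        (\<J> X B \<oplus>\<^bsub>X\<^esub> c X A C) \<cdot>\<^bsub>X\<^esub> a X B A C \<cdot>\<^bsub>X\<^esub> (c X A B \<oplus>\<^bsub>X\<^esub> \<J> X C) =
        a X B C A \<cdot>\<^bsub>X\<^esub> c X A (B \<otimes>\<^bsub>X\<^esub> C) \<cdot>\<^bsub>X\<^esub> a X A B C)"

definition internal_compat_au :: "('s, 'o, 'a) int_assoc \<Rightarrow> ('s, 'f, 'o, 'a) int_unit \<Rightarrow> bool" where
  "internal_compat_au a u \<longleftrightarrow>
     (\<forall>X\<in>Obj S. \<forall>B\<in>Ob X. \<forall>C\<in>Ob X.
        tul u X (B \<otimes>\<^bsub>X\<^esub> C) \<cdot>\<^bsub>X\<^esub> a X (sob u X) B C = tul u X B \<oplus>\<^bsub>X\<^esub> \<J> X C) \<and>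
     (\<forall>X\<in>Obj S. \<forall>A\<in>Ob X. \<forall>C\<in>Ob X.
        (\<J> X A \<oplus>\<^bsub>X\<^esub> tul u X C) \<cdot>\<^bsub>X\<^esub> a X A (sob u X) C = tur u X A \<oplus>\<^bsub>X\<^esub> \<J> X C) \<and>
     (\<forall>X\<in>Obj S. \<forall>A\<in>Ob X. \<forall>B\<in>Ob X.
        (\<J> X A \<oplus>\<^bsub>X\<^esub> tur u X B) \<cdot>\<^bsub>X\<^esub> a X A B (sob u X) = tur u X (A \<otimes>\<^bsub>X\<^esub> B))"

definition internal_compat_cu :: "('s, 'o, 'a) int_comm \<Rightarrow> ('s, 'f, 'o, 'a) int_unit \<Rightarrow> bool" where
  "internal_compat_cu c u \<longleftrightarrow>
     (\<forall>X\<in>Obj S. \<forall>B\<in>Ob X. tur u X B \<cdot>\<^bsub>X\<^esub> c X (sob u X) B = tul u X B)"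

end

definition K_internal :: "tensor_property set \<Rightarrow> ('s, 'f, 'o, 'a) K_int \<Rightarrow> bool" where
  "K_internal K T \<longleftrightarrow>
     internal_tensor T \<and>
     (tassoc T \<noteq> None \<longleftrightarrow> Associative \<in> K) \<and>
     (tcomm T \<noteq> None \<longleftrightarrow> Symmetric \<in> K) \<and>
     (tunit T \<noteq> None \<longleftrightarrow> Unitary \<in> K) \<and>
     (\<forall>a. tassoc T = Some a \<longrightarrow> internal_assoc T a) \<and>
     (\<forall>c. tcomm T = Some c \<longrightarrow> internal_comm T c) \<and>
     (\<forall>u. tunit T = Some u \<longrightarrow> internal_unit T u) \<and>
     (\<forall>a c. tassoc T = Some a \<and> tcomm T = Some c \<longrightarrow> internal_compat_ac T a c) \<and>
     (\<forall>a u. tassoc T = Some a \<and> tunit T = Some u \<longrightarrow> internal_compat_au T a u) \<and>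
     (\<forall>c u. tcomm T = Some c \<and> tunit T = Some u \<longrightarrow> internal_compat_cu c u)"

definition is_internal_equivalence ::
    "('s, 'f, 'o, 'a) K_int \<Rightarrow> ('s, 'f, 'o, 'a) K_int \<Rightarrow> ('s \<Rightarrow> 'o \<Rightarrow> 'o \<Rightarrow> 'a) \<Rightarrow> bool" where
  "is_internal_equivalence T T' e \<longleftrightarrow>
     (\<forall>X\<in>Obj S. nat_iso (prod_cat (Fib H X) (Fib H X)) (Fib H X)
        (\<lambda>(A, B). tob T X A B) (\<lambda>(u, v). tar T X u v)
        (\<lambda>(A, B). tob T' X A B) (\<lambda>(u, v). tar T' X u v)
        (\<lambda>(A, B). e X A B)) \<and>
     (\<forall>X Y. \<forall>f\<in>Hom S Y X. \<forall>A\<in>Ob X. \<forall>B\<in>Ob X.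
        (f \<star>\<^sub>a e X A B) \<cdot>\<^bsub>Y\<^esub> tm T f A B = tm T' f A B \<cdot>\<^bsub>Y\<^esub> e Y (f \<star> A) (f \<star> B)) \<and>
     (\<forall>a a'. tassoc T = Some a \<and> tassoc T' = Some a' \<longrightarrow>
        (\<forall>X\<in>Obj S. \<forall>A\<in>Ob X. \<forall>B\<in>Ob X. \<forall>C\<in>Ob X.
           a' X A B C \<cdot>\<^bsub>X\<^esub> e X (tob T' X A B) C \<cdot>\<^bsub>X\<^esub> tar T X (e X A B) (\<J> X C) =
           e X A (tob T' X B C) \<cdot>\<^bsub>X\<^esub> tar T X (\<J> X A) (e X B C) \<cdot>\<^bsub>X\<^esub> a X A B C)) \<and>
     (\<forall>c c'. tcomm T = Some c \<and> tcomm T' = Some c' \<longrightarrow>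
        (\<forall>X\<in>Obj S. \<forall>A\<in>Ob X. \<forall>B\<in>Ob X.
           c' X A B \<cdot>\<^bsub>X\<^esub> e X A B = e X B A \<cdot>\<^bsub>X\<^esub> c X A B)) \<and>
     (\<forall>u u'. tunit T = Some u \<and> tunit T' = Some u' \<longrightarrow>
        (\<exists>w. is_section_iso u u' w \<and>
           (\<forall>X\<in>Obj S. \<forall>A\<in>Ob X.
              tur u X A = tur u' X A \<cdot>\<^bsub>X\<^esub> e X A (sob u' X) \<cdot>\<^bsub>X\<^esub> tar T X (\<J> X A) (w X)) \<and>
           (\<forall>X\<in>Obj S. \<forall>B\<in>Ob X.
              tul u X B = tul u' X B \<cdot>\<^bsub>X\<^esub> e X (sob u' X) B \<cdot>\<^bsub>X\<^esub> tar T X (w X) (\<J> X B))))"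

definition internal_equivalence ::
    "tensor_property set \<Rightarrow> (('s, 'f, 'o, 'a) K_int \<times> ('s, 'f, 'o, 'a) K_int) set" where
  "internal_equivalence K =
     {(T, T'). K_internal K T \<and> K_internal K T' \<and> (\<exists>e. is_internal_equivalence T T' e)}"

subsection \<open>External tensor structures\<close>

context
  fixes T :: "('s, 'f, 'o, 'a) K_ext"
begin

abbreviation eob :: "'o \<Rightarrow> 's \<Rightarrow> 's \<Rightarrow> 'o \<Rightarrow> 'o" ("(_ \<box>\<^bsub>_,_\<^esub>/ _)" [71, 0, 0, 71] 70)
  where "A \<box>\<^bsub>X,Y\<^esub> B \<equiv> xob T X Y A B"
abbreviation ear :: "'a \<Rightarrow> 's \<Rightarrow> 's \<Rightarrow> 'a \<Rightarrow> 'a" ("(_ \<diamond>\<^bsub>_,_\<^esub>/ _)" [71, 0, 0, 71] 70)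
  where "u \<diamond>\<^bsub>X,Y\<^esub> v \<equiv> xar T X Y u v"  \<comment> \<open>the external product of arrows\<close>
abbreviation em :: "'f \<Rightarrow> 'f \<Rightarrow> 'o \<Rightarrow> 'o \<Rightarrow> 'a" ("\<mu>") where "\<mu> f g A B \<equiv> xm T f g A B"

definition external_tensor :: bool where
  "external_tensor \<longleftrightarrow>
     (\<forall>X1\<in>Obj S. \<forall>X2\<in>Obj S. is_functor (prod_cat (Fib H X1) (Fib H X2)) (Fib H (X1 \<times>\<^sub>o X2))
        (\<lambda>(A1, A2). A1 \<box>\<^bsub>X1,X2\<^esub> A2) (\<lambda>(u1, u2). u1 \<diamond>\<^bsub>X1,X2\<^esub> u2)) \<and>
     (\<forall>X1 X2 Y1 Y2. \<forall>f1\<in>Hom S Y1 X1. \<forall>f2\<in>Hom S Y2 X2.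
        nat_iso (prod_cat (Fib H X1) (Fib H X2)) (Fib H (Y1 \<times>\<^sub>o Y2))
        (\<lambda>(A1, A2). (f1 \<star> A1) \<box>\<^bsub>Y1,Y2\<^esub> (f2 \<star> A2)) (\<lambda>(u1, u2). (f1 \<star>\<^sub>a u1) \<diamond>\<^bsub>Y1,Y2\<^esub> (f2 \<star>\<^sub>a u2))
        (\<lambda>(A1, A2). (f1 \<times>\<^sub>a f2) \<star> (A1 \<box>\<^bsub>X1,X2\<^esub> A2)) (\<lambda>(u1, u2). (f1 \<times>\<^sub>a f2) \<star>\<^sub>a (u1 \<diamond>\<^bsub>X1,X2\<^esub> u2))
        (\<lambda>(A1, A2). \<mu> f1 f2 A1 A2)) \<and>
     (\<forall>X1 X2 Y1 Y2 Z1 Z2. \<forall>f1\<in>Hom S Z1 Y1. \<forall>f2\<in>Hom S Z2 Y2. \<forall>g1\<in>Hom S Y1 X1. \<forall>g2\<in>Hom S Y2 X2.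
        \<forall>A1\<in>Ob X1. \<forall>A2\<in>Ob X2.
        \<gamma> (f1 \<times>\<^sub>a f2) (g1 \<times>\<^sub>a g2) (A1 \<box>\<^bsub>X1,X2\<^esub> A2) \<cdot>\<^bsub>Z1 \<times>\<^sub>o Z2\<^esub> \<mu> (g1 \<odot> f1) (g2 \<odot> f2) A1 A2 =
        ((f1 \<times>\<^sub>a f2) \<star>\<^sub>a \<mu> g1 g2 A1 A2) \<cdot>\<^bsub>Z1 \<times>\<^sub>o Z2\<^esub> \<mu> f1 f2 (g1 \<star> A1) (g2 \<star> A2)
          \<cdot>\<^bsub>Z1 \<times>\<^sub>o Z2\<^esub> (\<gamma> f1 g1 A1 \<diamond>\<^bsub>Z1,Z2\<^esub> \<gamma> f2 g2 A2))"

text \<open>\<open>a X1 X2 X3 A1 A2 A3 : (A1 \<box> A2) \<box> A3 \<rightarrow> (\<alpha> X1 X2 X3)\<^sup>*(A1 \<box> (A2 \<box> A3))\<close> over \<open>(X1 \<times> X2) \<times> X3\<close>.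
  Where two composites end in different iterated inverse images of one object along the same arrow
  of \<open>S\<close>, both are continued by the inverse connection isomorphism to the inverse image along that
  arrow. In the pentagon the arrow is \<open>((X1 \<times> X2) \<times> X3) \<times> X4 \<rightarrow> X1 \<times> (X2 \<times> (X3 \<times> X4))\<close>.\<close>

definition external_assoc :: "('s, 'o, 'a) ext_assoc \<Rightarrow> bool" where
  "external_assoc a \<longleftrightarrow>
     (\<forall>X1\<in>Obj S. \<forall>X2\<in>Obj S. \<forall>X3\<in>Obj S.
        nat_iso (prod_cat (prod_cat (Fib H X1) (Fib H X2)) (Fib H X3)) (Fib H (X1 \<times>\<^sub>o X2 \<times>\<^sub>o X3))
        (\<lambda>((A1, A2), A3). (A1 \<box>\<^bsub>X1,X2\<^esub> A2) \<box>\<^bsub>X1 \<times>\<^sub>o X2,X3\<^esub> A3)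
        (\<lambda>((u1, u2), u3). (u1 \<diamond>\<^bsub>X1,X2\<^esub> u2) \<diamond>\<^bsub>X1 \<times>\<^sub>o X2,X3\<^esub> u3)
        (\<lambda>((A1, A2), A3). \<alpha> X1 X2 X3 \<star> (A1 \<box>\<^bsub>X1,X2 \<times>\<^sub>o X3\<^esub> (A2 \<box>\<^bsub>X2,X3\<^esub> A3)))
        (\<lambda>((u1, u2), u3). \<alpha> X1 X2 X3 \<star>\<^sub>a (u1 \<diamond>\<^bsub>X1,X2 \<times>\<^sub>o X3\<^esub> (u2 \<diamond>\<^bsub>X2,X3\<^esub> u3)))
        (\<lambda>((A1, A2), A3). a X1 X2 X3 A1 A2 A3)) \<and>
     (\<forall>X1\<in>Obj S. \<forall>X2\<in>Obj S. \<forall>X3\<in>Obj S. \<forall>X4\<in>Obj S.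
        \<forall>A1\<in>Ob X1. \<forall>A2\<in>Ob X2. \<forall>A3\<in>Ob X3. \<forall>A4\<in>Ob X4.
        let Q = X1 \<times>\<^sub>o X2 \<times>\<^sub>o X3 \<times>\<^sub>o X4;
            A34 = A3 \<box>\<^bsub>X3,X4\<^esub> A4;
            A = A1 \<box>\<^bsub>X1,X2 \<times>\<^sub>o (X3 \<times>\<^sub>o X4)\<^esub> (A2 \<box>\<^bsub>X2,X3 \<times>\<^sub>o X4\<^esub> A34)
        in \<V> Q (\<gamma> (\<alpha> (X1 \<times>\<^sub>o X2) X3 X4) (\<alpha> X1 X2 (X3 \<times>\<^sub>o X4)) A)
             \<cdot>\<^bsub>Q\<^esub> (\<alpha> (X1 \<times>\<^sub>o X2) X3 X4 \<star>\<^sub>a a X1 X2 (X3 \<times>\<^sub>o X4) A1 A2 A34)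
             \<cdot>\<^bsub>Q\<^esub> a (X1 \<times>\<^sub>o X2) X3 X4 (A1 \<box>\<^bsub>X1,X2\<^esub> A2) A3 A4
         = \<V> Q (conn3 (\<alpha> X1 X2 X3 \<times>\<^sub>a \<iota> X4) (\<alpha> X1 (X2 \<times>\<^sub>o X3) X4) (\<iota> X1 \<times>\<^sub>a \<alpha> X2 X3 X4) A)
             \<cdot>\<^bsub>Q\<^esub> ((\<alpha> X1 X2 X3 \<times>\<^sub>a \<iota> X4) \<star>\<^sub>a \<alpha> X1 (X2 \<times>\<^sub>o X3) X4 \<star>\<^sub>a
                   (\<mu> (\<iota> X1) (\<alpha> X2 X3 X4) A1 (A2 \<box>\<^bsub>X2,X3 \<times>\<^sub>o X4\<^esub> A34)))
             \<cdot>\<^bsub>Q\<^esub> ((\<alpha> X1 X2 X3 \<times>\<^sub>a \<iota> X4) \<star>\<^sub>a \<alpha> X1 (X2 \<times>\<^sub>o X3) X4 \<star>\<^sub>a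
                   (\<J> X1 A1 \<diamond>\<^bsub>X1,X2 \<times>\<^sub>o X3 \<times>\<^sub>o X4\<^esub> a X2 X3 X4 A2 A3 A4))
             \<cdot>\<^bsub>Q\<^esub> ((\<alpha> X1 X2 X3 \<times>\<^sub>a \<iota> X4) \<star>\<^sub>a a X1 (X2 \<times>\<^sub>o X3) X4 A1 (A2 \<box>\<^bsub>X2,X3\<^esub> A3) A4)
             \<cdot>\<^bsub>Q\<^esub> \<mu> (\<alpha> X1 X2 X3) (\<iota> X4) (A1 \<box>\<^bsub>X1,X2 \<times>\<^sub>o X3\<^esub> (A2 \<box>\<^bsub>X2,X3\<^esub> A3)) A4
             \<cdot>\<^bsub>Q\<^esub> (a X1 X2 X3 A1 A2 A3 \<diamond>\<^bsub>X1 \<times>\<^sub>o X2 \<times>\<^sub>o X3,X4\<^esub> \<J> X4 A4)) \<and>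
     (\<forall>X1 X2 X3 Y1 Y2 Y3. \<forall>f1\<in>Hom S Y1 X1. \<forall>f2\<in>Hom S Y2 X2. \<forall>f3\<in>Hom S Y3 X3.
        \<forall>A1\<in>Ob X1. \<forall>A2\<in>Ob X2. \<forall>A3\<in>Ob X3.
        let Q = Y1 \<times>\<^sub>o Y2 \<times>\<^sub>o Y3;
            A = A1 \<box>\<^bsub>X1,X2 \<times>\<^sub>o X3\<^esub> (A2 \<box>\<^bsub>X2,X3\<^esub> A3)
        in \<V> Q (\<gamma> (f1 \<times>\<^sub>a f2 \<times>\<^sub>a f3) (\<alpha> X1 X2 X3) A)
             \<cdot>\<^bsub>Q\<^esub> ((f1 \<times>\<^sub>a f2 \<times>\<^sub>a f3) \<star>\<^sub>a a X1 X2 X3 A1 A2 A3)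
             \<cdot>\<^bsub>Q\<^esub> \<mu> (f1 \<times>\<^sub>a f2) f3 (A1 \<box>\<^bsub>X1,X2\<^esub> A2) A3
             \<cdot>\<^bsub>Q\<^esub> (\<mu> f1 f2 A1 A2 \<diamond>\<^bsub>Y1 \<times>\<^sub>o Y2,Y3\<^esub> \<J> Y3 (f3 \<star> A3))
         = \<V> Q (\<gamma> (\<alpha> Y1 Y2 Y3) (f1 \<times>\<^sub>a (f2 \<times>\<^sub>a f3)) A)
             \<cdot>\<^bsub>Q\<^esub> (\<alpha> Y1 Y2 Y3 \<star>\<^sub>a \<mu> f1 (f2 \<times>\<^sub>a f3) A1 (A2 \<box>\<^bsub>X2,X3\<^esub> A3))
             \<cdot>\<^bsub>Q\<^esub> (\<alpha> Y1 Y2 Y3 \<star>\<^sub>a (\<J> Y1 (f1 \<star> A1) \<diamond>\<^bsub>Y1,Y2 \<times>\<^sub>o Y3\<^esub> \<mu> f2 f3 A2 A3))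
             \<cdot>\<^bsub>Q\<^esub> a Y1 Y2 Y3 (f1 \<star> A1) (f2 \<star> A2) (f3 \<star> A3))"

text \<open>\<open>c X1 X2 A1 A2 : A1 \<box> A2 \<rightarrow> (\<tau> X1 X2)\<^sup>*(A2 \<box> A1)\<close>. The identification of an object with its
  inverse image under \<open>\<tau> \<tau> = id\<close> is a connection isomorphism because of strict unitality.\<close>

definition external_comm :: "('s, 'o, 'a) ext_comm \<Rightarrow> bool" where
  "external_comm c \<longleftrightarrow>
     (\<forall>X1\<in>Obj S. \<forall>X2\<in>Obj S. nat_iso (prod_cat (Fib H X1) (Fib H X2)) (Fib H (X1 \<times>\<^sub>o X2))
        (\<lambda>(A1, A2). A1 \<box>\<^bsub>X1,X2\<^esub> A2) (\<lambda>(u1, u2). u1 \<diamond>\<^bsub>X1,X2\<^esub> u2)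
        (\<lambda>(A1, A2). \<tau> X1 X2 \<star> (A2 \<box>\<^bsub>X2,X1\<^esub> A1)) (\<lambda>(u1, u2). \<tau> X1 X2 \<star>\<^sub>a (u2 \<diamond>\<^bsub>X2,X1\<^esub> u1))
        (\<lambda>(A1, A2). c X1 X2 A1 A2)) \<and>
     (\<forall>X1\<in>Obj S. \<forall>X2\<in>Obj S. \<forall>A1\<in>Ob X1. \<forall>A2\<in>Ob X2.
        (\<tau> X1 X2 \<star>\<^sub>a c X2 X1 A2 A1) \<cdot>\<^bsub>X1 \<times>\<^sub>o X2\<^esub> c X1 X2 A1 A2 =
        \<gamma> (\<tau> X1 X2) (\<tau> X2 X1) (A1 \<box>\<^bsub>X1,X2\<^esub> A2)) \<and>
     (\<forall>X1 X2 Y1 Y2. \<forall>f1\<in>Hom S Y1 X1. \<forall>f2\<in>Hom S Y2 X2. \<forall>A1\<in>Ob X1. \<forall>A2\<in>Ob X2.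
        ((f1 \<times>\<^sub>a f2) \<star>\<^sub>a c X1 X2 A1 A2) \<cdot>\<^bsub>Y1 \<times>\<^sub>o Y2\<^esub> \<mu> f1 f2 A1 A2 =
        ident (\<tau> Y1 Y2) (f2 \<times>\<^sub>a f1) (f1 \<times>\<^sub>a f2) (\<tau> X1 X2) (A2 \<box>\<^bsub>X2,X1\<^esub> A1)
          \<cdot>\<^bsub>Y1 \<times>\<^sub>o Y2\<^esub> (\<tau> Y1 Y2 \<star>\<^sub>a \<mu> f2 f1 A2 A1)
          \<cdot>\<^bsub>Y1 \<times>\<^sub>o Y2\<^esub> c Y1 Y2 (f1 \<star> A1) (f2 \<star> A2))"

definition external_unit :: "('s, 'f, 'o, 'a) ext_unit \<Rightarrow> bool" where
  "external_unit u \<longleftrightarrow>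
     is_section u \<and>
     (\<forall>X1\<in>Obj S. \<forall>X2\<in>Obj S. nat_iso (Fib H X1) (Fib H (X1 \<times>\<^sub>o X2))
        (\<lambda>A1. A1 \<box>\<^bsub>X1,X2\<^esub> sob u X2) (\<lambda>v. v \<diamond>\<^bsub>X1,X2\<^esub> \<J> X2 (sob u X2))
        (pbo H (\<pi>\<^sub>1 X1 X2)) (pba H (\<pi>\<^sub>1 X1 X2)) (xur u X1 X2)) \<and>
     (\<forall>X1\<in>Obj S. \<forall>X2\<in>Obj S. nat_iso (Fib H X2) (Fib H (X1 \<times>\<^sub>o X2))
        (\<lambda>A2. sob u X1 \<box>\<^bsub>X1,X2\<^esub> A2) (\<lambda>v. \<J> X1 (sob u X1) \<diamond>\<^bsub>X1,X2\<^esub> v)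
        (pbo H (\<pi>\<^sub>2 X1 X2)) (pba H (\<pi>\<^sub>2 X1 X2)) (xul u X1 X2)) \<and>
     (\<forall>X1\<in>Obj S. \<forall>X2\<in>Obj S.
        sar u (\<pi>\<^sub>1 X1 X2) \<cdot>\<^bsub>X1 \<times>\<^sub>o X2\<^esub> xur u X1 X2 (sob u X1) =
        sar u (\<pi>\<^sub>2 X1 X2) \<cdot>\<^bsub>X1 \<times>\<^sub>o X2\<^esub> xul u X1 X2 (sob u X2)) \<and>
     (\<forall>X1 X2 Y1 Y2. \<forall>f1\<in>Hom S Y1 X1. \<forall>f2\<in>Hom S Y2 X2. \<forall>A1\<in>Ob X1.
        ((f1 \<times>\<^sub>a f2) \<star>\<^sub>a xur u X1 X2 A1) \<cdot>\<^bsub>Y1 \<times>\<^sub>o Y2\<^esub> \<mu> f1 f2 A1 (sob u X2) =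
        ident (\<pi>\<^sub>1 Y1 Y2) f1 (f1 \<times>\<^sub>a f2) (\<pi>\<^sub>1 X1 X2) A1
          \<cdot>\<^bsub>Y1 \<times>\<^sub>o Y2\<^esub> xur u Y1 Y2 (f1 \<star> A1)
          \<cdot>\<^bsub>Y1 \<times>\<^sub>o Y2\<^esub> (\<J> Y1 (f1 \<star> A1) \<diamond>\<^bsub>Y1,Y2\<^esub> sar u f2)) \<and>
     (\<forall>X1 X2 Y1 Y2. \<forall>f1\<in>Hom S Y1 X1. \<forall>f2\<in>Hom S Y2 X2. \<forall>A2\<in>Ob X2.
        ((f1 \<times>\<^sub>a f2) \<star>\<^sub>a xul u X1 X2 A2) \<cdot>\<^bsub>Y1 \<times>\<^sub>o Y2\<^esub> \<mu> f1 f2 (sob u X1) A2 =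
        ident (\<pi>\<^sub>2 Y1 Y2) f2 (f1 \<times>\<^sub>a f2) (\<pi>\<^sub>2 X1 X2) A2
          \<cdot>\<^bsub>Y1 \<times>\<^sub>o Y2\<^esub> xul u Y1 Y2 (f2 \<star> A2)
          \<cdot>\<^bsub>Y1 \<times>\<^sub>o Y2\<^esub> (sar u f1 \<diamond>\<^bsub>Y1,Y2\<^esub> \<J> Y2 (f2 \<star> A2)))"

definition external_compat_ac :: "('s, 'o, 'a) ext_assoc \<Rightarrow> ('s, 'o, 'a) ext_comm \<Rightarrow> bool" where
  "external_compat_ac a c \<longleftrightarrow>
     (\<forall>X1\<in>Obj S. \<forall>X2\<in>Obj S. \<forall>X3\<in>Obj S. \<forall>A1\<in>Ob X1. \<forall>A2\<in>Ob X2. \<forall>A3\<in>Ob X3.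
        let Q = X1 \<times>\<^sub>o X2 \<times>\<^sub>o X3;
            t = \<tau> X1 X2 \<times>\<^sub>a \<iota> X3;
            A = A2 \<box>\<^bsub>X2,X3 \<times>\<^sub>o X1\<^esub> (A3 \<box>\<^bsub>X3,X1\<^esub> A1)
        in \<V> Q (conn3 t (\<alpha> X2 X1 X3) (\<iota> X2 \<times>\<^sub>a \<tau> X1 X3) A)
             \<cdot>\<^bsub>Q\<^esub> (t \<star>\<^sub>a \<alpha> X2 X1 X3 \<star>\<^sub>a \<mu> (\<iota> X2) (\<tau> X1 X3) A2 (A3 \<box>\<^bsub>X3,X1\<^esub> A1))
             \<cdot>\<^bsub>Q\<^esub> (t \<star>\<^sub>a \<alpha> X2 X1 X3 \<star>\<^sub>a (\<J> X2 A2 \<diamond>\<^bsub>X2,X1 \<times>\<^sub>o X3\<^esub> c X1 X3 A1 A3))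
             \<cdot>\<^bsub>Q\<^esub> (t \<star>\<^sub>a a X2 X1 X3 A2 A1 A3)
             \<cdot>\<^bsub>Q\<^esub> \<mu> (\<tau> X1 X2) (\<iota> X3) (A2 \<box>\<^bsub>X2,X1\<^esub> A1) A3
             \<cdot>\<^bsub>Q\<^esub> (c X1 X2 A1 A2 \<diamond>\<^bsub>X1 \<times>\<^sub>o X2,X3\<^esub> \<J> X3 A3)
         = \<V> Q (conn3 (\<alpha> X1 X2 X3) (\<tau> X1 (X2 \<times>\<^sub>o X3)) (\<alpha> X2 X3 X1) A)
             \<cdot>\<^bsub>Q\<^esub> (\<alpha> X1 X2 X3 \<star>\<^sub>a \<tau> X1 (X2 \<times>\<^sub>o X3) \<star>\<^sub>a a X2 X3 X1 A2 A3 A1)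
             \<cdot>\<^bsub>Q\<^esub> (\<alpha> X1 X2 X3 \<star>\<^sub>a c X1 (X2 \<times>\<^sub>o X3) A1 (A2 \<box>\<^bsub>X2,X3\<^esub> A3))
             \<cdot>\<^bsub>Q\<^esub> a X1 X2 X3 A1 A2 A3)"

text \<open>The projections of \<open>(X1 \<times> X2) \<times> X3\<close> to \<open>X2 \<times> X3\<close> and \<open>X1 \<times> X3\<close> are \<open>\<pi>\<^sub>2 \<times> id\<close> and \<open>\<pi>\<^sub>1 \<times> id\<close>.\<close>

definition external_compat_au :: "('s, 'o, 'a) ext_assoc \<Rightarrow> ('s, 'f, 'o, 'a) ext_unit \<Rightarrow> bool" where
  "external_compat_au a u \<longleftrightarrow>
     (\<forall>X1\<in>Obj S. \<forall>X2\<in>Obj S. \<forall>X3\<in>Obj S. \<forall>A2\<in>Ob X2. \<forall>A3\<in>Ob X3.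
        let Q = X1 \<times>\<^sub>o X2 \<times>\<^sub>o X3
        in \<V> Q (\<gamma> (\<alpha> X1 X2 X3) (\<pi>\<^sub>2 X1 (X2 \<times>\<^sub>o X3)) (A2 \<box>\<^bsub>X2,X3\<^esub> A3))
             \<cdot>\<^bsub>Q\<^esub> (\<alpha> X1 X2 X3 \<star>\<^sub>a xul u X1 (X2 \<times>\<^sub>o X3) (A2 \<box>\<^bsub>X2,X3\<^esub> A3))
             \<cdot>\<^bsub>Q\<^esub> a X1 X2 X3 (sob u X1) A2 A3
         = \<mu> (\<pi>\<^sub>2 X1 X2) (\<iota> X3) A2 A3 \<cdot>\<^bsub>Q\<^esub> (xul u X1 X2 A2 \<diamond>\<^bsub>X1 \<times>\<^sub>o X2,X3\<^esub> \<J> X3 A3)) \<and>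
     (\<forall>X1\<in>Obj S. \<forall>X2\<in>Obj S. \<forall>X3\<in>Obj S. \<forall>A1\<in>Ob X1. \<forall>A3\<in>Ob X3.
        let Q = X1 \<times>\<^sub>o X2 \<times>\<^sub>o X3
        in \<V> Q (\<gamma> (\<alpha> X1 X2 X3) (\<iota> X1 \<times>\<^sub>a \<pi>\<^sub>2 X2 X3) (A1 \<box>\<^bsub>X1,X3\<^esub> A3))
             \<cdot>\<^bsub>Q\<^esub> (\<alpha> X1 X2 X3 \<star>\<^sub>a \<mu> (\<iota> X1) (\<pi>\<^sub>2 X2 X3) A1 A3)
             \<cdot>\<^bsub>Q\<^esub> (\<alpha> X1 X2 X3 \<star>\<^sub>a (\<J> X1 A1 \<diamond>\<^bsub>X1,X2 \<times>\<^sub>o X3\<^esub> xul u X2 X3 A3))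
             \<cdot>\<^bsub>Q\<^esub> a X1 X2 X3 A1 (sob u X2) A3
         = \<mu> (\<pi>\<^sub>1 X1 X2) (\<iota> X3) A1 A3 \<cdot>\<^bsub>Q\<^esub> (xur u X1 X2 A1 \<diamond>\<^bsub>X1 \<times>\<^sub>o X2,X3\<^esub> \<J> X3 A3)) \<and>
     (\<forall>X1\<in>Obj S. \<forall>X2\<in>Obj S. \<forall>X3\<in>Obj S. \<forall>A1\<in>Ob X1. \<forall>A2\<in>Ob X2.
        let Q = X1 \<times>\<^sub>o X2 \<times>\<^sub>o X3
        in \<V> Q (\<gamma> (\<alpha> X1 X2 X3) (\<iota> X1 \<times>\<^sub>a \<pi>\<^sub>1 X2 X3) (A1 \<box>\<^bsub>X1,X2\<^esub> A2))
             \<cdot>\<^bsub>Q\<^esub> (\<alpha> X1 X2 X3 \<star>\<^sub>a \<mu> (\<iota> X1) (\<pi>\<^sub>1 X2 X3) A1 A2)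
             \<cdot>\<^bsub>Q\<^esub> (\<alpha> X1 X2 X3 \<star>\<^sub>a (\<J> X1 A1 \<diamond>\<^bsub>X1,X2 \<times>\<^sub>o X3\<^esub> xur u X2 X3 A2))
             \<cdot>\<^bsub>Q\<^esub> a X1 X2 X3 A1 A2 (sob u X3)
         = xur u (X1 \<times>\<^sub>o X2) X3 (A1 \<box>\<^bsub>X1,X2\<^esub> A2))"

definition external_compat_cu :: "('s, 'o, 'a) ext_comm \<Rightarrow> ('s, 'f, 'o, 'a) ext_unit \<Rightarrow> bool" where
  "external_compat_cu c u \<longleftrightarrow>
     (\<forall>X1\<in>Obj S. \<forall>X2\<in>Obj S. \<forall>B2\<in>Ob X2.
        \<V> (X1 \<times>\<^sub>o X2) (\<gamma> (\<tau> X1 X2) (\<pi>\<^sub>1 X2 X1) B2)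
          \<cdot>\<^bsub>X1 \<times>\<^sub>o X2\<^esub> (\<tau> X1 X2 \<star>\<^sub>a xur u X2 X1 B2)
          \<cdot>\<^bsub>X1 \<times>\<^sub>o X2\<^esub> c X1 X2 (sob u X1) B2
        = xul u X1 X2 B2)"

end

definition K_external :: "tensor_property set \<Rightarrow> ('s, 'f, 'o, 'a) K_ext \<Rightarrow> bool" where
  "K_external K T \<longleftrightarrow>
     external_tensor T \<and>
     (xassoc T \<noteq> None \<longleftrightarrow> Associative \<in> K) \<and>
     (xcomm T \<noteq> None \<longleftrightarrow> Symmetric \<in> K) \<and>
     (xunit T \<noteq> None \<longleftrightarrow> Unitary \<in> K) \<and>
     (\<forall>a. xassoc T = Some a \<longrightarrow> external_assoc T a) \<and>
     (\<forall>c. xcomm T = Some c \<longrightarrow> external_comm T c) \<and>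
     (\<forall>u. xunit T = Some u \<longrightarrow> external_unit T u) \<and>
     (\<forall>a c. xassoc T = Some a \<and> xcomm T = Some c \<longrightarrow> external_compat_ac T a c) \<and>
     (\<forall>a u. xassoc T = Some a \<and> xunit T = Some u \<longrightarrow> external_compat_au T a u) \<and>
     (\<forall>c u. xcomm T = Some c \<and> xunit T = Some u \<longrightarrow> external_compat_cu c u)"

definition is_external_equivalence ::
    "('s, 'f, 'o, 'a) K_ext \<Rightarrow> ('s, 'f, 'o, 'a) K_ext \<Rightarrow> ('s \<Rightarrow> 's \<Rightarrow> 'o \<Rightarrow> 'o \<Rightarrow> 'a) \<Rightarrow> bool" where
  "is_external_equivalence T T' e \<longleftrightarrow>
     (\<forall>X1\<in>Obj S. \<forall>X2\<in>Obj S. nat_iso (prod_cat (Fib H X1) (Fib H X2)) (Fib H (X1 \<times>\<^sub>o X2))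
        (\<lambda>(A1, A2). xob T X1 X2 A1 A2) (\<lambda>(u1, u2). xar T X1 X2 u1 u2)
        (\<lambda>(A1, A2). xob T' X1 X2 A1 A2) (\<lambda>(u1, u2). xar T' X1 X2 u1 u2)
        (\<lambda>(A1, A2). e X1 X2 A1 A2)) \<and>
     (\<forall>X1 X2 Y1 Y2. \<forall>f1\<in>Hom S Y1 X1. \<forall>f2\<in>Hom S Y2 X2. \<forall>A1\<in>Ob X1. \<forall>A2\<in>Ob X2.
        ((f1 \<times>\<^sub>a f2) \<star>\<^sub>a e X1 X2 A1 A2) \<cdot>\<^bsub>Y1 \<times>\<^sub>o Y2\<^esub> xm T f1 f2 A1 A2 =
        xm T' f1 f2 A1 A2 \<cdot>\<^bsub>Y1 \<times>\<^sub>o Y2\<^esub> e Y1 Y2 (f1 \<star> A1) (f2 \<star> A2)) \<and>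
     (\<forall>a a'. xassoc T = Some a \<and> xassoc T' = Some a' \<longrightarrow>
        (\<forall>X1\<in>Obj S. \<forall>X2\<in>Obj S. \<forall>X3\<in>Obj S. \<forall>A1\<in>Ob X1. \<forall>A2\<in>Ob X2. \<forall>A3\<in>Ob X3.
           let Q = X1 \<times>\<^sub>o X2 \<times>\<^sub>o X3
           in a' X1 X2 X3 A1 A2 A3
                \<cdot>\<^bsub>Q\<^esub> e (X1 \<times>\<^sub>o X2) X3 (xob T' X1 X2 A1 A2) A3
                \<cdot>\<^bsub>Q\<^esub> xar T (X1 \<times>\<^sub>o X2) X3 (e X1 X2 A1 A2) (\<J> X3 A3)
            = (\<alpha> X1 X2 X3 \<star>\<^sub>a e X1 (X2 \<times>\<^sub>o X3) A1 (xob T' X2 X3 A2 A3))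
                \<cdot>\<^bsub>Q\<^esub> (\<alpha> X1 X2 X3 \<star>\<^sub>a xar T X1 (X2 \<times>\<^sub>o X3) (\<J> X1 A1) (e X2 X3 A2 A3))
                \<cdot>\<^bsub>Q\<^esub> a X1 X2 X3 A1 A2 A3)) \<and>
     (\<forall>c c'. xcomm T = Some c \<and> xcomm T' = Some c' \<longrightarrow>
        (\<forall>X1\<in>Obj S. \<forall>X2\<in>Obj S. \<forall>A1\<in>Ob X1. \<forall>A2\<in>Ob X2.
           c' X1 X2 A1 A2 \<cdot>\<^bsub>X1 \<times>\<^sub>o X2\<^esub> e X1 X2 A1 A2 =
           (\<tau> X1 X2 \<star>\<^sub>a e X2 X1 A2 A1) \<cdot>\<^bsub>X1 \<times>\<^sub>o X2\<^esub> c X1 X2 A1 A2)) \<and>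
     (\<forall>u u'. xunit T = Some u \<and> xunit T' = Some u' \<longrightarrow>
        (\<exists>w. is_section_iso u u' w \<and>
           (\<forall>X1\<in>Obj S. \<forall>X2\<in>Obj S. \<forall>A1\<in>Ob X1.
              xur u X1 X2 A1 = xur u' X1 X2 A1
                \<cdot>\<^bsub>X1 \<times>\<^sub>o X2\<^esub> e X1 X2 A1 (sob u' X2) \<cdot>\<^bsub>X1 \<times>\<^sub>o X2\<^esub> xar T X1 X2 (\<J> X1 A1) (w X2)) \<and>
           (\<forall>X1\<in>Obj S. \<forall>X2\<in>Obj S. \<forall>A2\<in>Ob X2.
              xul u X1 X2 A2 = xul u' X1 X2 A2
                \<cdot>\<^bsub>X1 \<times>\<^sub>o X2\<^esub> e X1 X2 (sob u' X1) A2 \<cdot>\<^bsub>X1 \<times>\<^sub>o X2\<^esub> xar T X1 X2 (w X1) (\<J> X2 A2))))"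

definition external_equivalence ::
    "tensor_property set \<Rightarrow> (('s, 'f, 'o, 'a) K_ext \<times> ('s, 'f, 'o, 'a) K_ext) set" where
  "external_equivalence K =
     {(T, T'). K_external K T \<and> K_external K T' \<and> (\<exists>e. is_external_equivalence T T' e)}"

subsection \<open>From internal to external structures\<close>

context
  fixes T :: "('s, 'f, 'o, 'a) K_int"
begin

definition E_ob :: "'s \<Rightarrow> 's \<Rightarrow> 'o \<Rightarrow> 'o \<Rightarrow> 'o" where
  "E_ob X1 X2 A1 A2 = tob T (X1 \<times>\<^sub>o X2) (\<pi>\<^sub>1 X1 X2 \<star> A1) (\<pi>\<^sub>2 X1 X2 \<star> A2)"

definition E_ar :: "'s \<Rightarrow> 's \<Rightarrow> 'a \<Rightarrow> 'a \<Rightarrow> 'a" where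
  "E_ar X1 X2 u1 u2 = tar T (X1 \<times>\<^sub>o X2) (\<pi>\<^sub>1 X1 X2 \<star>\<^sub>a u1) (\<pi>\<^sub>2 X1 X2 \<star>\<^sub>a u2)"

definition E_m :: "'f \<Rightarrow> 'f \<Rightarrow> 'o \<Rightarrow> 'o \<Rightarrow> 'a" where
  "E_m f1 f2 A1 A2 =
    (let Y1 = Dom S f1; Y2 = Dom S f2; X1 = Cod S f1; X2 = Cod S f2
     in tm T (f1 \<times>\<^sub>a f2) (\<pi>\<^sub>1 X1 X2 \<star> A1) (\<pi>\<^sub>2 X1 X2 \<star> A2)
          \<cdot>\<^bsub>Y1 \<times>\<^sub>o Y2\<^esub> tar T (Y1 \<times>\<^sub>o Y2)
            (ident (\<pi>\<^sub>1 Y1 Y2) f1 (f1 \<times>\<^sub>a f2) (\<pi>\<^sub>1 X1 X2) A1)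
            (ident (\<pi>\<^sub>2 Y1 Y2) f2 (f1 \<times>\<^sub>a f2) (\<pi>\<^sub>2 X1 X2) A2))"

text \<open>In \<open>E_assoc\<close> the two leftmost factors are the identification of \<open>pr1\<^sup>* A1 \<otimes> pr23\<^sup>*(A2 \<box> A3)\<close> with
  \<open>\<alpha>\<^sup>*(A1 \<box> (A2 \<box> A3))\<close> that results from identifying the iterated products along \<open>\<alpha>\<close>.\<close>

definition E_assoc :: "('s, 'o, 'a) int_assoc \<Rightarrow> ('s, 'o, 'a) ext_assoc" where
  "E_assoc a X1 X2 X3 A1 A2 A3 =
    (let Q = X1 \<times>\<^sub>o X2 \<times>\<^sub>o X3; R = X2 \<times>\<^sub>o X3;
         pr12 = \<pi>\<^sub>1 (X1 \<times>\<^sub>o X2) X3; pr23 = \<pi>\<^sub>2 X1 R \<odot> \<alpha> X1 X2 X3;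
         pr1 = \<pi>\<^sub>1 X1 X2 \<odot> pr12; pr2 = \<pi>\<^sub>2 X1 X2 \<odot> pr12; pr3 = \<pi>\<^sub>2 (X1 \<times>\<^sub>o X2) X3;
         A23 = E_ob X2 X3 A2 A3
     in tm T (\<alpha> X1 X2 X3) (\<pi>\<^sub>1 X1 R \<star> A1) (\<pi>\<^sub>2 X1 R \<star> A23)
          \<cdot>\<^bsub>Q\<^esub> tar T Q (\<gamma> (\<alpha> X1 X2 X3) (\<pi>\<^sub>1 X1 R) A1) (\<gamma> (\<alpha> X1 X2 X3) (\<pi>\<^sub>2 X1 R) A23)
          \<cdot>\<^bsub>Q\<^esub> tar T Q (\<J> Q (pr1 \<star> A1)) (tm T pr23 (\<pi>\<^sub>1 X2 X3 \<star> A2) (\<pi>\<^sub>2 X2 X3 \<star> A3))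
          \<cdot>\<^bsub>Q\<^esub> tar T Q (\<J> Q (pr1 \<star> A1)) (tar T Q (\<gamma> pr23 (\<pi>\<^sub>1 X2 X3) A2) (\<gamma> pr23 (\<pi>\<^sub>2 X2 X3) A3))
          \<cdot>\<^bsub>Q\<^esub> a Q (pr1 \<star> A1) (pr2 \<star> A2) (pr3 \<star> A3)
          \<cdot>\<^bsub>Q\<^esub> tar T Q (tar T Q (\<V> Q (\<gamma> pr12 (\<pi>\<^sub>1 X1 X2) A1)) (\<V> Q (\<gamma> pr12 (\<pi>\<^sub>2 X1 X2) A2)))
                (\<J> Q (pr3 \<star> A3))
          \<cdot>\<^bsub>Q\<^esub> tar T Q (\<V> Q (tm T pr12 (\<pi>\<^sub>1 X1 X2 \<star> A1) (\<pi>\<^sub>2 X1 X2 \<star> A2))) (\<J> Q (pr3 \<star> A3)))"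

definition E_comm :: "('s, 'o, 'a) int_comm \<Rightarrow> ('s, 'o, 'a) ext_comm" where
  "E_comm c X1 X2 A1 A2 =
    (let Q = X1 \<times>\<^sub>o X2
     in tm T (\<tau> X1 X2) (\<pi>\<^sub>1 X2 X1 \<star> A2) (\<pi>\<^sub>2 X2 X1 \<star> A1)
          \<cdot>\<^bsub>Q\<^esub> c Q (\<tau> X1 X2 \<star> \<pi>\<^sub>2 X2 X1 \<star> A1) (\<tau> X1 X2 \<star> \<pi>\<^sub>1 X2 X1 \<star> A2)
          \<cdot>\<^bsub>Q\<^esub> tar T Q (\<gamma> (\<tau> X1 X2) (\<pi>\<^sub>2 X2 X1) A1) (\<gamma> (\<tau> X1 X2) (\<pi>\<^sub>1 X2 X1) A2))"

definition E_unit :: "('s, 'f, 'o, 'a) int_unit \<Rightarrow> ('s, 'f, 'o, 'a) ext_unit" where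
  "E_unit u = \<lparr> sob = sob u, sar = sar u,
     xur = (\<lambda>X1 X2 A1. tur u (X1 \<times>\<^sub>o X2) (\<pi>\<^sub>1 X1 X2 \<star> A1)
       \<cdot>\<^bsub>X1 \<times>\<^sub>o X2\<^esub> tar T (X1 \<times>\<^sub>o X2) (\<J> (X1 \<times>\<^sub>o X2) (\<pi>\<^sub>1 X1 X2 \<star> A1)) (sar u (\<pi>\<^sub>2 X1 X2))),
     xul = (\<lambda>X1 X2 A2. tul u (X1 \<times>\<^sub>o X2) (\<pi>\<^sub>2 X1 X2 \<star> A2)
       \<cdot>\<^bsub>X1 \<times>\<^sub>o X2\<^esub> tar T (X1 \<times>\<^sub>o X2) (sar u (\<pi>\<^sub>1 X1 X2)) (\<J> (X1 \<times>\<^sub>o X2) (\<pi>\<^sub>2 X1 X2 \<star> A2))) \<rparr>"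

end

definition constr_E :: "('s, 'f, 'o, 'a) K_int \<Rightarrow> ('s, 'f, 'o, 'a) K_ext" where
  "constr_E T = \<lparr> xob = E_ob T, xar = E_ar T, xm = E_m T,
     xassoc = map_option (E_assoc T) (tassoc T),
     xcomm = map_option (E_comm T) (tcomm T),
     xunit = map_option (E_unit T) (tunit T) \<rparr>"

subsection \<open>From external to internal structures\<close>

context
  fixes T :: "('s, 'f, 'o, 'a) K_ext"
begin

definition I_ob :: "'s \<Rightarrow> 'o \<Rightarrow> 'o \<Rightarrow> 'o" where
  "I_ob X A B = \<Delta> X \<star> xob T X X A B"

definition I_ar :: "'s \<Rightarrow> 'a \<Rightarrow> 'a \<Rightarrow> 'a" where
  "I_ar X u v = \<Delta> X \<star>\<^sub>a xar T X X u v"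

definition I_m :: "'f \<Rightarrow> 'o \<Rightarrow> 'o \<Rightarrow> 'a" where
  "I_m f A B =
    (let Y = Dom S f; X = Cod S f
     in ident (\<Delta> Y) (f \<times>\<^sub>a f) f (\<Delta> X) (xob T X X A B) \<cdot>\<^bsub>Y\<^esub> (\<Delta> Y \<star>\<^sub>a xm T f f A B))"

text \<open>The identifications use \<open>(\<Delta> \<times> id) \<Delta> = diag3\<close> and \<open>\<alpha> diag3 = (id \<times> \<Delta>) \<Delta>\<close>.\<close>

definition I_assoc :: "('s, 'o, 'a) ext_assoc \<Rightarrow> ('s, 'o, 'a) int_assoc" where
  "I_assoc a X A B C =
    (let AB_C = xob T (X \<times>\<^sub>o X) X (xob T X X A B) C;
         A_BC = xob T X (X \<times>\<^sub>o X) A (xob T X X B C)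
     in (\<Delta> X \<star>\<^sub>a \<V> (X \<times>\<^sub>o X) (xm T (\<iota> X) (\<Delta> X) A (xob T X X B C)))
          \<cdot>\<^bsub>X\<^esub> ident (diag3 S X) (\<alpha> X X X) (\<Delta> X) (\<iota> X \<times>\<^sub>a \<Delta> X) A_BC
          \<cdot>\<^bsub>X\<^esub> (diag3 S X \<star>\<^sub>a a X X X A B C)
          \<cdot>\<^bsub>X\<^esub> \<V> X (\<gamma> (\<Delta> X) (\<Delta> X \<times>\<^sub>a \<iota> X) AB_C)
          \<cdot>\<^bsub>X\<^esub> (\<Delta> X \<star>\<^sub>a xm T (\<Delta> X) (\<iota> X) (xob T X X A B) C))"

definition I_comm :: "('s, 'o, 'a) ext_comm \<Rightarrow> ('s, 'o, 'a) int_comm" where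
  "I_comm c X A B =
     \<V> X (\<gamma> (\<Delta> X) (\<tau> X X) (xob T X X B A)) \<cdot>\<^bsub>X\<^esub> (\<Delta> X \<star>\<^sub>a c X X A B)"

definition I_unit :: "('s, 'f, 'o, 'a) ext_unit \<Rightarrow> ('s, 'f, 'o, 'a) int_unit" where
  "I_unit u = \<lparr> sob = sob u, sar = sar u,
     tur = (\<lambda>X A. \<V> X (\<gamma> (\<Delta> X) (\<pi>\<^sub>1 X X) A) \<cdot>\<^bsub>X\<^esub> (\<Delta> X \<star>\<^sub>a xur u X X A)),
     tul = (\<lambda>X B. \<V> X (\<gamma> (\<Delta> X) (\<pi>\<^sub>2 X X) B) \<cdot>\<^bsub>X\<^esub> (\<Delta> X \<star>\<^sub>a xul u X X B)) \<rparr>"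

end

definition constr_I :: "('s, 'f, 'o, 'a) K_ext \<Rightarrow> ('s, 'f, 'o, 'a) K_int" where
  "constr_I T = \<lparr> tob = I_ob T, tar = I_ar T, tm = I_m T,
     tassoc = map_option (I_assoc T) (xassoc T),
     tcomm = map_option (I_comm T) (xcomm T),
     tunit = map_option I_unit (xunit T) \<rparr>"

end

text \<open>The map on equivalence classes induced by a map \<open>F\<close> of representatives, for a target
  equivalence relation \<open>r\<close>.\<close>

definition induced :: "('b \<times> 'b) set \<Rightarrow> ('a \<Rightarrow> 'b) \<Rightarrow> 'a set \<Rightarrow> 'b set" where
  "induced r F c = r `` (F ` c)"

end

theory Submission
  imports Defs
begin

text \<open>Both kinds of structures are compared inside one category. The pairs \<open>(f, A)\<close>, standing for
  \<open>f\<^sup>* A\<close>, form a split fibered category \<open>G\<close> equivalent to \<open>H\<close>, in which the connection isomorphisms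
  have become identities. An internal structure on \<open>H\<close> induces a tensor structure on \<open>G\<close>, and so does an
  external one: the product of \<open>(f, A)\<close> and \<open>(g, B)\<close> is the pullback of \<open>A \<box> B\<close> along the arrow with
  components \<open>f\<close> and \<open>g\<close>, and its isomorphisms \<open>m\<close> are identities. In both cases the axioms and the
  equivalences over \<open>H\<close> amount to those over \<open>G\<close>. The isomorphisms \<open>m\<close> of an internal structure \<open>T\<close> for
  the arrows with two components give an equivalence over \<open>G\<close> between \<open>T\<close> and \<open>E T\<close>, and those of an external
  structure give one between \<open>T\<close> and \<open>I T\<close>. Since the axioms can be transported along an equivalence, this
  shows at once that \<open>E T\<close> and \<open>I T\<close> satisfy them, that \<open>E\<close> and \<open>I\<close> preserve equivalence, and that they are
  mutually inverse up to equivalence.\<close>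

section \<open>Categories\<close>

text \<open>The overview leaves open why laws over the fibers and over \<open>G\<close> imply each
  other. Downwards, an axiom over the fibers is the law over \<open>G\<close> at universal objects:
  embedded objects for an internal structure, pairs of a projection and an object over a product for
  an external one. Upwards, the law of an external structure at objects with base arrows f1, f2, ...
  is the axiom over the product of their codomains, pulled back along the arrow with components f1,
  f2, ... . Naturality is the exception, since an arrow from f^*A to g^*B is in general no pullback
  of an arrow from A to B. It is assembled from naturality inside one fiber and compatibility with
  m; over \<open>G\<close> the latter is itself a naturality statement, at the arrows
  \<open>lam\<close>. Two further points shape the statements. An equivalence must be allowed to end
  in data that are merely well typed, since at first nothing more is known of E T and I T. And the
  external unit isomorphisms over X1 x X2 are not among the values of the lifted structure, so extra
  equations have to recover them from these values.\<close>

definition isoar :: "('o, 'a, 'z) cat_scheme \<Rightarrow> 'a \<Rightarrow> bool" where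
  "isoar C u \<longleftrightarrow> u \<in> Arr C \<and> (\<exists>v. inverse_arrows C u v)"

lemma Hom_iff: "f \<in> Hom C A B \<longleftrightarrow> f \<in> Arr C \<and> Dom C f = A \<and> Cod C f = B"
  by (auto simp: Hom_def)

text \<open>Invertibility is kept apart from typing. With \<open>isoar\<close>, domain and codomain
  are equations on \<open>Dom\<close> and \<open>Cod\<close> that conditional rewriting can
  discharge, whereas membership in \<open>Iso C A B\<close> requires \<open>A\<close> and
  \<open>B\<close> to be supplied.\<close>

lemma Iso_iff: "u \<in> Iso C A B \<longleftrightarrow> isoar C u \<and> Dom C u = A \<and> Cod C u = B"
  by (auto simp: Iso_def isoar_def Hom_iff)

context category
begin

lemma Ide_arr: "A \<in> Obj C \<Longrightarrow> Ide C A \<in> Arr C"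
  and Ide_dom: "A \<in> Obj C \<Longrightarrow> Dom C (Ide C A) = A"
  and Ide_cod: "A \<in> Obj C \<Longrightarrow> Cod C (Ide C A) = A"
  using ide_hom by (auto simp: Hom_iff)

lemma Cmp_arr: "u \<in> Arr C \<Longrightarrow> v \<in> Arr C \<Longrightarrow> Dom C v = Cod C u \<Longrightarrow> Cmp C v u \<in> Arr C"
  and Cmp_dom: "u \<in> Arr C \<Longrightarrow> v \<in> Arr C \<Longrightarrow> Dom C v = Cod C u \<Longrightarrow> Dom C (Cmp C v u) = Dom C u"
  and Cmp_cod: "u \<in> Arr C \<Longrightarrow> v \<in> Arr C \<Longrightarrow> Dom C v = Cod C u \<Longrightarrow> Cod C (Cmp C v u) = Cod C v"
  using cmp_hom[of u "Dom C u" "Cod C u" v "Cod C v"] by (auto simp: Hom_iff)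

lemma Cmp_Ide: "u \<in> Arr C \<Longrightarrow> Dom C u = A \<Longrightarrow> Cmp C u (Ide C A) = u"
  and Ide_Cmp: "u \<in> Arr C \<Longrightarrow> Cod C u = A \<Longrightarrow> Cmp C (Ide C A) u = u"
  using cmp_ide[of u A] ide_cmp[of u _ A] by (auto simp: Hom_iff)

lemma Cmp_assoc: "u \<in> Arr C \<Longrightarrow> v \<in> Arr C \<Longrightarrow> w \<in> Arr C \<Longrightarrow> Dom C v = Cod C u \<Longrightarrow> Dom C w = Cod C v \<Longrightarrow>
    Cmp C (Cmp C w v) u = Cmp C w (Cmp C v u)"
  using cmp_assoc[of u "Dom C u" "Cod C u" v "Cod C v" w "Cod C w"] by (auto simp: Hom_iff)

lemma inverse_unique:
  assumes "u \<in> Arr C" "inverse_arrows C u v" "inverse_arrows C u v'" shows "v = v'"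
proof -
  have v: "v \<in> Arr C" "Dom C v = Cod C u" "Cod C v = Dom C u" "Cmp C v u = Ide C (Dom C u)"
    and v': "v' \<in> Arr C" "Dom C v' = Cod C u" "Cod C v' = Dom C u" "Cmp C u v' = Ide C (Cod C u)"
    using assms by (auto simp: inverse_arrows_def Hom_iff)
  have "v = Cmp C v (Cmp C u v')"
    using v v' assms(1) by (simp add: Cmp_Ide)
  also have "\<dots> = Cmp C (Cmp C v u) v'"
    using v(1-3) v'(1-3) assms(1) Cmp_assoc by metis
  also have "\<dots> = v'" using v v' assms(1) by (simp add: Ide_Cmp)
  finally show ?thesis .
qed

lemma Inv_eqI:
  assumes "u \<in> Arr C" "inverse_arrows C u v" shows "Inv C u = v"
  unfolding Inv_def using assms inverse_unique by blast

lemma Inv_inverse: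
  assumes "isoar C u" shows "inverse_arrows C u (Inv C u)"
  using assms Inv_eqI by (auto simp: isoar_def)

lemma isoar_arr: "isoar C u \<Longrightarrow> u \<in> Arr C"
  by (simp add: isoar_def)

lemma Inv_arr: "isoar C u \<Longrightarrow> Inv C u \<in> Arr C"
  and Inv_dom: "isoar C u \<Longrightarrow> Dom C (Inv C u) = Cod C u"
  and Inv_cod: "isoar C u \<Longrightarrow> Cod C (Inv C u) = Dom C u"
  and Inv_Cmp: "isoar C u \<Longrightarrow> Cmp C (Inv C u) u = Ide C (Dom C u)"
  and Cmp_Inv: "isoar C u \<Longrightarrow> Cmp C u (Inv C u) = Ide C (Cod C u)"
  using Inv_inverse[of u] by (auto simp: inverse_arrows_def Hom_iff)

lemma Inv_Cmp_tail: "isoar C u \<Longrightarrow> w \<in> Arr C \<Longrightarrow> Cod C w = Dom C u \<Longrightarrow> Cmp C (Inv C u) (Cmp C u w) = w"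
  by (simp add: Cmp_assoc[symmetric] Inv_arr Inv_dom isoar_arr Inv_Cmp Ide_Cmp)

lemma Cmp_Inv_tail: "isoar C u \<Longrightarrow> w \<in> Arr C \<Longrightarrow> Cod C w = Cod C u \<Longrightarrow> Cmp C u (Cmp C (Inv C u) w) = w"
  by (simp add: Cmp_assoc[symmetric] Inv_arr Inv_cod Inv_dom isoar_arr Cmp_Inv Ide_Cmp)

lemma inverseI:
  assumes "u \<in> Arr C" "v \<in> Arr C" "Dom C v = Cod C u" "Cod C v = Dom C u"
    "Cmp C v u = Ide C (Dom C u)" "Cmp C u v = Ide C (Cod C u)"
  shows "isoar C u" "Inv C u = v"
proof -
  have i: "inverse_arrows C u v" using assms by (simp add: inverse_arrows_def Hom_iff)
  then show "isoar C u" using assms by (auto simp: isoar_def)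
  show "Inv C u = v" using i assms by (intro Inv_eqI)
qed

lemma isoar_Inv: "isoar C u \<Longrightarrow> isoar C (Inv C u)"
  and Inv_Inv: "isoar C u \<Longrightarrow> Inv C (Inv C u) = u"
  using inverseI[of "Inv C u" u]
  by (auto simp: Inv_arr Inv_dom Inv_cod Inv_Cmp Cmp_Inv isoar_arr)

lemma isoar_Ide: "A \<in> Obj C \<Longrightarrow> isoar C (Ide C A)"
  and Inv_Ide: "A \<in> Obj C \<Longrightarrow> Inv C (Ide C A) = Ide C A"
  using inverseI[of "Ide C A" "Ide C A"] by (auto simp: Ide_arr Ide_dom Ide_cod Cmp_Ide)

lemma isoar_Cmp: "isoar C u \<Longrightarrow> isoar C v \<Longrightarrow> Dom C v = Cod C u \<Longrightarrow> isoar C (Cmp C v u)"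
  and Inv_of_Cmp: "isoar C u \<Longrightarrow> isoar C v \<Longrightarrow> Dom C v = Cod C u \<Longrightarrow>
    Inv C (Cmp C v u) = Cmp C (Inv C u) (Inv C v)"
proof -
  assume a: "isoar C u" "isoar C v" "Dom C v = Cod C u"
  note s = Inv_arr Inv_dom Inv_cod Inv_Cmp Cmp_Inv isoar_arr Cmp_arr Cmp_dom Cmp_cod Cmp_assoc
    Inv_Cmp_tail Cmp_Inv_tail
  have "isoar C (Cmp C v u) \<and> Inv C (Cmp C v u) = Cmp C (Inv C u) (Inv C v)"
    using a by (intro conjI; intro inverseI[where v = "Cmp C (Inv C u) (Inv C v)"]) (simp_all add: s)
  then show "isoar C (Cmp C v u)" "Inv C (Cmp C v u) = Cmp C (Inv C u) (Inv C v)" by auto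
qed

lemma Cmp_left_cancel:
  "isoar C s \<Longrightarrow> u \<in> Arr C \<Longrightarrow> v \<in> Arr C \<Longrightarrow> Cod C u = Dom C s \<Longrightarrow> Cod C v = Dom C s \<Longrightarrow>
    Cmp C s u = Cmp C s v \<Longrightarrow> u = v"
  by (metis Inv_Cmp_tail)

lemma Cmp_right_cancel:
  assumes "isoar C s" "u \<in> Arr C" "v \<in> Arr C" "Dom C u = Cod C s" "Dom C v = Cod C s" "Cmp C u s = Cmp C v s"
  shows "u = v"
proof -
  have "u = Cmp C (Cmp C u s) (Inv C s)"
    using assms(1,2,4) by (simp add: Cmp_assoc Inv_arr Inv_dom Inv_cod isoar_arr Cmp_Inv Cmp_Ide)
  also have "\<dots> = Cmp C (Cmp C v s) (Inv C s)" using assms(6) by simp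
  also have "\<dots> = v"
    using assms(1,3,5) by (simp add: Cmp_assoc Inv_arr Inv_dom Inv_cod isoar_arr Cmp_Inv Cmp_Ide)
  finally show ?thesis .
qed

text \<open>Rewriting nests composites to the right, and there the left side of an equation between
  composites is no longer a subterm. This lemma and \<open>reassoc3\<close> make such an equation
  applicable at the head of a longer composite.\<close>

lemma reassoc:
  "Cmp C x y = z \<Longrightarrow> x \<in> Arr C \<Longrightarrow> y \<in> Arr C \<Longrightarrow> w \<in> Arr C \<Longrightarrow> Dom C x = Cod C y \<Longrightarrow> Dom C y = Cod C w \<Longrightarrow>
    Cmp C x (Cmp C y w) = Cmp C z w"
  using Cmp_assoc[of w y x] by simp

lemma reassoc3:
  "Cmp C x (Cmp C y y') = z \<Longrightarrow> x \<in> Arr C \<Longrightarrow> y \<in> Arr C \<Longrightarrow> y' \<in> Arr C \<Longrightarrow> w \<in> Arr C \<Longrightarrow>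
    Dom C x = Cod C y \<Longrightarrow> Dom C y = Cod C y' \<Longrightarrow> Dom C y' = Cod C w \<Longrightarrow>
    Cmp C x (Cmp C y (Cmp C y' w)) = Cmp C z w"
  using Cmp_assoc[of w y' y] Cmp_assoc[of w "Cmp C y y'" x] by (simp add: Cmp_arr Cmp_dom Cmp_cod)

lemmas cat_simps = dom_obj cod_obj Ide_arr Ide_dom Ide_cod Cmp_arr Cmp_dom Cmp_cod Cmp_Ide Ide_Cmp Cmp_assoc
  isoar_arr Inv_arr Inv_dom Inv_cod Inv_Cmp Cmp_Inv Inv_Cmp_tail Cmp_Inv_tail isoar_Inv Inv_Inv
  isoar_Ide Inv_Ide isoar_Cmp Inv_of_Cmp

end

text \<open>For passing to inverse equivalences: a commutative square stays commutative when two
  opposite sides are inverted.\<close>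

lemma (in category) Inv_square:
  assumes "isoar C s" "isoar C r" "x \<in> Arr C" "y \<in> Arr C" "Dom C x = Dom C s" "Cod C x = Dom C r"
    "Dom C y = Cod C s" "Cod C y = Cod C r" "Cmp C y s = Cmp C r x"
  shows "Cmp C x (Inv C s) = Cmp C (Inv C r) y"
proof (rule Cmp_right_cancel[of s])
  have "Cmp C (Cmp C (Inv C r) y) s = Cmp C (Inv C r) (Cmp C r x)"
    using assms by (simp add: cat_simps)
  then show "Cmp C (Cmp C x (Inv C s)) s = Cmp C (Cmp C (Inv C r) y) s"
    using assms by (simp add: cat_simps)
qed (use assms in \<open>simp_all add: cat_simps\<close>)

section \<open>Strict vertical categories and their tensor structures\<close>

text \<open>All fibers of a split fibered category are collected in one category \<open>G\<close>: the base object of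
  an object \<open>a\<close> is \<open>bs a\<close>, and all arrows are vertical.\<close>

locale vertical = base: category S + tot: category G
  for S :: "('s, 'f, 'z) cat_scheme" and G :: "('x, 'y) cat" +
  fixes bs :: "'x \<Rightarrow> 's" and pl :: "'f \<Rightarrow> 'x \<Rightarrow> 'x" and pa :: "'f \<Rightarrow> 'y \<Rightarrow> 'y"
  assumes bs_obj: "a \<in> Obj G \<Longrightarrow> bs a \<in> Obj S"
    and bs_arr: "u \<in> Arr G \<Longrightarrow> bs (Cod G u) = bs (Dom G u)"
    and pl_obj: "k \<in> Arr S \<Longrightarrow> a \<in> Obj G \<Longrightarrow> bs a = Cod S k \<Longrightarrow> pl k a \<in> Obj G"
    and bs_pl: "k \<in> Arr S \<Longrightarrow> a \<in> Obj G \<Longrightarrow> bs a = Cod S k \<Longrightarrow> bs (pl k a) = Dom S k"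
    and pa_arr: "k \<in> Arr S \<Longrightarrow> u \<in> Arr G \<Longrightarrow> bs (Dom G u) = Cod S k \<Longrightarrow> pa k u \<in> Arr G"
    and pa_dom: "k \<in> Arr S \<Longrightarrow> u \<in> Arr G \<Longrightarrow> bs (Dom G u) = Cod S k \<Longrightarrow> Dom G (pa k u) = pl k (Dom G u)"
    and pa_cod: "k \<in> Arr S \<Longrightarrow> u \<in> Arr G \<Longrightarrow> bs (Dom G u) = Cod S k \<Longrightarrow> Cod G (pa k u) = pl k (Cod G u)"
    and pa_Ide: "k \<in> Arr S \<Longrightarrow> a \<in> Obj G \<Longrightarrow> bs a = Cod S k \<Longrightarrow> pa k (Ide G a) = Ide G (pl k a)"
    and pa_Cmp: "k \<in> Arr S \<Longrightarrow> u \<in> Arr G \<Longrightarrow> v \<in> Arr G \<Longrightarrow> Dom G v = Cod G u \<Longrightarrow> bs (Dom G u) = Cod S k \<Longrightarrow>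
      pa k (Cmp G v u) = Cmp G (pa k v) (pa k u)"
    and pl_Ide: "a \<in> Obj G \<Longrightarrow> bs a = X \<Longrightarrow> pl (Ide S X) a = a"
    and pa_Ide_base: "u \<in> Arr G \<Longrightarrow> bs (Dom G u) = X \<Longrightarrow> pa (Ide S X) u = u"
    and pl_pl: "k \<in> Arr S \<Longrightarrow> l \<in> Arr S \<Longrightarrow> Cod S l = Dom S k \<Longrightarrow> a \<in> Obj G \<Longrightarrow> bs a = Cod S k \<Longrightarrow>
      pl l (pl k a) = pl (Cmp S k l) a"
    and pa_pa: "k \<in> Arr S \<Longrightarrow> l \<in> Arr S \<Longrightarrow> Cod S l = Dom S k \<Longrightarrow> u \<in> Arr G \<Longrightarrow> bs (Dom G u) = Cod S k \<Longrightarrow>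
      pa l (pa k u) = pa (Cmp S k l) u"
begin

lemma isoar_pa: "isoar G u \<Longrightarrow> k \<in> Arr S \<Longrightarrow> bs (Dom G u) = Cod S k \<Longrightarrow> isoar G (pa k u)"
  and Inv_pa: "isoar G u \<Longrightarrow> k \<in> Arr S \<Longrightarrow> bs (Dom G u) = Cod S k \<Longrightarrow> Inv G (pa k u) = pa k (Inv G u)"
proof -
  assume a: "isoar G u" "k \<in> Arr S" "bs (Dom G u) = Cod S k"
  note s = pa_arr pa_dom pa_cod tot.cat_simps bs_arr pa_Cmp[symmetric] pa_Ide
  have "isoar G (pa k u) \<and> Inv G (pa k u) = pa k (Inv G u)"
    using a by (intro conjI; intro tot.inverseI[where v = "pa k (Inv G u)"]) (simp_all add: s)
  then show "isoar G (pa k u)" "Inv G (pa k u) = pa k (Inv G u)" by auto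
qed

lemmas vert_simps = tot.cat_simps base.cat_simps bs_obj bs_arr pl_obj bs_pl pa_arr pa_dom pa_cod pa_Ide pa_Cmp
  pl_Ide pa_Ide_base pl_pl pa_pa isoar_pa Inv_pa

end

text \<open>All constraints are plain fields. Which of them carry meaning is decided by the
  parameter \<open>K\<close> of the locales below, where every condition on a constraint is guarded
  by membership in \<open>K\<close>. The unit section consists of \<open>one\<close>, indexed by
  base objects, and \<open>sr\<close>, indexed by base arrows.\<close>

record ('s, 'f, 'x, 'y) stens =
  to :: "'x \<Rightarrow> 'x \<Rightarrow> 'x"
  ta :: "'y \<Rightarrow> 'y \<Rightarrow> 'y"
  sm :: "'f \<Rightarrow> 'x \<Rightarrow> 'x \<Rightarrow> 'y"
  sas :: "'x \<Rightarrow> 'x \<Rightarrow> 'x \<Rightarrow> 'y"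
  sco :: "'x \<Rightarrow> 'x \<Rightarrow> 'y"
  one :: "'s \<Rightarrow> 'x"
  sr :: "'f \<Rightarrow> 'y"
  ur :: "'x \<Rightarrow> 'y"
  ul :: "'x \<Rightarrow> 'y"

text \<open>Typing is separated from the laws because the target of an equivalence is at first only
  known to be well typed. The cocycle condition \<open>sr_cmp\<close> of the unit section is counted
  as typing: the constructions keep the unit section, so it is available from the start.\<close>

locale styped = vertical S G bs pl pa
  for S :: "('s, 'f, 'z) cat_scheme" and G :: "('x, 'y) cat" and bs pl pa +
  fixes K :: "tensor_property set" and t :: "('s, 'f, 'x, 'y) stens"
  assumes to_obj: "a \<in> Obj G \<Longrightarrow> b \<in> Obj G \<Longrightarrow> bs b = bs a \<Longrightarrow> to t a b \<in> Obj G"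
    and bs_to: "a \<in> Obj G \<Longrightarrow> b \<in> Obj G \<Longrightarrow> bs b = bs a \<Longrightarrow> bs (to t a b) = bs a"
    and ta_arr: "u \<in> Arr G \<Longrightarrow> v \<in> Arr G \<Longrightarrow> bs (Dom G v) = bs (Dom G u) \<Longrightarrow> ta t u v \<in> Arr G"
    and ta_dom: "u \<in> Arr G \<Longrightarrow> v \<in> Arr G \<Longrightarrow> bs (Dom G v) = bs (Dom G u) \<Longrightarrow>
      Dom G (ta t u v) = to t (Dom G u) (Dom G v)"
    and ta_cod: "u \<in> Arr G \<Longrightarrow> v \<in> Arr G \<Longrightarrow> bs (Dom G v) = bs (Dom G u) \<Longrightarrow>
      Cod G (ta t u v) = to t (Cod G u) (Cod G v)"
    and sm_arr: "k \<in> Arr S \<Longrightarrow> a \<in> Obj G \<Longrightarrow> b \<in> Obj G \<Longrightarrow> bs a = Cod S k \<Longrightarrow> bs b = Cod S k \<Longrightarrow>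
      sm t k a b \<in> Arr G"
    and sm_dom: "k \<in> Arr S \<Longrightarrow> a \<in> Obj G \<Longrightarrow> b \<in> Obj G \<Longrightarrow> bs a = Cod S k \<Longrightarrow> bs b = Cod S k \<Longrightarrow>
      Dom G (sm t k a b) = to t (pl k a) (pl k b)"
    and sm_cod: "k \<in> Arr S \<Longrightarrow> a \<in> Obj G \<Longrightarrow> b \<in> Obj G \<Longrightarrow> bs a = Cod S k \<Longrightarrow> bs b = Cod S k \<Longrightarrow>
      Cod G (sm t k a b) = pl k (to t a b)"
    and sas_arr: "Associative \<in> K \<Longrightarrow> a \<in> Obj G \<Longrightarrow> b \<in> Obj G \<Longrightarrow> c \<in> Obj G \<Longrightarrow> bs b = bs a \<Longrightarrow> bs c = bs a \<Longrightarrow>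
      sas t a b c \<in> Arr G"
    and sas_dom: "Associative \<in> K \<Longrightarrow> a \<in> Obj G \<Longrightarrow> b \<in> Obj G \<Longrightarrow> c \<in> Obj G \<Longrightarrow> bs b = bs a \<Longrightarrow> bs c = bs a \<Longrightarrow>
      Dom G (sas t a b c) = to t (to t a b) c"
    and sas_cod: "Associative \<in> K \<Longrightarrow> a \<in> Obj G \<Longrightarrow> b \<in> Obj G \<Longrightarrow> c \<in> Obj G \<Longrightarrow> bs b = bs a \<Longrightarrow> bs c = bs a \<Longrightarrow>
      Cod G (sas t a b c) = to t a (to t b c)"
    and sco_arr: "Symmetric \<in> K \<Longrightarrow> a \<in> Obj G \<Longrightarrow> b \<in> Obj G \<Longrightarrow> bs b = bs a \<Longrightarrow> sco t a b \<in> Arr G"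
    and sco_dom: "Symmetric \<in> K \<Longrightarrow> a \<in> Obj G \<Longrightarrow> b \<in> Obj G \<Longrightarrow> bs b = bs a \<Longrightarrow> Dom G (sco t a b) = to t a b"
    and sco_cod: "Symmetric \<in> K \<Longrightarrow> a \<in> Obj G \<Longrightarrow> b \<in> Obj G \<Longrightarrow> bs b = bs a \<Longrightarrow> Cod G (sco t a b) = to t b a"
    and one_obj: "Unitary \<in> K \<Longrightarrow> X \<in> Obj S \<Longrightarrow> one t X \<in> Obj G"
    and bs_one: "Unitary \<in> K \<Longrightarrow> X \<in> Obj S \<Longrightarrow> bs (one t X) = X"
    and sr_iso: "Unitary \<in> K \<Longrightarrow> k \<in> Arr S \<Longrightarrow> isoar G (sr t k)"
    and sr_dom: "Unitary \<in> K \<Longrightarrow> k \<in> Arr S \<Longrightarrow> Dom G (sr t k) = pl k (one t (Cod S k))"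
    and sr_cod: "Unitary \<in> K \<Longrightarrow> k \<in> Arr S \<Longrightarrow> Cod G (sr t k) = one t (Dom S k)"
    and sr_cmp: "Unitary \<in> K \<Longrightarrow> k \<in> Arr S \<Longrightarrow> l \<in> Arr S \<Longrightarrow> Cod S l = Dom S k \<Longrightarrow>
      sr t (Cmp S k l) = Cmp G (sr t l) (pa l (sr t k))"
    and ur_arr: "Unitary \<in> K \<Longrightarrow> a \<in> Obj G \<Longrightarrow> ur t a \<in> Arr G"
    and ur_dom: "Unitary \<in> K \<Longrightarrow> a \<in> Obj G \<Longrightarrow> Dom G (ur t a) = to t a (one t (bs a))"
    and ur_cod: "Unitary \<in> K \<Longrightarrow> a \<in> Obj G \<Longrightarrow> Cod G (ur t a) = a"
    and ul_arr: "Unitary \<in> K \<Longrightarrow> a \<in> Obj G \<Longrightarrow> ul t a \<in> Arr G"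
    and ul_dom: "Unitary \<in> K \<Longrightarrow> a \<in> Obj G \<Longrightarrow> Dom G (ul t a) = to t (one t (bs a)) a"
    and ul_cod: "Unitary \<in> K \<Longrightarrow> a \<in> Obj G \<Longrightarrow> Cod G (ul t a) = a"
begin

lemma sr_arr: "Unitary \<in> K \<Longrightarrow> k \<in> Arr S \<Longrightarrow> sr t k \<in> Arr G"
  by (simp add: sr_iso tot.isoar_arr)

lemmas typ_simps = to_obj bs_to ta_arr ta_dom ta_cod sm_arr sm_dom sm_cod sas_arr sas_dom sas_cod
  sco_arr sco_dom sco_cod one_obj bs_one sr_arr sr_iso sr_dom sr_cod ur_arr ur_dom ur_cod ul_arr ul_dom ul_cod

end

text \<open>These are the axioms of a \<open>K\<close>-internal structure over a split fibered
  category. Pullback is strictly functorial on objects and arrows, so no connection isomorphism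
  occurs, and being in a common fiber is the condition that the values of \<open>bs\<close>
  agree.\<close>

locale stensor = styped +
  assumes ta_Ide: "a \<in> Obj G \<Longrightarrow> b \<in> Obj G \<Longrightarrow> bs b = bs a \<Longrightarrow> ta t (Ide G a) (Ide G b) = Ide G (to t a b)"
    and ta_Cmp: "u \<in> Arr G \<Longrightarrow> v \<in> Arr G \<Longrightarrow> u' \<in> Arr G \<Longrightarrow> v' \<in> Arr G \<Longrightarrow> Dom G u' = Cod G u \<Longrightarrow>
      Dom G v' = Cod G v \<Longrightarrow> bs (Dom G v) = bs (Dom G u) \<Longrightarrow>
      ta t (Cmp G u' u) (Cmp G v' v) = Cmp G (ta t u' v') (ta t u v)"
    and sm_iso: "k \<in> Arr S \<Longrightarrow> a \<in> Obj G \<Longrightarrow> b \<in> Obj G \<Longrightarrow> bs a = Cod S k \<Longrightarrow> bs b = Cod S k \<Longrightarrow>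
      isoar G (sm t k a b)"
    and sm_nat: "k \<in> Arr S \<Longrightarrow> u \<in> Arr G \<Longrightarrow> v \<in> Arr G \<Longrightarrow> bs (Dom G u) = Cod S k \<Longrightarrow> bs (Dom G v) = Cod S k \<Longrightarrow>
      Cmp G (sm t k (Cod G u) (Cod G v)) (ta t (pa k u) (pa k v)) =
      Cmp G (pa k (ta t u v)) (sm t k (Dom G u) (Dom G v))"
    and sm_cmp: "k \<in> Arr S \<Longrightarrow> l \<in> Arr S \<Longrightarrow> Cod S l = Dom S k \<Longrightarrow> a \<in> Obj G \<Longrightarrow> b \<in> Obj G \<Longrightarrow>
      bs a = Cod S k \<Longrightarrow> bs b = Cod S k \<Longrightarrow>
      sm t (Cmp S k l) a b = Cmp G (pa l (sm t k a b)) (sm t l (pl k a) (pl k b))"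
    and sas_iso: "Associative \<in> K \<Longrightarrow> a \<in> Obj G \<Longrightarrow> b \<in> Obj G \<Longrightarrow> c \<in> Obj G \<Longrightarrow> bs b = bs a \<Longrightarrow> bs c = bs a \<Longrightarrow>
      isoar G (sas t a b c)"
    and sas_nat: "Associative \<in> K \<Longrightarrow> u \<in> Arr G \<Longrightarrow> v \<in> Arr G \<Longrightarrow> w \<in> Arr G \<Longrightarrow> bs (Dom G v) = bs (Dom G u) \<Longrightarrow>
      bs (Dom G w) = bs (Dom G u) \<Longrightarrow>
      Cmp G (sas t (Cod G u) (Cod G v) (Cod G w)) (ta t (ta t u v) w) =
      Cmp G (ta t u (ta t v w)) (sas t (Dom G u) (Dom G v) (Dom G w))"
    and pentagon: "Associative \<in> K \<Longrightarrow> a \<in> Obj G \<Longrightarrow> b \<in> Obj G \<Longrightarrow> c \<in> Obj G \<Longrightarrow> d \<in> Obj G \<Longrightarrow>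
      bs b = bs a \<Longrightarrow> bs c = bs a \<Longrightarrow> bs d = bs a \<Longrightarrow>
      Cmp G (sas t a b (to t c d)) (sas t (to t a b) c d) =
      Cmp G (ta t (Ide G a) (sas t b c d)) (Cmp G (sas t a (to t b c) d) (ta t (sas t a b c) (Ide G d)))"
    and sas_sm: "Associative \<in> K \<Longrightarrow> k \<in> Arr S \<Longrightarrow> a \<in> Obj G \<Longrightarrow> b \<in> Obj G \<Longrightarrow> c \<in> Obj G \<Longrightarrow>
      bs a = Cod S k \<Longrightarrow> bs b = Cod S k \<Longrightarrow> bs c = Cod S k \<Longrightarrow>
      Cmp G (pa k (sas t a b c)) (Cmp G (sm t k (to t a b) c) (ta t (sm t k a b) (Ide G (pl k c)))) =
      Cmp G (sm t k a (to t b c)) (Cmp G (ta t (Ide G (pl k a)) (sm t k b c)) (sas t (pl k a) (pl k b) (pl k c)))"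
    and sco_nat: "Symmetric \<in> K \<Longrightarrow> u \<in> Arr G \<Longrightarrow> v \<in> Arr G \<Longrightarrow> bs (Dom G v) = bs (Dom G u) \<Longrightarrow>
      Cmp G (sco t (Cod G u) (Cod G v)) (ta t u v) = Cmp G (ta t v u) (sco t (Dom G u) (Dom G v))"
    and sco_sco: "Symmetric \<in> K \<Longrightarrow> a \<in> Obj G \<Longrightarrow> b \<in> Obj G \<Longrightarrow> bs b = bs a \<Longrightarrow>
      Cmp G (sco t b a) (sco t a b) = Ide G (to t a b)"
    and sco_sm: "Symmetric \<in> K \<Longrightarrow> k \<in> Arr S \<Longrightarrow> a \<in> Obj G \<Longrightarrow> b \<in> Obj G \<Longrightarrow> bs a = Cod S k \<Longrightarrow> bs b = Cod S k \<Longrightarrow>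
      Cmp G (pa k (sco t a b)) (sm t k a b) = Cmp G (sm t k b a) (sco t (pl k a) (pl k b))"
    and ur_iso: "Unitary \<in> K \<Longrightarrow> a \<in> Obj G \<Longrightarrow> isoar G (ur t a)"
    and ul_iso: "Unitary \<in> K \<Longrightarrow> a \<in> Obj G \<Longrightarrow> isoar G (ul t a)"
    and ur_nat: "Unitary \<in> K \<Longrightarrow> u \<in> Arr G \<Longrightarrow>
      Cmp G (ur t (Cod G u)) (ta t u (Ide G (one t (bs (Dom G u))))) = Cmp G u (ur t (Dom G u))"
    and ul_nat: "Unitary \<in> K \<Longrightarrow> u \<in> Arr G \<Longrightarrow>
      Cmp G (ul t (Cod G u)) (ta t (Ide G (one t (bs (Dom G u)))) u) = Cmp G u (ul t (Dom G u))"
    and ur_ul: "Unitary \<in> K \<Longrightarrow> X \<in> Obj S \<Longrightarrow> ur t (one t X) = ul t (one t X)"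
    and ur_sm: "Unitary \<in> K \<Longrightarrow> k \<in> Arr S \<Longrightarrow> a \<in> Obj G \<Longrightarrow> bs a = Cod S k \<Longrightarrow>
      Cmp G (pa k (ur t a)) (sm t k a (one t (Cod S k))) = Cmp G (ur t (pl k a)) (ta t (Ide G (pl k a)) (sr t k))"
    and ul_sm: "Unitary \<in> K \<Longrightarrow> k \<in> Arr S \<Longrightarrow> a \<in> Obj G \<Longrightarrow> bs a = Cod S k \<Longrightarrow>
      Cmp G (pa k (ul t a)) (sm t k (one t (Cod S k)) a) = Cmp G (ul t (pl k a)) (ta t (sr t k) (Ide G (pl k a)))"
    and hexagon: "Associative \<in> K \<Longrightarrow> Symmetric \<in> K \<Longrightarrow> a \<in> Obj G \<Longrightarrow> b \<in> Obj G \<Longrightarrow> c \<in> Obj G \<Longrightarrow>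
      bs b = bs a \<Longrightarrow> bs c = bs a \<Longrightarrow>
      Cmp G (ta t (Ide G b) (sco t a c)) (Cmp G (sas t b a c) (ta t (sco t a b) (Ide G c))) =
      Cmp G (sas t b c a) (Cmp G (sco t a (to t b c)) (sas t a b c))"
    and ul_sas: "Associative \<in> K \<Longrightarrow> Unitary \<in> K \<Longrightarrow> b \<in> Obj G \<Longrightarrow> c \<in> Obj G \<Longrightarrow> bs c = bs b \<Longrightarrow>
      Cmp G (ul t (to t b c)) (sas t (one t (bs b)) b c) = ta t (ul t b) (Ide G c)"
    and ur_ul_sas: "Associative \<in> K \<Longrightarrow> Unitary \<in> K \<Longrightarrow> a \<in> Obj G \<Longrightarrow> c \<in> Obj G \<Longrightarrow> bs c = bs a \<Longrightarrow>
      Cmp G (ta t (Ide G a) (ul t c)) (sas t a (one t (bs a)) c) = ta t (ur t a) (Ide G c)"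
    and ur_sas: "Associative \<in> K \<Longrightarrow> Unitary \<in> K \<Longrightarrow> a \<in> Obj G \<Longrightarrow> b \<in> Obj G \<Longrightarrow> bs b = bs a \<Longrightarrow>
      Cmp G (ta t (Ide G a) (ur t b)) (sas t a b (one t (bs a))) = ur t (to t a b)"
    and ur_sco: "Symmetric \<in> K \<Longrightarrow> Unitary \<in> K \<Longrightarrow> b \<in> Obj G \<Longrightarrow>
      Cmp G (ur t b) (sco t (one t (bs b)) b) = ul t b"
begin

lemma isoar_ta: "isoar G u \<Longrightarrow> isoar G v \<Longrightarrow> bs (Dom G v) = bs (Dom G u) \<Longrightarrow> isoar G (ta t u v)"
  and Inv_ta: "isoar G u \<Longrightarrow> isoar G v \<Longrightarrow> bs (Dom G v) = bs (Dom G u) \<Longrightarrow>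
    Inv G (ta t u v) = ta t (Inv G u) (Inv G v)"
proof -
  assume a: "isoar G u" "isoar G v" "bs (Dom G v) = bs (Dom G u)"
  note s = typ_simps vert_simps ta_Cmp[symmetric] ta_Ide
  have "isoar G (ta t u v) \<and> Inv G (ta t u v) = ta t (Inv G u) (Inv G v)"
    using a by (intro conjI; intro tot.inverseI[where v = "ta t (Inv G u) (Inv G v)"]) (simp_all add: s)
  then show "isoar G (ta t u v)" "Inv G (ta t u v) = ta t (Inv G u) (Inv G v)" by auto
qed

lemma sco_iso: "Symmetric \<in> K \<Longrightarrow> a \<in> Obj G \<Longrightarrow> b \<in> Obj G \<Longrightarrow> bs b = bs a \<Longrightarrow> isoar G (sco t a b)"
  by (rule tot.inverseI[where v = "sco t b a"]) (simp_all add: sco_sco typ_simps)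

lemmas ten_simps = typ_simps ta_Ide sm_iso sas_iso ur_iso ul_iso isoar_ta Inv_ta sco_iso

end

section \<open>Equivalences and the transport of laws along them\<close>

text \<open>An equivalence \<open>e\<close>, with the isomorphism \<open>w\<close> of unit sections, from a tensor structure to
  data that are only known to be well typed.\<close>

locale sequiv_map = t1: stensor S G bs pl pa K t1 + t2: styped S G bs pl pa K t2
  for S :: "('s, 'f, 'z) cat_scheme" and G :: "('x, 'y) cat" and bs pl pa K
    and t1 t2 :: "('s, 'f, 'x, 'y) stens" +
  fixes e :: "'x \<Rightarrow> 'x \<Rightarrow> 'y" and w :: "'s \<Rightarrow> 'y"
  assumes e_iso: "a \<in> Obj G \<Longrightarrow> b \<in> Obj G \<Longrightarrow> bs b = bs a \<Longrightarrow> isoar G (e a b)"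
    and e_dom: "a \<in> Obj G \<Longrightarrow> b \<in> Obj G \<Longrightarrow> bs b = bs a \<Longrightarrow> Dom G (e a b) = to t1 a b"
    and e_cod: "a \<in> Obj G \<Longrightarrow> b \<in> Obj G \<Longrightarrow> bs b = bs a \<Longrightarrow> Cod G (e a b) = to t2 a b"
    and e_nat: "u \<in> Arr G \<Longrightarrow> v \<in> Arr G \<Longrightarrow> bs (Dom G v) = bs (Dom G u) \<Longrightarrow>
      Cmp G (e (Cod G u) (Cod G v)) (ta t1 u v) = Cmp G (ta t2 u v) (e (Dom G u) (Dom G v))"
    and e_sm: "k \<in> Arr S \<Longrightarrow> a \<in> Obj G \<Longrightarrow> b \<in> Obj G \<Longrightarrow> bs a = Cod S k \<Longrightarrow> bs b = Cod S k \<Longrightarrow>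
      Cmp G (pa k (e a b)) (sm t1 k a b) = Cmp G (sm t2 k a b) (e (pl k a) (pl k b))"
    and e_sas: "Associative \<in> K \<Longrightarrow> a \<in> Obj G \<Longrightarrow> b \<in> Obj G \<Longrightarrow> c \<in> Obj G \<Longrightarrow> bs b = bs a \<Longrightarrow> bs c = bs a \<Longrightarrow>
      Cmp G (sas t2 a b c) (Cmp G (e (to t2 a b) c) (ta t1 (e a b) (Ide G c))) =
      Cmp G (e a (to t2 b c)) (Cmp G (ta t1 (Ide G a) (e b c)) (sas t1 a b c))"
    and e_sco: "Symmetric \<in> K \<Longrightarrow> a \<in> Obj G \<Longrightarrow> b \<in> Obj G \<Longrightarrow> bs b = bs a \<Longrightarrow>
      Cmp G (sco t2 a b) (e a b) = Cmp G (e b a) (sco t1 a b)"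
    and w_iso: "Unitary \<in> K \<Longrightarrow> X \<in> Obj S \<Longrightarrow> isoar G (w X)"
    and w_dom: "Unitary \<in> K \<Longrightarrow> X \<in> Obj S \<Longrightarrow> Dom G (w X) = one t1 X"
    and w_cod: "Unitary \<in> K \<Longrightarrow> X \<in> Obj S \<Longrightarrow> Cod G (w X) = one t2 X"
    and w_sr: "Unitary \<in> K \<Longrightarrow> k \<in> Arr S \<Longrightarrow>
      Cmp G (sr t2 k) (pa k (w (Cod S k))) = Cmp G (w (Dom S k)) (sr t1 k)"
    and e_ur: "Unitary \<in> K \<Longrightarrow> a \<in> Obj G \<Longrightarrow>
      ur t1 a = Cmp G (ur t2 a) (Cmp G (e a (one t2 (bs a))) (ta t1 (Ide G a) (w (bs a))))"
    and e_ul: "Unitary \<in> K \<Longrightarrow> a \<in> Obj G \<Longrightarrow>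
      ul t1 a = Cmp G (ul t2 a) (Cmp G (e (one t2 (bs a)) a) (ta t1 (w (bs a)) (Ide G a)))"
begin

lemma e_arr: "a \<in> Obj G \<Longrightarrow> b \<in> Obj G \<Longrightarrow> bs b = bs a \<Longrightarrow> e a b \<in> Arr G"
  by (simp add: e_iso t1.tot.isoar_arr)

lemma w_arr: "Unitary \<in> K \<Longrightarrow> X \<in> Obj S \<Longrightarrow> w X \<in> Arr G"
  by (simp add: w_iso t1.tot.isoar_arr)

lemmas ew_simps = e_iso e_arr e_dom e_cod w_iso w_arr w_dom w_cod
lemmas all_simps = t1.vert_simps t1.ten_simps t2.typ_simps ew_simps

text \<open>\<open>st s r\<close> extends the equivalence from objects to isomorphisms. The relation \<open>rel s r x y\<close>
  says that \<open>y\<close> is conjugate to \<open>x\<close> along the isomorphisms \<open>s\<close> and \<open>r\<close>; it is respected by all the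
  operations of the two structures, which transports every law from \<open>t1\<close> to \<open>t2\<close>.\<close>

definition st :: "'y \<Rightarrow> 'y \<Rightarrow> 'y" where
  "st s r = Cmp G (e (Cod G s) (Cod G r)) (ta t1 s r)"

definition rel :: "'y \<Rightarrow> 'y \<Rightarrow> 'y \<Rightarrow> 'y \<Rightarrow> bool" where
  "rel s r x y \<longleftrightarrow> isoar G s \<and> isoar G r \<and> x \<in> Arr G \<and> y \<in> Arr G \<and> Dom G x = Dom G s \<and> Cod G x = Dom G r \<and>
     Dom G y = Cod G s \<and> Cod G y = Cod G r \<and> Cmp G y s = Cmp G r x"

lemma st_simps:
  assumes "isoar G s" "isoar G r" "bs (Dom G r) = bs (Dom G s)"
  shows "isoar G (st s r)" "Dom G (st s r) = to t1 (Dom G s) (Dom G r)" "Cod G (st s r) = to t2 (Cod G s) (Cod G r)"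
  using assms by (simp_all add: st_def all_simps)

lemma st_bs: "isoar G s \<Longrightarrow> isoar G r \<Longrightarrow> bs (Dom G r) = bs (Dom G s) \<Longrightarrow> bs (Dom G (st s r)) = bs (Dom G s)"
  by (simp add: st_simps all_simps)

lemma rel_simps: "rel s r x y \<Longrightarrow> isoar G s" "rel s r x y \<Longrightarrow> isoar G r"
   "rel s r x y \<Longrightarrow> bs (Dom G r) = bs (Dom G s)"
  using t1.bs_arr[of x] by (auto simp: rel_def)

lemma rel_eq:
  assumes "rel s r x y" "rel s r x' y'" "x = x'" shows "y = y'"
  using assms by (intro t1.tot.Cmp_right_cancel[of s y y']) (auto simp: rel_def)

lemma rel_iso:
  assumes "rel s r x y" "isoar G x" shows "isoar G y"
proof -
  have "y = Cmp G r (Cmp G x (Inv G s))"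
    using assms t1.tot.Cmp_right_cancel[of s y "Cmp G r (Cmp G x (Inv G s))"]
    by (simp add: rel_def all_simps)
  then show ?thesis using assms by (simp add: rel_def all_simps)
qed

lemma rel_Ide: "isoar G s \<Longrightarrow> rel s s (Ide G (Dom G s)) (Ide G (Cod G s))"
  by (simp add: rel_def all_simps)

lemma rel_arr: "u \<in> Arr G \<Longrightarrow> rel (Ide G (Dom G u)) (Ide G (Cod G u)) u u"
  by (simp add: rel_def all_simps)

lemma rel_Cmp:
  assumes "rel r q x' y'" "rel s r x y" shows "rel s q (Cmp G x' x) (Cmp G y' y)"
  using assms t1.tot.reassoc[of y' r "Cmp G q x'" x] by (simp add: rel_def all_simps)

lemma rel_ta:
  assumes "rel s r x y" "rel s' r' x' y'" "bs (Dom G s') = bs (Dom G s)"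
  shows "rel (st s s') (st r r') (ta t1 x x') (ta t2 y y')"
proof -
  note a = assms[unfolded rel_def]
  note b = rel_simps[OF assms(1)] rel_simps[OF assms(2)] assms(3)
  have bsc: "bs (Cod G s) = bs (Dom G s)" "bs (Cod G s') = bs (Dom G s)"
      "bs (Cod G r) = bs (Dom G s)" "bs (Cod G r') = bs (Dom G s)"
    using b by (simp_all add: all_simps)
  have "Cmp G (ta t2 y y') (Cmp G (e (Cod G s) (Cod G s')) (ta t1 s s')) =
      Cmp G (Cmp G (e (Cod G r) (Cod G r')) (ta t1 y y')) (ta t1 s s')"
    using a b bsc e_nat[of y y'] by (subst t1.tot.reassoc) (auto simp add: all_simps)
  also have "\<dots> = Cmp G (e (Cod G r) (Cod G r')) (ta t1 (Cmp G y s) (Cmp G y' s'))"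
    using a b bsc by (simp add: all_simps flip: t1.ta_Cmp)
  also have "\<dots> = Cmp G (Cmp G (e (Cod G r) (Cod G r')) (ta t1 r r')) (ta t1 x x')"
    using a b bsc by (simp add: all_simps flip: t1.ta_Cmp)
  finally show ?thesis
    using a b bsc st_simps[of s s'] st_simps[of r r'] unfolding rel_def st_def
    by (simp add: all_simps)
qed

lemma rel_pa:
  assumes "rel s r x y" "k \<in> Arr S" "bs (Dom G s) = Cod S k" shows "rel (pa k s) (pa k r) (pa k x) (pa k y)"
  using assms rel_simps[OF assms(1)] t1.bs_arr[of s]
  by (simp add: rel_def all_simps flip: t1.pa_Cmp)

lemma rel_sm:
  assumes "isoar G s" "isoar G r" "k \<in> Arr S" "bs (Dom G s) = Cod S k" "bs (Dom G r) = Cod S k"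
  shows "rel (st (pa k s) (pa k r)) (pa k (st s r)) (sm t1 k (Dom G s) (Dom G r)) (sm t2 k (Cod G s) (Cod G r))"
proof -
  have "Cmp G (sm t2 k (Cod G s) (Cod G r))
        (Cmp G (e (pl k (Cod G s)) (pl k (Cod G r))) (ta t1 (pa k s) (pa k r))) =
      Cmp G (Cmp G (pa k (e (Cod G s) (Cod G r))) (sm t1 k (Cod G s) (Cod G r))) (ta t1 (pa k s) (pa k r))"
    using assms e_sm[of k "Cod G s" "Cod G r"] by (subst t1.tot.reassoc) (auto simp add: all_simps)
  also have "\<dots> = Cmp G (pa k (e (Cod G s) (Cod G r))) (Cmp G (pa k (ta t1 s r)) (sm t1 k (Dom G s) (Dom G r)))"
    using assms t1.sm_nat[of k s r] by (simp add: all_simps)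
  finally show ?thesis using assms unfolding rel_def st_def by (simp add: all_simps)
qed

text \<open>The compatibility \<open>e_sas\<close> is the case of identities. Naturality of
  \<open>sas t1\<close> and of \<open>e\<close> extends it to arbitrary isomorphisms, which is
  needed because the laws apply the constraint to products and to units, where the comparison is an
  \<open>st\<close> or a \<open>w\<close>.\<close>

lemma rel_sas:
  assumes "Associative \<in> K" "isoar G s" "isoar G r" "isoar G q" "bs (Dom G r) = bs (Dom G s)" "bs (Dom G q) = bs (Dom G s)"
  shows "rel (st (st s r) q) (st s (st r q)) (sas t1 (Dom G s) (Dom G r) (Dom G q)) (sas t2 (Cod G s) (Cod G r) (Cod G q))"
proof -
  let ?a = "Cod G s" and ?b = "Cod G r" and ?c = "Cod G q"
  have "Cmp G (sas t2 ?a ?b ?c) (st (st s r) q) =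
      Cmp G (sas t2 ?a ?b ?c) (Cmp G (e (to t2 ?a ?b) ?c) (Cmp G (ta t1 (e ?a ?b) (Ide G ?c)) (ta t1 (ta t1 s r) q)))"
    using assms by (simp add: st_def all_simps flip: t1.ta_Cmp)
  also have "\<dots> = Cmp G (Cmp G (e ?a (to t2 ?b ?c)) (Cmp G (ta t1 (Ide G ?a) (e ?b ?c)) (sas t1 ?a ?b ?c))) (ta t1 (ta t1 s r) q)"
    using assms e_sas[of ?a ?b ?c] by (subst t1.tot.reassoc3) (auto simp add: all_simps)
  also have "\<dots> = Cmp G (e ?a (to t2 ?b ?c)) (Cmp G (Cmp G (ta t1 (Ide G ?a) (e ?b ?c)) (ta t1 s (ta t1 r q)))
        (sas t1 (Dom G s) (Dom G r) (Dom G q)))"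
    using assms t1.sas_nat[of s r q] by (simp add: all_simps)
  also have "\<dots> = Cmp G (st s (st r q)) (sas t1 (Dom G s) (Dom G r) (Dom G q))"
    using assms by (simp add: st_def all_simps flip: t1.ta_Cmp)
  finally show ?thesis using assms st_simps st_bs unfolding rel_def by (simp add: all_simps)
qed

lemma rel_sco:
  assumes "Symmetric \<in> K" "isoar G s" "isoar G r" "bs (Dom G r) = bs (Dom G s)"
  shows "rel (st s r) (st r s) (sco t1 (Dom G s) (Dom G r)) (sco t2 (Cod G s) (Cod G r))"
proof -
  have "Cmp G (sco t2 (Cod G s) (Cod G r)) (st s r) = Cmp G (Cmp G (e (Cod G r) (Cod G s)) (sco t1 (Cod G s) (Cod G r))) (ta t1 s r)"
    unfolding st_def
    using assms e_sco[of "Cod G s" "Cod G r"] by (subst t1.tot.reassoc) (auto simp add: all_simps)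
  also have "\<dots> = Cmp G (st r s) (sco t1 (Dom G s) (Dom G r))"
    using assms t1.sco_nat[of s r] by (simp add: st_def all_simps)
  finally show ?thesis using assms st_simps unfolding rel_def by (simp add: all_simps)
qed

text \<open>The unit factor has to be compared along \<open>w\<close> and not along an identity,
  because the unit objects of the two structures differ.\<close>

lemma rel_ur:
  assumes "Unitary \<in> K" "isoar G s" "bs (Dom G s) = X"
  shows "rel (st s (w X)) s (ur t1 (Dom G s)) (ur t2 (Cod G s))"
proof -
  have X: "X \<in> Obj S" using assms by (auto simp: all_simps)
  have "Cmp G (ur t2 (Cod G s)) (st s (w X)) =
     Cmp G (ur t1 (Cod G s)) (ta t1 s (Ide G (one t1 X)))"
    using assms X e_ur[of "Cod G s"] by (simp add: st_def all_simps flip: t1.ta_Cmp)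
  then show ?thesis using assms X st_simps t1.ur_nat[of s] unfolding rel_def by (simp add: all_simps)
qed

lemma rel_ul:
  assumes "Unitary \<in> K" "isoar G s" "bs (Dom G s) = X"
  shows "rel (st (w X) s) s (ul t1 (Dom G s)) (ul t2 (Cod G s))"
proof -
  have X: "X \<in> Obj S" using assms by (auto simp: all_simps)
  have "Cmp G (ul t2 (Cod G s)) (st (w X) s) =
     Cmp G (ul t1 (Cod G s)) (ta t1 (Ide G (one t1 X)) s)"
    using assms X e_ul[of "Cod G s"] by (simp add: st_def all_simps flip: t1.ta_Cmp)
  then show ?thesis using assms X st_simps t1.ul_nat[of s] unfolding rel_def by (simp add: all_simps)
qed

lemma rel_sr:
  assumes "Unitary \<in> K" "k \<in> Arr S"
  shows "rel (pa k (w (Cod S k))) (w (Dom S k)) (sr t1 k) (sr t2 k)"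
  using assms w_sr[of k] unfolding rel_def by (simp add: all_simps)

text \<open>One pattern serves all laws: the two sides of a law for \<open>t1\<close> are related to
  the two sides of the law for \<open>t2\<close> along the same pair of isomorphisms, and since
  conjugation along fixed isomorphisms has a unique result, \<open>rel_eq\<close> carries the
  equality over. Invertibility of the constraints follows in the same way from
  \<open>rel_iso\<close>.\<close>

lemma transport: "stensor S G bs pl pa K t2"
proof
  note bsc = all_simps
  let ?i = "Ide G"
  have i: "isoar G (?i a)" if "a \<in> Obj G" for a using that by (simp add: all_simps)
  have ri: "rel (?i a) (?i a) (?i a) (?i a)" if "a \<in> Obj G" for a
    using that rel_Ide[of "?i a"] by (simp add: all_simps)
  note rs = rel_simps
  {
    fix a b assume a: "a \<in> Obj G" "b \<in> Obj G" "bs b = bs a"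
    have "rel (st (?i a) (?i b)) (st (?i a) (?i b)) (ta t1 (?i a) (?i b)) (ta t2 (?i a) (?i b))"
      using a by (intro rel_ta ri) (simp_all add: all_simps)
    moreover have "rel (st (?i a) (?i b)) (st (?i a) (?i b)) (?i (to t1 a b)) (?i (to t2 a b))"
      using rel_Ide[of "st (?i a) (?i b)"] a by (simp add: all_simps st_simps)
    ultimately show "ta t2 (?i a) (?i b) = ?i (to t2 a b)"
      using a t1.ta_Ide by (elim rel_eq)
  next
    fix u v u' v' assume a: "u \<in> Arr G" "v \<in> Arr G" "u' \<in> Arr G" "v' \<in> Arr G" "Dom G u' = Cod G u"
      "Dom G v' = Cod G v" "bs (Dom G v) = bs (Dom G u)"
    have "rel (st (?i (Dom G u)) (?i (Dom G v))) (st (?i (Cod G u')) (?i (Cod G v')))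
        (ta t1 (Cmp G u' u) (Cmp G v' v)) (ta t2 (Cmp G u' u) (Cmp G v' v))"
      using a rel_arr[of "Cmp G u' u"] rel_arr[of "Cmp G v' v"] by (intro rel_ta) (simp_all add: all_simps)
    moreover have "rel (st (?i (Dom G u)) (?i (Dom G v))) (st (?i (Cod G u')) (?i (Cod G v')))
        (Cmp G (ta t1 u' v') (ta t1 u v)) (Cmp G (ta t2 u' v') (ta t2 u v))"
      using a rel_arr[of u] rel_arr[of v] rel_arr[of u'] rel_arr[of v']
      by (intro rel_Cmp[OF rel_ta rel_ta]) (simp_all add: all_simps)
    ultimately show "ta t2 (Cmp G u' u) (Cmp G v' v) = Cmp G (ta t2 u' v') (ta t2 u v)"
      using a t1.ta_Cmp by (elim rel_eq)
  next
    fix k a b assume a: "k \<in> Arr S" "a \<in> Obj G" "b \<in> Obj G" "bs a = Cod S k" "bs b = Cod S k"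
    show "isoar G (sm t2 k a b)"
      using rel_iso[OF rel_sm[of "?i a" "?i b" k]] a by (simp add: all_simps)
  next
    fix k u v assume a: "k \<in> Arr S" "u \<in> Arr G" "v \<in> Arr G" "bs (Dom G u) = Cod S k" "bs (Dom G v) = Cod S k"
    have "rel (st (pa k (?i (Dom G u))) (pa k (?i (Dom G v)))) (pa k (st (?i (Cod G u)) (?i (Cod G v))))
       (Cmp G (sm t1 k (Cod G u) (Cod G v)) (ta t1 (pa k u) (pa k v)))
       (Cmp G (sm t2 k (Cod G u) (Cod G v)) (ta t2 (pa k u) (pa k v)))"
      using a rel_sm[of "?i (Cod G u)" "?i (Cod G v)" k] rel_arr[of "pa k u"] rel_arr[of "pa k v"]
      by (intro rel_Cmp[OF _ rel_ta]) (simp_all add: all_simps)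
    moreover have "rel (st (pa k (?i (Dom G u))) (pa k (?i (Dom G v)))) (pa k (st (?i (Cod G u)) (?i (Cod G v))))
       (Cmp G (pa k (ta t1 u v)) (sm t1 k (Dom G u) (Dom G v))) (Cmp G (pa k (ta t2 u v)) (sm t2 k (Dom G u) (Dom G v)))"
      using a rel_sm[of "?i (Dom G u)" "?i (Dom G v)" k] rel_arr[of u] rel_arr[of v]
      by (intro rel_Cmp[OF rel_pa[OF rel_ta]]) (simp_all add: all_simps st_simps)
    ultimately show "Cmp G (sm t2 k (Cod G u) (Cod G v)) (ta t2 (pa k u) (pa k v)) =
      Cmp G (pa k (ta t2 u v)) (sm t2 k (Dom G u) (Dom G v))"
      using a t1.sm_nat[of k u v] by (elim rel_eq)
  next
    fix k l a b assume a: "k \<in> Arr S" "l \<in> Arr S" "Cod S l = Dom S k" "a \<in> Obj G" "b \<in> Obj G"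
      "bs a = Cod S k" "bs b = Cod S k"
    have "rel (st (pa l (pa k (?i a))) (pa l (pa k (?i b)))) (pa l (pa k (st (?i a) (?i b))))
       (Cmp G (pa l (sm t1 k a b)) (sm t1 l (pl k a) (pl k b)))
       (Cmp G (pa l (sm t2 k a b)) (sm t2 l (pl k a) (pl k b)))"
      using a rel_sm[of "?i a" "?i b" k] rel_sm[of "pa k (?i a)" "pa k (?i b)" l]
      by (intro rel_Cmp[OF rel_pa]) (simp_all add: all_simps st_simps)
    moreover have "rel (st (pa (Cmp S k l) (?i a)) (pa (Cmp S k l) (?i b))) (pa (Cmp S k l) (st (?i a) (?i b)))
       (sm t1 (Cmp S k l) a b) (sm t2 (Cmp S k l) a b)"
      using a rel_sm[of "?i a" "?i b" "Cmp S k l"] by (simp add: all_simps)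
    ultimately show "sm t2 (Cmp S k l) a b = Cmp G (pa l (sm t2 k a b)) (sm t2 l (pl k a) (pl k b))"
      using a t1.sm_cmp[of k l a b] rel_eq by (simp add: all_simps st_simps)
  next
    fix a b c assume a: "Associative \<in> K" "a \<in> Obj G" "b \<in> Obj G" "c \<in> Obj G" "bs b = bs a" "bs c = bs a"
    show "isoar G (sas t2 a b c)"
      using rel_iso[OF rel_sas[of "?i a" "?i b" "?i c"]] a by (simp add: all_simps)
  next
    fix u v w assume a: "Associative \<in> K" "u \<in> Arr G" "v \<in> Arr G" "w \<in> Arr G" "bs (Dom G v) = bs (Dom G u)"
      "bs (Dom G w) = bs (Dom G u)"
    let ?s = "st (st (?i (Dom G u)) (?i (Dom G v))) (?i (Dom G w))"
    let ?r = "st (?i (Cod G u)) (st (?i (Cod G v)) (?i (Cod G w)))"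
    have "rel ?s ?r (Cmp G (sas t1 (Cod G u) (Cod G v) (Cod G w)) (ta t1 (ta t1 u v) w))
       (Cmp G (sas t2 (Cod G u) (Cod G v) (Cod G w)) (ta t2 (ta t2 u v) w))"
      using a rel_sas[of "?i (Cod G u)" "?i (Cod G v)" "?i (Cod G w)"] rel_arr[of u] rel_arr[of v] rel_arr[of w]
      by (intro rel_Cmp[OF _ rel_ta[OF rel_ta]]) (simp_all add: all_simps st_simps)
    moreover have "rel ?s ?r (Cmp G (ta t1 u (ta t1 v w)) (sas t1 (Dom G u) (Dom G v) (Dom G w)))
       (Cmp G (ta t2 u (ta t2 v w)) (sas t2 (Dom G u) (Dom G v) (Dom G w)))"
      using a rel_sas[of "?i (Dom G u)" "?i (Dom G v)" "?i (Dom G w)"] rel_arr[of u] rel_arr[of v] rel_arr[of w]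
      by (intro rel_Cmp[OF rel_ta[OF _ rel_ta]]) (simp_all add: all_simps st_simps)
    ultimately show "Cmp G (sas t2 (Cod G u) (Cod G v) (Cod G w)) (ta t2 (ta t2 u v) w) =
      Cmp G (ta t2 u (ta t2 v w)) (sas t2 (Dom G u) (Dom G v) (Dom G w))"
      using t1.sas_nat a by (elim rel_eq)
  next
    fix a b c d assume a: "Associative \<in> K" "a \<in> Obj G" "b \<in> Obj G" "c \<in> Obj G" "d \<in> Obj G"
      "bs b = bs a" "bs c = bs a" "bs d = bs a"
    let ?s = "st (st (st (?i a) (?i b)) (?i c)) (?i d)"
    let ?r = "st (?i a) (st (?i b) (st (?i c) (?i d)))"
    have "rel ?s ?r (Cmp G (sas t1 a b (to t1 c d)) (sas t1 (to t1 a b) c d))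
        (Cmp G (sas t2 a b (to t2 c d)) (sas t2 (to t2 a b) c d))"
      using a rel_sas[of "?i a" "?i b" "st (?i c) (?i d)"] rel_sas[of "st (?i a) (?i b)" "?i c" "?i d"]
      by (intro rel_Cmp) (simp_all add: all_simps st_simps)
    moreover have "rel ?s ?r (Cmp G (ta t1 (?i a) (sas t1 b c d)) (Cmp G (sas t1 a (to t1 b c) d) (ta t1 (sas t1 a b c) (?i d))))
      (Cmp G (ta t2 (?i a) (sas t2 b c d)) (Cmp G (sas t2 a (to t2 b c) d) (ta t2 (sas t2 a b c) (?i d))))"
      using a rel_sas[of "?i b" "?i c" "?i d"] rel_sas[of "?i a" "st (?i b) (?i c)" "?i d"]
        rel_sas[of "?i a" "?i b" "?i c"] ri
      by (intro rel_Cmp[OF rel_ta rel_Cmp[OF _ rel_ta]]) (simp_all add: all_simps st_simps)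
    ultimately show "Cmp G (sas t2 a b (to t2 c d)) (sas t2 (to t2 a b) c d) =
      Cmp G (ta t2 (?i a) (sas t2 b c d)) (Cmp G (sas t2 a (to t2 b c) d) (ta t2 (sas t2 a b c) (?i d)))"
      using t1.pentagon a by (elim rel_eq)
  next
    fix k a b c assume a: "Associative \<in> K" "k \<in> Arr S" "a \<in> Obj G" "b \<in> Obj G" "c \<in> Obj G"
      "bs a = Cod S k" "bs b = Cod S k" "bs c = Cod S k"
    let ?s = "st (st (pa k (?i a)) (pa k (?i b))) (pa k (?i c))"
    let ?r = "pa k (st (?i a) (st (?i b) (?i c)))"
    have "rel ?s ?r (Cmp G (pa k (sas t1 a b c)) (Cmp G (sm t1 k (to t1 a b) c) (ta t1 (sm t1 k a b) (?i (pl k c)))))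
      (Cmp G (pa k (sas t2 a b c)) (Cmp G (sm t2 k (to t2 a b) c) (ta t2 (sm t2 k a b) (?i (pl k c)))))"
      using a rel_sas[of "?i a" "?i b" "?i c"] rel_sm[of "?i a" "?i b" k] rel_sm[of "st (?i a) (?i b)" "?i c" k]
        ri[of "pl k c"]
      by (intro rel_Cmp[OF rel_pa rel_Cmp[OF _ rel_ta]]) (simp_all add: all_simps st_simps)
    moreover have "rel ?s ?r (Cmp G (sm t1 k a (to t1 b c)) (Cmp G (ta t1 (?i (pl k a)) (sm t1 k b c)) (sas t1 (pl k a) (pl k b) (pl k c))))
      (Cmp G (sm t2 k a (to t2 b c)) (Cmp G (ta t2 (?i (pl k a)) (sm t2 k b c)) (sas t2 (pl k a) (pl k b) (pl k c))))"
      using a rel_sas[of "?i (pl k a)" "?i (pl k b)" "?i (pl k c)"] rel_sm[of "?i b" "?i c" k] rel_sm[of "?i a" "st (?i b) (?i c)" k]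
        ri[of "pl k a"]
      by (intro rel_Cmp[OF _ rel_Cmp[OF rel_ta]]) (simp_all add: all_simps st_simps)
    ultimately show "Cmp G (pa k (sas t2 a b c)) (Cmp G (sm t2 k (to t2 a b) c) (ta t2 (sm t2 k a b) (?i (pl k c)))) =
      Cmp G (sm t2 k a (to t2 b c)) (Cmp G (ta t2 (?i (pl k a)) (sm t2 k b c)) (sas t2 (pl k a) (pl k b) (pl k c)))"
      using t1.sas_sm a by (elim rel_eq)
  next
    fix u v assume a: "Symmetric \<in> K" "u \<in> Arr G" "v \<in> Arr G" "bs (Dom G v) = bs (Dom G u)"
    let ?s = "st (?i (Dom G u)) (?i (Dom G v))" and ?r = "st (?i (Cod G v)) (?i (Cod G u))"
    have "rel ?s ?r (Cmp G (sco t1 (Cod G u) (Cod G v)) (ta t1 u v)) (Cmp G (sco t2 (Cod G u) (Cod G v)) (ta t2 u v))"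
      using a rel_sco[of "?i (Cod G u)" "?i (Cod G v)"] rel_arr[of u] rel_arr[of v]
      by (intro rel_Cmp[OF _ rel_ta]) (simp_all add: all_simps st_simps)
    moreover have "rel ?s ?r (Cmp G (ta t1 v u) (sco t1 (Dom G u) (Dom G v))) (Cmp G (ta t2 v u) (sco t2 (Dom G u) (Dom G v)))"
      using a rel_sco[of "?i (Dom G u)" "?i (Dom G v)"] rel_arr[of u] rel_arr[of v]
      by (intro rel_Cmp[OF rel_ta]) (simp_all add: all_simps st_simps)
    ultimately show "Cmp G (sco t2 (Cod G u) (Cod G v)) (ta t2 u v) = Cmp G (ta t2 v u) (sco t2 (Dom G u) (Dom G v))"
      using t1.sco_nat a by (elim rel_eq)
  next
    fix a b assume a: "Symmetric \<in> K" "a \<in> Obj G" "b \<in> Obj G" "bs b = bs a"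
    let ?s = "st (?i a) (?i b)"
    have "rel ?s ?s (Cmp G (sco t1 b a) (sco t1 a b)) (Cmp G (sco t2 b a) (sco t2 a b))"
      using a rel_sco[of "?i a" "?i b"] rel_sco[of "?i b" "?i a"]
      by (intro rel_Cmp) (simp_all add: all_simps st_simps)
    moreover have "rel ?s ?s (?i (to t1 a b)) (?i (to t2 a b))"
      using rel_Ide[of "st (?i a) (?i b)"] a by (simp add: all_simps st_simps)
    ultimately show "Cmp G (sco t2 b a) (sco t2 a b) = ?i (to t2 a b)"
      using t1.sco_sco a by (elim rel_eq)
  next
    fix k a b assume a: "Symmetric \<in> K" "k \<in> Arr S" "a \<in> Obj G" "b \<in> Obj G" "bs a = Cod S k" "bs b = Cod S k"
    let ?s = "st (pa k (?i a)) (pa k (?i b))" and ?r = "pa k (st (?i b) (?i a))"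
    have "rel ?s ?r (Cmp G (pa k (sco t1 a b)) (sm t1 k a b)) (Cmp G (pa k (sco t2 a b)) (sm t2 k a b))"
      using a rel_sco[of "?i a" "?i b"] rel_sm[of "?i a" "?i b" k]
      by (intro rel_Cmp[OF rel_pa]) (simp_all add: all_simps st_simps)
    moreover have "rel ?s ?r (Cmp G (sm t1 k b a) (sco t1 (pl k a) (pl k b))) (Cmp G (sm t2 k b a) (sco t2 (pl k a) (pl k b)))"
      using a rel_sco[of "?i (pl k a)" "?i (pl k b)"] rel_sm[of "?i b" "?i a" k]
      by (intro rel_Cmp) (simp_all add: all_simps st_simps)
    ultimately show "Cmp G (pa k (sco t2 a b)) (sm t2 k a b) = Cmp G (sm t2 k b a) (sco t2 (pl k a) (pl k b))"
      using t1.sco_sm a by (elim rel_eq)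
  next
    fix a assume a: "Unitary \<in> K" "a \<in> Obj G"
    show "isoar G (ur t2 a)" "isoar G (ul t2 a)"
      using rel_iso[OF rel_ur[of "?i a"]] rel_iso[OF rel_ul[of "?i a"]] a by (simp_all add: all_simps)
  next
    fix u assume a: "Unitary \<in> K" "u \<in> Arr G"
    let ?X = "bs (Dom G u)"
    have X: "?X \<in> Obj S" using a by (simp add: all_simps)
    let ?s = "st (?i (Dom G u)) (w ?X)" and ?r = "?i (Cod G u)"
    \<comment> \<open>The identity of a unit object is conjugated along \<open>w\<close>, so that
      both sides of the naturality law start from the same comparison \<open>?s\<close>.\<close>
    have w: "rel (w ?X) (w ?X) (?i (one t1 ?X)) (?i (one t2 ?X))"
      using rel_Ide[of "w ?X"] a by (simp add: all_simps)
    have "rel ?s ?r (Cmp G (ur t1 (Cod G u)) (ta t1 u (?i (one t1 ?X)))) (Cmp G (ur t2 (Cod G u)) (ta t2 u (?i (one t2 ?X))))"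
      using a rel_ur[of "?i (Cod G u)" ?X] rel_arr[of u] w
      by (intro rel_Cmp[OF _ rel_ta]) (simp_all add: all_simps)
    moreover have "rel ?s ?r (Cmp G u (ur t1 (Dom G u))) (Cmp G u (ur t2 (Dom G u)))"
      using a rel_ur[of "?i (Dom G u)" ?X] rel_arr[of u] by (intro rel_Cmp) (simp_all add: all_simps)
    ultimately show "Cmp G (ur t2 (Cod G u)) (ta t2 u (?i (one t2 ?X))) = Cmp G u (ur t2 (Dom G u))"
      using t1.ur_nat a by (elim rel_eq)
    let ?s = "st (w ?X) (?i (Dom G u))"
    have "rel ?s ?r (Cmp G (ul t1 (Cod G u)) (ta t1 (?i (one t1 ?X)) u)) (Cmp G (ul t2 (Cod G u)) (ta t2 (?i (one t2 ?X)) u))"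
      using a rel_ul[of "?i (Cod G u)" ?X] rel_arr[of u] w
      by (intro rel_Cmp[OF _ rel_ta]) (simp_all add: all_simps)
    moreover have "rel ?s ?r (Cmp G u (ul t1 (Dom G u))) (Cmp G u (ul t2 (Dom G u)))"
      using a rel_ul[of "?i (Dom G u)" ?X] rel_arr[of u] by (intro rel_Cmp) (simp_all add: all_simps)
    ultimately show "Cmp G (ul t2 (Cod G u)) (ta t2 (?i (one t2 ?X)) u) = Cmp G u (ul t2 (Dom G u))"
      using t1.ul_nat a by (elim rel_eq)
  next
    fix X assume a: "Unitary \<in> K" "X \<in> Obj S"
    have "rel (st (w X) (w X)) (w X) (ur t1 (one t1 X)) (ur t2 (one t2 X))"
      using rel_ur[of "w X" X] a by (simp add: all_simps)
    moreover have "rel (st (w X) (w X)) (w X) (ul t1 (one t1 X)) (ul t2 (one t2 X))"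
      using rel_ul[of "w X" X] a by (simp add: all_simps)
    ultimately show "ur t2 (one t2 X) = ul t2 (one t2 X)"
      using t1.ur_ul a by (elim rel_eq)
  next
    fix k a assume a: "Unitary \<in> K" "k \<in> Arr S" "a \<in> Obj G" "bs a = Cod S k"
    let ?s = "st (pa k (?i a)) (pa k (w (Cod S k)))" and ?r = "pa k (?i a)"
    have "rel ?s ?r (Cmp G (pa k (ur t1 a)) (sm t1 k a (one t1 (Cod S k)))) (Cmp G (pa k (ur t2 a)) (sm t2 k a (one t2 (Cod S k))))"
      using a rel_ur[of "?i a" "Cod S k"] rel_sm[of "?i a" "w (Cod S k)" k]
      by (intro rel_Cmp[OF rel_pa]) (simp_all add: all_simps st_simps)
    moreover have "rel ?s ?r (Cmp G (ur t1 (pl k a)) (ta t1 (?i (pl k a)) (sr t1 k))) (Cmp G (ur t2 (pl k a)) (ta t2 (?i (pl k a)) (sr t2 k)))"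
      using a rel_ur[of "?i (pl k a)" "Dom S k"] ri[of "pl k a"] rel_sr[of k]
      by (intro rel_Cmp[OF _ rel_ta]) (simp_all add: all_simps st_simps)
    ultimately show "Cmp G (pa k (ur t2 a)) (sm t2 k a (one t2 (Cod S k))) = Cmp G (ur t2 (pl k a)) (ta t2 (?i (pl k a)) (sr t2 k))"
      using t1.ur_sm a by (elim rel_eq)
    let ?s = "st (pa k (w (Cod S k))) (pa k (?i a))"
    have "rel ?s ?r (Cmp G (pa k (ul t1 a)) (sm t1 k (one t1 (Cod S k)) a)) (Cmp G (pa k (ul t2 a)) (sm t2 k (one t2 (Cod S k)) a))"
      using a rel_ul[of "?i a" "Cod S k"] rel_sm[of "w (Cod S k)" "?i a" k]
      by (intro rel_Cmp[OF rel_pa]) (simp_all add: all_simps st_simps)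
    moreover have "rel ?s ?r (Cmp G (ul t1 (pl k a)) (ta t1 (sr t1 k) (?i (pl k a)))) (Cmp G (ul t2 (pl k a)) (ta t2 (sr t2 k) (?i (pl k a))))"
      using a rel_ul[of "?i (pl k a)" "Dom S k"] ri[of "pl k a"] rel_sr[of k]
      by (intro rel_Cmp[OF _ rel_ta]) (simp_all add: all_simps st_simps)
    ultimately show "Cmp G (pa k (ul t2 a)) (sm t2 k (one t2 (Cod S k)) a) = Cmp G (ul t2 (pl k a)) (ta t2 (sr t2 k) (?i (pl k a)))"
      using t1.ul_sm a by (elim rel_eq)
  next
    fix a b c assume a: "Associative \<in> K" "Symmetric \<in> K" "a \<in> Obj G" "b \<in> Obj G" "c \<in> Obj G" "bs b = bs a" "bs c = bs a"
    let ?s = "st (st (?i a) (?i b)) (?i c)" and ?r = "st (?i b) (st (?i c) (?i a))"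
    have "rel ?s ?r (Cmp G (ta t1 (?i b) (sco t1 a c)) (Cmp G (sas t1 b a c) (ta t1 (sco t1 a b) (?i c))))
      (Cmp G (ta t2 (?i b) (sco t2 a c)) (Cmp G (sas t2 b a c) (ta t2 (sco t2 a b) (?i c))))"
      using a ri rel_sas[of "?i b" "?i a" "?i c"] rel_sco[of "?i a" "?i c"] rel_sco[of "?i a" "?i b"]
      by (intro rel_Cmp[OF rel_ta rel_Cmp[OF _ rel_ta]]) (simp_all add: all_simps st_simps)
    moreover have "rel ?s ?r (Cmp G (sas t1 b c a) (Cmp G (sco t1 a (to t1 b c)) (sas t1 a b c)))
      (Cmp G (sas t2 b c a) (Cmp G (sco t2 a (to t2 b c)) (sas t2 a b c)))"
      using a rel_sas[of "?i b" "?i c" "?i a"] rel_sco[of "?i a" "st (?i b) (?i c)"] rel_sas[of "?i a" "?i b" "?i c"]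
      by (intro rel_Cmp[OF _ rel_Cmp]) (simp_all add: all_simps st_simps)
    ultimately show "Cmp G (ta t2 (?i b) (sco t2 a c)) (Cmp G (sas t2 b a c) (ta t2 (sco t2 a b) (?i c))) =
      Cmp G (sas t2 b c a) (Cmp G (sco t2 a (to t2 b c)) (sas t2 a b c))"
      using t1.hexagon a by (elim rel_eq)
  next
    fix b c assume a: "Associative \<in> K" "Unitary \<in> K" "b \<in> Obj G" "c \<in> Obj G" "bs c = bs b"
    let ?X = "bs b"
    have X: "?X \<in> Obj S" using a by (simp add: all_simps)
    let ?s = "st (st (w ?X) (?i b)) (?i c)" and ?r = "st (?i b) (?i c)"
    have "rel ?s ?r (Cmp G (ul t1 (to t1 b c)) (sas t1 (one t1 ?X) b c)) (Cmp G (ul t2 (to t2 b c)) (sas t2 (one t2 ?X) b c))"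
      using a X rel_ul[of "st (?i b) (?i c)" ?X] rel_sas[of "w ?X" "?i b" "?i c"]
      by (intro rel_Cmp) (simp_all add: all_simps st_simps)
    moreover have "rel ?s ?r (ta t1 (ul t1 b) (?i c)) (ta t2 (ul t2 b) (?i c))"
      using a X rel_ul[of "?i b" ?X] ri by (intro rel_ta) (simp_all add: all_simps st_simps)
    ultimately show "Cmp G (ul t2 (to t2 b c)) (sas t2 (one t2 ?X) b c) = ta t2 (ul t2 b) (?i c)"
      using t1.ul_sas a by (elim rel_eq)
    let ?s = "st (st (?i b) (w ?X)) (?i c)"
    have "rel ?s ?r (Cmp G (ta t1 (?i b) (ul t1 c)) (sas t1 b (one t1 ?X) c)) (Cmp G (ta t2 (?i b) (ul t2 c)) (sas t2 b (one t2 ?X) c))"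
      using a X rel_ul[of "?i c" ?X] rel_sas[of "?i b" "w ?X" "?i c"] ri
      by (intro rel_Cmp[OF rel_ta]) (simp_all add: all_simps st_simps)
    moreover have "rel ?s ?r (ta t1 (ur t1 b) (?i c)) (ta t2 (ur t2 b) (?i c))"
      using a X rel_ur[of "?i b" ?X] ri by (intro rel_ta) (simp_all add: all_simps st_simps)
    ultimately show "Cmp G (ta t2 (?i b) (ul t2 c)) (sas t2 b (one t2 ?X) c) = ta t2 (ur t2 b) (?i c)"
      using t1.ur_ul_sas a by (elim rel_eq)
    let ?s = "st (st (?i b) (?i c)) (w ?X)"
    have "rel ?s ?r (Cmp G (ta t1 (?i b) (ur t1 c)) (sas t1 b c (one t1 ?X))) (Cmp G (ta t2 (?i b) (ur t2 c)) (sas t2 b c (one t2 ?X)))"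
      using a X rel_ur[of "?i c" ?X] rel_sas[of "?i b" "?i c" "w ?X"] ri
      by (intro rel_Cmp[OF rel_ta]) (simp_all add: all_simps st_simps)
    moreover have "rel ?s ?r (ur t1 (to t1 b c)) (ur t2 (to t2 b c))"
      using a X rel_ur[of "st (?i b) (?i c)" ?X] by (simp add: all_simps st_simps)
    ultimately show "Cmp G (ta t2 (?i b) (ur t2 c)) (sas t2 b c (one t2 ?X)) = ur t2 (to t2 b c)"
      using t1.ur_sas a by (elim rel_eq)
  next
    fix b assume a: "Symmetric \<in> K" "Unitary \<in> K" "b \<in> Obj G"
    let ?X = "bs b"
    have X: "?X \<in> Obj S" using a by (simp add: all_simps)
    let ?s = "st (w ?X) (?i b)" and ?r = "?i b"
    have "rel ?s ?r (Cmp G (ur t1 b) (sco t1 (one t1 ?X) b)) (Cmp G (ur t2 b) (sco t2 (one t2 ?X) b))"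
      using a X rel_ur[of "?i b" ?X] rel_sco[of "w ?X" "?i b"] by (intro rel_Cmp) (simp_all add: all_simps st_simps)
    moreover have "rel ?s ?r (ul t1 b) (ul t2 b)"
      using a X rel_ul[of "?i b" ?X] by (simp add: all_simps st_simps)
    ultimately show "Cmp G (ur t2 b) (sco t2 (one t2 ?X) b) = ul t2 b"
      using t1.ur_sco a by (elim rel_eq)
  }
qed

text \<open>The source of an equivalence has to satisfy the laws, so \<open>t2\<close> must first
  receive them by \<open>transport\<close>. After that every compatibility is the old square with
  two sides inverted.\<close>

lemma sequiv_map_sym: "sequiv_map S G bs pl pa K t2 t1 (\<lambda>a b. Inv G (e a b)) (\<lambda>X. Inv G (w X))"
proof -
  interpret t2': stensor S G bs pl pa K t2 by (rule transport)
  note all = all_simps t2'.ten_simps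
  have w1: "Cmp G (w X) (Inv G (w X)) = Ide G (one t2 X)" if "Unitary \<in> K" "X \<in> Obj S" for X
    using that by (simp add: all)
  show ?thesis
  proof (unfold_locales, goal_cases)
    case (4 u v)
    then show ?case
      using e_nat[of u v] by (intro t1.tot.Inv_square[symmetric]) (simp_all add: all)
  next
    case (5 k a b)
    then show ?case
      using e_sm[of k a b] t1.tot.Inv_square[of "e (pl k a) (pl k b)" "pa k (e a b)" "sm t1 k a b" "sm t2 k a b"]
      by (simp add: all)
  next
    case (6 a b c)
    \<comment> \<open>By naturality of \<open>e\<close> the two comparison composites are rewritten
      so that \<open>e\<close> stands at products formed in \<open>t1\<close>. Their inverses then
      have exactly the shape required of the inverse equivalence.\<close>
    let ?s = "Cmp G (ta t2 (e a b) (Ide G c)) (e (to t1 a b) c)"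
    let ?r = "Cmp G (ta t2 (Ide G a) (e b c)) (e a (to t1 b c))"
    have s: "?s = Cmp G (e (to t2 a b) c) (ta t1 (e a b) (Ide G c))"
      and r: "?r = Cmp G (e a (to t2 b c)) (ta t1 (Ide G a) (e b c))"
      using 6 e_nat[of "e a b" "Ide G c"] e_nat[of "Ide G a" "e b c"] by (simp_all add: all)
    have "Cmp G (sas t1 a b c) (Inv G ?s) = Cmp G (Inv G ?r) (sas t2 a b c)"
      using 6 e_sas[of a b c] by (intro t1.tot.Inv_square) (simp_all add: all s r)
    then show ?case using 6 by (simp add: all)
  next
    case (7 a b)
    then show ?case
      using e_sco[of a b] t1.tot.Inv_square[of "e a b" "e b a" "sco t1 a b" "sco t2 a b"] by (simp add: all)
  next
    case (11 k)
    then show ?case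
      using w_sr[of k] t1.tot.Inv_square[of "pa k (w (Cod S k))" "w (Dom S k)" "sr t1 k" "sr t2 k"] by (simp add: all)
  next
    case (12 a)
    have "ur t1 a = Cmp G (ur t2 a) (Cmp G (ta t2 (Ide G a) (w (bs a))) (e a (one t1 (bs a))))"
      using 12 e_ur[of a] e_nat[of "Ide G a" "w (bs a)"] by (simp add: all)
    then show ?case
      using 12 by (simp add: all flip: t2'.ta_Cmp)
  next
    case (13 a)
    have "ul t1 a = Cmp G (ul t2 a) (Cmp G (ta t2 (w (bs a)) (Ide G a)) (e (one t1 (bs a)) a))"
      using 13 e_ul[of a] e_nat[of "w (bs a)" "Ide G a"] by (simp add: all)
    then show ?case
      using 13 by (simp add: all flip: t2'.ta_Cmp)
  qed (simp_all add: all)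
qed

end

lemma (in stensor) sequiv_map_refl:
  "sequiv_map S G bs pl pa K t t (\<lambda>a b. Ide G (to t a b)) (\<lambda>X. Ide G (one t X))"
  by unfold_locales (simp_all add: vert_simps ten_simps)

lemma sequiv_map_trans:
  assumes "sequiv_map S G bs pl pa K t1 t2 e w" "sequiv_map S G bs pl pa K t2 t3 e' w'"
  shows "sequiv_map S G bs pl pa K t1 t3 (\<lambda>a b. Cmp G (e' a b) (e a b)) (\<lambda>X. Cmp G (w' X) (w X))"
proof -
  interpret m: sequiv_map S G bs pl pa K t1 t2 e w by fact
  interpret n: sequiv_map S G bs pl pa K t2 t3 e' w' by fact
  note all = m.all_simps n.all_simps
  note re = m.t1.tot.reassoc
  show ?thesis
  proof (unfold_locales, goal_cases)
    case (4 u v)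
    then show ?case
      using m.e_nat[of u v] n.e_nat[of u v] re[OF n.e_nat[of u v]] by (simp add: all)
  next
    case (5 k a b)
    then show ?case
      using m.e_sm[of k a b] re[OF n.e_sm[of k a b]] by (simp add: all)
  next
    case (6 a b c)
    \<comment> \<open>Naturality of \<open>e\<close> at the components of \<open>e'\<close> replaces
      \<open>e\<close> at a product of \<open>t3\<close> by \<open>e\<close> at a product of
      \<open>t2\<close>, after which the square of \<open>e'\<close> and the square of
      \<open>e\<close> can be pasted.\<close>
    have l: "Cmp G (e (to t3 a b) c) (ta t1 (e' a b) (Ide G c)) = Cmp G (ta t2 (e' a b) (Ide G c)) (e (to t2 a b) c)"
      "Cmp G (e a (to t3 b c)) (ta t1 (Ide G a) (e' b c)) = Cmp G (ta t2 (Ide G a) (e' b c)) (e a (to t2 b c))"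
      using 6 m.e_nat[of "e' a b" "Ide G c"] m.e_nat[of "Ide G a" "e' b c"] by (simp_all add: all)
    have "ta t1 (Cmp G (e' a b) (e a b)) (Ide G c) = Cmp G (ta t1 (e' a b) (Ide G c)) (ta t1 (e a b) (Ide G c))"
      "ta t1 (Ide G a) (Cmp G (e' b c) (e b c)) = Cmp G (ta t1 (Ide G a) (e' b c)) (ta t1 (Ide G a) (e b c))"
      using 6 by (simp_all add: all flip: m.t1.ta_Cmp)
    then show ?case
      using 6 m.e_sas[of a b c] m.t1.tot.reassoc3[OF n.e_sas[of a b c]] re[OF l(1)] re[OF l(2)] by (simp add: all)
  next
    case (7 a b)
    then show ?case
      using m.e_sco[of a b] re[OF n.e_sco[of a b]] by (simp add: all)
  next
    case (11 k)
    then show ?case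
      using m.w_sr[of k] re[OF n.w_sr[of k]] by (simp add: all)
  next
    case (12 a)
    have l: "Cmp G (e a (one t3 (bs a))) (ta t1 (Ide G a) (w' (bs a))) = Cmp G (ta t2 (Ide G a) (w' (bs a))) (e a (one t2 (bs a)))"
      using 12 m.e_nat[of "Ide G a" "w' (bs a)"] by (simp add: all)
    have "ta t1 (Ide G a) (Cmp G (w' (bs a)) (w (bs a))) = Cmp G (ta t1 (Ide G a) (w' (bs a))) (ta t1 (Ide G a) (w (bs a)))"
      using 12 by (simp add: all flip: m.t1.ta_Cmp)
    then show ?case
      using 12 m.e_ur[of a] n.e_ur[of a] re[OF l] by (simp add: all)
  next
    case (13 a)
    have l: "Cmp G (e (one t3 (bs a)) a) (ta t1 (w' (bs a)) (Ide G a)) = Cmp G (ta t2 (w' (bs a)) (Ide G a)) (e (one t2 (bs a)) a)"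
      using 13 m.e_nat[of "w' (bs a)" "Ide G a"] by (simp add: all)
    have "ta t1 (Cmp G (w' (bs a)) (w (bs a))) (Ide G a) = Cmp G (ta t1 (w' (bs a)) (Ide G a)) (ta t1 (w (bs a)) (Ide G a))"
      using 13 by (simp add: all flip: m.t1.ta_Cmp)
    then show ?case
      using 13 m.e_ul[of a] n.e_ul[of a] re[OF l] by (simp add: all)
  qed (simp_all add: all)
qed

section \<open>The split fibered category of a fibered category\<close>

context category_with_binary_products
begin

lemma Pr1_simps: "X \<in> Obj S \<Longrightarrow> Y \<in> Obj S \<Longrightarrow> Pr1 S X Y \<in> Arr S"
    "X \<in> Obj S \<Longrightarrow> Y \<in> Obj S \<Longrightarrow> Dom S (Pr1 S X Y) = Prd S X Y"
    "X \<in> Obj S \<Longrightarrow> Y \<in> Obj S \<Longrightarrow> Cod S (Pr1 S X Y) = X"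
  using pr1_hom[of X Y] by (simp_all add: Hom_iff)

lemma Pr2_simps: "X \<in> Obj S \<Longrightarrow> Y \<in> Obj S \<Longrightarrow> Pr2 S X Y \<in> Arr S"
    "X \<in> Obj S \<Longrightarrow> Y \<in> Obj S \<Longrightarrow> Dom S (Pr2 S X Y) = Prd S X Y"
    "X \<in> Obj S \<Longrightarrow> Y \<in> Obj S \<Longrightarrow> Cod S (Pr2 S X Y) = Y"
  using pr2_hom[of X Y] by (simp_all add: Hom_iff)

lemma pair_simps:
  assumes "f \<in> Arr S" "g \<in> Arr S" "Dom S g = Dom S f"
  shows "pair S f g \<in> Arr S" "Dom S (pair S f g) = Dom S f" "Cod S (pair S f g) = Prd S (Cod S f) (Cod S g)"
    "Cod S f = X \<Longrightarrow> Cod S g = Y \<Longrightarrow> Cmp S (Pr1 S X Y) (pair S f g) = f"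
    "Cod S f = X \<Longrightarrow> Cod S g = Y \<Longrightarrow> Cmp S (Pr2 S X Y) (pair S f g) = g"
  using theI'[OF prd_universal[of f "Dom S f" "Cod S f" g "Cod S g"]] assms
  by (auto simp: pair_def Hom_iff)

lemma pair_eqI:
  assumes "h \<in> Arr S" "h' \<in> Arr S" "Dom S h = Dom S h'" "Cod S h = Prd S X Y" "Cod S h' = Prd S X Y"
    "X \<in> Obj S" "Y \<in> Obj S"
    "Cmp S (Pr1 S X Y) h = Cmp S (Pr1 S X Y) h'" "Cmp S (Pr2 S X Y) h = Cmp S (Pr2 S X Y) h'"
  shows "h = h'"
  using prd_universal[of "Cmp S (Pr1 S X Y) h" "Dom S h" X "Cmp S (Pr2 S X Y) h" Y] assms
  by (auto simp: Hom_iff Pr1_simps Pr2_simps cat_simps)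

text \<open>Oriented so that an arrow into an iterated product becomes a nested \<open>pair\<close>
  of its components. Equations between associativity isomorphisms, permutations, diagonals and
  products of arrows are then decided by comparing components.\<close>

lemma pair_Cmp:
  assumes "f \<in> Arr S" "g \<in> Arr S" "Dom S g = Dom S f" "h \<in> Arr S" "Cod S h = Dom S f"
  shows "Cmp S (pair S f g) h = pair S (Cmp S f h) (Cmp S g h)"
  by (rule pair_eqI[of _ _ "Cod S f" "Cod S g"])
    (use assms in \<open>simp_all add: Pr1_simps Pr2_simps pair_simps cat_simps flip: Cmp_assoc\<close>)

lemma pair_eta:
  assumes "h \<in> Arr S" "Cod S h = Prd S X Y" "X \<in> Obj S" "Y \<in> Obj S"
  shows "pair S (Cmp S (Pr1 S X Y) h) (Cmp S (Pr2 S X Y) h) = h"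
  by (rule pair_eqI[of _ _ X Y])
    (use assms in \<open>simp_all add: Pr1_simps Pr2_simps pair_simps cat_simps\<close>)

lemma pair_Pr:
  assumes "X \<in> Obj S" "Y \<in> Obj S"
  shows "pair S (Pr1 S X Y) (Pr2 S X Y) = Ide S (Prd S X Y)"
  using pair_eta[of "Ide S (Prd S X Y)" X Y] assms by (simp add: Pr1_simps Pr2_simps cat_simps prd_obj)

lemmas prd_basic = prd_obj Pr1_simps Pr2_simps pair_simps pair_Cmp pair_eta pair_Pr cat_simps

lemma prd_arr_simps:
  assumes "f \<in> Arr S" "g \<in> Arr S"
  shows "prd_arr S f g \<in> Arr S" "Dom S (prd_arr S f g) = Prd S (Dom S f) (Dom S g)"
    "Cod S (prd_arr S f g) = Prd S (Cod S f) (Cod S g)"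
    "h \<in> Arr S \<Longrightarrow> k \<in> Arr S \<Longrightarrow> Dom S k = Dom S h \<Longrightarrow> Cod S h = Dom S f \<Longrightarrow> Cod S k = Dom S g \<Longrightarrow>
      Cmp S (prd_arr S f g) (pair S h k) = pair S (Cmp S f h) (Cmp S g k)"
    "Cod S f = X \<Longrightarrow> Cod S g = Y \<Longrightarrow> Cmp S (Pr1 S X Y) (prd_arr S f g) = Cmp S f (Pr1 S (Dom S f) (Dom S g))"
    "Cod S f = X \<Longrightarrow> Cod S g = Y \<Longrightarrow> Cmp S (Pr2 S X Y) (prd_arr S f g) = Cmp S g (Pr2 S (Dom S f) (Dom S g))"
  using assms by (simp_all add: prd_arr_def prd_basic)

lemma prd_arr_Ide: "X \<in> Obj S \<Longrightarrow> Y \<in> Obj S \<Longrightarrow> prd_arr S (Ide S X) (Ide S Y) = Ide S (Prd S X Y)"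
  by (simp add: prd_arr_def prd_basic)

lemma passoc_simps:
  assumes "X \<in> Obj S" "Y \<in> Obj S" "Z \<in> Obj S"
  shows "passoc S X Y Z \<in> Arr S" "Dom S (passoc S X Y Z) = Prd S (Prd S X Y) Z"
    "Cod S (passoc S X Y Z) = Prd S X (Prd S Y Z)"
    "f \<in> Arr S \<Longrightarrow> g \<in> Arr S \<Longrightarrow> h \<in> Arr S \<Longrightarrow> Dom S g = Dom S f \<Longrightarrow> Dom S h = Dom S f \<Longrightarrow> Cod S f = X \<Longrightarrow>
      Cod S g = Y \<Longrightarrow> Cod S h = Z \<Longrightarrow> Cmp S (passoc S X Y Z) (pair S (pair S f g) h) = pair S f (pair S g h)"
  using assms by (simp_all add: passoc_def prd_basic)

lemma pswap_simps:
  assumes "X \<in> Obj S" "Y \<in> Obj S"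
  shows "pswap S X Y \<in> Arr S" "Dom S (pswap S X Y) = Prd S X Y" "Cod S (pswap S X Y) = Prd S Y X"
    "f \<in> Arr S \<Longrightarrow> g \<in> Arr S \<Longrightarrow> Dom S g = Dom S f \<Longrightarrow> Cod S f = X \<Longrightarrow> Cod S g = Y \<Longrightarrow>
      Cmp S (pswap S X Y) (pair S f g) = pair S g f"
    "Cmp S (pswap S X Y) (pswap S Y X) = Ide S (Prd S Y X)"
  using assms by (simp_all add: pswap_def prd_basic)

lemma diag_simps:
  assumes "X \<in> Obj S"
  shows "diag S X \<in> Arr S" "Dom S (diag S X) = X" "Cod S (diag S X) = Prd S X X"
    "f \<in> Arr S \<Longrightarrow> Cod S f = X \<Longrightarrow> Cmp S (diag S X) f = pair S f f"
    "f \<in> Arr S \<Longrightarrow> g \<in> Arr S \<Longrightarrow> Dom S f = X \<Longrightarrow> Dom S g = X \<Longrightarrow> Cmp S (prd_arr S f g) (diag S X) = pair S f g"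
  using assms by (simp_all add: diag_def prd_basic prd_arr_simps)

lemmas prd_simps = prd_basic prd_arr_simps prd_arr_Ide passoc_simps pswap_simps diag_simps

end

section \<open>Pullback functors of the fibered category and the category \<open>G\<close> of formal
  pullbacks\<close>

locale fibered_over_products = category_with_binary_products S + fibered_category S H
  for S :: "('s, 'f) pcat" and H :: "('s, 'f, 'o, 'a) fib"
begin

lemma pbo_obj: "k \<in> Arr S \<Longrightarrow> Dom S k = Y \<Longrightarrow> A \<in> Obj (Fib H (Cod S k)) \<Longrightarrow> pbo H k A \<in> Obj (Fib H Y)"
  using pb_functor[of k Y "Cod S k"] by (auto simp: Hom_iff is_functor_def)

lemma pba_simps:
  assumes "k \<in> Arr S" "Dom S k = Y" "u \<in> Arr (Fib H (Cod S k))"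
  shows "pba H k u \<in> Arr (Fib H Y)"
    "Dom (Fib H Y) (pba H k u) = pbo H k (Dom (Fib H (Cod S k)) u)"
    "Cod (Fib H Y) (pba H k u) = pbo H k (Cod (Fib H (Cod S k)) u)"
  using pb_functor[of k Y "Cod S k"] assms by (auto simp: Hom_iff is_functor_def)

lemma pba_Ide: "k \<in> Arr S \<Longrightarrow> Cod S k = X \<Longrightarrow> A \<in> Obj (Fib H X) \<Longrightarrow>
    pba H k (Ide (Fib H X) A) = Ide (Fib H (Dom S k)) (pbo H k A)"
  using pb_functor[of k "Dom S k" X] by (auto simp: Hom_iff is_functor_def)

lemma pba_Cmp: "k \<in> Arr S \<Longrightarrow> Cod S k = X \<Longrightarrow> u \<in> Arr (Fib H X) \<Longrightarrow> v \<in> Arr (Fib H X) \<Longrightarrow>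
    Dom (Fib H X) v = Cod (Fib H X) u \<Longrightarrow>
    pba H k (Cmp (Fib H X) v u) = Cmp (Fib H (Dom S k)) (pba H k v) (pba H k u)"
  using pb_functor[of k "Dom S k" X] by (auto simp: Hom_iff is_functor_def)

lemma conn_simps:
  assumes "k \<in> Arr S" "Dom S k = Z" "g \<in> Arr S" "Dom S g = Cod S k" "A \<in> Obj (Fib H (Cod S g))"
  shows "isoar (Fib H Z) (conn H k g A)"
    "Dom (Fib H Z) (conn H k g A) = pbo H (Cmp S g k) A"
    "Cod (Fib H Z) (conn H k g A) = pbo H k (pbo H g A)"
  using conn_iso[of k Z "Cod S k" g "Cod S g"] assms by (auto simp: Hom_iff nat_iso_def Iso_iff)

lemma conn_nat:
  assumes "k \<in> Arr S" "Dom S k = Z" "g \<in> Arr S" "Dom S g = Cod S k" "u \<in> Arr (Fib H (Cod S g))"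
  shows "Cmp (Fib H Z) (conn H k g (Cod (Fib H (Cod S g)) u)) (pba H (Cmp S g k) u) =
    Cmp (Fib H Z) (pba H k (pba H g u)) (conn H k g (Dom (Fib H (Cod S g)) u))"
  using conn_iso[of k Z "Cod S k" g "Cod S g"] assms by (auto simp: Hom_iff nat_iso_def)

lemma conn_Ide:
  assumes "f \<in> Arr S" "A \<in> Obj (Fib H (Cod S f))"
  shows "Dom S f = Y \<Longrightarrow> conn H (Ide S Y) f A = Ide (Fib H Y) (pbo H f A)"
    and "Cod S f = X \<Longrightarrow> conn H f (Ide S X) A = Ide (Fib H (Dom S f)) (pbo H f A)"
  using conn_ide_left[of f Y "Cod S f"] conn_ide_right[of f "Dom S f" X] assms by (auto simp: Hom_iff)

lemma cocycle:
  assumes "f \<in> Arr S" "Dom S f = W" "g \<in> Arr S" "Dom S g = Cod S f" "h \<in> Arr S" "Dom S h = Cod S g" "A \<in> Obj (Fib H (Cod S h))"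
  shows "Cmp (Fib H W) (pba H f (conn H g h A)) (conn H f (Cmp S h g) A) =
      Cmp (Fib H W) (conn H f g (pbo H h A)) (conn H (Cmp S g f) h A)"
  using conn_cocycle[of f W "Cod S f" g "Cod S g" h "Cod S h" A] assms by (auto simp: Hom_iff)

lemma pba_isoar:
  assumes "k \<in> Arr S" "Dom S k = Y" "isoar (Fib H (Cod S k)) u"
  shows "isoar (Fib H Y) (pba H k u)" "Inv (Fib H Y) (pba H k u) = pba H k (Inv (Fib H (Cod S k)) u)"
proof -
  have X: "category (Fib H (Cod S k))" "category (Fib H Y)"
    using assms fib_cat cat_simps by auto
  note s = pba_simps pbo_obj category.cat_simps[OF X(1)] category.cat_simps[OF X(2)] pba_Ide
  have "isoar (Fib H Y) (pba H k u) \<and> Inv (Fib H Y) (pba H k u) = pba H k (Inv (Fib H (Cod S k)) u)"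
    using assms pba_Cmp[of k "Cod S k" u "Inv (Fib H (Cod S k)) u"] pba_Cmp[of k "Cod S k" "Inv (Fib H (Cod S k)) u" u]
    by (intro conjI; intro category.inverseI[OF X(2), where v = "pba H k (Inv (Fib H (Cod S k)) u)"]) (simp_all add: s)
  then show "isoar (Fib H Y) (pba H k u)" "Inv (Fib H Y) (pba H k u) = pba H k (Inv (Fib H (Cod S k)) u)" by auto
qed

lemmas fib_simps = fib_cat category.cat_simps pbo_obj pba_simps pba_Ide pba_Cmp conn_simps conn_Ide pba_isoar pbo_ide pba_ide

text \<open>The object \<open>(f, A)\<close> stands for \<open>f\<^sup>* A\<close>, and \<open>(a, u, b)\<close> for an arrow \<open>u\<close> between the objects
  of the fiber for which \<open>a\<close> and \<open>b\<close> stand. Pulling back \<open>(f, A)\<close> composes base arrows, so it is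
  strictly functorial.\<close>

definition real :: "'f \<times> 'o \<Rightarrow> 'o" where
  "real a = pbo H (fst a) (snd a)"

definition gbs :: "'f \<times> 'o \<Rightarrow> 's" where
  "gbs a = Dom S (fst a)"

abbreviation und :: "('f \<times> 'o) \<times> 'a \<times> ('f \<times> 'o) \<Rightarrow> 'a" where
  "und u \<equiv> fst (snd u)"

definition G :: "('f \<times> 'o, ('f \<times> 'o) \<times> 'a \<times> ('f \<times> 'o)) cat" where
  "G = \<lparr> Obj = {a. fst a \<in> Arr S \<and> snd a \<in> Obj (Fib H (Cod S (fst a)))},
     Arr = {(a, u, b). fst a \<in> Arr S \<and> snd a \<in> Obj (Fib H (Cod S (fst a))) \<and>
       fst b \<in> Arr S \<and> snd b \<in> Obj (Fib H (Cod S (fst b))) \<and> gbs b = gbs a \<and>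
       u \<in> Hom (Fib H (gbs a)) (real a) (real b)},
     Dom = fst, Cod = snd \<circ> snd, Ide = (\<lambda>a. (a, Ide (Fib H (gbs a)) (real a), a)),
     Cmp = (\<lambda>v u. (fst u, Cmp (Fib H (gbs (fst u))) (und v) (und u), snd (snd v))) \<rparr>"

definition gpl :: "'f \<Rightarrow> 'f \<times> 'o \<Rightarrow> 'f \<times> 'o" where
  "gpl k a = (Cmp S (fst a) k, snd a)"

text \<open>An arrow from f^*A to g^*B has to be sent to one from (f k)^*A to (g k)^*B, but its
  pullback runs from k^*f^*A to k^*g^*B; hence the conjugation by connection isomorphisms.\<close>

definition gpa :: "'f \<Rightarrow> ('f \<times> 'o) \<times> 'a \<times> ('f \<times> 'o) \<Rightarrow> ('f \<times> 'o) \<times> 'a \<times> ('f \<times> 'o)" where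
  "gpa k u = (let a = fst u; b = snd (snd u); Z = Dom S k in
     (gpl k a, Cmp (Fib H Z) (Inv (Fib H Z) (conn H k (fst b) (snd b)))
        (Cmp (Fib H Z) (pba H k (und u)) (conn H k (fst a) (snd a))), gpl k b))"

lemma G_Obj: "a \<in> Obj G \<longleftrightarrow> fst a \<in> Arr S \<and> snd a \<in> Obj (Fib H (Cod S (fst a)))"
  by (simp add: G_def)

lemma G_Arr: "(a, u, b) \<in> Arr G \<longleftrightarrow> a \<in> Obj G \<and> b \<in> Obj G \<and> gbs b = gbs a \<and>
    u \<in> Arr (Fib H (gbs a)) \<and> Dom (Fib H (gbs a)) u = real a \<and> Cod (Fib H (gbs a)) u = real b"
  by (auto simp: G_def Hom_iff)

lemma G_proj: "Dom G (a, u, b) = a" "Cod G (a, u, b) = b" "Dom G x = fst x" "Cod G x = snd (snd x)"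
  by (simp_all add: G_def)

lemma G_Ide: "Ide G a = (a, Ide (Fib H (gbs a)) (real a), a)"
  by (simp add: G_def)

lemma G_Cmp: "Cmp G (b', v, c) (a, u, b) = (a, Cmp (Fib H (gbs a)) v u, c)"
  by (simp add: G_def)

lemma gpl_pair: "gpl k (f, A) = (Cmp S f k, A)"
  by (simp add: gpl_def)

lemma real_pair: "real (f, A) = pbo H f A"
  by (simp add: real_def)

lemma gbs_pair: "gbs (f, A) = Dom S f"
  by (simp add: gbs_def)

lemma gpa_tuple: "gpa k ((f, A), u, (g, B)) = ((Cmp S f k, A), Cmp (Fib H (Dom S k)) (Inv (Fib H (Dom S k)) (conn H k g B))
        (Cmp (Fib H (Dom S k)) (pba H k u) (conn H k f A)), (Cmp S g k, B))"
  by (simp add: gpa_def gpl_def Let_def)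

lemmas G_simps = G_Obj G_Arr G_proj(1,2) G_Ide G_Cmp gpl_pair real_pair gbs_pair gpa_tuple

lemma und_simps:
  assumes "u \<in> Arr G"
  shows "und u \<in> Arr (Fib H (gbs (Dom G u)))" "Dom (Fib H (gbs (Dom G u))) (und u) = real (Dom G u)"
    "Cod (Fib H (gbs (Dom G u))) (und u) = real (Cod G u)"
  using assms by (cases u; simp add: G_simps)+

lemma G_arr_cases:
  assumes "u \<in> Arr G"
  obtains f A v g B where "u = ((f, A), v, (g, B))" "f \<in> Arr S" "A \<in> Obj (Fib H (Cod S f))" "g \<in> Arr S"
    "B \<in> Obj (Fib H (Cod S g))" "Dom S g = Dom S f" "v \<in> Arr (Fib H (Dom S f))"
    "Dom (Fib H (Dom S f)) v = pbo H f A" "Cod (Fib H (Dom S f)) v = pbo H g B"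
  using assms by (cases u) (auto simp: G_simps)

lemma real_obj: "a \<in> Obj G \<Longrightarrow> gbs a = Z \<Longrightarrow> real a \<in> Obj (Fib H Z)"
  by (auto simp: real_def G_Obj gbs_def pbo_obj)

text \<open>Strict functoriality of the pullback of arrows is what the cocycle condition of the
  connection isomorphisms expresses, together with their naturality.\<close>

lemma gpa_gpa:
  assumes "k \<in> Arr S" "l \<in> Arr S" "Cod S l = Dom S k" "u \<in> Arr G" "gbs (Dom G u) = Cod S k"
  shows "gpa l (gpa k u) = gpa (Cmp S k l) u"
proof -
  obtain f A v g B where u: "u = ((f, A), v, (g, B))" "f \<in> Arr S" "A \<in> Obj (Fib H (Cod S f))" "g \<in> Arr S"
    "B \<in> Obj (Fib H (Cod S g))" "Dom S g = Dom S f" "v \<in> Arr (Fib H (Dom S f))"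
    "Dom (Fib H (Dom S f)) v = pbo H f A" "Cod (Fib H (Dom S f)) v = pbo H g B"
    using assms(4) by (rule G_arr_cases)
  have f: "Dom S f = Cod S k" using assms(5) u by (simp add: G_simps)
  let ?Z = "Dom S l"
  have v: "v \<in> Arr (Fib H (Cod S k))" "Dom (Fib H (Cod S k)) v = pbo H f A" "Cod (Fib H (Cod S k)) v = pbo H g B"
    using u f by simp_all
  note s = assms(1-3) u(2-6) f v fib_simps cat_simps
  have Z: "category (Fib H ?Z)" using assms by (simp add: fib_cat cat_simps)
  note ra = category.reassoc[OF Z]
  have cA: "Cmp (Fib H ?Z) (pba H l (conn H k f A)) (conn H l (Cmp S f k) A) =
      Cmp (Fib H ?Z) (conn H l k (pbo H f A)) (conn H (Cmp S k l) f A)"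
    and cB: "Cmp (Fib H ?Z) (pba H l (conn H k g B)) (conn H l (Cmp S g k) B) =
      Cmp (Fib H ?Z) (conn H l k (pbo H g B)) (conn H (Cmp S k l) g B)"
    using cocycle[of l ?Z k f A] cocycle[of l ?Z k g B] by (simp_all add: s)
  \<comment> \<open>For the target of the arrow the cocycle condition enters inverted, as
    \<open>gpa\<close> uses the inverse connection isomorphism on that side.\<close>
  have "Inv (Fib H ?Z) (Cmp (Fib H ?Z) (pba H l (conn H k g B)) (conn H l (Cmp S g k) B)) =
    Inv (Fib H ?Z) (Cmp (Fib H ?Z) (conn H l k (pbo H g B)) (conn H (Cmp S k l) g B))"
    by (simp only: cB)
  then have cB': "Cmp (Fib H ?Z) (Inv (Fib H ?Z) (conn H l (Cmp S g k) B)) (pba H l (Inv (Fib H (Dom S k)) (conn H k g B))) =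
      Cmp (Fib H ?Z) (Inv (Fib H ?Z) (conn H (Cmp S k l) g B)) (Inv (Fib H ?Z) (conn H l k (pbo H g B)))"
    by (simp add: s)
  have n: "Cmp (Fib H ?Z) (pba H l (pba H k v)) (conn H l k (pbo H f A)) =
     Cmp (Fib H ?Z) (conn H l k (pbo H g B)) (pba H (Cmp S k l) v)"
    using conn_nat[of l ?Z k v] by (simp add: s)
  show ?thesis unfolding u
    by (simp add: G_simps s cA ra[OF cB'] ra[OF n])
qed

sublocale vertical S G gbs gpl gpa
proof (unfold_locales, goal_cases)
  case (3 a)
  then show ?case
    by (cases a) (auto simp: G_simps Hom_iff fib_simps cat_simps)
next
  case (4 u a b v c)
  then show ?case
    by (auto elim!: G_arr_cases simp: G_simps Hom_iff fib_simps cat_simps)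
next
  case (5 u a b)
  then show ?case
    by (auto elim!: G_arr_cases simp: G_simps Hom_iff fib_simps cat_simps)
next
  case (6 u a b)
  then show ?case
    by (auto elim!: G_arr_cases simp: G_simps Hom_iff fib_simps cat_simps)
next
  case (7 u a b v c w d)
  then show ?case
    by (auto elim!: G_arr_cases simp: G_simps Hom_iff fib_simps cat_simps)
qed (auto elim!: G_arr_cases simp: G_simps G_proj gpl_def gbs_def fib_simps cat_simps gpa_gpa)

end

text \<open>The definitions quantify over hom-sets and over product categories. These equivalences
  replace hom-sets by equations on \<open>Dom\<close> and \<open>Cod\<close> and unfold the
  products, which is the form used by rewriting.\<close>

lemma is_functor_iff:
  "is_functor C E F Fa \<longleftrightarrow>
    (\<forall>A\<in>Obj C. F A \<in> Obj E) \<and>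
    (\<forall>u\<in>Arr C. Fa u \<in> Arr E \<and> Dom E (Fa u) = F (Dom C u) \<and> Cod E (Fa u) = F (Cod C u)) \<and>
    (\<forall>A\<in>Obj C. Fa (Ide C A) = Ide E (F A)) \<and>
    (\<forall>u\<in>Arr C. \<forall>v\<in>Arr C. Dom C v = Cod C u \<longrightarrow> Fa (Cmp C v u) = Cmp E (Fa v) (Fa u))"
  by (auto simp: is_functor_def Hom_iff)

lemma is_functor2_iff:
  "is_functor (prod_cat C D) E (\<lambda>(A, B). F A B) (\<lambda>(u, v). Fa u v) \<longleftrightarrow>
    (\<forall>A\<in>Obj C. \<forall>B\<in>Obj D. F A B \<in> Obj E) \<and>
    (\<forall>u\<in>Arr C. \<forall>v\<in>Arr D. Fa u v \<in> Arr E \<and> Dom E (Fa u v) = F (Dom C u) (Dom D v) \<and>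
      Cod E (Fa u v) = F (Cod C u) (Cod D v)) \<and>
    (\<forall>A\<in>Obj C. \<forall>B\<in>Obj D. Fa (Ide C A) (Ide D B) = Ide E (F A B)) \<and>
    (\<forall>u\<in>Arr C. \<forall>v\<in>Arr D. \<forall>u'\<in>Arr C. \<forall>v'\<in>Arr D. Dom C u' = Cod C u \<longrightarrow> Dom D v' = Cod D v \<longrightarrow>
      Fa (Cmp C u' u) (Cmp D v' v) = Cmp E (Fa u' v') (Fa u v))"
  unfolding is_functor_iff by (auto simp: prod_cat_def)

lemma nat_iso_iff:
  "nat_iso C E F Fa F' Fa' \<eta> \<longleftrightarrow>
    (\<forall>A\<in>Obj C. isoar E (\<eta> A) \<and> Dom E (\<eta> A) = F A \<and> Cod E (\<eta> A) = F' A) \<and>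
    (\<forall>u\<in>Arr C. Cmp E (\<eta> (Cod C u)) (Fa u) = Cmp E (Fa' u) (\<eta> (Dom C u)))"
  by (auto simp: nat_iso_def Hom_iff Iso_iff)

lemma nat_iso2_iff:
  "nat_iso (prod_cat C D) E (\<lambda>(A, B). F A B) (\<lambda>(u, v). Fa u v) (\<lambda>(A, B). F' A B) (\<lambda>(u, v). Fa' u v)
      (\<lambda>(A, B). \<eta> A B) \<longleftrightarrow>
    (\<forall>A\<in>Obj C. \<forall>B\<in>Obj D. isoar E (\<eta> A B) \<and> Dom E (\<eta> A B) = F A B \<and> Cod E (\<eta> A B) = F' A B) \<and>
    (\<forall>u\<in>Arr C. \<forall>v\<in>Arr D. Cmp E (\<eta> (Cod C u) (Cod D v)) (Fa u v) = Cmp E (Fa' u v) (\<eta> (Dom C u) (Dom D v)))"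
  unfolding nat_iso_iff by (simp add: prod_cat_def)

lemma nat_iso3_iff:
  "nat_iso (prod_cat (prod_cat B C) D) E (\<lambda>((X, Y), Z). F X Y Z) (\<lambda>((u, v), w). Fa u v w)
      (\<lambda>((X, Y), Z). F' X Y Z) (\<lambda>((u, v), w). Fa' u v w) (\<lambda>((X, Y), Z). \<eta> X Y Z) \<longleftrightarrow>
    (\<forall>X\<in>Obj B. \<forall>Y\<in>Obj C. \<forall>Z\<in>Obj D. isoar E (\<eta> X Y Z) \<and> Dom E (\<eta> X Y Z) = F X Y Z \<and> Cod E (\<eta> X Y Z) = F' X Y Z) \<and>
    (\<forall>u\<in>Arr B. \<forall>v\<in>Arr C. \<forall>w\<in>Arr D. Cmp E (\<eta> (Cod B u) (Cod C v) (Cod D w)) (Fa u v w) =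
      Cmp E (Fa' u v w) (\<eta> (Dom B u) (Dom C v) (Dom D w)))"
  unfolding nat_iso_iff by (simp add: prod_cat_def)

lemmas frozen_iff = is_functor2_iff nat_iso2_iff Hom_iff Iso_iff Ball_def
lemmas frozen1_iff = nat_iso_iff Hom_iff Iso_iff Ball_def
lemmas frozen3_iff = nat_iso3_iff Hom_iff Iso_iff Ball_def

context fibered_over_products
begin

lemma G_isoar:
  "isoar G (a, u, b) \<longleftrightarrow> (a, u, b) \<in> Arr G \<and> isoar (Fib H (gbs a)) u" (is ?A)
  "isoar G (a, u, b) \<Longrightarrow> Inv G (a, u, b) = (b, Inv (Fib H (gbs a)) u, a)"
proof -
  have *: "isoar G (a, u, b) \<and> Inv G (a, u, b) = (b, Inv (Fib H (gbs a)) u, a)"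
    if "(a, u, b) \<in> Arr G" "isoar (Fib H (gbs a)) u"
  proof -
    have Z: "category (Fib H (gbs a))" using that by (auto simp: G_Arr G_Obj gbs_def fib_cat cat_simps)
    show ?thesis
      using that category.cat_simps[OF Z]
      by (intro conjI tot.inverseI[where v = "(b, Inv (Fib H (gbs a)) u, a)"])
        (auto simp: G_Arr G_proj G_Cmp G_Ide)
  qed
  have **: "isoar (Fib H (gbs a)) u" if i: "isoar G (a, u, b)"
  proof -
    have Z: "category (Fib H (gbs a))"
      using that by (auto simp: isoar_def G_Arr G_Obj gbs_def fib_cat cat_simps)
    obtain x where "inverse_arrows G (a, u, b) x"
      using i unfolding isoar_def by blast
    moreover obtain c v d where "x = (c, v, d)" by (cases x)
    ultimately have v: "inverse_arrows G (a, u, b) (c, v, d)" by simp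
    then have cd: "c = b" "d = a"
      by (simp_all add: inverse_arrows_def Hom_iff G_proj)
    have "(b, v, a) \<in> Arr G" "Cmp G (b, v, a) (a, u, b) = Ide G a" "Cmp G (a, u, b) (b, v, a) = Ide G b"
      using v unfolding cd by (simp_all add: inverse_arrows_def Hom_iff G_proj)
    moreover have "(a, u, b) \<in> Arr G" using i by (simp add: isoar_def)
    ultimately show ?thesis
      by (intro category.inverseI(1)[OF Z, where v = v]) (simp_all add: G_Arr G_Cmp G_Ide)
  qed
  show ?A using * ** tot.isoar_arr by blast
  show "isoar G (a, u, b) \<Longrightarrow> Inv G (a, u, b) = (b, Inv (Fib H (gbs a)) u, a)"
    using * ** tot.isoar_arr by blast
qed

section \<open>Internal structures over the split fibered category\<close>

text \<open>The tensor product of two formal pullbacks is formed from the objects they stand for and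
  is placed over an identity of the base. Since \<open>gpl k (f, A)\<close> stands for (f k)^*A and
  not for k^*f^*A, the field \<open>sm\<close> has to insert connection isomorphisms before
  \<open>tm\<close>.\<close>

definition lift_int :: "('s, 'f, 'o, 'a) K_int \<Rightarrow> ('s, 'f, 'f \<times> 'o, ('f \<times> 'o) \<times> 'a \<times> ('f \<times> 'o)) stens" where
  "lift_int T =
    (let u = the (tunit T);
         tt = (\<lambda>a b. (Ide S (gbs a), tob T (gbs a) (real a) (real b)));
         o1 = (\<lambda>X. (Ide S X, sob u X))
     in \<lparr> to = tt,
          ta = (\<lambda>u v. (tt (Dom G u) (Dom G v), tar T (gbs (Dom G u)) (und u) (und v), tt (Cod G u) (Cod G v))),
          sm = (\<lambda>k a b. (tt (gpl k a) (gpl k b),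
             Cmp (Fib H (Dom S k)) (tm T k (real a) (real b))
               (tar T (Dom S k) (conn H k (fst a) (snd a)) (conn H k (fst b) (snd b))), gpl k (tt a b))),
          sas = (\<lambda>a b c. (tt (tt a b) c, the (tassoc T) (gbs a) (real a) (real b) (real c), tt a (tt b c))),
          sco = (\<lambda>a b. (tt a b, the (tcomm T) (gbs a) (real a) (real b), tt b a)),
          one = o1, sr = (\<lambda>k. (gpl k (o1 (Cod S k)), sar u k, o1 (Dom S k))),
          ur = (\<lambda>a. (tt a (o1 (gbs a)), tur u (gbs a) (real a), a)),
          ul = (\<lambda>a. (tt (o1 (gbs a)) a, tul u (gbs a) (real a), a)) \<rparr>)"

lemma lift_sel:
  "to (lift_int T) a b = (Ide S (gbs a), tob T (gbs a) (real a) (real b))"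
  "ta (lift_int T) u v = (to (lift_int T) (Dom G u) (Dom G v), tar T (gbs (Dom G u)) (und u) (und v),
      to (lift_int T) (Cod G u) (Cod G v))"
  "sm (lift_int T) k a b = (to (lift_int T) (gpl k a) (gpl k b),
             Cmp (Fib H (Dom S k)) (tm T k (real a) (real b))
               (tar T (Dom S k) (conn H k (fst a) (snd a)) (conn H k (fst b) (snd b))), gpl k (to (lift_int T) a b))"
  "sas (lift_int T) a b c = (to (lift_int T) (to (lift_int T) a b) c, the (tassoc T) (gbs a) (real a) (real b) (real c),
      to (lift_int T) a (to (lift_int T) b c))"
  "sco (lift_int T) a b = (to (lift_int T) a b, the (tcomm T) (gbs a) (real a) (real b), to (lift_int T) b a)"
  "one (lift_int T) X = (Ide S X, sob (the (tunit T)) X)"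
  "sr (lift_int T) k = (gpl k (one (lift_int T) (Cod S k)), sar (the (tunit T)) k, one (lift_int T) (Dom S k))"
  "ur (lift_int T) a = (to (lift_int T) a (one (lift_int T) (gbs a)), tur (the (tunit T)) (gbs a) (real a), a)"
  "ul (lift_int T) a = (to (lift_int T) (one (lift_int T) (gbs a)) a, tul (the (tunit T)) (gbs a) (real a), a)"
  by (simp_all add: lift_int_def Let_def)

end

section \<open>The tensor structure on \<open>G\<close> induced by an internal structure\<close>

locale internal_structure = fibered_over_products S H
  for S :: "('s, 'f) pcat" and H :: "('s, 'f, 'o, 'a) fib" +
  fixes K :: "tensor_property set" and T :: "('s, 'f, 'o, 'a) K_int"
  assumes K_int: "K_internal S H K T"
begin

abbreviation "aT \<equiv> the (tassoc T)"
abbreviation "cT \<equiv> the (tcomm T)"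
abbreviation "uT \<equiv> the (tunit T)"

lemma T_base: "internal_tensor S H T"
  and T_assoc: "Associative \<in> K \<Longrightarrow> internal_assoc S H T aT"
  and T_comm: "Symmetric \<in> K \<Longrightarrow> internal_comm S H T cT"
  and T_unit: "Unitary \<in> K \<Longrightarrow> internal_unit S H T uT"
  and T_ac: "Associative \<in> K \<Longrightarrow> Symmetric \<in> K \<Longrightarrow> internal_compat_ac S H T aT cT"
  and T_au: "Associative \<in> K \<Longrightarrow> Unitary \<in> K \<Longrightarrow> internal_compat_au S H T aT uT"
  and T_cu: "Symmetric \<in> K \<Longrightarrow> Unitary \<in> K \<Longrightarrow> internal_compat_cu S H cT uT"
  using K_int by (auto simp: K_internal_def)

lemma tob_obj: "X \<in> Obj S \<Longrightarrow> A \<in> Obj (Fib H X) \<Longrightarrow> B \<in> Obj (Fib H X) \<Longrightarrow> tob T X A B \<in> Obj (Fib H X)"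
  using T_base by (simp add: internal_tensor_def frozen_iff)

lemma tar_simps:
  assumes "X \<in> Obj S" "u \<in> Arr (Fib H X)" "v \<in> Arr (Fib H X)"
  shows "tar T X u v \<in> Arr (Fib H X)" "Dom (Fib H X) (tar T X u v) = tob T X (Dom (Fib H X) u) (Dom (Fib H X) v)"
    "Cod (Fib H X) (tar T X u v) = tob T X (Cod (Fib H X) u) (Cod (Fib H X) v)"
  using T_base assms by (auto simp: internal_tensor_def frozen_iff)

lemma tar_Ide: "X \<in> Obj S \<Longrightarrow> A \<in> Obj (Fib H X) \<Longrightarrow> B \<in> Obj (Fib H X) \<Longrightarrow>
    tar T X (Ide (Fib H X) A) (Ide (Fib H X) B) = Ide (Fib H X) (tob T X A B)"
  using T_base by (simp add: internal_tensor_def frozen_iff)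

lemma tar_Cmp: "X \<in> Obj S \<Longrightarrow> u \<in> Arr (Fib H X) \<Longrightarrow> v \<in> Arr (Fib H X) \<Longrightarrow> u' \<in> Arr (Fib H X) \<Longrightarrow> v' \<in> Arr (Fib H X) \<Longrightarrow>
    Dom (Fib H X) u' = Cod (Fib H X) u \<Longrightarrow> Dom (Fib H X) v' = Cod (Fib H X) v \<Longrightarrow>
    tar T X (Cmp (Fib H X) u' u) (Cmp (Fib H X) v' v) = Cmp (Fib H X) (tar T X u' v') (tar T X u v)"
  using T_base by (simp add: internal_tensor_def frozen_iff)

lemma tm_simps:
  assumes "k \<in> Arr S" "Dom S k = Y" "A \<in> Obj (Fib H (Cod S k))" "B \<in> Obj (Fib H (Cod S k))"
  shows "isoar (Fib H Y) (tm T k A B)" "Dom (Fib H Y) (tm T k A B) = tob T Y (pbo H k A) (pbo H k B)"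
    "Cod (Fib H Y) (tm T k A B) = pbo H k (tob T (Cod S k) A B)"
  using T_base assms by (auto simp: internal_tensor_def frozen_iff)

lemma tm_nat:
  assumes "k \<in> Arr S" "Dom S k = Y" "u \<in> Arr (Fib H (Cod S k))" "v \<in> Arr (Fib H (Cod S k))"
  shows "Cmp (Fib H Y) (tm T k (Cod (Fib H (Cod S k)) u) (Cod (Fib H (Cod S k)) v)) (tar T Y (pba H k u) (pba H k v)) =
     Cmp (Fib H Y) (pba H k (tar T (Cod S k) u v)) (tm T k (Dom (Fib H (Cod S k)) u) (Dom (Fib H (Cod S k)) v))"
  using T_base assms by (auto simp: internal_tensor_def frozen_iff)

lemma tm_cocycle:
  assumes "f \<in> Arr S" "Dom S f = Z" "g \<in> Arr S" "Dom S g = Cod S f" "A \<in> Obj (Fib H (Cod S g))" "B \<in> Obj (Fib H (Cod S g))"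
  shows "Cmp (Fib H Z) (pba H f (tm T g A B)) (Cmp (Fib H Z) (tm T f (pbo H g A) (pbo H g B))
         (tar T Z (conn H f g A) (conn H f g B))) =
      Cmp (Fib H Z) (conn H f g (tob T (Cod S g) A B)) (tm T (Cmp S g f) A B)"
  using T_base assms by (auto simp: internal_tensor_def frozen_iff)

lemma tar_isoar:
  assumes "X \<in> Obj S" "isoar (Fib H X) u" "isoar (Fib H X) v"
  shows "isoar (Fib H X) (tar T X u v)" "Inv (Fib H X) (tar T X u v) = tar T X (Inv (Fib H X) u) (Inv (Fib H X) v)"
proof -
  have X: "category (Fib H X)" using assms by (simp add: fib_cat)
  have "isoar (Fib H X) (tar T X u v) \<and> Inv (Fib H X) (tar T X u v) = tar T X (Inv (Fib H X) u) (Inv (Fib H X) v)"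
    using assms category.cat_simps[OF X]
    by (intro conjI; intro category.inverseI[OF X, where v = "tar T X (Inv (Fib H X) u) (Inv (Fib H X) v)"])
      (simp_all add: tar_simps tar_Ide flip: tar_Cmp)
  then show "isoar (Fib H X) (tar T X u v)" "Inv (Fib H X) (tar T X u v) = tar T X (Inv (Fib H X) u) (Inv (Fib H X) v)"
    by auto
qed

lemmas int_simps = tob_obj tar_simps tar_Ide tm_simps tar_isoar

lemma assoc_simps:
  assumes "Associative \<in> K" "X \<in> Obj S" "A \<in> Obj (Fib H X)" "B \<in> Obj (Fib H X)" "C \<in> Obj (Fib H X)"
  shows "isoar (Fib H X) (aT X A B C)" "Dom (Fib H X) (aT X A B C) = tob T X (tob T X A B) C"
    "Cod (Fib H X) (aT X A B C) = tob T X A (tob T X B C)"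
  using T_assoc assms by (auto simp: internal_assoc_def frozen3_iff)

lemma assoc_nat:
  assumes "Associative \<in> K" "X \<in> Obj S" "u \<in> Arr (Fib H X)" "v \<in> Arr (Fib H X)" "w \<in> Arr (Fib H X)"
  shows "Cmp (Fib H X) (aT X (Cod (Fib H X) u) (Cod (Fib H X) v) (Cod (Fib H X) w)) (tar T X (tar T X u v) w) =
    Cmp (Fib H X) (tar T X u (tar T X v w)) (aT X (Dom (Fib H X) u) (Dom (Fib H X) v) (Dom (Fib H X) w))"
  using T_assoc assms by (auto simp: internal_assoc_def frozen3_iff)

lemma assoc_m:
  assumes "Associative \<in> K" "f \<in> Arr S" "A \<in> Obj (Fib H (Cod S f))" "B \<in> Obj (Fib H (Cod S f))" "C \<in> Obj (Fib H (Cod S f))"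
  shows "Cmp (Fib H (Dom S f)) (pba H f (aT (Cod S f) A B C)) (Cmp (Fib H (Dom S f)) (tm T f (tob T (Cod S f) A B) C)
        (tar T (Dom S f) (tm T f A B) (Ide (Fib H (Dom S f)) (pbo H f C)))) =
    Cmp (Fib H (Dom S f)) (tm T f A (tob T (Cod S f) B C)) (Cmp (Fib H (Dom S f))
        (tar T (Dom S f) (Ide (Fib H (Dom S f)) (pbo H f A)) (tm T f B C)) (aT (Dom S f) (pbo H f A) (pbo H f B) (pbo H f C)))"
  using T_assoc assms by (auto simp: internal_assoc_def frozen3_iff)

lemma comm_simps:
  assumes "Symmetric \<in> K" "X \<in> Obj S" "A \<in> Obj (Fib H X)" "B \<in> Obj (Fib H X)"
  shows "isoar (Fib H X) (cT X A B)" "Dom (Fib H X) (cT X A B) = tob T X A B"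
    "Cod (Fib H X) (cT X A B) = tob T X B A"
  using T_comm assms by (auto simp: internal_comm_def frozen_iff)

lemma comm_nat:
  assumes "Symmetric \<in> K" "X \<in> Obj S" "u \<in> Arr (Fib H X)" "v \<in> Arr (Fib H X)"
  shows "Cmp (Fib H X) (cT X (Cod (Fib H X) u) (Cod (Fib H X) v)) (tar T X u v) =
    Cmp (Fib H X) (tar T X v u) (cT X (Dom (Fib H X) u) (Dom (Fib H X) v))"
  using T_comm assms by (auto simp: internal_comm_def frozen_iff)

lemma comm_m:
  assumes "Symmetric \<in> K" "f \<in> Arr S" "A \<in> Obj (Fib H (Cod S f))" "B \<in> Obj (Fib H (Cod S f))"
  shows "Cmp (Fib H (Dom S f)) (pba H f (cT (Cod S f) A B)) (tm T f A B) =
    Cmp (Fib H (Dom S f)) (tm T f B A) (cT (Dom S f) (pbo H f A) (pbo H f B))"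
  using T_comm assms by (auto simp: internal_comm_def frozen_iff)

lemma unit_obj: "Unitary \<in> K \<Longrightarrow> X \<in> Obj S \<Longrightarrow> sob uT X \<in> Obj (Fib H X)"
  using T_unit by (simp add: internal_unit_def is_section_def)

lemma sar_simps:
  assumes "Unitary \<in> K" "f \<in> Arr S" "Dom S f = Y"
  shows "isoar (Fib H Y) (sar uT f)" "Dom (Fib H Y) (sar uT f) = pbo H f (sob uT (Cod S f))"
    "Cod (Fib H Y) (sar uT f) = sob uT Y"
  using T_unit assms by (auto simp: internal_unit_def is_section_def frozen1_iff)

lemma sar_Cmp:
  assumes "Unitary \<in> K" "f \<in> Arr S" "Dom S f = Z" "g \<in> Arr S" "Dom S g = Cod S f"
  shows "sar uT (Cmp S g f) = Cmp (Fib H Z) (sar uT f) (Cmp (Fib H Z) (pba H f (sar uT g)) (conn H f g (sob uT (Cod S g))))"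
  using T_unit assms by (auto simp: internal_unit_def is_section_def frozen1_iff)

lemma ur_simps:
  assumes "Unitary \<in> K" "X \<in> Obj S" "A \<in> Obj (Fib H X)"
  shows "isoar (Fib H X) (tur uT X A)" "Dom (Fib H X) (tur uT X A) = tob T X A (sob uT X)"
    "Cod (Fib H X) (tur uT X A) = A"
    "isoar (Fib H X) (tul uT X A)" "Dom (Fib H X) (tul uT X A) = tob T X (sob uT X) A"
    "Cod (Fib H X) (tul uT X A) = A"
  using T_unit assms by (auto simp: internal_unit_def frozen1_iff)

lemma ur_law:
  assumes "Unitary \<in> K"
  shows "X \<in> Obj S \<Longrightarrow> v \<in> Arr (Fib H X) \<Longrightarrow>
     Cmp (Fib H X) (tur uT X (Cod (Fib H X) v)) (tar T X v (Ide (Fib H X) (sob uT X))) =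
     Cmp (Fib H X) v (tur uT X (Dom (Fib H X) v))"
   "X \<in> Obj S \<Longrightarrow> v \<in> Arr (Fib H X) \<Longrightarrow>
     Cmp (Fib H X) (tul uT X (Cod (Fib H X) v)) (tar T X (Ide (Fib H X) (sob uT X)) v) =
     Cmp (Fib H X) v (tul uT X (Dom (Fib H X) v))"
   "X \<in> Obj S \<Longrightarrow> tur uT X (sob uT X) = tul uT X (sob uT X)"
   "f \<in> Arr S \<Longrightarrow> Dom S f = Y \<Longrightarrow> A \<in> Obj (Fib H (Cod S f)) \<Longrightarrow>
     Cmp (Fib H Y) (pba H f (tur uT (Cod S f) A)) (tm T f A (sob uT (Cod S f))) =
     Cmp (Fib H Y) (tur uT Y (pbo H f A)) (tar T Y (Ide (Fib H Y) (pbo H f A)) (sar uT f))"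
   "f \<in> Arr S \<Longrightarrow> Dom S f = Y \<Longrightarrow> A \<in> Obj (Fib H (Cod S f)) \<Longrightarrow>
     Cmp (Fib H Y) (pba H f (tul uT (Cod S f) A)) (tm T f (sob uT (Cod S f)) A) =
     Cmp (Fib H Y) (tul uT Y (pbo H f A)) (tar T Y (sar uT f) (Ide (Fib H Y) (pbo H f A)))"
  using T_unit assms by (auto simp: internal_unit_def frozen1_iff)

lemmas con_simps = assoc_simps comm_simps unit_obj sar_simps ur_simps

lemmas lift_simps = lift_sel G_simps G_isoar real_obj int_simps con_simps fib_simps cat_simps

lemma styped_lift: "styped S G gbs gpl gpa K (lift_int T)"
proof (unfold_locales, goal_cases)
  case (3 u v)
  then show ?case
    by (auto elim!: G_arr_cases simp: lift_simps)
qed (simp_all add: lift_simps G_proj sar_Cmp gbs_def und_simps real_def gpl_def)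

text \<open>Laws inside one fiber are those of \<open>T\<close> at the objects
  \<open>real a\<close>. In the laws that involve \<open>sm\<close>, naturality carries the
  connection isomorphisms across the constraints of \<open>T\<close> until they cancel.\<close>

lemma stensor_lift: "stensor S G gbs gpl gpa K (lift_int T)"
proof (rule stensor.intro[OF styped_lift stensor_axioms.intro], goal_cases)
  case (1 a b)
  then show ?case by (simp add: lift_simps G_proj gbs_def und_simps real_def)
next
  case (2 u v u' v')
  then show ?case by (auto elim!: G_arr_cases simp: lift_simps simp flip: tar_Cmp)
next
  case (3 k a b)
  then show ?case by (simp add: lift_simps G_proj gbs_def und_simps real_def gpl_def)
next
  case (4 k u v)
  obtain f A v1 g B where u: "u = ((f, A), v1, (g, B))" "f \<in> Arr S" "A \<in> Obj (Fib H (Cod S f))" "g \<in> Arr S"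
    "B \<in> Obj (Fib H (Cod S g))" "Dom S g = Dom S f" "v1 \<in> Arr (Fib H (Dom S f))"
    "Dom (Fib H (Dom S f)) v1 = pbo H f A" "Cod (Fib H (Dom S f)) v1 = pbo H g B"
    using 4(2) by (rule G_arr_cases)
  obtain f' A' v2 g' B' where v: "v = ((f', A'), v2, (g', B'))" "f' \<in> Arr S" "A' \<in> Obj (Fib H (Cod S f'))" "g' \<in> Arr S"
    "B' \<in> Obj (Fib H (Cod S g'))" "Dom S g' = Dom S f'" "v2 \<in> Arr (Fib H (Dom S f'))"
    "Dom (Fib H (Dom S f')) v2 = pbo H f' A'" "Cod (Fib H (Dom S f')) v2 = pbo H g' B'"
    using 4(3) by (rule G_arr_cases)
  have f: "Dom S f = Cod S k" "Dom S f' = Cod S k" using 4 u v by (simp_all add: G_simps)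
  have Z: "category (Fib H (Dom S k))" using 4 by (simp add: fib_simps cat_simps)
  show ?case
    using 4(1) u v f category.reassoc[OF Z tm_nat[of k "Dom S k" v1 v2, symmetric]]
    by (simp add: lift_simps flip: tar_Cmp)
next
  case (5 k l a b)
  obtain f A g B where o: "a = (f, A)" "b = (g, B)" by (cases a; cases b)
  let ?Z = "Dom S l"
  have Z: "category (Fib H ?Z)" using 5 by (simp add: fib_simps cat_simps)
  note ra = category.reassoc[OF Z]
  have d: "Dom S f = Cod S k" "Dom S g = Cod S k" "f \<in> Arr S" "g \<in> Arr S" "A \<in> Obj (Fib H (Cod S f))" "B \<in> Obj (Fib H (Cod S g))"
    using 5 o by (simp_all add: G_simps)
  \<comment> \<open>Three moves follow: naturality takes \<open>tm T l\<close> past the connection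
    isomorphisms, the cocycle condition of the fibered category is applied in both tensor factors at
    once, and the cocycle condition of \<open>tm\<close> finishes.\<close>
  have n: "Cmp (Fib H ?Z) (pba H l (tar T (Dom S k) (conn H k f A) (conn H k g B)))
        (tm T l (pbo H (Cmp S f k) A) (pbo H (Cmp S g k) B)) =
      Cmp (Fib H ?Z) (tm T l (pbo H k (pbo H f A)) (pbo H k (pbo H g B)))
       (tar T ?Z (pba H l (conn H k f A)) (pba H l (conn H k g B)))"
    using tm_nat[of l ?Z "conn H k f A" "conn H k g B"] 5 d by (simp add: fib_simps cat_simps)
  have c: "Cmp (Fib H ?Z) (pba H l (conn H k f A)) (conn H l (Cmp S f k) A) =
      Cmp (Fib H ?Z) (conn H l k (pbo H f A)) (conn H (Cmp S k l) f A)"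
     "Cmp (Fib H ?Z) (pba H l (conn H k g B)) (conn H l (Cmp S g k) B) =
      Cmp (Fib H ?Z) (conn H l k (pbo H g B)) (conn H (Cmp S k l) g B)"
    using 5 d by (simp_all add: cocycle)
  have t: "Cmp (Fib H ?Z) (tar T ?Z (pba H l (conn H k f A)) (pba H l (conn H k g B)))
        (tar T ?Z (conn H l (Cmp S f k) A) (conn H l (Cmp S g k) B)) =
      Cmp (Fib H ?Z) (tar T ?Z (conn H l k (pbo H f A)) (conn H l k (pbo H g B)))
         (tar T ?Z (conn H (Cmp S k l) f A) (conn H (Cmp S k l) g B))"
    using 5 d by (simp add: fib_simps cat_simps c flip: tar_Cmp)
  have mc: "Cmp (Fib H ?Z) (pba H l (tm T k (pbo H f A) (pbo H g B)))
      (Cmp (Fib H ?Z) (tm T l (pbo H k (pbo H f A)) (pbo H k (pbo H g B)))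
         (tar T ?Z (conn H l k (pbo H f A)) (conn H l k (pbo H g B)))) =
      Cmp (Fib H ?Z) (conn H l k (tob T (Cod S k) (pbo H f A) (pbo H g B))) (tm T (Cmp S k l) (pbo H f A) (pbo H g B))"
    using 5 d tm_cocycle[of l ?Z k "pbo H f A" "pbo H g B"] by (simp add: fib_simps)
  show ?case
    using 5(1-3) d by (simp add: o lift_simps ra[OF n] t category.reassoc3[OF Z mc])
next
  case (6 a b c)
  then show ?case by (simp add: lift_simps G_proj gbs_def und_simps real_def)
next
  case (7 u v w)
  then show ?case
    using assoc_nat[of "gbs (Dom G u)" "und u" "und v" "und w"]
    by (elim G_arr_cases) (simp add: lift_simps)
next
  case (8 a b c d)
  then show ?case
    using T_assoc by (simp add: lift_simps G_proj gbs_def und_simps real_def internal_assoc_def)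
next
  case (9 k a b c)
  obtain f A g B h C where o: "a = (f, A)" "b = (g, B)" "c = (h, C)" by (cases a; cases b; cases c)
  let ?Z = "Dom S k" and ?A = "pbo H f A" and ?B = "pbo H g B" and ?C = "pbo H h C"
  have Z: "category (Fib H ?Z)" using 9 by (simp add: fib_simps cat_simps)
  have d: "Dom S f = Cod S k" "Dom S g = Cod S k" "Dom S h = Cod S k" "f \<in> Arr S" "g \<in> Arr S" "h \<in> Arr S"
    "A \<in> Obj (Fib H (Cod S f))" "B \<in> Obj (Fib H (Cod S g))" "C \<in> Obj (Fib H (Cod S h))"
    using 9 o by (simp_all add: G_simps)
  let ?fA = "conn H k f A" and ?gB = "conn H k g B" and ?hC = "conn H k h C"
  \<comment> \<open>Bifunctoriality splits the connection isomorphisms off from \<open>tm\<close>,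
    so that naturality of the associativity constraint can carry all three of them to the other
    side.\<close>
  have l: "tar T ?Z (Cmp (Fib H ?Z) (tm T k ?A ?B) (tar T ?Z ?fA ?gB)) ?hC =
      Cmp (Fib H ?Z) (tar T ?Z (tm T k ?A ?B) (Ide (Fib H ?Z) (pbo H k ?C))) (tar T ?Z (tar T ?Z ?fA ?gB) ?hC)"
    "tar T ?Z ?fA (Cmp (Fib H ?Z) (tm T k ?B ?C) (tar T ?Z ?gB ?hC)) =
      Cmp (Fib H ?Z) (tar T ?Z (Ide (Fib H ?Z) (pbo H k ?A)) (tm T k ?B ?C)) (tar T ?Z ?fA (tar T ?Z ?gB ?hC))"
    using 9(2) d by (simp_all add: int_simps fib_simps cat_simps flip: tar_Cmp)
  let ?W = "Cmp (Fib H ?Z) (tm T k ?B ?C) (tar T ?Z ?gB ?hC)"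
  have m: "Cmp (Fib H ?Z) (tar T ?Z ?fA (Ide (Fib H ?Z) (pbo H k (tob T (Cod S k) ?B ?C))))
      (tar T ?Z (Ide (Fib H ?Z) (pbo H (Cmp S f k) A)) ?W) = tar T ?Z ?fA ?W"
    using 9(2) d by (simp add: int_simps fib_simps cat_simps flip: tar_Cmp)
  have "Cmp (Fib H ?Z) (pba H k (aT (Cod S k) ?A ?B ?C)) (Cmp (Fib H ?Z) (tm T k (tob T (Cod S k) ?A ?B) ?C)
      (tar T ?Z (Cmp (Fib H ?Z) (tm T k ?A ?B) (tar T ?Z ?fA ?gB)) ?hC)) =
     Cmp (Fib H ?Z) (tm T k ?A (tob T (Cod S k) ?B ?C)) (Cmp (Fib H ?Z)
      (tar T ?Z ?fA (Cmp (Fib H ?Z) (tm T k ?B ?C) (tar T ?Z ?gB ?hC))) (aT ?Z (pbo H (Cmp S f k) A) (pbo H (Cmp S g k) B) (pbo H (Cmp S h k) C)))"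
    using 9(1,2) d assoc_m[of k ?A ?B ?C] assoc_nat[of ?Z ?fA ?gB ?hC]
    unfolding l
    by (simp add: lift_simps category.reassoc3[OF Z assoc_m])
  then show ?case
    using 9(1,2) d category.reassoc[OF Z m] by (simp add: o lift_simps flip: tar_Cmp)
next
  case (10 u v)
  then show ?case
    using comm_nat[of "gbs (Dom G u)" "und u" "und v"]
    by (elim G_arr_cases) (simp add: lift_simps)
next
  case (11 a b)
  then show ?case
    using T_comm by (simp add: lift_simps G_proj gbs_def und_simps real_def internal_comm_def)
next
  case (12 k a b)
  obtain f A g B where o: "a = (f, A)" "b = (g, B)" by (cases a; cases b)
  have Z: "category (Fib H (Dom S k))" using 12 by (simp add: fib_simps cat_simps)
  show ?case
    using 12 comm_nat[of "Dom S k" "conn H k f A" "conn H k g B"] category.reassoc[OF Z comm_m[of k "pbo H f A" "pbo H g B"]]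
    by (simp add: o lift_simps)
next
  case (15 u)
  then show ?case
    using ur_law(1)[of "gbs (Dom G u)" "und u"]
    by (elim G_arr_cases) (simp add: lift_simps)
next
  case (16 u)
  then show ?case
    using ur_law(2)[of "gbs (Dom G u)" "und u"]
    by (elim G_arr_cases) (simp add: lift_simps)
next
  case (17 X)
  then show ?case
    using ur_law(3)[of X] by (simp add: lift_simps)
next
  case (18 k a)
  obtain f A where o: "a = (f, A)" by (cases a)
  have Z: "category (Fib H (Dom S k))" using 18 by (simp add: fib_simps cat_simps)
  let ?Z = "Dom S k" and ?g = "conn H k f A"
  have d: "Dom S f = Cod S k" "f \<in> Arr S" "A \<in> Obj (Fib H (Cod S f))"
    using 18 o by (simp_all add: G_simps)
  \<comment> \<open>The tensor product of the connection isomorphism and the unit arrow is split, so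
    that naturality of \<open>tur\<close> can act on the first factor alone.\<close>
  have s: "tar T ?Z (?g) (sar uT k) = Cmp (Fib H ?Z) (tar T ?Z (?g) (Ide (Fib H ?Z) (sob uT ?Z))) (tar T ?Z (Ide (Fib H ?Z) (pbo H (Cmp S f k) A)) (sar uT k))"
    using 18(1,2) d by (simp add: lift_simps flip: tar_Cmp)
  have "Cmp (Fib H ?Z) (tur uT ?Z (pbo H k (pbo H f A))) (tar T ?Z (?g) (sar uT k)) =
      Cmp (Fib H ?Z) ?g (Cmp (Fib H ?Z) (tur uT ?Z (pbo H (Cmp S f k) A)) (tar T ?Z (Ide (Fib H ?Z) (pbo H (Cmp S f k) A)) (sar uT k)))"
    using 18(1,2) d category.reassoc[OF Z ur_law(1)[of ?Z ?g]] unfolding s by (simp add: lift_simps)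
  then show ?case
    using 18(1,2) d category.reassoc[OF Z ur_law(4)[of k ?Z "pbo H f A"]]
    by (simp add: o lift_simps flip: tar_Cmp)
next
  case (19 k a)
  obtain f A where o: "a = (f, A)" by (cases a)
  have Z: "category (Fib H (Dom S k))" using 19 by (simp add: fib_simps cat_simps)
  let ?Z = "Dom S k" and ?g = "conn H k f A"
  have d: "Dom S f = Cod S k" "f \<in> Arr S" "A \<in> Obj (Fib H (Cod S f))"
    using 19 o by (simp_all add: G_simps)
  have s: "tar T ?Z (sar uT k) (?g) = Cmp (Fib H ?Z) (tar T ?Z (Ide (Fib H ?Z) (sob uT ?Z)) (?g)) (tar T ?Z (sar uT k) (Ide (Fib H ?Z) (pbo H (Cmp S f k) A)))"
    using 19(1,2) d by (simp add: lift_simps flip: tar_Cmp)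
  have "Cmp (Fib H ?Z) (tul uT ?Z (pbo H k (pbo H f A))) (tar T ?Z (sar uT k) (?g)) =
      Cmp (Fib H ?Z) ?g (Cmp (Fib H ?Z) (tul uT ?Z (pbo H (Cmp S f k) A)) (tar T ?Z (sar uT k) (Ide (Fib H ?Z) (pbo H (Cmp S f k) A))))"
    using 19(1,2) d category.reassoc[OF Z ur_law(2)[of ?Z ?g]] unfolding s by (simp add: lift_simps)
  then show ?case
    using 19(1,2) d category.reassoc[OF Z ur_law(5)[of k ?Z "pbo H f A"]]
    by (simp add: o lift_simps flip: tar_Cmp)
next
  case (20 a b c)
  then show ?case
    using T_ac by (simp add: lift_simps G_proj gbs_def und_simps real_def internal_compat_ac_def)
next
  case (21 b c)
  then show ?case
    using T_au by (simp add: lift_simps G_proj gbs_def und_simps real_def internal_compat_au_def)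
next
  case (22 b c)
  then show ?case
    using T_au by (simp add: lift_simps G_proj gbs_def und_simps real_def internal_compat_au_def)
next
  case (23 b c)
  then show ?case
    using T_au by (simp add: lift_simps G_proj gbs_def und_simps real_def internal_compat_au_def)
next
  case (24 b)
  then show ?case
    using T_cu by (simp add: lift_simps G_proj gbs_def und_simps real_def internal_compat_cu_def)
qed (simp_all add: lift_simps G_proj gbs_def und_simps real_def)

end

section \<open>Embedding the fibers into \<open>G\<close> and reading laws back from it\<close>

context fibered_over_products
begin

text \<open>\<open>emb X A\<close> is the object \<open>A\<close> of the fiber over \<open>X\<close>, and \<open>dec X u\<close> the arrow \<open>u\<close>. The arrow
  \<open>lam f A\<close> is the identity of \<open>f\<^sup>* A\<close>, seen as an arrow from the embedded object \<open>f\<^sup>* A\<close> to \<open>(f, A)\<close>.\<close>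

definition emb :: "'s \<Rightarrow> 'o \<Rightarrow> 'f \<times> 'o" where
  "emb X A = (Ide S X, A)"

definition dec :: "'s \<Rightarrow> 'a \<Rightarrow> ('f \<times> 'o) \<times> 'a \<times> ('f \<times> 'o)" where
  "dec X u = (emb X (Dom (Fib H X) u), u, emb X (Cod (Fib H X) u))"

lemma emb_simps:
  assumes "X \<in> Obj S" "A \<in> Obj (Fib H X)"
  shows "emb X A \<in> Obj G" "gbs (emb X A) = X" "real (emb X A) = A" "k \<in> Arr S \<Longrightarrow> Cod S k = X \<Longrightarrow> gpl k (emb X A) = (k, A)"
  using assms by (simp_all add: emb_def G_simps fib_simps cat_simps)

lemma emb_proj: "fst (emb X A) = Ide S X" "snd (emb X A) = A"
  by (simp_all add: emb_def)

lemma dec_simps: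
  assumes "X \<in> Obj S" "u \<in> Arr (Fib H X)"
  shows "dec X u \<in> Arr G" "Dom G (dec X u) = emb X (Dom (Fib H X) u)" "Cod G (dec X u) = emb X (Cod (Fib H X) u)"
     "und (dec X u) = u"
     "k \<in> Arr S \<Longrightarrow> Cod S k = X \<Longrightarrow> gpa k (dec X u) = ((k, Dom (Fib H X) u), pba H k u, (k, Cod (Fib H X) u))"
  using assms by (simp_all add: dec_def emb_def G_simps fib_simps cat_simps)

lemma dec_Ide: "X \<in> Obj S \<Longrightarrow> A \<in> Obj (Fib H X) \<Longrightarrow> dec X (Ide (Fib H X) A) = Ide G (emb X A)"
  by (simp add: dec_def G_simps emb_simps fib_simps)

definition lam :: "'f \<Rightarrow> 'o \<Rightarrow> ('f \<times> 'o) \<times> 'a \<times> ('f \<times> 'o)" where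
  "lam f A = (emb (Dom S f) (pbo H f A), Ide (Fib H (Dom S f)) (pbo H f A), (f, A))"

lemma lam_simps:
  assumes "f \<in> Arr S" "A \<in> Obj (Fib H (Cod S f))"
  shows "isoar G (lam f A)" "Dom G (lam f A) = emb (Dom S f) (pbo H f A)" "Cod G (lam f A) = (f, A)" "lam f A \<in> Arr G"
  using assms by (simp_all add: lam_def emb_def G_simps G_isoar fib_simps cat_simps)

lemma lam_square:
  assumes "f \<in> Arr S" "A \<in> Obj (Fib H (Cod S f))" "g \<in> Arr S" "B \<in> Obj (Fib H (Cod S g))" "Dom S g = Dom S f"
    "x \<in> Arr (Fib H (Dom S f))" "Dom (Fib H (Dom S f)) x = pbo H f A" "Cod (Fib H (Dom S f)) x = pbo H g B"
  shows "Cmp G ((f, A), x, (g, B)) (lam f A) = Cmp G (lam g B) (dec (Dom S f) x)"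
  using assms by (simp add: lam_def dec_def emb_def G_simps fib_simps cat_simps)

definition Lam :: "'f \<times> 'o \<Rightarrow> ('f \<times> 'o) \<times> 'a \<times> ('f \<times> 'o)" where
  "Lam a = lam (fst a) (snd a)"

definition Emb :: "'f \<times> 'o \<Rightarrow> 'f \<times> 'o" where
  "Emb a = emb (gbs a) (real a)"

definition Dec :: "('f \<times> 'o) \<times> 'a \<times> ('f \<times> 'o) \<Rightarrow> ('f \<times> 'o) \<times> 'a \<times> ('f \<times> 'o)" where
  "Dec u = dec (gbs (Dom G u)) (und u)"

lemma Lam_pair: "Lam (f, A) = lam f A"
  by (simp add: Lam_def)

lemma Lam_simps:
  assumes "a \<in> Obj G"
  shows "isoar G (Lam a)" "Dom G (Lam a) = Emb a" "Cod G (Lam a) = a" "Lam a \<in> Arr G"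
  using assms by (cases a; simp add: Lam_pair Emb_def lam_simps G_simps)+

lemma Emb_simps:
  assumes "a \<in> Obj G"
  shows "Emb a \<in> Obj G" "gbs (Emb a) = gbs a"
  using assms by (simp_all add: Emb_def emb_simps real_obj vert_simps)

lemma Dec_simps:
  assumes "u \<in> Arr G"
  shows "Dec u \<in> Arr G" "Dom G (Dec u) = Emb (Dom G u)" "Cod G (Dec u) = Emb (Cod G u)"
  using assms by (simp_all add: Dec_def Emb_def dec_simps und_simps vert_simps)

text \<open>Conjugation by \<open>Lam\<close> turns an arbitrary arrow of \<open>G\<close> into an
  arrow of a single fiber. Naturality over \<open>G\<close> is reduced by this to naturality in a
  fiber and to a statement about the arrows \<open>Lam\<close>.\<close>

lemma Lam_square: "u \<in> Arr G \<Longrightarrow> Cmp G u (Lam (Dom G u)) = Cmp G (Lam (Cod G u)) (Dec u)"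
  by (erule G_arr_cases) (use lam_square in \<open>simp add: Lam_pair Dec_def G_proj gbs_pair\<close>)

lemma lam_Ide: "X \<in> Obj S \<Longrightarrow> A \<in> Obj (Fib H X) \<Longrightarrow> lam (Ide S X) A = Ide G (Ide S X, A)"
  by (simp add: lam_def emb_def G_simps fib_simps cat_simps)

end

text \<open>The converse of \<open>stensor_lift\<close>: laws over \<open>G\<close> are evaluated at
  \<open>emb X A\<close>, where strict unitality makes the connection isomorphisms identities. The
  assumption \<open>tm_typed\<close> is there because \<open>lift_int\<close> contains
  \<open>tm\<close> only inside a composite, and typing of a composite says nothing about its
  factors.\<close>

locale lifted_structure = fibered_over_products S H + L: stensor S G gbs gpl gpa K "lift_int T"
  for S :: "('s, 'f) pcat" and H :: "('s, 'f, 'o, 'a) fib" and K T +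
  assumes shape: "tassoc T \<noteq> None \<longleftrightarrow> Associative \<in> K" "tcomm T \<noteq> None \<longleftrightarrow> Symmetric \<in> K" "tunit T \<noteq> None \<longleftrightarrow> Unitary \<in> K"
    and tm_typed: "k \<in> Arr S \<Longrightarrow> A \<in> Obj (Fib H (Cod S k)) \<Longrightarrow> B \<in> Obj (Fib H (Cod S k)) \<Longrightarrow>
      tm T k A B \<in> Arr (Fib H (Dom S k)) \<and> Dom (Fib H (Dom S k)) (tm T k A B) = tob T (Dom S k) (pbo H k A) (pbo H k B)"
begin

abbreviation "aT \<equiv> the (tassoc T)"
abbreviation "cT \<equiv> the (tcomm T)"
abbreviation "uT \<equiv> the (tunit T)"

lemma tob_obj: "X \<in> Obj S \<Longrightarrow> A \<in> Obj (Fib H X) \<Longrightarrow> B \<in> Obj (Fib H X) \<Longrightarrow> tob T X A B \<in> Obj (Fib H X)"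
  using L.to_obj[of "emb X A" "emb X B"] by (simp add: lift_sel emb_def dec_def G_simps fib_simps cat_simps)

lemma tar_simps:
  assumes "X \<in> Obj S" "u \<in> Arr (Fib H X)" "v \<in> Arr (Fib H X)"
  shows "tar T X u v \<in> Arr (Fib H X)" "Dom (Fib H X) (tar T X u v) = tob T X (Dom (Fib H X) u) (Dom (Fib H X) v)"
    "Cod (Fib H X) (tar T X u v) = tob T X (Cod (Fib H X) u) (Cod (Fib H X) v)"
  using L.ta_arr[of "dec X u" "dec X v"] assms
  by (simp_all add: lift_sel emb_def dec_def G_simps fib_simps cat_simps tob_obj)

lemma tar_Ide: "X \<in> Obj S \<Longrightarrow> A \<in> Obj (Fib H X) \<Longrightarrow> B \<in> Obj (Fib H X) \<Longrightarrow>
    tar T X (Ide (Fib H X) A) (Ide (Fib H X) B) = Ide (Fib H X) (tob T X A B)"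
  using L.ta_Ide[of "emb X A" "emb X B"]
  by (simp add: lift_sel emb_def dec_def G_simps fib_simps cat_simps tob_obj)

lemma tar_Cmp: "X \<in> Obj S \<Longrightarrow> u \<in> Arr (Fib H X) \<Longrightarrow> v \<in> Arr (Fib H X) \<Longrightarrow> u' \<in> Arr (Fib H X) \<Longrightarrow> v' \<in> Arr (Fib H X) \<Longrightarrow>
    Dom (Fib H X) u' = Cod (Fib H X) u \<Longrightarrow> Dom (Fib H X) v' = Cod (Fib H X) v \<Longrightarrow>
    tar T X (Cmp (Fib H X) u' u) (Cmp (Fib H X) v' v) = Cmp (Fib H X) (tar T X u' v') (tar T X u v)"
  using L.ta_Cmp[of "dec X u" "dec X v" "dec X u'" "dec X v'"]
  by (simp add: lift_sel emb_def dec_def G_simps fib_simps cat_simps tob_obj tar_simps)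

lemma tm_simps:
  assumes "k \<in> Arr S" "Dom S k = Y" "A \<in> Obj (Fib H (Cod S k))" "B \<in> Obj (Fib H (Cod S k))"
  shows "isoar (Fib H Y) (tm T k A B)" "Dom (Fib H Y) (tm T k A B) = tob T Y (pbo H k A) (pbo H k B)"
    "Cod (Fib H Y) (tm T k A B) = pbo H k (tob T (Cod S k) A B)"
  using L.sm_iso[of k "emb (Cod S k) A" "emb (Cod S k) B"] assms tm_typed[of k A B]
  by (auto simp: lift_sel emb_def dec_def G_simps G_isoar fib_simps cat_simps tob_obj tar_Ide)

lemma tm_nat:
  assumes "k \<in> Arr S" "Dom S k = Y" "u \<in> Arr (Fib H (Cod S k))" "v \<in> Arr (Fib H (Cod S k))"
  shows "Cmp (Fib H Y) (tm T k (Cod (Fib H (Cod S k)) u) (Cod (Fib H (Cod S k)) v)) (tar T Y (pba H k u) (pba H k v)) =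
     Cmp (Fib H Y) (pba H k (tar T (Cod S k) u v)) (tm T k (Dom (Fib H (Cod S k)) u) (Dom (Fib H (Cod S k)) v))"
  using L.sm_nat[of k "dec (Cod S k) u" "dec (Cod S k) v"] assms
  by (auto simp: lift_sel emb_def dec_def G_simps fib_simps cat_simps tob_obj tar_Ide tar_simps tm_simps)

lemma tm_cocycle:
  assumes "f \<in> Arr S" "Dom S f = Z" "g \<in> Arr S" "Dom S g = Cod S f" "A \<in> Obj (Fib H (Cod S g))" "B \<in> Obj (Fib H (Cod S g))"
  shows "Cmp (Fib H Z) (conn H f g (tob T (Cod S g) A B)) (tm T (Cmp S g f) A B) =
    Cmp (Fib H Z) (pba H f (tm T g A B)) (Cmp (Fib H Z) (tm T f (pbo H g A) (pbo H g B))
         (tar T Z (conn H f g A) (conn H f g B)))"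
proof -
  have Z: "Z \<in> Obj S" using assms by (auto simp: cat_simps)
  have "Cmp (Fib H Z) (tm T (Cmp S g f) A B) (Ide (Fib H Z) (tob T Z (pbo H (Cmp S g f) A) (pbo H (Cmp S g f) B))) = tm T (Cmp S g f) A B"
    using assms Z by (auto simp: fib_simps cat_simps tm_simps tob_obj)
  then have "tm T (Cmp S g f) A B = Cmp (Fib H Z) (Inv (Fib H Z) (conn H f g (tob T (Cod S g) A B)))
     (Cmp (Fib H Z) (pba H f (tm T g A B)) (Cmp (Fib H Z) (tm T f (pbo H g A) (pbo H g B))
         (tar T Z (conn H f g A) (conn H f g B))))"
    using L.sm_cmp[of g f "emb (Cod S g) A" "emb (Cod S g) B"] assms Z
    by (simp add: lift_sel emb_def dec_def G_simps fib_simps cat_simps tob_obj tar_Ide tar_simps tm_simps)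
  then show ?thesis using assms Z
    by (simp add: fib_simps cat_simps tob_obj tar_Ide tar_simps tm_simps)
qed

lemma base: "internal_tensor S H T"
  unfolding internal_tensor_def frozen_iff
  using tob_obj tar_simps tar_Ide tar_Cmp tm_simps tm_nat tm_cocycle by auto

lemmas l_simps = lift_sel emb_def dec_def G_simps G_isoar fib_simps cat_simps tob_obj tar_Ide tar_simps tm_simps

lemma assoc:
  assumes K: "Associative \<in> K" shows "internal_assoc S H T aT"
proof -
  have t: "isoar (Fib H X) (aT X A B C) \<and> Dom (Fib H X) (aT X A B C) = tob T X (tob T X A B) C \<and>
    Cod (Fib H X) (aT X A B C) = tob T X A (tob T X B C)" if "X \<in> Obj S" "A \<in> Obj (Fib H X)" "B \<in> Obj (Fib H X)" "C \<in> Obj (Fib H X)" for X A B C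
    using L.sas_iso[of "emb X A" "emb X B" "emb X C"] that K by (simp add: l_simps)
  have n: "Cmp (Fib H X) (aT X (Cod (Fib H X) u) (Cod (Fib H X) v) (Cod (Fib H X) w)) (tar T X (tar T X u v) w) =
    Cmp (Fib H X) (tar T X u (tar T X v w)) (aT X (Dom (Fib H X) u) (Dom (Fib H X) v) (Dom (Fib H X) w))"
    if "X \<in> Obj S" "u \<in> Arr (Fib H X)" "v \<in> Arr (Fib H X)" "w \<in> Arr (Fib H X)" for X u v w
    using L.sas_nat[of "dec X u" "dec X v" "dec X w"] that K by (simp add: l_simps)
  have p: "Cmp (Fib H X) (aT X A B (tob T X C D)) (aT X (tob T X A B) C D) =
     Cmp (Fib H X) (tar T X (Ide (Fib H X) A) (aT X B C D)) (Cmp (Fib H X) (aT X A (tob T X B C) D) (tar T X (aT X A B C) (Ide (Fib H X) D)))"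
    if "X \<in> Obj S" "A \<in> Obj (Fib H X)" "B \<in> Obj (Fib H X)" "C \<in> Obj (Fib H X)" "D \<in> Obj (Fib H X)" for X A B C D
    using L.pentagon[of "emb X A" "emb X B" "emb X C" "emb X D"] that K by (simp add: l_simps)
  have m: "Cmp (Fib H (Dom S f)) (pba H f (aT (Cod S f) A B C)) (Cmp (Fib H (Dom S f)) (tm T f (tob T (Cod S f) A B) C)
        (tar T (Dom S f) (tm T f A B) (Ide (Fib H (Dom S f)) (pbo H f C)))) =
    Cmp (Fib H (Dom S f)) (tm T f A (tob T (Cod S f) B C)) (Cmp (Fib H (Dom S f))
        (tar T (Dom S f) (Ide (Fib H (Dom S f)) (pbo H f A)) (tm T f B C)) (aT (Dom S f) (pbo H f A) (pbo H f B) (pbo H f C)))"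
    if "f \<in> Arr S" "A \<in> Obj (Fib H (Cod S f))" "B \<in> Obj (Fib H (Cod S f))" "C \<in> Obj (Fib H (Cod S f))" for f A B C
    using L.sas_sm[of f "emb (Cod S f) A" "emb (Cod S f) B" "emb (Cod S f) C"] that K by (simp add: l_simps t)
  show ?thesis unfolding internal_assoc_def frozen3_iff using t n p m by auto
qed

lemma comm:
  assumes K: "Symmetric \<in> K" shows "internal_comm S H T cT"
proof -
  have t: "isoar (Fib H X) (cT X A B) \<and> Dom (Fib H X) (cT X A B) = tob T X A B \<and>
    Cod (Fib H X) (cT X A B) = tob T X B A" if "X \<in> Obj S" "A \<in> Obj (Fib H X)" "B \<in> Obj (Fib H X)" for X A B
    using L.sco_iso[of "emb X A" "emb X B"] that K by (simp add: l_simps)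
  have n: "Cmp (Fib H X) (cT X (Cod (Fib H X) u) (Cod (Fib H X) v)) (tar T X u v) =
    Cmp (Fib H X) (tar T X v u) (cT X (Dom (Fib H X) u) (Dom (Fib H X) v))"
    if "X \<in> Obj S" "u \<in> Arr (Fib H X)" "v \<in> Arr (Fib H X)" for X u v
    using L.sco_nat[of "dec X u" "dec X v"] that K by (simp add: l_simps)
  have p: "Cmp (Fib H X) (cT X B A) (cT X A B) = Ide (Fib H X) (tob T X A B)"
    if "X \<in> Obj S" "A \<in> Obj (Fib H X)" "B \<in> Obj (Fib H X)" for X A B
    using L.sco_sco[of "emb X A" "emb X B"] that K by (simp add: l_simps)
  have m: "Cmp (Fib H (Dom S f)) (pba H f (cT (Cod S f) A B)) (tm T f A B) =
    Cmp (Fib H (Dom S f)) (tm T f B A) (cT (Dom S f) (pbo H f A) (pbo H f B))"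
    if "f \<in> Arr S" "A \<in> Obj (Fib H (Cod S f))" "B \<in> Obj (Fib H (Cod S f))" for f A B
    using L.sco_sm[of f "emb (Cod S f) A" "emb (Cod S f) B"] that K by (simp add: l_simps t)
  show ?thesis unfolding internal_comm_def frozen_iff using t n p m by auto
qed

lemma unit:
  assumes K: "Unitary \<in> K" shows "internal_unit S H T uT"
proof -
  have o: "sob uT X \<in> Obj (Fib H X)" if "X \<in> Obj S" for X
    using L.one_obj[of X] that K by (simp add: l_simps)
  have s: "isoar (Fib H Y) (sar uT f) \<and> Dom (Fib H Y) (sar uT f) = pbo H f (sob uT (Cod S f)) \<and>
    Cod (Fib H Y) (sar uT f) = sob uT Y" if "f \<in> Arr S" "Dom S f = Y" for f Y
    using L.sr_iso[of f] that K by (auto simp add: l_simps o)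
  have sc: "sar uT (Cmp S g f) = Cmp (Fib H Z) (sar uT f) (Cmp (Fib H Z) (pba H f (sar uT g)) (conn H f g (sob uT (Cod S g))))"
    if "f \<in> Arr S" "Dom S f = Z" "g \<in> Arr S" "Dom S g = Cod S f" for f g Z
    using L.sr_cmp[of g f] that K s[of g "Cod S f"] by (auto simp add: l_simps o)
  have t: "isoar (Fib H X) (tur uT X A) \<and> Dom (Fib H X) (tur uT X A) = tob T X A (sob uT X) \<and>
    Cod (Fib H X) (tur uT X A) = A"
    "isoar (Fib H X) (tul uT X A) \<and> Dom (Fib H X) (tul uT X A) = tob T X (sob uT X) A \<and>
    Cod (Fib H X) (tul uT X A) = A" if "X \<in> Obj S" "A \<in> Obj (Fib H X)" for X A
    using L.ur_iso[of "emb X A"] L.ul_iso[of "emb X A"] that K by (simp_all add: l_simps o)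
  have n: "Cmp (Fib H X) (tur uT X (Cod (Fib H X) v)) (tar T X v (Ide (Fib H X) (sob uT X))) =
     Cmp (Fib H X) v (tur uT X (Dom (Fib H X) v))"
    "Cmp (Fib H X) (tul uT X (Cod (Fib H X) v)) (tar T X (Ide (Fib H X) (sob uT X)) v) =
     Cmp (Fib H X) v (tul uT X (Dom (Fib H X) v))"
    if "X \<in> Obj S" "v \<in> Arr (Fib H X)" for X v
    using L.ur_nat[of "dec X v"] L.ul_nat[of "dec X v"] that K by (simp_all add: l_simps o)
  have p: "tur uT X (sob uT X) = tul uT X (sob uT X)" if "X \<in> Obj S" for X
    using L.ur_ul[of X] that K by (simp add: l_simps o)
  have m: "Cmp (Fib H (Dom S f)) (pba H f (tur uT (Cod S f) A)) (tm T f A (sob uT (Cod S f))) =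
     Cmp (Fib H (Dom S f)) (tur uT (Dom S f) (pbo H f A)) (tar T (Dom S f) (Ide (Fib H (Dom S f)) (pbo H f A)) (sar uT f))"
    "Cmp (Fib H (Dom S f)) (pba H f (tul uT (Cod S f) A)) (tm T f (sob uT (Cod S f)) A) =
     Cmp (Fib H (Dom S f)) (tul uT (Dom S f) (pbo H f A)) (tar T (Dom S f) (sar uT f) (Ide (Fib H (Dom S f)) (pbo H f A)))"
    if "f \<in> Arr S" "A \<in> Obj (Fib H (Cod S f))" for f A
    using L.ur_sm[of f "emb (Cod S f) A"] L.ul_sm[of f "emb (Cod S f) A"] that K by (simp_all add: l_simps o t)
  show ?thesis unfolding internal_unit_def is_section_def frozen1_iff using o s sc t n p m by auto
qed

lemma K_internal_lifted: "K_internal S H K T"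
proof -
  have ac: "internal_compat_ac S H T aT cT" if "Associative \<in> K" "Symmetric \<in> K"
  proof -
    have "Cmp (Fib H X) (tar T X (Ide (Fib H X) B) (cT X A C)) (Cmp (Fib H X) (aT X B A C) (tar T X (cT X A B) (Ide (Fib H X) C))) =
      Cmp (Fib H X) (aT X B C A) (Cmp (Fib H X) (cT X A (tob T X B C)) (aT X A B C))"
      if "X \<in> Obj S" "A \<in> Obj (Fib H X)" "B \<in> Obj (Fib H X)" "C \<in> Obj (Fib H X)" for X A B C
      using L.hexagon[of "emb X A" "emb X B" "emb X C"] \<open>Associative \<in> K\<close> \<open>Symmetric \<in> K\<close> that by (simp add: l_simps)
    then show ?thesis by (simp add: internal_compat_ac_def)
  qed
  have o: "sob uT X \<in> Obj (Fib H X)" if "X \<in> Obj S" "Unitary \<in> K" for X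
    using L.one_obj[of X] that by (simp add: l_simps)
  have au: "internal_compat_au S H T aT uT" if "Associative \<in> K" "Unitary \<in> K"
  proof -
    have "Cmp (Fib H X) (tul uT X (tob T X B C)) (aT X (sob uT X) B C) = tar T X (tul uT X B) (Ide (Fib H X) C)"
      "Cmp (Fib H X) (tar T X (Ide (Fib H X) B) (tul uT X C)) (aT X B (sob uT X) C) = tar T X (tur uT X B) (Ide (Fib H X) C)"
      "Cmp (Fib H X) (tar T X (Ide (Fib H X) B) (tur uT X C)) (aT X B C (sob uT X)) = tur uT X (tob T X B C)"
      if "X \<in> Obj S" "B \<in> Obj (Fib H X)" "C \<in> Obj (Fib H X)" for X B C
      using L.ul_sas[of "emb X B" "emb X C"] L.ur_ul_sas[of "emb X B" "emb X C"] L.ur_sas[of "emb X B" "emb X C"]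
        \<open>Associative \<in> K\<close> \<open>Unitary \<in> K\<close> that by (simp_all add: l_simps o)
    then show ?thesis by (simp add: internal_compat_au_def)
  qed
  have cu: "internal_compat_cu S H cT uT" if "Symmetric \<in> K" "Unitary \<in> K"
  proof -
    have "Cmp (Fib H X) (tur uT X B) (cT X (sob uT X) B) = tul uT X B" if "X \<in> Obj S" "B \<in> Obj (Fib H X)" for X B
      using L.ur_sco[of "emb X B"] \<open>Symmetric \<in> K\<close> \<open>Unitary \<in> K\<close> that by (simp add: l_simps o)
    then show ?thesis by (simp add: internal_compat_cu_def)
  qed
  show ?thesis
    unfolding K_internal_def using base assoc comm unit ac au cu shape by auto
qed

end

section \<open>Equivalences of internal structures and equivalences over \<open>G\<close>\<close>

context fibered_over_products
begin

lemma sequiv_lift: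
  assumes T1: "K_internal S H K T1" and T2: "K_internal S H K T2" and e: "is_internal_equivalence S H T1 T2 e"
  shows "\<exists>e' w. sequiv_map S G gbs gpl gpa K (lift_int T1) (lift_int T2) e' w"
proof -
  interpret T1: internal_structure S H K T1 by unfold_locales fact
  interpret T2: internal_structure S H K T2 by unfold_locales fact
  note E = e[unfolded is_internal_equivalence_def frozen_iff]
  have et: "isoar (Fib H X) (e X A B) \<and> Dom (Fib H X) (e X A B) = tob T1 X A B \<and> Cod (Fib H X) (e X A B) = tob T2 X A B"
    if "X \<in> Obj S" "A \<in> Obj (Fib H X)" "B \<in> Obj (Fib H X)" for X A B
    using E that by auto
  have en: "Cmp (Fib H X) (e X (Cod (Fib H X) u) (Cod (Fib H X) v)) (tar T1 X u v) =
      Cmp (Fib H X) (tar T2 X u v) (e X (Dom (Fib H X) u) (Dom (Fib H X) v))"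
    if "X \<in> Obj S" "u \<in> Arr (Fib H X)" "v \<in> Arr (Fib H X)" for X u v
    using E that by auto
  have em: "Cmp (Fib H (Dom S f)) (pba H f (e (Cod S f) A B)) (tm T1 f A B) =
      Cmp (Fib H (Dom S f)) (tm T2 f A B) (e (Dom S f) (pbo H f A) (pbo H f B))"
    if "f \<in> Arr S" "A \<in> Obj (Fib H (Cod S f))" "B \<in> Obj (Fib H (Cod S f))" for f A B
    using E that by auto
  have ea: "Cmp (Fib H X) (T2.aT X A B C) (Cmp (Fib H X) (e X (tob T2 X A B) C) (tar T1 X (e X A B) (Ide (Fib H X) C))) =
      Cmp (Fib H X) (e X A (tob T2 X B C)) (Cmp (Fib H X) (tar T1 X (Ide (Fib H X) A) (e X B C)) (T1.aT X A B C))"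
    if "Associative \<in> K" "X \<in> Obj S" "A \<in> Obj (Fib H X)" "B \<in> Obj (Fib H X)" "C \<in> Obj (Fib H X)" for X A B C
    using E T1 T2 that by (auto simp: K_internal_def)
  have ec: "Cmp (Fib H X) (T2.cT X A B) (e X A B) = Cmp (Fib H X) (e X B A) (T1.cT X A B)"
    if "Symmetric \<in> K" "X \<in> Obj S" "A \<in> Obj (Fib H X)" "B \<in> Obj (Fib H X)" for X A B
    using E T1 T2 that by (auto simp: K_internal_def)
  \<comment> \<open>The condition on \<open>K\<close> is put under the existential quantifier, so
    that a family \<open>w\<close> can be obtained whether or not there is a unit
    constraint.\<close>
  have "\<exists>w. Unitary \<in> K \<longrightarrow> is_section_iso S H T1.uT T2.uT w \<and>
           (\<forall>X\<in>Obj S. \<forall>A\<in>Obj (Fib H X).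
              tur T1.uT X A = Cmp (Fib H X) (tur T2.uT X A) (Cmp (Fib H X) (e X A (sob T2.uT X)) (tar T1 X (Ide (Fib H X) A) (w X)))) \<and>
           (\<forall>X\<in>Obj S. \<forall>B\<in>Obj (Fib H X).
              tul T1.uT X B = Cmp (Fib H X) (tul T2.uT X B) (Cmp (Fib H X) (e X (sob T2.uT X) B) (tar T1 X (w X) (Ide (Fib H X) B))))"
    using e[unfolded is_internal_equivalence_def] T1 T2 by (auto simp: K_internal_def)
  then obtain w where w: "Unitary \<in> K \<Longrightarrow> is_section_iso S H T1.uT T2.uT w"
    and wr: "\<And>X A. Unitary \<in> K \<Longrightarrow> X \<in> Obj S \<Longrightarrow> A \<in> Obj (Fib H X) \<Longrightarrow>
              tur T1.uT X A = Cmp (Fib H X) (tur T2.uT X A) (Cmp (Fib H X) (e X A (sob T2.uT X)) (tar T1 X (Ide (Fib H X) A) (w X)))"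
    and wl: "\<And>X B. Unitary \<in> K \<Longrightarrow> X \<in> Obj S \<Longrightarrow> B \<in> Obj (Fib H X) \<Longrightarrow>
              tul T1.uT X B = Cmp (Fib H X) (tul T2.uT X B) (Cmp (Fib H X) (e X (sob T2.uT X) B) (tar T1 X (w X) (Ide (Fib H X) B)))"
    by blast
  have wt: "isoar (Fib H X) (w X) \<and> Dom (Fib H X) (w X) = sob T1.uT X \<and> Cod (Fib H X) (w X) = sob T2.uT X"
    if "Unitary \<in> K" "X \<in> Obj S" for X
    using w that by (auto simp: is_section_iso_def frozen_iff)
  have ws: "Cmp (Fib H (Dom S f)) (sar T2.uT f) (pba H f (w (Cod S f))) = Cmp (Fib H (Dom S f)) (w (Dom S f)) (sar T1.uT f)"
    if "Unitary \<in> K" "f \<in> Arr S" for f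
    using w that by (auto simp: is_section_iso_def frozen_iff)
  let ?e = "\<lambda>a b. (to (lift_int T1) a b, e (gbs a) (real a) (real b), to (lift_int T2) a b)"
  let ?w = "\<lambda>X. (one (lift_int T1) X, w X, one (lift_int T2) X)"
  note ls = T1.lift_simps T2.lift_simps et wt
  have "sequiv_map S G gbs gpl gpa K (lift_int T1) (lift_int T2) ?e ?w"
  proof (rule sequiv_map.intro[OF T1.stensor_lift T2.styped_lift sequiv_map_axioms.intro], goal_cases)
    case (4 u v)
    then show ?case
      using en[of "gbs (Dom G u)" "und u" "und v"] by (elim G_arr_cases) (simp add: ls)
  next
    case (5 k a b)
    obtain f A g B where o: "a = (f, A)" "b = (g, B)" by (cases a; cases b)
    have Z: "category (Fib H (Dom S k))" using 5 by (simp add: fib_simps cat_simps)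
    show ?case
      using 5 en[of "Dom S k" "conn H k f A" "conn H k g B"] category.reassoc[OF Z em[of k "pbo H f A" "pbo H g B"]]
      by (simp add: o ls)
  next
    case (6 a b c)
    then show ?case
      using ea[of "gbs a" "real a" "real b" "real c"] by (simp add: ls gbs_def real_def G_proj)
  next
    case (7 a b)
    then show ?case
      using ec[of "gbs a" "real a" "real b"] by (simp add: ls gbs_def real_def G_proj)
  next
    case (11 k)
    then show ?case
      using ws[of k] by (simp add: ls)
  next
    case (12 a)
    then show ?case
      using wr[of "gbs a" "real a"] by (simp add: ls gbs_def real_def G_proj)
  next
    case (13 a)
    then show ?case
      using wl[of "gbs a" "real a"] by (simp add: ls gbs_def real_def G_proj)
  qed (simp_all add: ls gbs_def real_def G_proj)
  then show ?thesis by blast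
qed

lemma equivalence_of_sequiv_lift:
  assumes T1: "K_internal S H K T1" and T2: "K_internal S H K T2"
    and e: "sequiv_map S G gbs gpl gpa K (lift_int T1) (lift_int T2) e' w'"
  shows "\<exists>e. is_internal_equivalence S H T1 T2 e"
proof -
  interpret T1: internal_structure S H K T1 by unfold_locales fact
  interpret T2: internal_structure S H K T2 by unfold_locales fact
  interpret sequiv_map S G gbs gpl gpa K "lift_int T1" "lift_int T2" e' w' by fact
  define e where "e X A B = und (e' (emb X A) (emb X B))" for X A B
  define w where "w X = und (w' X)" for X
  note ls0 = T1.lift_simps T2.lift_simps emb_def dec_def
  have e': "e' (emb X A) (emb X B) = (emb X (tob T1 X A B), e X A B, emb X (tob T2 X A B))"
    if "X \<in> Obj S" "A \<in> Obj (Fib H X)" "B \<in> Obj (Fib H X)" for X A B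
    using e_dom[of "emb X A" "emb X B"] e_cod[of "emb X A" "emb X B"] that
    by (intro prod_eqI) (simp_all add: ls0 e_def G_proj)
  have et: "isoar (Fib H X) (e X A B)" "Dom (Fib H X) (e X A B) = tob T1 X A B" "Cod (Fib H X) (e X A B) = tob T2 X A B"
    if "X \<in> Obj S" "A \<in> Obj (Fib H X)" "B \<in> Obj (Fib H X)" for X A B
    using e_iso[of "emb X A" "emb X B"] e'[OF that] that by (simp_all add: ls0)
  have w': "w' X = (emb X (sob T1.uT X), w X, emb X (sob T2.uT X))" if "Unitary \<in> K" "X \<in> Obj S" for X
    using w_dom[of X] w_cod[of X] that
    by (intro prod_eqI) (simp_all add: ls0 w_def G_proj)
  have wt: "isoar (Fib H X) (w X)" "Dom (Fib H X) (w X) = sob T1.uT X" "Cod (Fib H X) (w X) = sob T2.uT X"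
    if "Unitary \<in> K" "X \<in> Obj S" for X
    using w_iso[of X] w'[OF that] that by (simp_all add: ls0)
  note ls = ls0 et wt e'[unfolded emb_def] w'[unfolded emb_def]
  have en: "Cmp (Fib H X) (e X (Cod (Fib H X) u) (Cod (Fib H X) v)) (tar T1 X u v) =
      Cmp (Fib H X) (tar T2 X u v) (e X (Dom (Fib H X) u) (Dom (Fib H X) v))"
    if "X \<in> Obj S" "u \<in> Arr (Fib H X)" "v \<in> Arr (Fib H X)" for X u v
    using e_nat[of "dec X u" "dec X v"] that by (simp add: ls)
  \<comment> \<open>Pulling back an embedded object gives \<open>(k, A)\<close>, which is not
    embedded. The value of \<open>e'\<close> there is found by naturality along the identity of
    k^*A, seen as an arrow from \<open>(k, A)\<close> to the embedded object k^*A.\<close>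
  have ek: "e' (k, A) (k, B) = (emb (Dom S k) (tob T1 (Dom S k) (pbo H k A) (pbo H k B)), e (Dom S k) (pbo H k A) (pbo H k B),
        emb (Dom S k) (tob T2 (Dom S k) (pbo H k A) (pbo H k B)))"
    if "k \<in> Arr S" "A \<in> Obj (Fib H (Cod S k))" "B \<in> Obj (Fib H (Cod S k))" for k A B
  proof -
    let ?k = "\<lambda>A. ((k, A), Ide (Fib H (Dom S k)) (pbo H k A), emb (Dom S k) (pbo H k A))"
    define x where "x = und (e' (k, A) (k, B))"
    have x: "e' (k, A) (k, B) = (emb (Dom S k) (tob T1 (Dom S k) (pbo H k A) (pbo H k B)), x,
        emb (Dom S k) (tob T2 (Dom S k) (pbo H k A) (pbo H k B)))"
      using e_dom[of "(k, A)" "(k, B)"] e_cod[of "(k, A)" "(k, B)"] that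
      by (intro prod_eqI) (simp_all add: ls0 G_proj x_def)
    have "isoar (Fib H (Dom S k)) x \<and> Dom (Fib H (Dom S k)) x = tob T1 (Dom S k) (pbo H k A) (pbo H k B)
        \<and> Cod (Fib H (Dom S k)) x = tob T2 (Dom S k) (pbo H k A) (pbo H k B)"
      using e_iso[of "(k, A)" "(k, B)"] that x by (simp add: ls0)
    then show ?thesis
      using e_nat[of "?k A" "?k B"] that x by (simp add: ls)
  qed
  have em: "Cmp (Fib H (Dom S f)) (pba H f (e (Cod S f) A B)) (tm T1 f A B) =
      Cmp (Fib H (Dom S f)) (tm T2 f A B) (e (Dom S f) (pbo H f A) (pbo H f B))"
    if "f \<in> Arr S" "A \<in> Obj (Fib H (Cod S f))" "B \<in> Obj (Fib H (Cod S f))" for f A B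
    using e_sm[of f "emb (Cod S f) A" "emb (Cod S f) B"] that by (simp add: ls ek)
  have ea: "Cmp (Fib H X) (T2.aT X A B C) (Cmp (Fib H X) (e X (tob T2 X A B) C) (tar T1 X (e X A B) (Ide (Fib H X) C))) =
      Cmp (Fib H X) (e X A (tob T2 X B C)) (Cmp (Fib H X) (tar T1 X (Ide (Fib H X) A) (e X B C)) (T1.aT X A B C))"
    if "Associative \<in> K" "X \<in> Obj S" "A \<in> Obj (Fib H X)" "B \<in> Obj (Fib H X)" "C \<in> Obj (Fib H X)" for X A B C
    using e_sas[of "emb X A" "emb X B" "emb X C"] that by (simp add: ls)
  have ec: "Cmp (Fib H X) (T2.cT X A B) (e X A B) = Cmp (Fib H X) (e X B A) (T1.cT X A B)"
    if "Symmetric \<in> K" "X \<in> Obj S" "A \<in> Obj (Fib H X)" "B \<in> Obj (Fib H X)" for X A B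
    using e_sco[of "emb X A" "emb X B"] that by (simp add: ls)
  have ws: "Cmp (Fib H (Dom S f)) (sar T2.uT f) (pba H f (w (Cod S f))) = Cmp (Fib H (Dom S f)) (w (Dom S f)) (sar T1.uT f)"
    if "Unitary \<in> K" "f \<in> Arr S" for f
    using w_sr[of f] that by (simp add: ls)
  have wr: "tur T1.uT X A = Cmp (Fib H X) (tur T2.uT X A) (Cmp (Fib H X) (e X A (sob T2.uT X)) (tar T1 X (Ide (Fib H X) A) (w X)))"
    "tul T1.uT X A = Cmp (Fib H X) (tul T2.uT X A) (Cmp (Fib H X) (e X (sob T2.uT X) A) (tar T1 X (w X) (Ide (Fib H X) A)))"
    if "Unitary \<in> K" "X \<in> Obj S" "A \<in> Obj (Fib H X)" for X A
    using e_ur[of "emb X A"] e_ul[of "emb X A"] that by (simp_all add: ls)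
  have ws': "is_section_iso S H T1.uT T2.uT w" if "Unitary \<in> K"
    using ws wt that by (auto simp: is_section_iso_def frozen_iff)
  have sh: "tassoc T1 = Some a \<Longrightarrow> T1.aT = a \<and> Associative \<in> K" "tassoc T2 = Some a \<Longrightarrow> T2.aT = a \<and> Associative \<in> K"
     "tcomm T1 = Some c \<Longrightarrow> T1.cT = c \<and> Symmetric \<in> K" "tcomm T2 = Some c \<Longrightarrow> T2.cT = c \<and> Symmetric \<in> K"
     "tunit T1 = Some u \<Longrightarrow> T1.uT = u \<and> Unitary \<in> K" "tunit T2 = Some u \<Longrightarrow> T2.uT = u \<and> Unitary \<in> K" for a c u
    using T1 T2 by (auto simp: K_internal_def)
  have "is_internal_equivalence S H T1 T2 e"
    unfolding is_internal_equivalence_def frozen_iff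
  proof (intro conjI allI impI, goal_cases)
    case (6 a a' X A B C)
    then show ?case using ea[of X A B C] sh(1)[of a] sh(2)[of a'] by auto
  next
    case (7 c c' X A B)
    then show ?case using ec[of X A B] sh(3)[of c] sh(4)[of c'] by auto
  next
    case (8 u u')
    then show ?case using ws' wr sh(5)[of u] sh(6)[of u'] by (intro exI[of _ w]) auto
  qed (use et en em in auto)
  then show ?thesis by blast
qed

end

section \<open>External structures over the split fibered category\<close>

context category_with_binary_products
begin

lemma prd_arr_Cmp:
  assumes "f \<in> Arr S" "g \<in> Arr S" "h \<in> Arr S" "k \<in> Arr S" "Cod S h = Dom S f" "Cod S k = Dom S g"
  shows "Cmp S (prd_arr S f g) (prd_arr S h k) = prd_arr S (Cmp S f h) (Cmp S g k)"
  using assms by (simp add: prd_arr_def prd_basic)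

end

context fibered_over_products
begin

text \<open>Rewriting moves \<open>Inv\<close> inside \<open>pba\<close>, where the general
  cancellation rules for inverses no longer match; these are their pulled back forms.\<close>

lemma pba_cancel:
  assumes "k \<in> Arr S" "Dom S k = Y" "Cod S k = X" "isoar (Fib H X) u"
  shows "Cmp (Fib H Y) (pba H k (Inv (Fib H X) u)) (pba H k u) = Ide (Fib H Y) (pbo H k (Dom (Fib H X) u))"
    "Cmp (Fib H Y) (pba H k u) (pba H k (Inv (Fib H X) u)) = Ide (Fib H Y) (pbo H k (Cod (Fib H X) u))"
    "w \<in> Arr (Fib H Y) \<Longrightarrow> Cod (Fib H Y) w = pbo H k (Dom (Fib H X) u) \<Longrightarrow>
      Cmp (Fib H Y) (pba H k (Inv (Fib H X) u)) (Cmp (Fib H Y) (pba H k u) w) = w"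
    "w \<in> Arr (Fib H Y) \<Longrightarrow> Cod (Fib H Y) w = pbo H k (Cod (Fib H X) u) \<Longrightarrow>
      Cmp (Fib H Y) (pba H k u) (Cmp (Fib H Y) (pba H k (Inv (Fib H X) u)) w) = w"
proof -
  have Y: "category (Fib H Y)" using assms by (auto simp: fib_simps cat_simps)
  have X: "category (Fib H X)" using assms by (auto simp: fib_simps cat_simps)
  have i: "isoar (Fib H Y) (pba H k u)" "Inv (Fib H Y) (pba H k u) = pba H k (Inv (Fib H X) u)"
    "Dom (Fib H Y) (pba H k u) = pbo H k (Dom (Fib H X) u)" "Cod (Fib H Y) (pba H k u) = pbo H k (Cod (Fib H X) u)"
    using assms pba_isoar[of k Y u] by (auto simp: pba_simps category.isoar_arr[OF X])
  show "Cmp (Fib H Y) (pba H k (Inv (Fib H X) u)) (pba H k u) = Ide (Fib H Y) (pbo H k (Dom (Fib H X) u))"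
    "Cmp (Fib H Y) (pba H k u) (pba H k (Inv (Fib H X) u)) = Ide (Fib H Y) (pbo H k (Cod (Fib H X) u))"
    "w \<in> Arr (Fib H Y) \<Longrightarrow> Cod (Fib H Y) w = pbo H k (Dom (Fib H X) u) \<Longrightarrow>
      Cmp (Fib H Y) (pba H k (Inv (Fib H X) u)) (Cmp (Fib H Y) (pba H k u) w) = w"
    "w \<in> Arr (Fib H Y) \<Longrightarrow> Cod (Fib H Y) w = pbo H k (Cod (Fib H X) u) \<Longrightarrow>
      Cmp (Fib H Y) (pba H k u) (Cmp (Fib H Y) (pba H k (Inv (Fib H X) u)) w) = w"
    using i category.Inv_Cmp[OF Y i(1)] category.Cmp_Inv[OF Y i(1)]
      category.Inv_Cmp_tail[OF Y i(1)] category.Cmp_Inv_tail[OF Y i(1)] by simp_all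
qed

end

section \<open>External products as operations on \<open>G\<close>\<close>

locale external_base = fibered_over_products S H
  for S :: "('s, 'f) pcat" and H :: "('s, 'f, 'o, 'a) fib" +
  fixes T :: "('s, 'f, 'o, 'a) K_ext"
  assumes T_base: "external_tensor S H T"
begin

lemma xob_obj: "X \<in> Obj S \<Longrightarrow> Y \<in> Obj S \<Longrightarrow> A \<in> Obj (Fib H X) \<Longrightarrow> B \<in> Obj (Fib H Y) \<Longrightarrow>
    xob T X Y A B \<in> Obj (Fib H (Prd S X Y))"
  using T_base by (simp add: external_tensor_def frozen_iff)

lemma xar_simps:
  assumes "X \<in> Obj S" "Y \<in> Obj S" "u \<in> Arr (Fib H X)" "v \<in> Arr (Fib H Y)"
  shows "xar T X Y u v \<in> Arr (Fib H (Prd S X Y))"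
    "Dom (Fib H (Prd S X Y)) (xar T X Y u v) = xob T X Y (Dom (Fib H X) u) (Dom (Fib H Y) v)"
    "Cod (Fib H (Prd S X Y)) (xar T X Y u v) = xob T X Y (Cod (Fib H X) u) (Cod (Fib H Y) v)"
  using T_base assms by (auto simp: external_tensor_def frozen_iff)

lemma xar_Ide: "X \<in> Obj S \<Longrightarrow> Y \<in> Obj S \<Longrightarrow> A \<in> Obj (Fib H X) \<Longrightarrow> B \<in> Obj (Fib H Y) \<Longrightarrow>
    xar T X Y (Ide (Fib H X) A) (Ide (Fib H Y) B) = Ide (Fib H (Prd S X Y)) (xob T X Y A B)"
  using T_base by (simp add: external_tensor_def frozen_iff)

lemma xar_Cmp: "X \<in> Obj S \<Longrightarrow> Y \<in> Obj S \<Longrightarrow> u \<in> Arr (Fib H X) \<Longrightarrow> v \<in> Arr (Fib H Y) \<Longrightarrow> u' \<in> Arr (Fib H X) \<Longrightarrow>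
    v' \<in> Arr (Fib H Y) \<Longrightarrow> Dom (Fib H X) u' = Cod (Fib H X) u \<Longrightarrow> Dom (Fib H Y) v' = Cod (Fib H Y) v \<Longrightarrow>
    xar T X Y (Cmp (Fib H X) u' u) (Cmp (Fib H Y) v' v) = Cmp (Fib H (Prd S X Y)) (xar T X Y u' v') (xar T X Y u v)"
  using T_base by (simp add: external_tensor_def frozen_iff)

lemma xm_simps:
  assumes "f \<in> Arr S" "g \<in> Arr S" "Dom S f = X" "Dom S g = Y" "A \<in> Obj (Fib H (Cod S f))" "B \<in> Obj (Fib H (Cod S g))"
  shows "isoar (Fib H (Prd S X Y)) (xm T f g A B)"
    "Dom (Fib H (Prd S X Y)) (xm T f g A B) = xob T X Y (pbo H f A) (pbo H g B)"
    "Cod (Fib H (Prd S X Y)) (xm T f g A B) = pbo H (prd_arr S f g) (xob T (Cod S f) (Cod S g) A B)"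
  using T_base assms by (auto simp: external_tensor_def frozen_iff)

lemma xm_nat:
  assumes "f \<in> Arr S" "g \<in> Arr S" "u \<in> Arr (Fib H (Cod S f))" "v \<in> Arr (Fib H (Cod S g))"
  shows "Cmp (Fib H (Prd S (Dom S f) (Dom S g))) (xm T f g (Cod (Fib H (Cod S f)) u) (Cod (Fib H (Cod S g)) v))
      (xar T (Dom S f) (Dom S g) (pba H f u) (pba H g v)) =
     Cmp (Fib H (Prd S (Dom S f) (Dom S g))) (pba H (prd_arr S f g) (xar T (Cod S f) (Cod S g) u v))
       (xm T f g (Dom (Fib H (Cod S f)) u) (Dom (Fib H (Cod S g)) v))"
  using T_base assms by (simp add: external_tensor_def frozen_iff)

lemma xm_cocycle:
  assumes "f1 \<in> Arr S" "f2 \<in> Arr S" "g1 \<in> Arr S" "g2 \<in> Arr S" "Dom S g1 = Cod S f1" "Dom S g2 = Cod S f2"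
    "A \<in> Obj (Fib H (Cod S g1))" "B \<in> Obj (Fib H (Cod S g2))"
  shows "Cmp (Fib H (Prd S (Dom S f1) (Dom S f2))) (conn H (prd_arr S f1 f2) (prd_arr S g1 g2) (xob T (Cod S g1) (Cod S g2) A B))
        (xm T (Cmp S g1 f1) (Cmp S g2 f2) A B) =
     Cmp (Fib H (Prd S (Dom S f1) (Dom S f2))) (pba H (prd_arr S f1 f2) (xm T g1 g2 A B))
       (Cmp (Fib H (Prd S (Dom S f1) (Dom S f2))) (xm T f1 f2 (pbo H g1 A) (pbo H g2 B))
         (xar T (Dom S f1) (Dom S f2) (conn H f1 g1 A) (conn H f2 g2 B)))"
  using T_base assms by (simp add: external_tensor_def frozen_iff)

lemma xar_isoar:
  assumes "X \<in> Obj S" "Y \<in> Obj S" "isoar (Fib H X) u" "isoar (Fib H Y) v"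
  shows "isoar (Fib H (Prd S X Y)) (xar T X Y u v)"
    "Inv (Fib H (Prd S X Y)) (xar T X Y u v) = xar T X Y (Inv (Fib H X) u) (Inv (Fib H Y) v)"
proof -
  have X: "category (Fib H X)" "category (Fib H Y)" "category (Fib H (Prd S X Y))"
    using assms by (simp_all add: fib_cat prd_obj)
  have "isoar (Fib H (Prd S X Y)) (xar T X Y u v) \<and>
    Inv (Fib H (Prd S X Y)) (xar T X Y u v) = xar T X Y (Inv (Fib H X) u) (Inv (Fib H Y) v)"
    using assms
    by (intro conjI; intro category.inverseI[OF X(3), where v = "xar T X Y (Inv (Fib H X) u) (Inv (Fib H Y) v)"])
      (simp_all add: fib_simps xar_simps xar_Ide flip: xar_Cmp)
  then show "isoar (Fib H (Prd S X Y)) (xar T X Y u v)"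
    "Inv (Fib H (Prd S X Y)) (xar T X Y u v) = xar T X Y (Inv (Fib H X) u) (Inv (Fib H Y) v)" by auto
qed

text \<open>The cocycle condition for identities makes this isomorphism idempotent, and an
  idempotent isomorphism is an identity.\<close>

lemma xm_Ide:
  assumes "X \<in> Obj S" "Y \<in> Obj S" "A \<in> Obj (Fib H X)" "B \<in> Obj (Fib H Y)"
  shows "xm T (Ide S X) (Ide S Y) A B = Ide (Fib H (Prd S X Y)) (xob T X Y A B)"
proof -
  let ?Z = "Prd S X Y" and ?m = "xm T (Ide S X) (Ide S Y) A B"
  have Z: "category (Fib H ?Z)" using assms by (simp add: fib_cat prd_obj)
  have m: "isoar (Fib H ?Z) ?m" "Dom (Fib H ?Z) ?m = xob T X Y A B" "Cod (Fib H ?Z) ?m = xob T X Y A B"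
    using assms xm_simps[of "Ide S X" "Ide S Y" X Y A B]
    by (simp_all add: prd_simps fib_simps xob_obj)
  let ?i = "Ide S X" and ?j = "Ide S Y"
  have "Cmp (Fib H ?Z) ?m ?m = Cmp (Fib H (Prd S (Dom S ?i) (Dom S ?j))) (pba H (prd_arr S ?i ?j) (xm T ?i ?j A B))
       (Cmp (Fib H (Prd S (Dom S ?i) (Dom S ?j))) (xm T ?i ?j (pbo H ?i A) (pbo H ?j B))
         (xar T (Dom S ?i) (Dom S ?j) (conn H ?i ?i A) (conn H ?j ?j B)))"
    using assms m by (simp add: prd_simps fib_simps xob_obj xar_Ide)
  also have "\<dots> = Cmp (Fib H (Prd S (Dom S ?i) (Dom S ?j))) (conn H (prd_arr S ?i ?j) (prd_arr S ?i ?j) (xob T (Cod S ?i) (Cod S ?j) A B))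
        (xm T (Cmp S ?i ?i) (Cmp S ?j ?j) A B)"
    using assms by (intro xm_cocycle[symmetric]) (simp_all add: prd_simps)
  also have "\<dots> = ?m"
    using assms m by (simp add: prd_simps fib_simps xob_obj)
  also have "\<dots> = Cmp (Fib H ?Z) ?m (Ide (Fib H ?Z) (xob T X Y A B))"
    using assms m by (simp add: fib_simps prd_simps)
  finally have eq: "Cmp (Fib H ?Z) ?m ?m = Cmp (Fib H ?Z) ?m (Ide (Fib H ?Z) (xob T X Y A B))" .
  show ?thesis
    by (rule category.Cmp_left_cancel[OF Z m(1) _ _ _ _ eq]) (use assms m in \<open>simp_all add: fib_simps prd_simps xob_obj\<close>)
qed

lemmas ext_simps = xob_obj xar_simps xar_Ide xm_simps xar_isoar xm_Ide

definition bo :: "'f \<times> 'o \<Rightarrow> 'f \<times> 'o \<Rightarrow> 'f \<times> 'o" where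
  "bo a b = (prd_arr S (fst a) (fst b), xob T (Cod S (fst a)) (Cod S (fst b)) (snd a) (snd b))"

text \<open>The object \<open>bo (f, A) (g, B)\<close> stands for the pullback of the external
  product of A and B along f x g, while \<open>xar\<close> connects external products of pullbacks.
  Conjugation by \<open>xm\<close> bridges the two, and in this way m is absorbed into the product
  of arrows.\<close>

definition ba :: "('f \<times> 'o) \<times> 'a \<times> ('f \<times> 'o) \<Rightarrow> ('f \<times> 'o) \<times> 'a \<times> ('f \<times> 'o) \<Rightarrow> ('f \<times> 'o) \<times> 'a \<times> ('f \<times> 'o)" where
  "ba u v = (let X = gbs (fst u); Y = gbs (fst v); a = fst u; b = fst v; a' = snd (snd u); b' = snd (snd v); Z = Prd S X Y in
     (bo a b, Cmp (Fib H Z) (xm T (fst a') (fst b') (snd a') (snd b')) (Cmp (Fib H Z) (xar T X Y (und u) (und v))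
        (Inv (Fib H Z) (xm T (fst a) (fst b) (snd a) (snd b)))), bo a' b'))"

lemma bo_pair: "bo (f, A) (g, B) = (prd_arr S f g, xob T (Cod S f) (Cod S g) A B)"
  by (simp add: bo_def)

lemma ba_tuple: "ba ((f, A), u, (f', A')) ((g, B), v, (g', B')) =
   ((prd_arr S f g, xob T (Cod S f) (Cod S g) A B),
    Cmp (Fib H (Prd S (Dom S f) (Dom S g))) (xm T f' g' A' B') (Cmp (Fib H (Prd S (Dom S f) (Dom S g)))
      (xar T (Dom S f) (Dom S g) u v) (Inv (Fib H (Prd S (Dom S f) (Dom S g))) (xm T f g A B))),
    (prd_arr S f' g', xob T (Cod S f') (Cod S g') A' B'))"
  by (simp add: ba_def Let_def gbs_def bo_def)

lemmas b_simps = bo_pair ba_tuple G_simps G_isoar fib_simps prd_simps ext_simps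

lemma bo_simps:
  assumes "a \<in> Obj G" "b \<in> Obj G"
  shows "bo a b \<in> Obj G" "gbs (bo a b) = Prd S (gbs a) (gbs b)"
  using assms by (cases a; cases b; simp add: b_simps)+

lemma ba_simps:
  assumes "u \<in> Arr G" "v \<in> Arr G"
  shows "ba u v \<in> Arr G" "Dom G (ba u v) = bo (Dom G u) (Dom G v)" "Cod G (ba u v) = bo (Cod G u) (Cod G v)"
  using assms by (elim G_arr_cases; simp add: b_simps)+

lemma ba_Ide:
  assumes "a \<in> Obj G" "b \<in> Obj G"
  shows "ba (Ide G a) (Ide G b) = Ide G (bo a b)"
  using assms by (cases a; cases b; simp add: b_simps)

lemma ba_Cmp:
  assumes "u \<in> Arr G" "v \<in> Arr G" "u' \<in> Arr G" "v' \<in> Arr G" "Dom G u' = Cod G u" "Dom G v' = Cod G v"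
  shows "ba (Cmp G u' u) (Cmp G v' v) = Cmp G (ba u' v') (ba u v)"
proof -
  obtain f A x g B where u: "u = ((f, A), x, (g, B))" "f \<in> Arr S" "A \<in> Obj (Fib H (Cod S f))" "g \<in> Arr S"
    "B \<in> Obj (Fib H (Cod S g))" "Dom S g = Dom S f" "x \<in> Arr (Fib H (Dom S f))"
    "Dom (Fib H (Dom S f)) x = pbo H f A" "Cod (Fib H (Dom S f)) x = pbo H g B"
    using assms(1) by (rule G_arr_cases)
  obtain f' A' y g' B' where v: "v = ((f', A'), y, (g', B'))" "f' \<in> Arr S" "A' \<in> Obj (Fib H (Cod S f'))" "g' \<in> Arr S"
    "B' \<in> Obj (Fib H (Cod S g'))" "Dom S g' = Dom S f'" "y \<in> Arr (Fib H (Dom S f'))"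
    "Dom (Fib H (Dom S f')) y = pbo H f' A'" "Cod (Fib H (Dom S f')) y = pbo H g' B'"
    using assms(2) by (rule G_arr_cases)
  obtain x' h C where u': "u' = ((g, B), x', (h, C))" "h \<in> Arr S" "C \<in> Obj (Fib H (Cod S h))" "Dom S h = Dom S f"
    "x' \<in> Arr (Fib H (Dom S f))" "Dom (Fib H (Dom S f)) x' = pbo H g B" "Cod (Fib H (Dom S f)) x' = pbo H h C"
    using assms(3,5) u by (elim G_arr_cases) (auto simp: G_proj)
  obtain y' h' C' where v': "v' = ((g', B'), y', (h', C'))" "h' \<in> Arr S" "C' \<in> Obj (Fib H (Cod S h'))" "Dom S h' = Dom S f'"
    "y' \<in> Arr (Fib H (Dom S f'))" "Dom (Fib H (Dom S f')) y' = pbo H g' B'" "Cod (Fib H (Dom S f')) y' = pbo H h' C'"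
    using assms(4,6) v by (elim G_arr_cases) (auto simp: G_proj)
  show ?thesis
    unfolding u(1) v(1) u'(1) v'(1)
    by (simp add: b_simps u(2-) v(2-) u'(2-) v'(2-) xar_Cmp)
qed

text \<open>Naturality and the cocycle condition of m combine into a strict equality. This is why
  the lifted external structure can have identities for its own m.\<close>

lemma gpa_ba:
  assumes "u \<in> Arr G" "v \<in> Arr G" "k \<in> Arr S" "l \<in> Arr S" "Cod S k = gbs (Dom G u)" "Cod S l = gbs (Dom G v)"
  shows "gpa (prd_arr S k l) (ba u v) = ba (gpa k u) (gpa l v)"
proof -
  obtain f A x g B where u: "u = ((f, A), x, (g, B))" "f \<in> Arr S" "A \<in> Obj (Fib H (Cod S f))" "g \<in> Arr S"
    "B \<in> Obj (Fib H (Cod S g))" "Dom S g = Dom S f" "x \<in> Arr (Fib H (Dom S f))"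
    "Dom (Fib H (Dom S f)) x = pbo H f A" "Cod (Fib H (Dom S f)) x = pbo H g B"
    using assms(1) by (rule G_arr_cases)
  obtain f' A' y g' B' where v: "v = ((f', A'), y, (g', B'))" "f' \<in> Arr S" "A' \<in> Obj (Fib H (Cod S f'))" "g' \<in> Arr S"
    "B' \<in> Obj (Fib H (Cod S g'))" "Dom S g' = Dom S f'" "y \<in> Arr (Fib H (Dom S f'))"
    "Dom (Fib H (Dom S f')) y = pbo H f' A'" "Cod (Fib H (Dom S f')) y = pbo H g' B'"
    using assms(2) by (rule G_arr_cases)
  have kl: "Cod S k = Dom S f" "Cod S l = Dom S f'" using assms u v by (simp_all add: G_simps)
  let ?K = "prd_arr S k l" and ?Z = "Prd S (Dom S k) (Dom S l)"
  have Z: "category (Fib H ?Z)" using assms by (simp add: fib_simps prd_simps)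
  note ra = category.reassoc[OF Z]
  note s = assms(3,4) u(2-9) v(2-9) kl
  note c1 = xm_cocycle[of k l f f' A A'] and c2 = xm_cocycle[of k l g g' B B']
  have n: "Cmp (Fib H ?Z) (pba H ?K (xar T (Dom S f) (Dom S f') x y)) (xm T k l (pbo H f A) (pbo H f' A')) =
      Cmp (Fib H ?Z) (xm T k l (pbo H g B) (pbo H g' B')) (xar T (Dom S k) (Dom S l) (pba H k x) (pba H l y))"
    using xm_nat[of k l x y] s by simp
  have m2: "xm T (Cmp S g k) (Cmp S g' l) B B' = Cmp (Fib H ?Z) (Inv (Fib H ?Z) (conn H ?K (prd_arr S g g') (xob T (Cod S g) (Cod S g') B B')))
     (Cmp (Fib H ?Z) (pba H ?K (xm T g g' B B')) (Cmp (Fib H ?Z) (xm T k l (pbo H g B) (pbo H g' B'))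
         (xar T (Dom S k) (Dom S l) (conn H k g B) (conn H l g' B'))))"
    using s c2[symmetric] by (simp add: b_simps prd_arr_Cmp)
  have c1': "Cmp (Fib H ?Z) (conn H ?K (prd_arr S f f') (xob T (Cod S f) (Cod S f') A A')) (xm T (Cmp S f k) (Cmp S f' l) A A') =
     Cmp (Fib H ?Z) (pba H ?K (xm T f f' A A'))
       (Cmp (Fib H ?Z) (xm T k l (pbo H f A) (pbo H f' A'))
         (xar T (Dom S k) (Dom S l) (conn H k f A) (conn H l f' A')))"
    using s c1 by simp
  let ?m = "xm T (Cmp S f k) (Cmp S f' l) A A'"
  \<comment> \<open>Composing with \<open>?m\<close> removes the inverse at the end of the right
    side, and on the left side it lets the cocycle condition for the source act.\<close>
  have main: "Cmp (Fib H ?Z) (Inv (Fib H ?Z) (conn H ?K (prd_arr S g g') (xob T (Cod S g) (Cod S g') B B')))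
      (Cmp (Fib H ?Z) (pba H ?K (Cmp (Fib H (Prd S (Dom S f) (Dom S f'))) (xm T g g' B B') (Cmp (Fib H (Prd S (Dom S f) (Dom S f')))
          (xar T (Dom S f) (Dom S f') x y) (Inv (Fib H (Prd S (Dom S f) (Dom S f'))) (xm T f f' A A')))))
        (conn H ?K (prd_arr S f f') (xob T (Cod S f) (Cod S f') A A'))) =
      Cmp (Fib H ?Z) (xm T (Cmp S g k) (Cmp S g' l) B B')
       (Cmp (Fib H ?Z) (xar T (Dom S k) (Dom S l)
          (Cmp (Fib H (Dom S k)) (Inv (Fib H (Dom S k)) (conn H k g B)) (Cmp (Fib H (Dom S k)) (pba H k x) (conn H k f A)))
          (Cmp (Fib H (Dom S l)) (Inv (Fib H (Dom S l)) (conn H l g' B')) (Cmp (Fib H (Dom S l)) (pba H l y) (conn H l f' A'))))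
        (Inv (Fib H ?Z) ?m))" (is "?L = ?R")
  proof (rule category.Cmp_right_cancel[OF Z, of ?m])
    show "Cmp (Fib H ?Z) ?L ?m = Cmp (Fib H ?Z) ?R ?m"
      using s by (simp add: b_simps prd_arr_Cmp c1' ra[OF n] m2 pba_cancel flip: xar_Cmp)
  qed (use s in \<open>simp_all add: b_simps prd_arr_Cmp\<close>)
  show ?thesis
    using s main by (simp add: u(1) v(1) b_simps prd_arr_Cmp)
qed

definition xto :: "'f \<times> 'o \<Rightarrow> 'f \<times> 'o \<Rightarrow> 'f \<times> 'o" where
  "xto a b = gpl (diag S (gbs a)) (bo a b)"

definition xta :: "('f \<times> 'o) \<times> 'a \<times> ('f \<times> 'o) \<Rightarrow> ('f \<times> 'o) \<times> 'a \<times> ('f \<times> 'o) \<Rightarrow> ('f \<times> 'o) \<times> 'a \<times> ('f \<times> 'o)" where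
  "xta u v = gpa (diag S (gbs (Dom G u))) (ba u v)"

lemma xto_pair: "f \<in> Arr S \<Longrightarrow> g \<in> Arr S \<Longrightarrow> Dom S g = Dom S f \<Longrightarrow>
    xto (f, A) (g, B) = (pair S f g, xob T (Cod S f) (Cod S g) A B)"
  by (simp add: xto_def b_simps)

lemma xto_simps:
  assumes "a \<in> Obj G" "b \<in> Obj G" "gbs b = gbs a"
  shows "xto a b \<in> Obj G" "gbs (xto a b) = gbs a" "k \<in> Arr S \<Longrightarrow> gbs a = Cod S k \<Longrightarrow> gpl k (xto a b) = xto (gpl k a) (gpl k b)"
  using assms by (cases a; cases b; simp add: b_simps xto_pair)+

lemma xta_simps:
  assumes "u \<in> Arr G" "v \<in> Arr G" "gbs (Dom G v) = gbs (Dom G u)"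
  shows "xta u v \<in> Arr G" "Dom G (xta u v) = xto (Dom G u) (Dom G v)" "Cod G (xta u v) = xto (Cod G u) (Cod G v)"
  using assms by (simp_all add: xta_def xto_def vert_simps ba_simps bo_simps prd_simps)

text \<open>Factor \<open>h\<close> as the diagonal followed by the product of its two components,
  then apply \<open>gpa_ba\<close>. As a rewrite rule this turns an external law, pulled back along
  an arrow with prescribed components, into a law for \<open>xta\<close>.\<close>

lemma gpa_ba_xta:
  assumes "u \<in> Arr G" "v \<in> Arr G" "h \<in> Arr S" "Cod S h = Prd S (gbs (Dom G u)) (gbs (Dom G v))"
  shows "gpa h (ba u v) = xta (gpa (Cmp S (Pr1 S (gbs (Dom G u)) (gbs (Dom G v))) h) u) (gpa (Cmp S (Pr2 S (gbs (Dom G u)) (gbs (Dom G v))) h) v)"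
proof -
  let ?k = "Cmp S (Pr1 S (gbs (Dom G u)) (gbs (Dom G v))) h" and ?l = "Cmp S (Pr2 S (gbs (Dom G u)) (gbs (Dom G v))) h"
  have o: "gbs (Dom G u) \<in> Obj S" "gbs (Dom G v) \<in> Obj S" using assms by (simp_all add: vert_simps)
  have "xta (gpa ?k u) (gpa ?l v) = gpa (diag S (Dom S h)) (gpa (prd_arr S ?k ?l) (ba u v))"
    using assms o by (simp add: xta_def vert_simps prd_simps gpa_ba)
  also have "\<dots> = gpa (Cmp S (prd_arr S ?k ?l) (diag S (Dom S h))) (ba u v)"
    using assms o by (intro pa_pa) (simp_all add: prd_simps ba_simps bo_simps vert_simps)
  also have "Cmp S (prd_arr S ?k ?l) (diag S (Dom S h)) = h"
    using assms o by (simp add: prd_simps)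
  finally show ?thesis by simp
qed

lemma gpl_bo_xto:
  assumes "a \<in> Obj G" "b \<in> Obj G" "h \<in> Arr S" "Cod S h = Prd S (gbs a) (gbs b)"
  shows "gpl h (bo a b) = xto (gpl (Cmp S (Pr1 S (gbs a) (gbs b)) h) a) (gpl (Cmp S (Pr2 S (gbs a) (gbs b)) h) b)"
  using gpa_ba_xta[of "Ide G a" "Ide G b" h] assms
    xta_simps(2)[of "gpa (Cmp S (Pr1 S (gbs a) (gbs b)) h) (Ide G a)" "gpa (Cmp S (Pr2 S (gbs a) (gbs b)) h) (Ide G b)"]
    pa_dom[of h "Ide G (bo a b)"]
  by (simp add: vert_simps prd_simps ba_Ide bo_simps)

lemma gpa_xta:
  assumes "u \<in> Arr G" "v \<in> Arr G" "gbs (Dom G v) = gbs (Dom G u)" "k \<in> Arr S" "gbs (Dom G u) = Cod S k"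
  shows "gpa k (xta u v) = xta (gpa k u) (gpa k v)"
  using assms gpa_ba_xta[of u v "Cmp S (diag S (Cod S k)) k"]
  by (simp add: xta_def[of u v] vert_simps prd_simps ba_simps bo_simps)

lemma xta_Ide: "a \<in> Obj G \<Longrightarrow> b \<in> Obj G \<Longrightarrow> gbs b = gbs a \<Longrightarrow> xta (Ide G a) (Ide G b) = Ide G (xto a b)"
  by (simp add: xta_def xto_def vert_simps ba_Ide bo_simps prd_simps)

lemma xta_Cmp:
  assumes "u \<in> Arr G" "v \<in> Arr G" "u' \<in> Arr G" "v' \<in> Arr G" "Dom G u' = Cod G u" "Dom G v' = Cod G v"
    "gbs (Dom G v) = gbs (Dom G u)"
  shows "xta (Cmp G u' u) (Cmp G v' v) = Cmp G (xta u' v') (xta u v)"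
  using assms by (simp add: xta_def vert_simps ba_Cmp ba_simps bo_simps prd_simps)

abbreviation "aT \<equiv> the (xassoc T)"
abbreviation "cT \<equiv> the (xcomm T)"
abbreviation "uT \<equiv> the (xunit T)"

text \<open>The constraints as arrows of \<open>G\<close>. They are constraints between objects over different bases; the
  ones of \<open>lift_ext\<close> are their pullbacks.\<close>

definition da where
  "da X1 X2 X3 A1 A2 A3 = (emb (Prd S (Prd S X1 X2) X3) (xob T (Prd S X1 X2) X3 (xob T X1 X2 A1 A2) A3), aT X1 X2 X3 A1 A2 A3,
     (passoc S X1 X2 X3, xob T X1 (Prd S X2 X3) A1 (xob T X2 X3 A2 A3)))"

definition dc where
  "dc X1 X2 A1 A2 = (emb (Prd S X1 X2) (xob T X1 X2 A1 A2), cT X1 X2 A1 A2, (pswap S X1 X2, xob T X2 X1 A2 A1))"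

definition dr where
  "dr X1 X2 A = (emb (Prd S X1 X2) (xob T X1 X2 A (sob uT X2)), xur uT X1 X2 A, (Pr1 S X1 X2, A))"

definition dl where
  "dl X1 X2 A = (emb (Prd S X1 X2) (xob T X1 X2 (sob uT X1) A), xul uT X1 X2 A, (Pr2 S X1 X2, A))"

definition lift_ext :: "('s, 'f, 'f \<times> 'o, ('f \<times> 'o) \<times> 'a \<times> ('f \<times> 'o)) stens" where
  "lift_ext = \<lparr> to = xto, ta = xta, sm = (\<lambda>k a b. Ide G (gpl k (xto a b))),
     sas = (\<lambda>a b c. gpa (pair S (pair S (fst a) (fst b)) (fst c)) (da (Cod S (fst a)) (Cod S (fst b)) (Cod S (fst c)) (snd a) (snd b) (snd c))),
     sco = (\<lambda>a b. gpa (pair S (fst a) (fst b)) (dc (Cod S (fst a)) (Cod S (fst b)) (snd a) (snd b))),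
     one = (\<lambda>X. emb X (sob uT X)), sr = (\<lambda>k. ((k, sob uT (Cod S k)), sar uT k, emb (Dom S k) (sob uT (Dom S k)))),
     ur = (\<lambda>a. gpa (pair S (fst a) (Ide S (gbs a))) (dr (Cod S (fst a)) (gbs a) (snd a))),
     ul = (\<lambda>a. gpa (pair S (Ide S (gbs a)) (fst a)) (dl (gbs a) (Cod S (fst a)) (snd a))) \<rparr>"

lemma ext_sel:
  "to lift_ext = xto" "ta lift_ext = xta" "sm lift_ext k a b = Ide G (gpl k (xto a b))"
  "sas lift_ext a b c = gpa (pair S (pair S (fst a) (fst b)) (fst c)) (da (Cod S (fst a)) (Cod S (fst b)) (Cod S (fst c)) (snd a) (snd b) (snd c))"
  "sco lift_ext a b = gpa (pair S (fst a) (fst b)) (dc (Cod S (fst a)) (Cod S (fst b)) (snd a) (snd b))"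
  "one lift_ext X = emb X (sob uT X)" "sr lift_ext k = ((k, sob uT (Cod S k)), sar uT k, emb (Dom S k) (sob uT (Dom S k)))"
  "ur lift_ext a = gpa (pair S (fst a) (Ide S (gbs a))) (dr (Cod S (fst a)) (gbs a) (snd a))"
  "ul lift_ext a = gpa (pair S (Ide S (gbs a)) (fst a)) (dl (gbs a) (Cod S (fst a)) (snd a))"
  by (simp_all add: lift_ext_def)

end

text \<open>Shared by structures that satisfy the axioms and by candidates of which only the typing
  is known. Since \<open>da\<close>, \<open>dc\<close>, \<open>dr\<close> and \<open>dl\<close> have
  source and target built in, invertibility in \<open>G\<close> also states the domain and codomain
  of the constraints.\<close>

locale external_typed = external_base S H T
  for S :: "('s, 'f) pcat" and H :: "('s, 'f, 'o, 'a) fib" and T +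
  fixes K :: "tensor_property set"
  assumes a_typed: "Associative \<in> K \<Longrightarrow> X1 \<in> Obj S \<Longrightarrow> X2 \<in> Obj S \<Longrightarrow> X3 \<in> Obj S \<Longrightarrow> A1 \<in> Obj (Fib H X1) \<Longrightarrow>
      A2 \<in> Obj (Fib H X2) \<Longrightarrow> A3 \<in> Obj (Fib H X3) \<Longrightarrow> isoar G (da X1 X2 X3 A1 A2 A3)"
    and c_typed: "Symmetric \<in> K \<Longrightarrow> X1 \<in> Obj S \<Longrightarrow> X2 \<in> Obj S \<Longrightarrow> A1 \<in> Obj (Fib H X1) \<Longrightarrow>
      A2 \<in> Obj (Fib H X2) \<Longrightarrow> isoar G (dc X1 X2 A1 A2)"
    and u_section: "Unitary \<in> K \<Longrightarrow> is_section S H uT"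
    and r_typed: "Unitary \<in> K \<Longrightarrow> X1 \<in> Obj S \<Longrightarrow> X2 \<in> Obj S \<Longrightarrow> A1 \<in> Obj (Fib H X1) \<Longrightarrow> isoar G (dr X1 X2 A1)"
    and l_typed: "Unitary \<in> K \<Longrightarrow> X1 \<in> Obj S \<Longrightarrow> X2 \<in> Obj S \<Longrightarrow> A2 \<in> Obj (Fib H X2) \<Longrightarrow> isoar G (dl X1 X2 A2)"
begin

lemma d_dom_cod:
  "Dom G (da X1 X2 X3 A1 A2 A3) = emb (Prd S (Prd S X1 X2) X3) (xob T (Prd S X1 X2) X3 (xob T X1 X2 A1 A2) A3)"
  "Cod G (da X1 X2 X3 A1 A2 A3) = (passoc S X1 X2 X3, xob T X1 (Prd S X2 X3) A1 (xob T X2 X3 A2 A3))"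
  "Dom G (dc X1 X2 A1 A2) = emb (Prd S X1 X2) (xob T X1 X2 A1 A2)"
  "Cod G (dc X1 X2 A1 A2) = (pswap S X1 X2, xob T X2 X1 A2 A1)"
  "Dom G (dr X1 X2 A1) = emb (Prd S X1 X2) (xob T X1 X2 A1 (sob uT X2))"
  "Cod G (dr X1 X2 A1) = (Pr1 S X1 X2, A1)"
  "Dom G (dl X1 X2 A2) = emb (Prd S X1 X2) (xob T X1 X2 (sob uT X1) A2)"
  "Cod G (dl X1 X2 A2) = (Pr2 S X1 X2, A2)"
  by (simp_all add: da_def dc_def dr_def dl_def G_proj)

lemma unit_obj: "Unitary \<in> K \<Longrightarrow> X \<in> Obj S \<Longrightarrow> sob uT X \<in> Obj (Fib H X)"
  using u_section by (simp add: is_section_def)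

lemma sar_simps:
  assumes "Unitary \<in> K" "f \<in> Arr S" "Dom S f = Y"
  shows "isoar (Fib H Y) (sar uT f)" "Dom (Fib H Y) (sar uT f) = pbo H f (sob uT (Cod S f))"
    "Cod (Fib H Y) (sar uT f) = sob uT Y"
  using u_section assms by (auto simp: is_section_def frozen_iff)

lemma sar_Cmp:
  assumes "Unitary \<in> K" "f \<in> Arr S" "Dom S f = Z" "g \<in> Arr S" "Dom S g = Cod S f"
  shows "sar uT (Cmp S g f) = Cmp (Fib H Z) (sar uT f) (Cmp (Fib H Z) (pba H f (sar uT g)) (conn H f g (sob uT (Cod S g))))"
  using u_section assms by (auto simp: is_section_def frozen_iff)

lemmas d_typed = a_typed c_typed r_typed l_typed d_dom_cod unit_obj sar_simps

lemma d_arr: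
  "Associative \<in> K \<Longrightarrow> X1 \<in> Obj S \<Longrightarrow> X2 \<in> Obj S \<Longrightarrow> X3 \<in> Obj S \<Longrightarrow> A1 \<in> Obj (Fib H X1) \<Longrightarrow>
      A2 \<in> Obj (Fib H X2) \<Longrightarrow> A3 \<in> Obj (Fib H X3) \<Longrightarrow> da X1 X2 X3 A1 A2 A3 \<in> Arr G"
  "Symmetric \<in> K \<Longrightarrow> X1 \<in> Obj S \<Longrightarrow> X2 \<in> Obj S \<Longrightarrow> A1 \<in> Obj (Fib H X1) \<Longrightarrow>
      A2 \<in> Obj (Fib H X2) \<Longrightarrow> dc X1 X2 A1 A2 \<in> Arr G"
  "Unitary \<in> K \<Longrightarrow> X1 \<in> Obj S \<Longrightarrow> X2 \<in> Obj S \<Longrightarrow> A1 \<in> Obj (Fib H X1) \<Longrightarrow> dr X1 X2 A1 \<in> Arr G"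
  "Unitary \<in> K \<Longrightarrow> X1 \<in> Obj S \<Longrightarrow> X2 \<in> Obj S \<Longrightarrow> A2 \<in> Obj (Fib H X2) \<Longrightarrow> dl X1 X2 A2 \<in> Arr G"
  by (simp_all add: a_typed c_typed r_typed l_typed tot.isoar_arr)

lemma G_Obj_pair: "(f, A) \<in> Obj G \<longleftrightarrow> f \<in> Arr S \<and> A \<in> Obj (Fib H (Cod S f))"
  by (simp add: G_Obj)

lemmas d_simps = G_Obj_pair gpl_pair real_pair gbs_pair vert_simps prd_simps d_typed d_arr xob_obj emb_simps(1,2) emb_proj xto_pair ext_sel

lemma styped_ext: "styped S G gbs gpl gpa K lift_ext"
proof (unfold_locales, goal_cases)
  case (3 u v) then show ?case by (simp add: ext_sel xta_simps)
next
  case (4 u v) then show ?case by (simp add: ext_sel xta_simps)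
next
  case (5 u v) then show ?case by (simp add: ext_sel xta_simps)
next
  case (20 k l)
  then show ?case
    by (simp add: ext_sel emb_def G_simps fib_simps cat_simps sar_Cmp unit_obj sar_simps)
next
  case (17 k)
  then show ?case
    by (simp add: ext_sel emb_def G_simps G_isoar fib_simps cat_simps unit_obj sar_simps)
next
  case (6 k a b) then show ?case by (simp add: ext_sel xto_simps vert_simps)
next
  case (7 k a b) then show ?case by (simp add: ext_sel xto_simps vert_simps)
next
  case (8 k a b) then show ?case by (simp add: ext_sel xto_simps vert_simps)
qed (auto simp: d_simps xto_simps emb_def G_simps)

end

section \<open>Coherence equations in the base category\<close>

context category_with_binary_products
begin

text \<open>These equalities of base arrows justify the identifications of targets in the pentagon,
  in the compatibility of associativity with commutativity, and in the compatibilities with units.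
  Each holds because the components agree.\<close>

lemma prd_equations:
  assumes "X1 \<in> Obj S" "X2 \<in> Obj S" "X3 \<in> Obj S"
  shows "X4 \<in> Obj S \<Longrightarrow> Cmp S (passoc S X1 X2 (Prd S X3 X4)) (passoc S (Prd S X1 X2) X3 X4) =
      Cmp S (prd_arr S (Ide S X1) (passoc S X2 X3 X4)) (Cmp S (passoc S X1 (Prd S X2 X3) X4) (prd_arr S (passoc S X1 X2 X3) (Ide S X4)))"
    "Cmp S (prd_arr S (Ide S X2) (pswap S X1 X3)) (Cmp S (passoc S X2 X1 X3) (prd_arr S (pswap S X1 X2) (Ide S X3))) =
      Cmp S (passoc S X2 X3 X1) (Cmp S (pswap S X1 (Prd S X2 X3)) (passoc S X1 X2 X3))"
    "Cmp S (Pr2 S X1 (Prd S X2 X3)) (passoc S X1 X2 X3) = prd_arr S (Pr2 S X1 X2) (Ide S X3)"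
    "Cmp S (prd_arr S (Ide S X1) (Pr2 S X2 X3)) (passoc S X1 X2 X3) = prd_arr S (Pr1 S X1 X2) (Ide S X3)"
    "Cmp S (prd_arr S (Ide S X1) (Pr1 S X2 X3)) (passoc S X1 X2 X3) = Pr1 S (Prd S X1 X2) X3"
    "Cmp S (Pr1 S X2 X1) (pswap S X1 X2) = Pr2 S X1 X2" "Cmp S (Pr2 S X2 X1) (pswap S X1 X2) = Pr1 S X1 X2"
  using assms by (simp_all add: passoc_def pswap_def prd_arr_def prd_basic)

lemma prd_nat:
  assumes "f1 \<in> Arr S" "f2 \<in> Arr S"
  shows "f3 \<in> Arr S \<Longrightarrow> Cmp S (passoc S (Cod S f1) (Cod S f2) (Cod S f3)) (prd_arr S (prd_arr S f1 f2) f3) =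
     Cmp S (prd_arr S f1 (prd_arr S f2 f3)) (passoc S (Dom S f1) (Dom S f2) (Dom S f3))"
    "Cmp S (pswap S (Cod S f1) (Cod S f2)) (prd_arr S f1 f2) = Cmp S (prd_arr S f2 f1) (pswap S (Dom S f1) (Dom S f2))"
  using assms by (simp_all add: passoc_def pswap_def prd_arr_def prd_basic)

end

text \<open>Needed for axioms in which a connection isomorphism stands on one side of the equation
  while over \<open>G\<close> its inverse belongs to the other side.\<close>

lemma (in category) Inv_move:
  assumes "isoar C s" "x \<in> Arr C" "y \<in> Arr C" "Cod C x = Cod C s" "Cod C y = Dom C s"
  shows "Cmp C (Inv C s) x = y \<longleftrightarrow> x = Cmp C s y"
  using assms by (auto simp: cat_simps)

section \<open>The external axioms as equations in \<open>G\<close>\<close>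

context external_typed
begin

lemma a_und:
  assumes "Associative \<in> K" "X1 \<in> Obj S" "X2 \<in> Obj S" "X3 \<in> Obj S" "A1 \<in> Obj (Fib H X1)" "A2 \<in> Obj (Fib H X2)" "A3 \<in> Obj (Fib H X3)"
  shows "isoar (Fib H (Prd S (Prd S X1 X2) X3)) (aT X1 X2 X3 A1 A2 A3)"
    "Dom (Fib H (Prd S (Prd S X1 X2) X3)) (aT X1 X2 X3 A1 A2 A3) = xob T (Prd S X1 X2) X3 (xob T X1 X2 A1 A2) A3"
    "Cod (Fib H (Prd S (Prd S X1 X2) X3)) (aT X1 X2 X3 A1 A2 A3) = pbo H (passoc S X1 X2 X3) (xob T X1 (Prd S X2 X3) A1 (xob T X2 X3 A2 A3))"
  using a_typed[OF assms] assms by (simp_all add: da_def emb_def b_simps)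

lemma c_und:
  assumes "Symmetric \<in> K" "X1 \<in> Obj S" "X2 \<in> Obj S" "A1 \<in> Obj (Fib H X1)" "A2 \<in> Obj (Fib H X2)"
  shows "isoar (Fib H (Prd S X1 X2)) (cT X1 X2 A1 A2)"
    "Dom (Fib H (Prd S X1 X2)) (cT X1 X2 A1 A2) = xob T X1 X2 A1 A2"
    "Cod (Fib H (Prd S X1 X2)) (cT X1 X2 A1 A2) = pbo H (pswap S X1 X2) (xob T X2 X1 A2 A1)"
  using c_typed[OF assms] assms by (simp_all add: dc_def emb_def b_simps)

lemma u_und:
  assumes "Unitary \<in> K" "X1 \<in> Obj S" "X2 \<in> Obj S"
  shows "A1 \<in> Obj (Fib H X1) \<Longrightarrow> isoar (Fib H (Prd S X1 X2)) (xur uT X1 X2 A1)"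
    "A1 \<in> Obj (Fib H X1) \<Longrightarrow> Dom (Fib H (Prd S X1 X2)) (xur uT X1 X2 A1) = xob T X1 X2 A1 (sob uT X2)"
    "A1 \<in> Obj (Fib H X1) \<Longrightarrow> Cod (Fib H (Prd S X1 X2)) (xur uT X1 X2 A1) = pbo H (Pr1 S X1 X2) A1"
    "A2 \<in> Obj (Fib H X2) \<Longrightarrow> isoar (Fib H (Prd S X1 X2)) (xul uT X1 X2 A2)"
    "A2 \<in> Obj (Fib H X2) \<Longrightarrow> Dom (Fib H (Prd S X1 X2)) (xul uT X1 X2 A2) = xob T X1 X2 (sob uT X1) A2"
    "A2 \<in> Obj (Fib H X2) \<Longrightarrow> Cod (Fib H (Prd S X1 X2)) (xul uT X1 X2 A2) = pbo H (Pr2 S X1 X2) A2"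
  using r_typed[OF assms] l_typed[OF assms] assms by (simp_all add: dr_def dl_def emb_def b_simps unit_obj)

lemmas und_all = a_und c_und u_und unit_obj sar_simps pba_cancel da_def dc_def dr_def dl_def lam_def emb_def dec_def b_simps

text \<open>The axioms of an external structure as equations in \<open>G\<close>, on the left of each equivalence, where no
  connection isomorphisms occur.\<close>

lemma nat_a_iff:
  assumes "Associative \<in> K" "X1 \<in> Obj S" "X2 \<in> Obj S" "X3 \<in> Obj S" "u \<in> Arr (Fib H X1)" "v \<in> Arr (Fib H X2)" "w \<in> Arr (Fib H X3)"
  shows "Cmp G (da X1 X2 X3 (Cod (Fib H X1) u) (Cod (Fib H X2) v) (Cod (Fib H X3) w)) (ba (ba (dec X1 u) (dec X2 v)) (dec X3 w)) =
     Cmp G (gpa (passoc S X1 X2 X3) (ba (dec X1 u) (ba (dec X2 v) (dec X3 w)))) (da X1 X2 X3 (Dom (Fib H X1) u) (Dom (Fib H X2) v) (Dom (Fib H X3) w)) \<longleftrightarrow>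
    Cmp (Fib H (Prd S (Prd S X1 X2) X3)) (aT X1 X2 X3 (Cod (Fib H X1) u) (Cod (Fib H X2) v) (Cod (Fib H X3) w)) (xar T (Prd S X1 X2) X3 (xar T X1 X2 u v) w) =
    Cmp (Fib H (Prd S (Prd S X1 X2) X3)) (pba H (passoc S X1 X2 X3) (xar T X1 (Prd S X2 X3) u (xar T X2 X3 v w))) (aT X1 X2 X3 (Dom (Fib H X1) u) (Dom (Fib H X2) v) (Dom (Fib H X3) w))"
  by (simp add: und_all assms)

lemma pentagon_iff:
  assumes "Associative \<in> K" "X1 \<in> Obj S" "X2 \<in> Obj S" "X3 \<in> Obj S" "X4 \<in> Obj S"
    "A1 \<in> Obj (Fib H X1)" "A2 \<in> Obj (Fib H X2)" "A3 \<in> Obj (Fib H X3)" "A4 \<in> Obj (Fib H X4)"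
  shows "Cmp G (gpa (passoc S (Prd S X1 X2) X3 X4) (da X1 X2 (Prd S X3 X4) A1 A2 (xob T X3 X4 A3 A4))) (da (Prd S X1 X2) X3 X4 (xob T X1 X2 A1 A2) A3 A4) =
     Cmp G (gpa (prd_arr S (passoc S X1 X2 X3) (Ide S X4)) (gpa (passoc S X1 (Prd S X2 X3) X4) (ba (Ide G (emb X1 A1)) (da X2 X3 X4 A2 A3 A4))))
      (Cmp G (gpa (prd_arr S (passoc S X1 X2 X3) (Ide S X4)) (da X1 (Prd S X2 X3) X4 A1 (xob T X2 X3 A2 A3) A4))
        (ba (da X1 X2 X3 A1 A2 A3) (Ide G (emb X4 A4)))) \<longleftrightarrow>
     (let Q = Prd S (Prd S (Prd S X1 X2) X3) X4; A34 = xob T X3 X4 A3 A4; A = xob T X1 (Prd S X2 (Prd S X3 X4)) A1 (xob T X2 (Prd S X3 X4) A2 A34) in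
      Cmp (Fib H Q) (Inv (Fib H Q) (conn H (passoc S (Prd S X1 X2) X3 X4) (passoc S X1 X2 (Prd S X3 X4)) A))
       (Cmp (Fib H Q) (pba H (passoc S (Prd S X1 X2) X3 X4) (aT X1 X2 (Prd S X3 X4) A1 A2 A34))
         (aT (Prd S X1 X2) X3 X4 (xob T X1 X2 A1 A2) A3 A4)) =
      Cmp (Fib H Q) (Inv (Fib H Q) (conn3 S H (prd_arr S (passoc S X1 X2 X3) (Ide S X4)) (passoc S X1 (Prd S X2 X3) X4) (prd_arr S (Ide S X1) (passoc S X2 X3 X4)) A))
       (Cmp (Fib H Q) (pba H (prd_arr S (passoc S X1 X2 X3) (Ide S X4)) (pba H (passoc S X1 (Prd S X2 X3) X4) (xm T (Ide S X1) (passoc S X2 X3 X4) A1 (xob T X2 (Prd S X3 X4) A2 A34))))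
       (Cmp (Fib H Q) (pba H (prd_arr S (passoc S X1 X2 X3) (Ide S X4)) (pba H (passoc S X1 (Prd S X2 X3) X4) (xar T X1 (Prd S (Prd S X2 X3) X4) (Ide (Fib H X1) A1) (aT X2 X3 X4 A2 A3 A4))))
       (Cmp (Fib H Q) (pba H (prd_arr S (passoc S X1 X2 X3) (Ide S X4)) (aT X1 (Prd S X2 X3) X4 A1 (xob T X2 X3 A2 A3) A4))
       (Cmp (Fib H Q) (xm T (passoc S X1 X2 X3) (Ide S X4) (xob T X1 (Prd S X2 X3) A1 (xob T X2 X3 A2 A3)) A4)
          (xar T (Prd S (Prd S X1 X2) X3) X4 (aT X1 X2 X3 A1 A2 A3) (Ide (Fib H X4) A4)))))))"
  by (simp add: und_all assms prd_equations conn3_def Let_def)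

text \<open>In \<open>G\<close> the isomorphism m appears as
  \<open>ba (lam f1 A1) (lam f2 A2)\<close>: each \<open>lam\<close> is an identity over the fibers,
  so only \<open>xm\<close> is left of this product. Compatibility of associativity with m thereby
  takes the form of a naturality square for \<open>da\<close>.\<close>

lemma m_a_iff:
  assumes "Associative \<in> K" "f1 \<in> Arr S" "f2 \<in> Arr S" "f3 \<in> Arr S" "A1 \<in> Obj (Fib H (Cod S f1))" "A2 \<in> Obj (Fib H (Cod S f2))" "A3 \<in> Obj (Fib H (Cod S f3))"
  shows "Cmp G (gpa (prd_arr S (prd_arr S f1 f2) f3) (da (Cod S f1) (Cod S f2) (Cod S f3) A1 A2 A3)) (ba (ba (lam f1 A1) (lam f2 A2)) (lam f3 A3)) =
    Cmp G (gpa (passoc S (Dom S f1) (Dom S f2) (Dom S f3)) (ba (lam f1 A1) (ba (lam f2 A2) (lam f3 A3))))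
     (da (Dom S f1) (Dom S f2) (Dom S f3) (pbo H f1 A1) (pbo H f2 A2) (pbo H f3 A3)) \<longleftrightarrow>
   (let Q = Prd S (Prd S (Dom S f1) (Dom S f2)) (Dom S f3); A = xob T (Cod S f1) (Prd S (Cod S f2) (Cod S f3)) A1 (xob T (Cod S f2) (Cod S f3) A2 A3);
      aY = passoc S (Dom S f1) (Dom S f2) (Dom S f3) in
     Cmp (Fib H Q) (Inv (Fib H Q) (conn H (prd_arr S (prd_arr S f1 f2) f3) (passoc S (Cod S f1) (Cod S f2) (Cod S f3)) A))
      (Cmp (Fib H Q) (pba H (prd_arr S (prd_arr S f1 f2) f3) (aT (Cod S f1) (Cod S f2) (Cod S f3) A1 A2 A3))
       (Cmp (Fib H Q) (xm T (prd_arr S f1 f2) f3 (xob T (Cod S f1) (Cod S f2) A1 A2) A3)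
         (xar T (Prd S (Dom S f1) (Dom S f2)) (Dom S f3) (xm T f1 f2 A1 A2) (Ide (Fib H (Dom S f3)) (pbo H f3 A3))))) =
     Cmp (Fib H Q) (Inv (Fib H Q) (conn H aY (prd_arr S f1 (prd_arr S f2 f3)) A))
      (Cmp (Fib H Q) (pba H aY (xm T f1 (prd_arr S f2 f3) A1 (xob T (Cod S f2) (Cod S f3) A2 A3)))
       (Cmp (Fib H Q) (pba H aY (xar T (Dom S f1) (Prd S (Dom S f2) (Dom S f3)) (Ide (Fib H (Dom S f1)) (pbo H f1 A1)) (xm T f2 f3 A2 A3)))
         (aT (Dom S f1) (Dom S f2) (Dom S f3) (pbo H f1 A1) (pbo H f2 A2) (pbo H f3 A3)))))"
  by (simp add: und_all assms prd_nat Let_def)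

lemma nat_c_iff:
  assumes "Symmetric \<in> K" "X1 \<in> Obj S" "X2 \<in> Obj S" "u \<in> Arr (Fib H X1)" "v \<in> Arr (Fib H X2)"
  shows "Cmp G (dc X1 X2 (Cod (Fib H X1) u) (Cod (Fib H X2) v)) (ba (dec X1 u) (dec X2 v)) =
     Cmp G (gpa (pswap S X1 X2) (ba (dec X2 v) (dec X1 u))) (dc X1 X2 (Dom (Fib H X1) u) (Dom (Fib H X2) v)) \<longleftrightarrow>
    Cmp (Fib H (Prd S X1 X2)) (cT X1 X2 (Cod (Fib H X1) u) (Cod (Fib H X2) v)) (xar T X1 X2 u v) =
    Cmp (Fib H (Prd S X1 X2)) (pba H (pswap S X1 X2) (xar T X2 X1 v u)) (cT X1 X2 (Dom (Fib H X1) u) (Dom (Fib H X2) v))"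
  by (simp add: und_all assms)

lemma inv_c_iff:
  assumes "Symmetric \<in> K" "X1 \<in> Obj S" "X2 \<in> Obj S" "A1 \<in> Obj (Fib H X1)" "A2 \<in> Obj (Fib H X2)"
  shows "Cmp G (gpa (pswap S X1 X2) (dc X2 X1 A2 A1)) (dc X1 X2 A1 A2) = Ide G (emb (Prd S X1 X2) (xob T X1 X2 A1 A2)) \<longleftrightarrow>
    Cmp (Fib H (Prd S X1 X2)) (pba H (pswap S X1 X2) (cT X2 X1 A2 A1)) (cT X1 X2 A1 A2) = conn H (pswap S X1 X2) (pswap S X2 X1) (xob T X1 X2 A1 A2)"
proof -
  have Z: "category (Fib H (Prd S X1 X2))" using assms by (simp add: fib_simps prd_simps)
  show ?thesis
    using category.Inv_move[OF Z, of "conn H (pswap S X1 X2) (pswap S X2 X1) (xob T X1 X2 A1 A2)"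
      "Cmp (Fib H (Prd S X1 X2)) (pba H (pswap S X1 X2) (cT X2 X1 A2 A1)) (cT X1 X2 A1 A2)" "Ide (Fib H (Prd S X1 X2)) (xob T X1 X2 A1 A2)"]
    by (simp add: und_all assms)
qed

lemma m_c_iff:
  assumes "Symmetric \<in> K" "f1 \<in> Arr S" "f2 \<in> Arr S" "A1 \<in> Obj (Fib H (Cod S f1))" "A2 \<in> Obj (Fib H (Cod S f2))"
  shows "Cmp G (gpa (prd_arr S f1 f2) (dc (Cod S f1) (Cod S f2) A1 A2)) (ba (lam f1 A1) (lam f2 A2)) =
    Cmp G (gpa (pswap S (Dom S f1) (Dom S f2)) (ba (lam f2 A2) (lam f1 A1))) (dc (Dom S f1) (Dom S f2) (pbo H f1 A1) (pbo H f2 A2)) \<longleftrightarrow>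
   (let Q = Prd S (Dom S f1) (Dom S f2) in
     Cmp (Fib H Q) (pba H (prd_arr S f1 f2) (cT (Cod S f1) (Cod S f2) A1 A2)) (xm T f1 f2 A1 A2) =
     Cmp (Fib H Q) (ident S H (pswap S (Dom S f1) (Dom S f2)) (prd_arr S f2 f1) (prd_arr S f1 f2) (pswap S (Cod S f1) (Cod S f2)) (xob T (Cod S f2) (Cod S f1) A2 A1))
      (Cmp (Fib H Q) (pba H (pswap S (Dom S f1) (Dom S f2)) (xm T f2 f1 A2 A1)) (cT (Dom S f1) (Dom S f2) (pbo H f1 A1) (pbo H f2 A2))))"
proof -
  let ?Q = "Prd S (Dom S f1) (Dom S f2)"
  have Z: "category (Fib H ?Q)" using assms by (simp add: fib_simps prd_simps)
  \<comment> \<open>The axiom ends in an iterated pullback, the equation in \<open>G\<close> in the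
    pullback along the composite arrow; the last connection isomorphism has to be moved
    across.\<close>
  show ?thesis
    using category.Inv_move[OF Z, of "conn H (prd_arr S f1 f2) (pswap S (Cod S f1) (Cod S f2)) (xob T (Cod S f2) (Cod S f1) A2 A1)"
      "Cmp (Fib H ?Q) (pba H (prd_arr S f1 f2) (cT (Cod S f1) (Cod S f2) A1 A2)) (xm T f1 f2 A1 A2)"
      "Cmp (Fib H ?Q) (Inv (Fib H ?Q) (conn H (pswap S (Dom S f1) (Dom S f2)) (prd_arr S f2 f1) (xob T (Cod S f2) (Cod S f1) A2 A1)))
        (Cmp (Fib H ?Q) (pba H (pswap S (Dom S f1) (Dom S f2)) (xm T f2 f1 A2 A1)) (cT (Dom S f1) (Dom S f2) (pbo H f1 A1) (pbo H f2 A2)))"]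
    by (simp add: und_all assms prd_nat ident_def Let_def)
qed

lemma nat_r_iff:
  assumes "Unitary \<in> K" "X1 \<in> Obj S" "X2 \<in> Obj S" "v \<in> Arr (Fib H X1)"
  shows "Cmp G (dr X1 X2 (Cod (Fib H X1) v)) (ba (dec X1 v) (Ide G (emb X2 (sob uT X2)))) =
     Cmp G (gpa (Pr1 S X1 X2) (dec X1 v)) (dr X1 X2 (Dom (Fib H X1) v)) \<longleftrightarrow>
   Cmp (Fib H (Prd S X1 X2)) (xur uT X1 X2 (Cod (Fib H X1) v)) (xar T X1 X2 v (Ide (Fib H X2) (sob uT X2))) =
   Cmp (Fib H (Prd S X1 X2)) (pba H (Pr1 S X1 X2) v) (xur uT X1 X2 (Dom (Fib H X1) v))"
  by (simp add: und_all assms)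

lemma nat_l_iff:
  assumes "Unitary \<in> K" "X1 \<in> Obj S" "X2 \<in> Obj S" "v \<in> Arr (Fib H X2)"
  shows "Cmp G (dl X1 X2 (Cod (Fib H X2) v)) (ba (Ide G (emb X1 (sob uT X1))) (dec X2 v)) =
     Cmp G (gpa (Pr2 S X1 X2) (dec X2 v)) (dl X1 X2 (Dom (Fib H X2) v)) \<longleftrightarrow>
   Cmp (Fib H (Prd S X1 X2)) (xul uT X1 X2 (Cod (Fib H X2) v)) (xar T X1 X2 (Ide (Fib H X1) (sob uT X1)) v) =
   Cmp (Fib H (Prd S X1 X2)) (pba H (Pr2 S X1 X2) v) (xul uT X1 X2 (Dom (Fib H X2) v))"
  by (simp add: und_all assms)

lemma agree_iff:
  assumes "Unitary \<in> K" "X1 \<in> Obj S" "X2 \<in> Obj S"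
  shows "Cmp G (sr lift_ext (Pr1 S X1 X2)) (dr X1 X2 (sob uT X1)) = Cmp G (sr lift_ext (Pr2 S X1 X2)) (dl X1 X2 (sob uT X2)) \<longleftrightarrow>
   Cmp (Fib H (Prd S X1 X2)) (sar uT (Pr1 S X1 X2)) (xur uT X1 X2 (sob uT X1)) =
   Cmp (Fib H (Prd S X1 X2)) (sar uT (Pr2 S X1 X2)) (xul uT X1 X2 (sob uT X2))"
  by (simp add: und_all assms ext_sel)

lemma m_r_iff:
  assumes "Unitary \<in> K" "f1 \<in> Arr S" "f2 \<in> Arr S" "A1 \<in> Obj (Fib H (Cod S f1))"
  shows "Cmp G (gpa (prd_arr S f1 f2) (dr (Cod S f1) (Cod S f2) A1)) (ba (lam f1 A1) (lam f2 (sob uT (Cod S f2)))) =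
    Cmp G (gpa (Pr1 S (Dom S f1) (Dom S f2)) (lam f1 A1)) (Cmp G (dr (Dom S f1) (Dom S f2) (pbo H f1 A1))
      (ba (Ide G (emb (Dom S f1) (pbo H f1 A1))) (dec (Dom S f2) (sar uT f2)))) \<longleftrightarrow>
   (let Q = Prd S (Dom S f1) (Dom S f2) in
     Cmp (Fib H Q) (pba H (prd_arr S f1 f2) (xur uT (Cod S f1) (Cod S f2) A1)) (xm T f1 f2 A1 (sob uT (Cod S f2))) =
     Cmp (Fib H Q) (ident S H (Pr1 S (Dom S f1) (Dom S f2)) f1 (prd_arr S f1 f2) (Pr1 S (Cod S f1) (Cod S f2)) A1)
      (Cmp (Fib H Q) (xur uT (Dom S f1) (Dom S f2) (pbo H f1 A1)) (xar T (Dom S f1) (Dom S f2) (Ide (Fib H (Dom S f1)) (pbo H f1 A1)) (sar uT f2))))"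
proof -
  let ?Q = "Prd S (Dom S f1) (Dom S f2)"
  have Z: "category (Fib H ?Q)" using assms by (simp add: fib_simps prd_simps)
  show ?thesis
    using category.Inv_move[OF Z, of "conn H (prd_arr S f1 f2) (Pr1 S (Cod S f1) (Cod S f2)) A1"
      "Cmp (Fib H ?Q) (pba H (prd_arr S f1 f2) (xur uT (Cod S f1) (Cod S f2) A1)) (xm T f1 f2 A1 (sob uT (Cod S f2)))"
      "Cmp (Fib H ?Q) (Inv (Fib H ?Q) (conn H (Pr1 S (Dom S f1) (Dom S f2)) f1 A1))
        (Cmp (Fib H ?Q) (xur uT (Dom S f1) (Dom S f2) (pbo H f1 A1)) (xar T (Dom S f1) (Dom S f2) (Ide (Fib H (Dom S f1)) (pbo H f1 A1)) (sar uT f2)))"]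
    by (simp add: und_all assms ident_def Let_def)
qed

lemma m_l_iff:
  assumes "Unitary \<in> K" "f1 \<in> Arr S" "f2 \<in> Arr S" "A2 \<in> Obj (Fib H (Cod S f2))"
  shows "Cmp G (gpa (prd_arr S f1 f2) (dl (Cod S f1) (Cod S f2) A2)) (ba (lam f1 (sob uT (Cod S f1))) (lam f2 A2)) =
    Cmp G (gpa (Pr2 S (Dom S f1) (Dom S f2)) (lam f2 A2)) (Cmp G (dl (Dom S f1) (Dom S f2) (pbo H f2 A2))
      (ba (dec (Dom S f1) (sar uT f1)) (Ide G (emb (Dom S f2) (pbo H f2 A2))))) \<longleftrightarrow>
   (let Q = Prd S (Dom S f1) (Dom S f2) in
     Cmp (Fib H Q) (pba H (prd_arr S f1 f2) (xul uT (Cod S f1) (Cod S f2) A2)) (xm T f1 f2 (sob uT (Cod S f1)) A2) =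
     Cmp (Fib H Q) (ident S H (Pr2 S (Dom S f1) (Dom S f2)) f2 (prd_arr S f1 f2) (Pr2 S (Cod S f1) (Cod S f2)) A2)
      (Cmp (Fib H Q) (xul uT (Dom S f1) (Dom S f2) (pbo H f2 A2)) (xar T (Dom S f1) (Dom S f2) (sar uT f1) (Ide (Fib H (Dom S f2)) (pbo H f2 A2)))))"
proof -
  let ?Q = "Prd S (Dom S f1) (Dom S f2)"
  have Z: "category (Fib H ?Q)" using assms by (simp add: fib_simps prd_simps)
  show ?thesis
    using category.Inv_move[OF Z, of "conn H (prd_arr S f1 f2) (Pr2 S (Cod S f1) (Cod S f2)) A2"
      "Cmp (Fib H ?Q) (pba H (prd_arr S f1 f2) (xul uT (Cod S f1) (Cod S f2) A2)) (xm T f1 f2 (sob uT (Cod S f1)) A2)"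
      "Cmp (Fib H ?Q) (Inv (Fib H ?Q) (conn H (Pr2 S (Dom S f1) (Dom S f2)) f2 A2))
        (Cmp (Fib H ?Q) (xul uT (Dom S f1) (Dom S f2) (pbo H f2 A2)) (xar T (Dom S f1) (Dom S f2) (sar uT f1) (Ide (Fib H (Dom S f2)) (pbo H f2 A2))))"]
    by (simp add: und_all assms ident_def Let_def)
qed

lemma hexagon_iff:
  assumes "Associative \<in> K" "Symmetric \<in> K" "X1 \<in> Obj S" "X2 \<in> Obj S" "X3 \<in> Obj S"
    "A1 \<in> Obj (Fib H X1)" "A2 \<in> Obj (Fib H X2)" "A3 \<in> Obj (Fib H X3)"
  shows "Cmp G (gpa (prd_arr S (pswap S X1 X2) (Ide S X3)) (gpa (passoc S X2 X1 X3) (ba (Ide G (emb X2 A2)) (dc X1 X3 A1 A3))))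
       (Cmp G (gpa (prd_arr S (pswap S X1 X2) (Ide S X3)) (da X2 X1 X3 A2 A1 A3)) (ba (dc X1 X2 A1 A2) (Ide G (emb X3 A3)))) =
     Cmp G (gpa (passoc S X1 X2 X3) (gpa (pswap S X1 (Prd S X2 X3)) (da X2 X3 X1 A2 A3 A1)))
      (Cmp G (gpa (passoc S X1 X2 X3) (dc X1 (Prd S X2 X3) A1 (xob T X2 X3 A2 A3))) (da X1 X2 X3 A1 A2 A3)) \<longleftrightarrow>
     (let Q = Prd S (Prd S X1 X2) X3; t = prd_arr S (pswap S X1 X2) (Ide S X3); A = xob T X2 (Prd S X3 X1) A2 (xob T X3 X1 A3 A1) in
      Cmp (Fib H Q) (Inv (Fib H Q) (conn3 S H t (passoc S X2 X1 X3) (prd_arr S (Ide S X2) (pswap S X1 X3)) A))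
       (Cmp (Fib H Q) (pba H t (pba H (passoc S X2 X1 X3) (xm T (Ide S X2) (pswap S X1 X3) A2 (xob T X3 X1 A3 A1))))
       (Cmp (Fib H Q) (pba H t (pba H (passoc S X2 X1 X3) (xar T X2 (Prd S X1 X3) (Ide (Fib H X2) A2) (cT X1 X3 A1 A3))))
       (Cmp (Fib H Q) (pba H t (aT X2 X1 X3 A2 A1 A3))
       (Cmp (Fib H Q) (xm T (pswap S X1 X2) (Ide S X3) (xob T X2 X1 A2 A1) A3)
         (xar T (Prd S X1 X2) X3 (cT X1 X2 A1 A2) (Ide (Fib H X3) A3)))))) =
      Cmp (Fib H Q) (Inv (Fib H Q) (conn3 S H (passoc S X1 X2 X3) (pswap S X1 (Prd S X2 X3)) (passoc S X2 X3 X1) A))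
       (Cmp (Fib H Q) (pba H (passoc S X1 X2 X3) (pba H (pswap S X1 (Prd S X2 X3)) (aT X2 X3 X1 A2 A3 A1)))
       (Cmp (Fib H Q) (pba H (passoc S X1 X2 X3) (cT X1 (Prd S X2 X3) A1 (xob T X2 X3 A2 A3)))
         (aT X1 X2 X3 A1 A2 A3))))"
  by (simp add: und_all assms prd_equations conn3_def Let_def)

lemma au_iff:
  assumes "Associative \<in> K" "Unitary \<in> K" "X1 \<in> Obj S" "X2 \<in> Obj S" "X3 \<in> Obj S"
  shows "A2 \<in> Obj (Fib H X2) \<Longrightarrow> A3 \<in> Obj (Fib H X3) \<Longrightarrow>
    Cmp G (gpa (passoc S X1 X2 X3) (dl X1 (Prd S X2 X3) (xob T X2 X3 A2 A3))) (da X1 X2 X3 (sob uT X1) A2 A3) = ba (dl X1 X2 A2) (Ide G (emb X3 A3)) \<longleftrightarrow>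
    (let Q = Prd S (Prd S X1 X2) X3 in
      Cmp (Fib H Q) (Inv (Fib H Q) (conn H (passoc S X1 X2 X3) (Pr2 S X1 (Prd S X2 X3)) (xob T X2 X3 A2 A3)))
       (Cmp (Fib H Q) (pba H (passoc S X1 X2 X3) (xul uT X1 (Prd S X2 X3) (xob T X2 X3 A2 A3))) (aT X1 X2 X3 (sob uT X1) A2 A3)) =
      Cmp (Fib H Q) (xm T (Pr2 S X1 X2) (Ide S X3) A2 A3) (xar T (Prd S X1 X2) X3 (xul uT X1 X2 A2) (Ide (Fib H X3) A3)))"
   and "A1 \<in> Obj (Fib H X1) \<Longrightarrow> A3 \<in> Obj (Fib H X3) \<Longrightarrow>
    Cmp G (gpa (passoc S X1 X2 X3) (ba (Ide G (emb X1 A1)) (dl X2 X3 A3))) (da X1 X2 X3 A1 (sob uT X2) A3) = ba (dr X1 X2 A1) (Ide G (emb X3 A3)) \<longleftrightarrow>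
    (let Q = Prd S (Prd S X1 X2) X3 in
      Cmp (Fib H Q) (Inv (Fib H Q) (conn H (passoc S X1 X2 X3) (prd_arr S (Ide S X1) (Pr2 S X2 X3)) (xob T X1 X3 A1 A3)))
       (Cmp (Fib H Q) (pba H (passoc S X1 X2 X3) (xm T (Ide S X1) (Pr2 S X2 X3) A1 A3))
       (Cmp (Fib H Q) (pba H (passoc S X1 X2 X3) (xar T X1 (Prd S X2 X3) (Ide (Fib H X1) A1) (xul uT X2 X3 A3))) (aT X1 X2 X3 A1 (sob uT X2) A3))) =
      Cmp (Fib H Q) (xm T (Pr1 S X1 X2) (Ide S X3) A1 A3) (xar T (Prd S X1 X2) X3 (xur uT X1 X2 A1) (Ide (Fib H X3) A3)))"
   and "A1 \<in> Obj (Fib H X1) \<Longrightarrow> A2 \<in> Obj (Fib H X2) \<Longrightarrow>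
    Cmp G (gpa (passoc S X1 X2 X3) (ba (Ide G (emb X1 A1)) (dr X2 X3 A2))) (da X1 X2 X3 A1 A2 (sob uT X3)) = dr (Prd S X1 X2) X3 (xob T X1 X2 A1 A2) \<longleftrightarrow>
    (let Q = Prd S (Prd S X1 X2) X3 in
      Cmp (Fib H Q) (Inv (Fib H Q) (conn H (passoc S X1 X2 X3) (prd_arr S (Ide S X1) (Pr1 S X2 X3)) (xob T X1 X2 A1 A2)))
       (Cmp (Fib H Q) (pba H (passoc S X1 X2 X3) (xm T (Ide S X1) (Pr1 S X2 X3) A1 A2))
       (Cmp (Fib H Q) (pba H (passoc S X1 X2 X3) (xar T X1 (Prd S X2 X3) (Ide (Fib H X1) A1) (xur uT X2 X3 A2))) (aT X1 X2 X3 A1 A2 (sob uT X3)))) =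
      xur uT (Prd S X1 X2) X3 (xob T X1 X2 A1 A2))"
  by (simp_all add: und_all assms prd_equations Let_def)

lemma cu_iff:
  assumes "Symmetric \<in> K" "Unitary \<in> K" "X1 \<in> Obj S" "X2 \<in> Obj S" "B \<in> Obj (Fib H X2)"
  shows "Cmp G (gpa (pswap S X1 X2) (dr X2 X1 B)) (dc X1 X2 (sob uT X1) B) = dl X1 X2 B \<longleftrightarrow>
    Cmp (Fib H (Prd S X1 X2)) (Inv (Fib H (Prd S X1 X2)) (conn H (pswap S X1 X2) (Pr1 S X2 X1) B))
     (Cmp (Fib H (Prd S X1 X2)) (pba H (pswap S X1 X2) (xur uT X2 X1 B)) (cT X1 X2 (sob uT X1) B)) = xul uT X1 X2 B"
  by (simp add: und_all assms prd_equations(6)[OF assms(3,4,4)])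

end

text \<open>Naturality extends along isomorphisms \<open>l\<close>, \<open>l'\<close> with \<open>u l = l' d\<close> to which two functors
  \<open>F\<close> and \<open>F'\<close> have been applied.\<close>

lemma (in category) nat_extend:
  assumes "Cmp C Fu Fl = Cmp C Fl' Fd" "Cmp C F'u F'l = Cmp C F'l' F'd" "Cmp C sa Fl = Cmp C F'l sea"
    "Cmp C sb Fl' = Cmp C F'l' seb" "Cmp C seb Fd = Cmp C F'd sea" "isoar C Fl"
    and t: "Fu \<in> Arr C" "Fl' \<in> Arr C" "Fd \<in> Arr C" "F'u \<in> Arr C" "F'l \<in> Arr C" "F'l' \<in> Arr C" "F'd \<in> Arr C"
    "sa \<in> Arr C" "sb \<in> Arr C" "sea \<in> Arr C" "seb \<in> Arr C"
    "Dom C Fu = Cod C Fl" "Dom C Fl' = Cod C Fd" "Dom C F'u = Cod C F'l" "Dom C F'l' = Cod C F'd"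
    "Dom C sa = Cod C Fl" "Dom C F'l = Cod C sea" "Dom C sb = Cod C Fl'" "Dom C F'l' = Cod C seb"
    "Dom C seb = Cod C Fd" "Dom C F'd = Cod C sea" "Dom C sb = Cod C Fu" "Dom C F'u = Cod C sa"
  shows "Cmp C sb Fu = Cmp C F'u sa"
proof -
  have Fl: "Fl \<in> Arr C" using assms(6) by (rule isoar_arr)
  note re = reassoc
  have "Cmp C (Cmp C sb Fu) Fl = Cmp C (Cmp C sb Fl') Fd"
    using t Fl assms(1) by (simp add: Cmp_assoc)
  also have "\<dots> = Cmp C F'l' (Cmp C seb Fd)"
    using t unfolding assms(4) by (simp add: Cmp_assoc)
  also have "\<dots> = Cmp C (Cmp C F'l' F'd) sea"
    using t unfolding assms(5) by (simp add: Cmp_assoc)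
  also have "\<dots> = Cmp C F'u (Cmp C F'l sea)"
    using t unfolding assms(2)[symmetric] by (simp add: Cmp_assoc)
  also have "\<dots> = Cmp C (Cmp C F'u sa) Fl"
    using t Fl unfolding assms(3)[symmetric] by (simp add: Cmp_assoc)
  finally have eq: "Cmp C (Cmp C sb Fu) Fl = Cmp C (Cmp C F'u sa) Fl" .
  show ?thesis
    by (rule Cmp_right_cancel[OF assms(6) _ _ _ _ eq]) (use t Fl in \<open>simp_all add: Cmp_arr Cmp_dom Cmp_cod\<close>)
qed

context external_typed
begin

lemma xta_isoar:
  assumes "isoar G u" "isoar G v" "gbs (Dom G v) = gbs (Dom G u)"
  shows "isoar G (xta u v)"
  by (rule tot.inverseI(1)[where v = "xta (Inv G u) (Inv G v)"])
    (use assms in \<open>simp_all add: xta_simps vert_simps xta_Ide flip: xta_Cmp\<close>)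

end

section \<open>The lift of an external structure satisfies the laws\<close>

locale external_structure = fibered_over_products S H
  for S :: "('s, 'f) pcat" and H :: "('s, 'f, 'o, 'a) fib" +
  fixes K :: "tensor_property set" and T :: "('s, 'f, 'o, 'a) K_ext"
  assumes K_ext: "K_external S H K T"
begin

sublocale external_base S H T
  using K_ext by unfold_locales (simp add: K_external_def)

lemma T_assoc: "Associative \<in> K \<Longrightarrow> external_assoc S H T aT"
  and T_comm: "Symmetric \<in> K \<Longrightarrow> external_comm S H T cT"
  and T_unit: "Unitary \<in> K \<Longrightarrow> external_unit S H T uT"
  and T_ac: "Associative \<in> K \<Longrightarrow> Symmetric \<in> K \<Longrightarrow> external_compat_ac S H T aT cT"
  and T_au: "Associative \<in> K \<Longrightarrow> Unitary \<in> K \<Longrightarrow> external_compat_au S H T aT uT"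
  and T_cu: "Symmetric \<in> K \<Longrightarrow> Unitary \<in> K \<Longrightarrow> external_compat_cu S H cT uT"
  using K_ext by (auto simp: K_external_def)

sublocale external_typed S H T K
proof (unfold_locales, goal_cases)
  case (1 X1 X2 X3 A1 A2 A3)
  then have "isoar (Fib H (Prd S (Prd S X1 X2) X3)) (aT X1 X2 X3 A1 A2 A3)"
    "Dom (Fib H (Prd S (Prd S X1 X2) X3)) (aT X1 X2 X3 A1 A2 A3) = xob T (Prd S X1 X2) X3 (xob T X1 X2 A1 A2) A3"
    "Cod (Fib H (Prd S (Prd S X1 X2) X3)) (aT X1 X2 X3 A1 A2 A3) = pbo H (passoc S X1 X2 X3) (xob T X1 (Prd S X2 X3) A1 (xob T X2 X3 A2 A3))"
    using T_assoc by (auto simp: external_assoc_def frozen3_iff)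
  then show ?case using 1 by (simp add: da_def emb_def b_simps)
next
  case (2 X1 X2 A1 A2)
  then have "isoar (Fib H (Prd S X1 X2)) (cT X1 X2 A1 A2)"
    "Dom (Fib H (Prd S X1 X2)) (cT X1 X2 A1 A2) = xob T X1 X2 A1 A2"
    "Cod (Fib H (Prd S X1 X2)) (cT X1 X2 A1 A2) = pbo H (pswap S X1 X2) (xob T X2 X1 A2 A1)"
    using T_comm by (auto simp: external_comm_def frozen_iff)
  then show ?case using 2 by (simp add: dc_def emb_def b_simps)
next
  case 3
  then show ?case using T_unit by (simp add: external_unit_def)
next
  case (4 X1 X2 A1)
  then have "isoar (Fib H (Prd S X1 X2)) (xur uT X1 X2 A1)"
    "Dom (Fib H (Prd S X1 X2)) (xur uT X1 X2 A1) = xob T X1 X2 A1 (sob uT X2)"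
    "Cod (Fib H (Prd S X1 X2)) (xur uT X1 X2 A1) = pbo H (Pr1 S X1 X2) A1"
    "sob uT X2 \<in> Obj (Fib H X2)"
    using T_unit by (auto simp: external_unit_def is_section_def frozen1_iff)
  then show ?case using 4 by (simp add: dr_def emb_def b_simps)
next
  case (5 X1 X2 A2)
  then have "isoar (Fib H (Prd S X1 X2)) (xul uT X1 X2 A2)"
    "Dom (Fib H (Prd S X1 X2)) (xul uT X1 X2 A2) = xob T X1 X2 (sob uT X1) A2"
    "Cod (Fib H (Prd S X1 X2)) (xul uT X1 X2 A2) = pbo H (Pr2 S X1 X2) A2"
    "sob uT X1 \<in> Obj (Fib H X1)"
    using T_unit by (auto simp: external_unit_def is_section_def frozen1_iff)
  then show ?case using 5 by (simp add: dl_def emb_def b_simps)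
qed

lemma nat_a:
  assumes "Associative \<in> K" "X1 \<in> Obj S" "X2 \<in> Obj S" "X3 \<in> Obj S" "u \<in> Arr (Fib H X1)" "v \<in> Arr (Fib H X2)" "w \<in> Arr (Fib H X3)"
  shows "Cmp G (da X1 X2 X3 (Cod (Fib H X1) u) (Cod (Fib H X2) v) (Cod (Fib H X3) w)) (ba (ba (dec X1 u) (dec X2 v)) (dec X3 w)) =
     Cmp G (gpa (passoc S X1 X2 X3) (ba (dec X1 u) (ba (dec X2 v) (dec X3 w)))) (da X1 X2 X3 (Dom (Fib H X1) u) (Dom (Fib H X2) v) (Dom (Fib H X3) w))"
  unfolding nat_a_iff[OF assms]
  by (rule T_assoc[OF assms(1), unfolded external_assoc_def frozen3_iff, THEN conjunct1, rule_format, THEN conjunct2, rule_format, OF assms(2-7)])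

lemma pentagon_a:
  assumes "Associative \<in> K" "X1 \<in> Obj S" "X2 \<in> Obj S" "X3 \<in> Obj S" "X4 \<in> Obj S"
    "A1 \<in> Obj (Fib H X1)" "A2 \<in> Obj (Fib H X2)" "A3 \<in> Obj (Fib H X3)" "A4 \<in> Obj (Fib H X4)"
  shows "Cmp G (gpa (passoc S (Prd S X1 X2) X3 X4) (da X1 X2 (Prd S X3 X4) A1 A2 (xob T X3 X4 A3 A4))) (da (Prd S X1 X2) X3 X4 (xob T X1 X2 A1 A2) A3 A4) =
     Cmp G (gpa (prd_arr S (passoc S X1 X2 X3) (Ide S X4)) (gpa (passoc S X1 (Prd S X2 X3) X4) (ba (Ide G (emb X1 A1)) (da X2 X3 X4 A2 A3 A4))))
      (Cmp G (gpa (prd_arr S (passoc S X1 X2 X3) (Ide S X4)) (da X1 (Prd S X2 X3) X4 A1 (xob T X2 X3 A2 A3) A4))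
        (ba (da X1 X2 X3 A1 A2 A3) (Ide G (emb X4 A4))))"
  unfolding pentagon_iff[OF assms]
  by (rule T_assoc[OF assms(1), unfolded external_assoc_def, THEN conjunct2, THEN conjunct1, rule_format, OF assms(2-9)])

lemma m_a:
  assumes "Associative \<in> K" "f1 \<in> Arr S" "f2 \<in> Arr S" "f3 \<in> Arr S" "A1 \<in> Obj (Fib H (Cod S f1))" "A2 \<in> Obj (Fib H (Cod S f2))" "A3 \<in> Obj (Fib H (Cod S f3))"
  shows "Cmp G (gpa (prd_arr S (prd_arr S f1 f2) f3) (da (Cod S f1) (Cod S f2) (Cod S f3) A1 A2 A3)) (ba (ba (lam f1 A1) (lam f2 A2)) (lam f3 A3)) =
    Cmp G (gpa (passoc S (Dom S f1) (Dom S f2) (Dom S f3)) (ba (lam f1 A1) (ba (lam f2 A2) (lam f3 A3))))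
     (da (Dom S f1) (Dom S f2) (Dom S f3) (pbo H f1 A1) (pbo H f2 A2) (pbo H f3 A3))"
proof -
  have h: "f \<in> Arr S \<Longrightarrow> f \<in> Hom S (Dom S f) (Cod S f)" for f by (simp add: Hom_iff)
  show ?thesis
    unfolding m_a_iff[OF assms] Let_def
    by (rule T_assoc[OF assms(1), unfolded external_assoc_def Let_def, THEN conjunct2, THEN conjunct2, rule_format,
      OF h[OF assms(2)] h[OF assms(3)] h[OF assms(4)] assms(5-7)])
qed

end

lemmas (in category) arr_simps = dom_obj cod_obj Ide_arr Ide_dom Ide_cod Cmp_arr Cmp_dom Cmp_cod Cmp_Ide Ide_Cmp Cmp_assoc

lemmas (in category_with_binary_products) prd_arr_only = prd_obj Pr1_simps Pr2_simps pair_simps pair_Cmp pair_eta pair_Pr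
  prd_arr_simps prd_arr_Ide passoc_simps pswap_simps diag_simps arr_simps

lemmas (in vertical) vert_arr_only = tot.arr_simps base.arr_simps bs_obj bs_arr pl_obj bs_pl pa_arr pa_dom pa_cod pa_Ide pa_Cmp
  pl_Ide pa_Ide_base pl_pl pa_pa

context external_typed
begin

lemmas q_simps0 = G_Obj_pair gpl_pair real_pair gbs_pair vert_arr_only prd_arr_only d_arr d_dom_cod unit_obj xob_obj pbo_obj pbo_ide emb_def
  bo_pair xto_pair ext_sel xto_simps xta_simps xta_Ide gpa_ba_xta gpa_xta gpl_bo_xto ba_simps bo_simps lam_simps(2,3,4) dec_simps(1,2,3)

lemmas q_simps = q_simps0 lam_simps(2)[unfolded emb_def] dec_simps(2,3)[unfolded emb_def] d_dom_cod[unfolded emb_def]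

lemmas L_simps = xto_simps xta_simps xta_isoar Lam_simps Emb_simps Dec_simps Lam_square vert_simps

end

context external_structure
begin

interpretation t: styped S G gbs gpl gpa K lift_ext
  by (rule styped_ext)

text \<open>Compatibility of associativity with m, pulled back along the triple diagonal of the
  common base.\<close>

lemma sas_Lam:
  assumes "Associative \<in> K" "a \<in> Obj G" "b \<in> Obj G" "c \<in> Obj G" "gbs b = gbs a" "gbs c = gbs a"
  shows "Cmp G (sas lift_ext a b c) (xta (xta (Lam a) (Lam b)) (Lam c)) =
     Cmp G (xta (Lam a) (xta (Lam b) (Lam c))) (sas lift_ext (Emb a) (Emb b) (Emb c))"
proof -
  obtain f1 A1 f2 A2 f3 A3 where o: "a = (f1, A1)" "b = (f2, A2)" "c = (f3, A3)" by (cases a; cases b; cases c)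
  let ?Z = "Dom S f1"
  have s: "f1 \<in> Arr S" "A1 \<in> Obj (Fib H (Cod S f1))" "f2 \<in> Arr S" "A2 \<in> Obj (Fib H (Cod S f2))"
    "f3 \<in> Arr S" "A3 \<in> Obj (Fib H (Cod S f3))" "Dom S f2 = ?Z" "Dom S f3 = ?Z"
    using assms(2-) by (simp_all add: o G_simps)
  let ?h = "pair S (pair S (Ide S ?Z) (Ide S ?Z)) (Ide S ?Z)"
  show ?thesis
    using arg_cong[OF m_a[of f1 f2 f3 A1 A2 A3], of "gpa ?h"]
    by (simp add: o Lam_pair Emb_def q_simps assms(1) s)
qed

text \<open>Naturality of associativity inside one fiber, pulled back along the triple
  diagonal.\<close>

lemma sas_Dec:
  assumes "Associative \<in> K" "u \<in> Arr G" "v \<in> Arr G" "w \<in> Arr G" "gbs (Dom G v) = gbs (Dom G u)" "gbs (Dom G w) = gbs (Dom G u)"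
  shows "Cmp G (sas lift_ext (Emb (Cod G u)) (Emb (Cod G v)) (Emb (Cod G w))) (xta (xta (Dec u) (Dec v)) (Dec w)) =
     Cmp G (xta (Dec u) (xta (Dec v) (Dec w))) (sas lift_ext (Emb (Dom G u)) (Emb (Dom G v)) (Emb (Dom G w)))"
proof -
  let ?Z = "gbs (Dom G u)"
  let ?h = "pair S (pair S (Ide S ?Z) (Ide S ?Z)) (Ide S ?Z)"
  have Z: "?Z \<in> Obj S" using assms by (simp add: vert_simps)
  have n: "und v \<in> Arr (Fib H ?Z)" "Dom (Fib H ?Z) (und v) = real (Dom G v)" "Cod (Fib H ?Z) (und v) = real (Cod G v)"
    "und w \<in> Arr (Fib H ?Z)" "Dom (Fib H ?Z) (und w) = real (Dom G w)" "Cod (Fib H ?Z) (und w) = real (Cod G w)"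
    using und_simps[of v] und_simps[of w] assms by simp_all
  show ?thesis
    using arg_cong[OF nat_a[of ?Z ?Z ?Z "und u" "und v" "und w"], of "gpa ?h"]
    by (simp add: q_simps Emb_def Dec_def assms Z und_simps n real_obj)
qed

text \<open>This is no pullback of the naturality axiom, since an arrow of \<open>G\<close> need not
  come from arrows between the objects that are being pulled back. Conjugation by \<open>Lam\<close>
  splits it into compatibility with m, on the arrows \<open>Lam\<close>, and naturality in a fiber,
  on the arrows \<open>Dec\<close>.\<close>

lemma sas_nat_ext:
  assumes "Associative \<in> K" "u \<in> Arr G" "v \<in> Arr G" "w \<in> Arr G" "gbs (Dom G v) = gbs (Dom G u)" "gbs (Dom G w) = gbs (Dom G u)"
  shows "Cmp G (sas lift_ext (Cod G u) (Cod G v) (Cod G w)) (xta (xta u v) w) = Cmp G (xta u (xta v w)) (sas lift_ext (Dom G u) (Dom G v) (Dom G w))"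
proof (rule tot.nat_extend[OF _ _ sas_Lam sas_Lam sas_Dec])
  show "Cmp G (xta (xta u v) w) (xta (xta (Lam (Dom G u)) (Lam (Dom G v))) (Lam (Dom G w))) =
      Cmp G (xta (xta (Lam (Cod G u)) (Lam (Cod G v))) (Lam (Cod G w))) (xta (xta (Dec u) (Dec v)) (Dec w))"
    using assms by (simp add: L_simps flip: xta_Cmp)
  show "Cmp G (xta u (xta v w)) (xta (Lam (Dom G u)) (xta (Lam (Dom G v)) (Lam (Dom G w)))) =
      Cmp G (xta (Lam (Cod G u)) (xta (Lam (Cod G v)) (Lam (Cod G w)))) (xta (Dec u) (xta (Dec v) (Dec w)))"
    using assms by (simp add: L_simps flip: xta_Cmp)
qed (use assms in \<open>simp_all add: L_simps t.typ_simps[unfolded ext_sel(1,2)]\<close>)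

lemma nat_c:
  assumes "Symmetric \<in> K" "X1 \<in> Obj S" "X2 \<in> Obj S" "u \<in> Arr (Fib H X1)" "v \<in> Arr (Fib H X2)"
  shows "Cmp G (dc X1 X2 (Cod (Fib H X1) u) (Cod (Fib H X2) v)) (ba (dec X1 u) (dec X2 v)) =
     Cmp G (gpa (pswap S X1 X2) (ba (dec X2 v) (dec X1 u))) (dc X1 X2 (Dom (Fib H X1) u) (Dom (Fib H X2) v))"
  unfolding nat_c_iff[OF assms]
  by (rule T_comm[OF assms(1), unfolded external_comm_def nat_iso2_iff, THEN conjunct1, rule_format, THEN conjunct2, rule_format, OF assms(2-5)])

lemma Hom_self: "f \<in> Arr S \<Longrightarrow> f \<in> Hom S (Dom S f) (Cod S f)"
  by (simp add: Hom_iff)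

lemma inv_c:
  assumes "Symmetric \<in> K" "X1 \<in> Obj S" "X2 \<in> Obj S" "A1 \<in> Obj (Fib H X1)" "A2 \<in> Obj (Fib H X2)"
  shows "Cmp G (gpa (pswap S X1 X2) (dc X2 X1 A2 A1)) (dc X1 X2 A1 A2) = Ide G (emb (Prd S X1 X2) (xob T X1 X2 A1 A2))"
  unfolding inv_c_iff[OF assms]
  by (rule T_comm[OF assms(1), unfolded external_comm_def, THEN conjunct2, THEN conjunct1, rule_format, OF assms(2-5)])

lemma m_c:
  assumes "Symmetric \<in> K" "f1 \<in> Arr S" "f2 \<in> Arr S" "A1 \<in> Obj (Fib H (Cod S f1))" "A2 \<in> Obj (Fib H (Cod S f2))"
  shows "Cmp G (gpa (prd_arr S f1 f2) (dc (Cod S f1) (Cod S f2) A1 A2)) (ba (lam f1 A1) (lam f2 A2)) =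
    Cmp G (gpa (pswap S (Dom S f1) (Dom S f2)) (ba (lam f2 A2) (lam f1 A1))) (dc (Dom S f1) (Dom S f2) (pbo H f1 A1) (pbo H f2 A2))"
  unfolding m_c_iff[OF assms] Let_def
  by (rule T_comm[OF assms(1), unfolded external_comm_def, THEN conjunct2, THEN conjunct2, rule_format,
      OF assms(2,3)[THEN Hom_self] assms(4,5)])

lemma nat_r:
  assumes "Unitary \<in> K" "X1 \<in> Obj S" "X2 \<in> Obj S" "v \<in> Arr (Fib H X1)"
  shows "Cmp G (dr X1 X2 (Cod (Fib H X1) v)) (ba (dec X1 v) (Ide G (emb X2 (sob uT X2)))) =
     Cmp G (gpa (Pr1 S X1 X2) (dec X1 v)) (dr X1 X2 (Dom (Fib H X1) v))"
  unfolding nat_r_iff[OF assms]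
  by (rule T_unit[OF assms(1), unfolded external_unit_def nat_iso_iff, THEN conjunct2, THEN conjunct1,
    rule_format, THEN conjunct2, rule_format, OF assms(2-4)])

lemma nat_l:
  assumes "Unitary \<in> K" "X1 \<in> Obj S" "X2 \<in> Obj S" "v \<in> Arr (Fib H X2)"
  shows "Cmp G (dl X1 X2 (Cod (Fib H X2) v)) (ba (Ide G (emb X1 (sob uT X1))) (dec X2 v)) =
     Cmp G (gpa (Pr2 S X1 X2) (dec X2 v)) (dl X1 X2 (Dom (Fib H X2) v))"
  unfolding nat_l_iff[OF assms]
  by (rule T_unit[OF assms(1), unfolded external_unit_def nat_iso_iff, THEN conjunct2, THEN conjunct2, THEN conjunct1,
    rule_format, THEN conjunct2, rule_format, OF assms(2-4)])

lemma agree_u: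
  assumes "Unitary \<in> K" "X1 \<in> Obj S" "X2 \<in> Obj S"
  shows "Cmp G (sr lift_ext (Pr1 S X1 X2)) (dr X1 X2 (sob uT X1)) = Cmp G (sr lift_ext (Pr2 S X1 X2)) (dl X1 X2 (sob uT X2))"
  unfolding agree_iff[OF assms]
  by (rule T_unit[OF assms(1), unfolded external_unit_def, THEN conjunct2, THEN conjunct2, THEN conjunct2, THEN conjunct1,
    rule_format, OF assms(2-3)])

lemma m_r:
  assumes "Unitary \<in> K" "f1 \<in> Arr S" "f2 \<in> Arr S" "A1 \<in> Obj (Fib H (Cod S f1))"
  shows "Cmp G (gpa (prd_arr S f1 f2) (dr (Cod S f1) (Cod S f2) A1)) (ba (lam f1 A1) (lam f2 (sob uT (Cod S f2)))) =
    Cmp G (gpa (Pr1 S (Dom S f1) (Dom S f2)) (lam f1 A1)) (Cmp G (dr (Dom S f1) (Dom S f2) (pbo H f1 A1))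
      (ba (Ide G (emb (Dom S f1) (pbo H f1 A1))) (dec (Dom S f2) (sar uT f2))))"
  unfolding m_r_iff[OF assms] Let_def
  by (rule T_unit[OF assms(1), unfolded external_unit_def, THEN conjunct2, THEN conjunct2, THEN conjunct2, THEN conjunct2, THEN conjunct1,
    rule_format, OF assms(2,3)[THEN Hom_self] assms(4)])

lemma m_l:
  assumes "Unitary \<in> K" "f1 \<in> Arr S" "f2 \<in> Arr S" "A2 \<in> Obj (Fib H (Cod S f2))"
  shows "Cmp G (gpa (prd_arr S f1 f2) (dl (Cod S f1) (Cod S f2) A2)) (ba (lam f1 (sob uT (Cod S f1))) (lam f2 A2)) =
    Cmp G (gpa (Pr2 S (Dom S f1) (Dom S f2)) (lam f2 A2)) (Cmp G (dl (Dom S f1) (Dom S f2) (pbo H f2 A2))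
      (ba (dec (Dom S f1) (sar uT f1)) (Ide G (emb (Dom S f2) (pbo H f2 A2)))))"
  unfolding m_l_iff[OF assms] Let_def
  by (rule T_unit[OF assms(1), unfolded external_unit_def, THEN conjunct2, THEN conjunct2, THEN conjunct2, THEN conjunct2, THEN conjunct2,
    rule_format, OF assms(2,3)[THEN Hom_self] assms(4)])

lemma hexagon_ac:
  assumes "Associative \<in> K" "Symmetric \<in> K" "X1 \<in> Obj S" "X2 \<in> Obj S" "X3 \<in> Obj S"
    "A1 \<in> Obj (Fib H X1)" "A2 \<in> Obj (Fib H X2)" "A3 \<in> Obj (Fib H X3)"
  shows "Cmp G (gpa (prd_arr S (pswap S X1 X2) (Ide S X3)) (gpa (passoc S X2 X1 X3) (ba (Ide G (emb X2 A2)) (dc X1 X3 A1 A3))))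
       (Cmp G (gpa (prd_arr S (pswap S X1 X2) (Ide S X3)) (da X2 X1 X3 A2 A1 A3)) (ba (dc X1 X2 A1 A2) (Ide G (emb X3 A3)))) =
     Cmp G (gpa (passoc S X1 X2 X3) (gpa (pswap S X1 (Prd S X2 X3)) (da X2 X3 X1 A2 A3 A1)))
      (Cmp G (gpa (passoc S X1 X2 X3) (dc X1 (Prd S X2 X3) A1 (xob T X2 X3 A2 A3))) (da X1 X2 X3 A1 A2 A3))"
  unfolding hexagon_iff[OF assms]
  by (rule T_ac[OF assms(1,2), unfolded external_compat_ac_def, rule_format, OF assms(3-8)])

lemma au:
  assumes "Associative \<in> K" "Unitary \<in> K" "X1 \<in> Obj S" "X2 \<in> Obj S" "X3 \<in> Obj S"
  shows "A2 \<in> Obj (Fib H X2) \<Longrightarrow> A3 \<in> Obj (Fib H X3) \<Longrightarrow>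
    Cmp G (gpa (passoc S X1 X2 X3) (dl X1 (Prd S X2 X3) (xob T X2 X3 A2 A3))) (da X1 X2 X3 (sob uT X1) A2 A3) = ba (dl X1 X2 A2) (Ide G (emb X3 A3))"
   and "A1 \<in> Obj (Fib H X1) \<Longrightarrow> A3 \<in> Obj (Fib H X3) \<Longrightarrow>
    Cmp G (gpa (passoc S X1 X2 X3) (ba (Ide G (emb X1 A1)) (dl X2 X3 A3))) (da X1 X2 X3 A1 (sob uT X2) A3) = ba (dr X1 X2 A1) (Ide G (emb X3 A3))"
   and "A1 \<in> Obj (Fib H X1) \<Longrightarrow> A2 \<in> Obj (Fib H X2) \<Longrightarrow>
    Cmp G (gpa (passoc S X1 X2 X3) (ba (Ide G (emb X1 A1)) (dr X2 X3 A2))) (da X1 X2 X3 A1 A2 (sob uT X3)) = dr (Prd S X1 X2) X3 (xob T X1 X2 A1 A2)"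
  using au_iff(1)[OF assms, THEN iffD2, OF _ _ T_au[OF assms(1,2), unfolded external_compat_au_def, THEN conjunct1, rule_format, OF assms(3-5)]]
    au_iff(2)[OF assms, THEN iffD2, OF _ _ T_au[OF assms(1,2), unfolded external_compat_au_def, THEN conjunct2, THEN conjunct1, rule_format, OF assms(3-5)]]
    au_iff(3)[OF assms, THEN iffD2, OF _ _ T_au[OF assms(1,2), unfolded external_compat_au_def, THEN conjunct2, THEN conjunct2, rule_format, OF assms(3-5)]]
  by blast+

lemma cu:
  assumes "Symmetric \<in> K" "Unitary \<in> K" "X1 \<in> Obj S" "X2 \<in> Obj S" "B \<in> Obj (Fib H X2)"
  shows "Cmp G (gpa (pswap S X1 X2) (dr X2 X1 B)) (dc X1 X2 (sob uT X1) B) = dl X1 X2 B"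
  unfolding cu_iff[OF assms]
  by (rule T_cu[OF assms(1,2), unfolded external_compat_cu_def, rule_format, OF assms(3-5)])

end

context external_typed
begin

text \<open>Again an isomorphism that the cocycle condition makes idempotent.\<close>

lemma sar_Ide:
  assumes "Unitary \<in> K" "X \<in> Obj S" shows "sar uT (Ide S X) = Ide (Fib H X) (sob uT X)"
proof -
  let ?i = "Ide S X"
  have X: "category (Fib H X)" using assms by (simp add: fib_simps)
  have t: "isoar (Fib H X) (sar uT ?i)" "Dom (Fib H X) (sar uT ?i) = sob uT X" "Cod (Fib H X) (sar uT ?i) = sob uT X"
    using assms by (simp_all add: sar_simps cat_simps unit_obj pbo_ide)
  have "Cmp (Fib H X) (sar uT ?i) (sar uT ?i) = Cmp (Fib H X) (sar uT ?i) (Cmp (Fib H X) (pba H ?i (sar uT ?i)) (conn H ?i ?i (sob uT (Cod S ?i))))"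
    using assms t by (simp add: fib_simps cat_simps unit_obj)
  also have "\<dots> = sar uT (Cmp S ?i ?i)"
    using assms by (intro sar_Cmp[symmetric]) (simp_all add: cat_simps)
  also have "\<dots> = Cmp (Fib H X) (sar uT ?i) (Ide (Fib H X) (sob uT X))"
    using assms t by (simp add: fib_simps cat_simps unit_obj)
  finally have eq: "Cmp (Fib H X) (sar uT ?i) (sar uT ?i) = Cmp (Fib H X) (sar uT ?i) (Ide (Fib H X) (sob uT X))" .
  show ?thesis
    by (rule category.Cmp_left_cancel[OF X t(1) _ _ _ _ eq]) (use assms t in \<open>simp_all add: fib_simps unit_obj\<close>)
qed

lemma sr_Ide: "Unitary \<in> K \<Longrightarrow> X \<in> Obj S \<Longrightarrow> sr lift_ext (Ide S X) = Ide G (one lift_ext X)"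
  by (simp add: ext_sel sar_Ide emb_def G_simps fib_simps cat_simps unit_obj)

lemma sr_lam: "Unitary \<in> K \<Longrightarrow> k \<in> Arr S \<Longrightarrow> Cmp G (sr lift_ext k) (lam k (sob uT (Cod S k))) = dec (Dom S k) (sar uT k)"
  by (simp add: ext_sel lam_def dec_def emb_def G_simps fib_simps cat_simps unit_obj sar_simps)

end

context external_structure
begin

interpretation t: styped S G gbs gpl gpa K lift_ext
  by (rule styped_ext)

lemmas ty = L_simps t.typ_simps[unfolded ext_sel(1,2)]

lemma sco_Lam:
  assumes "Symmetric \<in> K" "a \<in> Obj G" "b \<in> Obj G" "gbs b = gbs a"
  shows "Cmp G (sco lift_ext a b) (xta (Lam a) (Lam b)) = Cmp G (xta (Lam b) (Lam a)) (sco lift_ext (Emb a) (Emb b))"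
proof -
  obtain f1 A1 f2 A2 where o: "a = (f1, A1)" "b = (f2, A2)" by (cases a; cases b)
  let ?Z = "Dom S f1"
  have s: "f1 \<in> Arr S" "A1 \<in> Obj (Fib H (Cod S f1))" "f2 \<in> Arr S" "A2 \<in> Obj (Fib H (Cod S f2))" "Dom S f2 = ?Z"
    using assms(2-) by (simp_all add: o G_simps)
  show ?thesis
    using arg_cong[OF m_c[of f1 f2 A1 A2], of "gpa (pair S (Ide S ?Z) (Ide S ?Z))"]
    by (simp add: o Lam_pair Emb_def q_simps assms(1) s)
qed

lemma sco_Dec:
  assumes "Symmetric \<in> K" "u \<in> Arr G" "v \<in> Arr G" "gbs (Dom G v) = gbs (Dom G u)"
  shows "Cmp G (sco lift_ext (Emb (Cod G u)) (Emb (Cod G v))) (xta (Dec u) (Dec v)) =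
     Cmp G (xta (Dec v) (Dec u)) (sco lift_ext (Emb (Dom G u)) (Emb (Dom G v)))"
proof -
  let ?Z = "gbs (Dom G u)"
  have Z: "?Z \<in> Obj S" using assms by (simp add: vert_simps)
  have n: "und v \<in> Arr (Fib H ?Z)" "Dom (Fib H ?Z) (und v) = real (Dom G v)" "Cod (Fib H ?Z) (und v) = real (Cod G v)"
    using und_simps[of v] assms by simp_all
  show ?thesis
    using arg_cong[OF nat_c[of ?Z ?Z "und u" "und v"], of "gpa (pair S (Ide S ?Z) (Ide S ?Z))"]
    by (simp add: q_simps Emb_def Dec_def assms Z und_simps n real_obj)
qed

lemma sco_nat_ext:
  assumes "Symmetric \<in> K" "u \<in> Arr G" "v \<in> Arr G" "gbs (Dom G v) = gbs (Dom G u)"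
  shows "Cmp G (sco lift_ext (Cod G u) (Cod G v)) (xta u v) = Cmp G (xta v u) (sco lift_ext (Dom G u) (Dom G v))"
proof (rule tot.nat_extend[OF _ _ sco_Lam sco_Lam sco_Dec])
  show "Cmp G (xta u v) (xta (Lam (Dom G u)) (Lam (Dom G v))) = Cmp G (xta (Lam (Cod G u)) (Lam (Cod G v))) (xta (Dec u) (Dec v))"
    using assms by (simp add: L_simps flip: xta_Cmp)
  show "Cmp G (xta v u) (xta (Lam (Dom G v)) (Lam (Dom G u))) = Cmp G (xta (Lam (Cod G v)) (Lam (Cod G u))) (xta (Dec v) (Dec u))"
    using assms by (simp add: L_simps flip: xta_Cmp)
qed (use assms in \<open>simp_all add: ty\<close>)

text \<open>Compatibility of the unit constraint with m, taken for an identity in the unit factor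
  and pulled back along the diagonal.\<close>

lemma ur_Lam:
  assumes "Unitary \<in> K" "a \<in> Obj G"
  shows "Cmp G (ur lift_ext a) (xta (Lam a) (Ide G (one lift_ext (gbs a)))) = Cmp G (Lam a) (ur lift_ext (Emb a))"
    "Cmp G (ul lift_ext a) (xta (Ide G (one lift_ext (gbs a))) (Lam a)) = Cmp G (Lam a) (ul lift_ext (Emb a))"
proof -
  obtain f A where o: "a = (f, A)" by (cases a)
  let ?Z = "Dom S f"
  have s: "f \<in> Arr S" "A \<in> Obj (Fib H (Cod S f))"
    using assms(2-) by (simp_all add: o G_simps)
  have d: "dec ?Z (Ide (Fib H ?Z) (sob uT ?Z)) = Ide G (emb ?Z (sob uT ?Z))"
    using s assms by (simp add: dec_Ide unit_obj cat_simps)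
  show "Cmp G (ur lift_ext a) (xta (Lam a) (Ide G (one lift_ext (gbs a)))) = Cmp G (Lam a) (ur lift_ext (Emb a))"
    using arg_cong[OF m_r[of f "Ide S ?Z" A], of "gpa (pair S (Ide S ?Z) (Ide S ?Z))"]
    by (simp add: o Lam_pair Emb_def q_simps assms(1) s lam_Ide sar_Ide d)
  show "Cmp G (ul lift_ext a) (xta (Ide G (one lift_ext (gbs a))) (Lam a)) = Cmp G (Lam a) (ul lift_ext (Emb a))"
    using arg_cong[OF m_l[of "Ide S ?Z" f A], of "gpa (pair S (Ide S ?Z) (Ide S ?Z))"]
    by (simp add: o Lam_pair Emb_def q_simps assms(1) s lam_Ide sar_Ide d)
qed

lemma ur_Dec:
  assumes "Unitary \<in> K" "u \<in> Arr G"
  shows "Cmp G (ur lift_ext (Emb (Cod G u))) (xta (Dec u) (Ide G (one lift_ext (gbs (Dom G u))))) = Cmp G (Dec u) (ur lift_ext (Emb (Dom G u)))"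
    "Cmp G (ul lift_ext (Emb (Cod G u))) (xta (Ide G (one lift_ext (gbs (Dom G u)))) (Dec u)) = Cmp G (Dec u) (ul lift_ext (Emb (Dom G u)))"
proof -
  let ?Z = "gbs (Dom G u)"
  have Z: "?Z \<in> Obj S" using assms by (simp add: vert_simps)
  show "Cmp G (ur lift_ext (Emb (Cod G u))) (xta (Dec u) (Ide G (one lift_ext (gbs (Dom G u))))) = Cmp G (Dec u) (ur lift_ext (Emb (Dom G u)))"
    using arg_cong[OF nat_r[of ?Z ?Z "und u"], of "gpa (pair S (Ide S ?Z) (Ide S ?Z))"]
    by (simp add: q_simps Emb_def Dec_def assms Z und_simps real_obj)
  show "Cmp G (ul lift_ext (Emb (Cod G u))) (xta (Ide G (one lift_ext (gbs (Dom G u)))) (Dec u)) = Cmp G (Dec u) (ul lift_ext (Emb (Dom G u)))"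
    using arg_cong[OF nat_l[of ?Z ?Z "und u"], of "gpa (pair S (Ide S ?Z) (Ide S ?Z))"]
    by (simp add: q_simps Emb_def Dec_def assms Z und_simps real_obj)
qed

lemma ur_nat_ext:
  assumes "Unitary \<in> K" "u \<in> Arr G"
  shows "Cmp G (ur lift_ext (Cod G u)) (xta u (Ide G (one lift_ext (gbs (Dom G u))))) = Cmp G u (ur lift_ext (Dom G u))"
    "Cmp G (ul lift_ext (Cod G u)) (xta (Ide G (one lift_ext (gbs (Dom G u)))) u) = Cmp G u (ul lift_ext (Dom G u))"
proof -
  let ?o = "Ide G (one lift_ext (gbs (Dom G u)))"
  note L' = ur_Lam[of "Cod G u"]
  have b: "gbs (Cod G u) = gbs (Dom G u)" "gbs (Dom G u) \<in> Obj S" using assms by (simp_all add: vert_simps)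
  show "Cmp G (ur lift_ext (Cod G u)) (xta u ?o) = Cmp G u (ur lift_ext (Dom G u))"
  proof (rule tot.nat_extend[OF _ Lam_square ur_Lam(1) L'(1)[unfolded b] ur_Dec(1)])
    show "Cmp G (xta u ?o) (xta (Lam (Dom G u)) ?o) = Cmp G (xta (Lam (Cod G u)) ?o) (xta (Dec u) ?o)"
      using assms b by (simp add: L_simps t.one_obj t.bs_one flip: xta_Cmp)
  qed (use assms b in \<open>simp_all add: ty\<close>)
  show "Cmp G (ul lift_ext (Cod G u)) (xta ?o u) = Cmp G u (ul lift_ext (Dom G u))"
  proof (rule tot.nat_extend[OF _ Lam_square ur_Lam(2) L'(2)[unfolded b] ur_Dec(2)])
    show "Cmp G (xta ?o u) (xta ?o (Lam (Dom G u))) = Cmp G (xta ?o (Lam (Cod G u))) (xta ?o (Dec u))"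
      using assms b by (simp add: L_simps t.one_obj t.bs_one flip: xta_Cmp)
  qed (use assms b in \<open>simp_all add: ty\<close>)
qed

text \<open>Compatibility with m is used for an identity in the factor of the object and for
  \<open>k\<close> in the unit factor, pulled back along the arrow with components f k and id. The
  unit arrow then splits as \<open>sr\<close> after \<open>lam\<close>, and this \<open>lam\<close>
  is cancelled.\<close>

lemma ur_sm_ext:
  assumes "Unitary \<in> K" "k \<in> Arr S" "a \<in> Obj G" "gbs a = Cod S k"
  shows "gpa k (ur lift_ext a) = Cmp G (ur lift_ext (gpl k a)) (xta (Ide G (gpl k a)) (sr lift_ext k))"
    "gpa k (ul lift_ext a) = Cmp G (ul lift_ext (gpl k a)) (xta (sr lift_ext k) (Ide G (gpl k a)))"
proof -
  obtain f A where o: "a = (f, A)" by (cases a)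
  let ?Y = "Dom S k" and ?l = "lam k (sob uT (Cod S k))"
  have s: "f \<in> Arr S" "A \<in> Obj (Fib H (Cod S f))" "Dom S f = Cod S k"
    using assms(3-) by (simp_all add: o G_simps)
  have l: "isoar G ?l" "?l \<in> Arr G" "gbs (Dom G ?l) = ?Y" "Cod G ?l = gpl k (one lift_ext (Cod S k))"
    using assms by (simp_all add: lam_simps unit_obj cat_simps ext_sel emb_simps fib_simps)
  have b: "gbs (gpl k a) = ?Y" "gpl k a \<in> Obj G" using assms by (simp_all add: vert_simps)
  have sA: "sar uT k \<in> Arr (Fib H ?Y)"
    using assms sar_simps(1)[of k ?Y] by (simp add: fib_simps cat_simps)
  have r: "Cmp G (gpa k (ur lift_ext a)) (xta (Ide G (gpl k a)) ?l) = Cmp G (ur lift_ext (gpl k a)) (xta (Ide G (gpl k a)) (dec ?Y (sar uT k)))"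
    using arg_cong[OF m_r[of "Ide S (Cod S f)" k A], of "gpa (pair S (Cmp S f k) (Ide S ?Y))"]
    by (simp add: o q_simps assms(1,2) s lam_Ide sar_simps sA)
  have r': "Cmp G (gpa k (ul lift_ext a)) (xta ?l (Ide G (gpl k a))) = Cmp G (ul lift_ext (gpl k a)) (xta (dec ?Y (sar uT k)) (Ide G (gpl k a)))"
    using arg_cong[OF m_l[of k "Ide S (Cod S f)" A], of "gpa (pair S (Ide S ?Y) (Cmp S f k))"]
    by (simp add: o q_simps assms(1,2) s lam_Ide sar_simps sA)
  have e: "xta (Ide G (gpl k a)) (dec ?Y (sar uT k)) = Cmp G (xta (Ide G (gpl k a)) (sr lift_ext k)) (xta (Ide G (gpl k a)) ?l)"
    "xta (dec ?Y (sar uT k)) (Ide G (gpl k a)) = Cmp G (xta (sr lift_ext k) (Ide G (gpl k a))) (xta ?l (Ide G (gpl k a)))"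
    using assms b l by (simp_all add: ty sr_lam flip: xta_Cmp)
  have q: "isoar G (xta (Ide G (gpl k a)) ?l)" "isoar G (xta ?l (Ide G (gpl k a)))"
    using assms b l by (simp_all add: ty)
  show "gpa k (ur lift_ext a) = Cmp G (ur lift_ext (gpl k a)) (xta (Ide G (gpl k a)) (sr lift_ext k))"
    by (rule tot.Cmp_right_cancel[OF q(1)], unfold r e) (use assms b l in \<open>simp_all add: ty\<close>)
  show "gpa k (ul lift_ext a) = Cmp G (ul lift_ext (gpl k a)) (xta (sr lift_ext k) (Ide G (gpl k a)))"
    by (rule tot.Cmp_right_cancel[OF q(2)], unfold r' e) (use assms b l in \<open>simp_all add: ty\<close>)
qed

text \<open>The agreement of the two unit isomorphisms over X x X is pulled back along the diagonal.
  The pulled back unit arrows of the two projections coincide there: each becomes the unit arrow of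
  an identity after composition with the unit arrow of the diagonal.\<close>

lemma ur_ul_ext:
  assumes "Unitary \<in> K" "X \<in> Obj S"
  shows "ur lift_ext (one lift_ext X) = ul lift_ext (one lift_ext X)"
proof -
  let ?d = "diag S X"
  have d: "?d = pair S (Ide S X) (Ide S X)" by (simp add: diag_def)
  have i: "Cmp G (sr lift_ext ?d) (gpa ?d (sr lift_ext (Pr1 S X X))) = Ide G (one lift_ext X)"
     "Cmp G (sr lift_ext ?d) (gpa ?d (sr lift_ext (Pr2 S X X))) = Ide G (one lift_ext X)"
    using t.sr_cmp[of "Pr1 S X X" ?d] t.sr_cmp[of "Pr2 S X X" ?d] assms sr_Ide[of X]
    by (simp_all add: prd_arr_only d)
  have t1: "gpa ?d (sr lift_ext (Pr1 S X X)) \<in> Arr G" "gpa ?d (sr lift_ext (Pr2 S X X)) \<in> Arr G" "isoar G (gpa ?d (sr lift_ext (Pr1 S X X)))"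
     "Cod G (gpa ?d (sr lift_ext (Pr1 S X X))) = gpl ?d (one lift_ext (Prd S X X))" "Cod G (gpa ?d (sr lift_ext (Pr2 S X X))) = gpl ?d (one lift_ext (Prd S X X))"
     "Dom G (gpa ?d (sr lift_ext (Pr1 S X X))) = one lift_ext X" "Dom G (gpa ?d (sr lift_ext (Pr2 S X X))) = one lift_ext X"
    using assms by (simp_all add: t.typ_simps vert_simps prd_simps d)
  have eq: "gpa ?d (sr lift_ext (Pr1 S X X)) = gpa ?d (sr lift_ext (Pr2 S X X))"
    by (rule tot.Cmp_left_cancel[of "sr lift_ext ?d"]) (use assms t1 i in \<open>simp_all add: t.typ_simps prd_simps\<close>)
  have "Cmp G (gpa ?d (sr lift_ext (Pr1 S X X))) (ur lift_ext (one lift_ext X)) = Cmp G (gpa ?d (sr lift_ext (Pr2 S X X))) (ul lift_ext (one lift_ext X))"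
    using arg_cong[OF agree_u[of X X], of "gpa ?d"] assms t.sr_dom[of "Pr1 S X X"] t.sr_dom[of "Pr2 S X X"] t.sr_arr[of "Pr1 S X X"] t.sr_arr[of "Pr2 S X X"]
    by (simp add: d q_simps)
  then have eq2: "Cmp G (gpa ?d (sr lift_ext (Pr1 S X X))) (ur lift_ext (one lift_ext X)) = Cmp G (gpa ?d (sr lift_ext (Pr1 S X X))) (ul lift_ext (one lift_ext X))"
    unfolding eq .
  show ?thesis
    by (rule tot.Cmp_left_cancel[OF t1(3) _ _ _ _ eq2]) (use assms t1 in \<open>simp_all add: t.typ_simps\<close>)
qed

text \<open>Apart from naturality and the laws already treated, each law is the external axiom over
  the product of the codomains, pulled back along the arrow whose components are the base arrows of
  the objects; a unit contributes an identity as its component. Compatibility of associativity and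
  commutativity with pullback holds by strict functoriality.\<close>

lemma stensor_ext: "stensor S G gbs gpl gpa K lift_ext"
proof (rule stensor.intro[OF styped_ext stensor_axioms.intro], goal_cases)
  case (1 a b)
  then show ?case by (simp add: ext_sel xta_Ide)
next
  case (2 u v u' v')
  then show ?case by (simp add: ext_sel xta_Cmp)
next
  case (3 k a b)
  then show ?case by (simp add: ext_sel xto_simps vert_simps)
next
  case (4 k u v)
  then show ?case by (simp add: ext_sel xta_simps xto_simps gpa_xta vert_simps)
next
  case (5 k l a b)
  then show ?case by (simp add: ext_sel xto_simps vert_simps)
next
  case (6 a b c)
  then show ?case by (cases a; cases b; cases c) (simp add: q_simps a_typed isoar_pa)
next
  case (7 u v w)
  then show ?case using sas_nat_ext by (simp add: ext_sel(2))
next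
  case (8 a b c d)
  obtain f1 A1 f2 A2 f3 A3 f4 A4 where o: "a = (f1, A1)" "b = (f2, A2)" "c = (f3, A3)" "d = (f4, A4)"
    by (cases a; cases b; cases c; cases d)
  let ?Z = "Dom S f1"
  have s: "f1 \<in> Arr S" "A1 \<in> Obj (Fib H (Cod S f1))" "f2 \<in> Arr S" "A2 \<in> Obj (Fib H (Cod S f2))"
    "f3 \<in> Arr S" "A3 \<in> Obj (Fib H (Cod S f3))" "f4 \<in> Arr S" "A4 \<in> Obj (Fib H (Cod S f4))"
    "Dom S f2 = ?Z" "Dom S f3 = ?Z" "Dom S f4 = ?Z"
    using 8(2-) by (simp_all add: o G_simps)
  show ?case
    using arg_cong[OF pentagon_a[of "Cod S f1" "Cod S f2" "Cod S f3" "Cod S f4" A1 A2 A3 A4], of "gpa (pair S (pair S (pair S f1 f2) f3) f4)"]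
    by (simp add: o q_simps 8(1) s)
next
  case (9 k a b c)
  then show ?case by (cases a; cases b; cases c) (simp add: q_simps)
next
  case (10 u v)
  then show ?case using sco_nat_ext by (simp add: ext_sel(2))
next
  case (11 a b)
  obtain f1 A1 f2 A2 where o: "a = (f1, A1)" "b = (f2, A2)" by (cases a; cases b)
  have s: "f1 \<in> Arr S" "A1 \<in> Obj (Fib H (Cod S f1))" "f2 \<in> Arr S" "A2 \<in> Obj (Fib H (Cod S f2))" "Dom S f2 = Dom S f1"
    using 11(2-) by (simp_all add: o G_simps)
  show ?case
    using arg_cong[OF inv_c[of "Cod S f1" "Cod S f2" A1 A2], of "gpa (pair S f1 f2)"]
    by (simp add: o q_simps 11(1) s)
next
  case (12 k a b)
  then show ?case by (cases a; cases b) (simp add: q_simps)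
next
  case (13 a)
  then show ?case by (cases a) (simp add: q_simps r_typed isoar_pa)
next
  case (14 a)
  then show ?case by (cases a) (simp add: q_simps l_typed isoar_pa)
next
  case (15 u)
  then show ?case using ur_nat_ext(1) by (simp add: ext_sel(2))
next
  case (16 u)
  then show ?case using ur_nat_ext(2) by (simp add: ext_sel(2))
next
  case (17 X)
  then show ?case by (rule ur_ul_ext)
next
  case (18 k a)
  then have "sm lift_ext k a (one lift_ext (Cod S k)) = Ide G (Dom G (gpa k (ur lift_ext a)))"
    by (simp add: ext_sel(3) ty cat_simps)
  then show ?case using 18 ur_sm_ext(1)[of k a] by (simp add: ext_sel(2) ty cat_simps)
next
  case (19 k a)
  then have "sm lift_ext k (one lift_ext (Cod S k)) a = Ide G (Dom G (gpa k (ul lift_ext a)))"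
    by (simp add: ext_sel(3) ty cat_simps)
  then show ?case using 19 ur_sm_ext(2)[of k a] by (simp add: ext_sel(2) ty cat_simps)
next
  case (20 a b c)
  obtain f1 A1 f2 A2 f3 A3 where o: "a = (f1, A1)" "b = (f2, A2)" "c = (f3, A3)" by (cases a; cases b; cases c)
  have s: "f1 \<in> Arr S" "A1 \<in> Obj (Fib H (Cod S f1))" "f2 \<in> Arr S" "A2 \<in> Obj (Fib H (Cod S f2))"
    "f3 \<in> Arr S" "A3 \<in> Obj (Fib H (Cod S f3))" "Dom S f2 = Dom S f1" "Dom S f3 = Dom S f1"
    using 20(3-) by (simp_all add: o G_simps)
  show ?case
    using arg_cong[OF hexagon_ac[of "Cod S f1" "Cod S f2" "Cod S f3" A1 A2 A3], of "gpa (pair S (pair S f1 f2) f3)"]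
    by (simp add: o q_simps 20(1,2) s)
next
  case (21 b c)
  obtain f2 A2 f3 A3 where o: "b = (f2, A2)" "c = (f3, A3)" by (cases b; cases c)
  have s: "f2 \<in> Arr S" "A2 \<in> Obj (Fib H (Cod S f2))" "f3 \<in> Arr S" "A3 \<in> Obj (Fib H (Cod S f3))" "Dom S f3 = Dom S f2"
    using 21(3-) by (simp_all add: o G_simps)
  show ?case
    using arg_cong[OF au(1)[of "Dom S f2" "Cod S f2" "Cod S f3" A2 A3], of "gpa (pair S (pair S (Ide S (Dom S f2)) f2) f3)"]
    by (simp add: o q_simps 21(1,2) s)
next
  case (22 b c)
  obtain f2 A2 f3 A3 where o: "b = (f2, A2)" "c = (f3, A3)" by (cases b; cases c)
  have s: "f2 \<in> Arr S" "A2 \<in> Obj (Fib H (Cod S f2))" "f3 \<in> Arr S" "A3 \<in> Obj (Fib H (Cod S f3))" "Dom S f3 = Dom S f2"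
    using 22(3-) by (simp_all add: o G_simps)
  show ?case
    using arg_cong[OF au(2)[of "Cod S f2" "Dom S f2" "Cod S f3" A2 A3], of "gpa (pair S (pair S f2 (Ide S (Dom S f2))) f3)"]
    by (simp add: o q_simps 22(1,2) s)
next
  case (23 b c)
  obtain f2 A2 f3 A3 where o: "b = (f2, A2)" "c = (f3, A3)" by (cases b; cases c)
  have s: "f2 \<in> Arr S" "A2 \<in> Obj (Fib H (Cod S f2))" "f3 \<in> Arr S" "A3 \<in> Obj (Fib H (Cod S f3))" "Dom S f3 = Dom S f2"
    using 23(3-) by (simp_all add: o G_simps)
  show ?case
    using arg_cong[OF au(3)[of "Cod S f2" "Cod S f3" "Dom S f2" A2 A3], of "gpa (pair S (pair S f2 f3) (Ide S (Dom S f2)))"]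
    by (simp add: o q_simps 23(1,2) s)
next
  case (24 b)
  obtain f2 A2 where o: "b = (f2, A2)" by (cases b)
  have s: "f2 \<in> Arr S" "A2 \<in> Obj (Fib H (Cod S f2))"
    using 24(3-) by (simp_all add: o G_simps)
  show ?case
    using arg_cong[OF cu[of "Dom S f2" "Cod S f2" A2], of "gpa (pair S (Ide S (Dom S f2)) f2)"]
    by (simp add: o q_simps 24(1,2) s)
qed

end

section \<open>Recovering the external unit isomorphisms from the lift\<close>

context external_structure
begin

interpretation t: stensor S G gbs gpl gpa K lift_ext
  by (rule stensor_ext)

text \<open>The unit isomorphisms over \<open>X1 \<times> X2\<close> are determined by the ones over \<open>X1 \<times> (X1 \<times> X2)\<close>
  and \<open>(X1 \<times> X2) \<times> X2\<close>, which are all that \<open>lift_ext\<close> sees.\<close>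

lemma dr_determined:
  assumes "Unitary \<in> K" "X1 \<in> Obj S" "X2 \<in> Obj S" "A \<in> Obj (Fib H X1)"
  shows "dr X1 X2 A = Cmp G (ur lift_ext (Pr1 S X1 X2, A)) (xta (Ide G (Pr1 S X1 X2, A)) (sr lift_ext (Pr2 S X1 X2)))"
proof -
  let ?p = "Pr1 S X1 X2" and ?k = "Pr2 S X1 X2" and ?Y = "Prd S X1 X2"
  let ?l = "lam ?k (sob uT X2)" and ?a = "(?p, A)"
  have b: "gbs ?a = ?Y" "?a \<in> Obj G" "?k \<in> Arr S" "Dom S ?k = ?Y" "Cod S ?k = X2" "?Y \<in> Obj S" using assms by (simp_all add: q_simps)
  have l: "isoar G ?l" "?l \<in> Arr G" "gbs (Dom G ?l) = ?Y" "Cod G ?l = gpl ?k (one lift_ext X2)" "Dom G ?l = Dom G (dec ?Y (sar uT ?k))"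
    using assms b by (simp_all add: lam_simps unit_obj cat_simps ext_sel emb_simps fib_simps dec_def G_proj(1,2) sar_simps)
  have sA: "sar uT ?k \<in> Arr (Fib H ?Y)"
    using assms b sar_simps(1)[of ?k ?Y] by (simp add: fib_simps cat_simps)
  \<comment> \<open>The product of the identity of \<open>X1\<close> with the second projection,
    preceded by the arrow with components the first projection and the identity, is the identity of
    X1 x X2. Pulling back compatibility with m in this way keeps \<open>dr X1 X2 A\<close> itself on
    the left.\<close>
  have r: "Cmp G (dr X1 X2 A) (xta (Ide G ?a) ?l) = Cmp G (ur lift_ext ?a) (xta (Ide G ?a) (dec ?Y (sar uT ?k)))"
    using arg_cong[OF m_r[of "Ide S X1" ?k A], of "gpa (pair S ?p (Ide S ?Y))"]
    by (simp add: q_simps assms lam_Ide sar_simps sA)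
  have e: "xta (Ide G ?a) (dec ?Y (sar uT ?k)) = Cmp G (xta (Ide G ?a) (sr lift_ext ?k)) (xta (Ide G ?a) ?l)"
    using assms b l sr_lam[of ?k] by (simp add: L_simps t.typ_simps[unfolded ext_sel(1,2)] flip: xta_Cmp)
  have q: "isoar G (xta (Ide G ?a) ?l)"
    using assms b l by (simp add: L_simps)
  have d: "Dom G (dr X1 X2 A) = Cod G (xta (Ide G ?a) ?l)" "dr X1 X2 A \<in> Arr G"
    using assms by (simp_all add: q_simps)
  show ?thesis
    by (rule tot.Cmp_right_cancel[OF q], unfold r e) (use assms b l d in \<open>simp_all add: L_simps t.typ_simps[unfolded ext_sel(1,2)]\<close>)
qed

lemma dl_determined:
  assumes "Unitary \<in> K" "X1 \<in> Obj S" "X2 \<in> Obj S" "A \<in> Obj (Fib H X2)"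
  shows "dl X1 X2 A = Cmp G (ul lift_ext (Pr2 S X1 X2, A)) (xta (sr lift_ext (Pr1 S X1 X2)) (Ide G (Pr2 S X1 X2, A)))"
proof -
  let ?p = "Pr2 S X1 X2" and ?k = "Pr1 S X1 X2" and ?Y = "Prd S X1 X2"
  let ?l = "lam ?k (sob uT X1)" and ?a = "(?p, A)"
  have b: "gbs ?a = ?Y" "?a \<in> Obj G" "?k \<in> Arr S" "Dom S ?k = ?Y" "Cod S ?k = X1" "?Y \<in> Obj S" using assms by (simp_all add: q_simps)
  have l: "isoar G ?l" "?l \<in> Arr G" "gbs (Dom G ?l) = ?Y" "Cod G ?l = gpl ?k (one lift_ext X1)" "Dom G ?l = Dom G (dec ?Y (sar uT ?k))"
    using assms b by (simp_all add: lam_simps unit_obj cat_simps ext_sel emb_simps fib_simps dec_def G_proj(1,2) sar_simps)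
  have sA: "sar uT ?k \<in> Arr (Fib H ?Y)"
    using assms b sar_simps(1)[of ?k ?Y] by (simp add: fib_simps cat_simps)
  have r: "Cmp G (dl X1 X2 A) (xta ?l (Ide G ?a)) = Cmp G (ul lift_ext ?a) (xta (dec ?Y (sar uT ?k)) (Ide G ?a))"
    using arg_cong[OF m_l[of ?k "Ide S X2" A], of "gpa (pair S (Ide S ?Y) ?p)"]
    by (simp add: q_simps assms lam_Ide sar_simps sA)
  have e: "xta (dec ?Y (sar uT ?k)) (Ide G ?a) = Cmp G (xta (sr lift_ext ?k) (Ide G ?a)) (xta ?l (Ide G ?a))"
    using assms b l sr_lam[of ?k] by (simp add: L_simps t.typ_simps[unfolded ext_sel(1,2)] flip: xta_Cmp)
  have q: "isoar G (xta ?l (Ide G ?a))"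
    using assms b l by (simp add: L_simps)
  have d: "Dom G (dl X1 X2 A) = Cod G (xta ?l (Ide G ?a))" "dl X1 X2 A \<in> Arr G"
    using assms by (simp_all add: q_simps)
  show ?thesis
    by (rule tot.Cmp_right_cancel[OF q], unfold r e) (use assms b l d in \<open>simp_all add: L_simps t.typ_simps[unfolded ext_sel(1,2)]\<close>)
qed

end

context external_typed
begin

text \<open>The case of the identity of the product in \<open>gpa_ba_xta\<close>. Through it,
  external laws become instances of the laws of \<open>lift_ext\<close> at objects whose base arrows
  are projections.\<close>

lemma ba_xta:
  assumes "u \<in> Arr G" "v \<in> Arr G"
  shows "ba u v = xta (gpa (Pr1 S (gbs (Dom G u)) (gbs (Dom G v))) u) (gpa (Pr2 S (gbs (Dom G u)) (gbs (Dom G v))) v)"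
  using gpa_ba_xta[of u v "Ide S (Prd S (gbs (Dom G u)) (gbs (Dom G v)))"] assms
  by (simp add: vert_arr_only prd_arr_only ba_simps bo_simps)

end

text \<open>The converse of \<open>stensor_ext\<close>. Associativity and commutativity are values
  of \<open>lift_ext\<close> at projections, see \<open>da_sas\<close> and \<open>dc_sco\<close>.
  The unit isomorphisms are only seen after pullback along arrows with an identity component;
  \<open>dr_det\<close> and \<open>dl_det\<close> therefore demand that they be the ones determined
  by the lift.\<close>

locale lifted_external = external_typed S H T K + t: stensor S G gbs gpl gpa K lift_ext
  for S :: "('s, 'f) pcat" and H :: "('s, 'f, 'o, 'a) fib" and T K +
  assumes shape: "xassoc T \<noteq> None \<longleftrightarrow> Associative \<in> K" "xcomm T \<noteq> None \<longleftrightarrow> Symmetric \<in> K" "xunit T \<noteq> None \<longleftrightarrow> Unitary \<in> K"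
    and dr_det: "Unitary \<in> K \<Longrightarrow> X1 \<in> Obj S \<Longrightarrow> X2 \<in> Obj S \<Longrightarrow> A \<in> Obj (Fib H X1) \<Longrightarrow>
      dr X1 X2 A = Cmp G (ur lift_ext (Pr1 S X1 X2, A)) (xta (Ide G (Pr1 S X1 X2, A)) (sr lift_ext (Pr2 S X1 X2)))"
    and dl_det: "Unitary \<in> K \<Longrightarrow> X1 \<in> Obj S \<Longrightarrow> X2 \<in> Obj S \<Longrightarrow> A \<in> Obj (Fib H X2) \<Longrightarrow>
      dl X1 X2 A = Cmp G (ul lift_ext (Pr2 S X1 X2, A)) (xta (sr lift_ext (Pr1 S X1 X2)) (Ide G (Pr2 S X1 X2, A)))"
begin

lemmas e_simps = q_simps ba_xta prd_arr_def passoc_def pswap_def diag_def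

lemma nat_a:
  assumes "Associative \<in> K" "X1 \<in> Obj S" "X2 \<in> Obj S" "X3 \<in> Obj S" "u \<in> Arr (Fib H X1)" "v \<in> Arr (Fib H X2)" "w \<in> Arr (Fib H X3)"
  shows "Cmp G (da X1 X2 X3 (Cod (Fib H X1) u) (Cod (Fib H X2) v) (Cod (Fib H X3) w)) (ba (ba (dec X1 u) (dec X2 v)) (dec X3 w)) =
     Cmp G (gpa (passoc S X1 X2 X3) (ba (dec X1 u) (ba (dec X2 v) (dec X3 w)))) (da X1 X2 X3 (Dom (Fib H X1) u) (Dom (Fib H X2) v) (Dom (Fib H X3) w))"
proof -
  let ?p = "Pr1 S (Prd S X1 X2) X3"
  have c: "Cod (Fib H X1) u \<in> Obj (Fib H X1)" "Cod (Fib H X2) v \<in> Obj (Fib H X2)" "Cod (Fib H X3) w \<in> Obj (Fib H X3)"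
    "Dom (Fib H X1) u \<in> Obj (Fib H X1)" "Dom (Fib H X2) v \<in> Obj (Fib H X2)" "Dom (Fib H X3) w \<in> Obj (Fib H X3)"
    using assms by (simp_all add: fib_simps)
  show ?thesis
    using t.sas_nat[of "gpa (Cmp S (Pr1 S X1 X2) ?p) (dec X1 u)" "gpa (Cmp S (Pr2 S X1 X2) ?p) (dec X2 v)" "gpa (Pr2 S (Prd S X1 X2) X3) (dec X3 w)"]
    by (simp add: e_simps assms c)
qed

text \<open>Since m is a product of arrows \<open>lam\<close>, its compatibility with associativity
  is naturality of \<open>sas lift_ext\<close> at the pullbacks of these arrows along the
  projections.\<close>

lemma m_a:
  assumes "Associative \<in> K" "f1 \<in> Arr S" "f2 \<in> Arr S" "f3 \<in> Arr S" "A1 \<in> Obj (Fib H (Cod S f1))" "A2 \<in> Obj (Fib H (Cod S f2))" "A3 \<in> Obj (Fib H (Cod S f3))"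
  shows "Cmp G (gpa (prd_arr S (prd_arr S f1 f2) f3) (da (Cod S f1) (Cod S f2) (Cod S f3) A1 A2 A3)) (ba (ba (lam f1 A1) (lam f2 A2)) (lam f3 A3)) =
    Cmp G (gpa (passoc S (Dom S f1) (Dom S f2) (Dom S f3)) (ba (lam f1 A1) (ba (lam f2 A2) (lam f3 A3))))
     (da (Dom S f1) (Dom S f2) (Dom S f3) (pbo H f1 A1) (pbo H f2 A2) (pbo H f3 A3))"
proof -
  let ?p = "Pr1 S (Prd S (Dom S f1) (Dom S f2)) (Dom S f3)"
  show ?thesis
    using t.sas_nat[of "gpa (Cmp S (Pr1 S (Dom S f1) (Dom S f2)) ?p) (lam f1 A1)" "gpa (Cmp S (Pr2 S (Dom S f1) (Dom S f2)) ?p) (lam f2 A2)" "gpa (Pr2 S (Prd S (Dom S f1) (Dom S f2)) (Dom S f3)) (lam f3 A3)"]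
    by (simp add: e_simps assms)
qed

lemma pentagon_a:
  assumes "Associative \<in> K" "X1 \<in> Obj S" "X2 \<in> Obj S" "X3 \<in> Obj S" "X4 \<in> Obj S"
    "A1 \<in> Obj (Fib H X1)" "A2 \<in> Obj (Fib H X2)" "A3 \<in> Obj (Fib H X3)" "A4 \<in> Obj (Fib H X4)"
  shows "Cmp G (gpa (passoc S (Prd S X1 X2) X3 X4) (da X1 X2 (Prd S X3 X4) A1 A2 (xob T X3 X4 A3 A4))) (da (Prd S X1 X2) X3 X4 (xob T X1 X2 A1 A2) A3 A4) =
     Cmp G (gpa (prd_arr S (passoc S X1 X2 X3) (Ide S X4)) (gpa (passoc S X1 (Prd S X2 X3) X4) (ba (Ide G (emb X1 A1)) (da X2 X3 X4 A2 A3 A4))))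
      (Cmp G (gpa (prd_arr S (passoc S X1 X2 X3) (Ide S X4)) (da X1 (Prd S X2 X3) X4 A1 (xob T X2 X3 A2 A3) A4))
        (ba (da X1 X2 X3 A1 A2 A3) (Ide G (emb X4 A4))))"
proof -
  let ?q = "Pr1 S (Prd S (Prd S X1 X2) X3) X4" and ?p = "Pr1 S (Prd S X1 X2) X3"
  show ?thesis
    using t.pentagon[of "(Cmp S (Pr1 S X1 X2) (Cmp S ?p ?q), A1)" "(Cmp S (Pr2 S X1 X2) (Cmp S ?p ?q), A2)" "(Cmp S (Pr2 S (Prd S X1 X2) X3) ?q, A3)"
      "(Pr2 S (Prd S (Prd S X1 X2) X3) X4, A4)"]
    by (simp add: e_simps assms)
qed

lemma nat_c:
  assumes "Symmetric \<in> K" "X1 \<in> Obj S" "X2 \<in> Obj S" "u \<in> Arr (Fib H X1)" "v \<in> Arr (Fib H X2)"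
  shows "Cmp G (dc X1 X2 (Cod (Fib H X1) u) (Cod (Fib H X2) v)) (ba (dec X1 u) (dec X2 v)) =
     Cmp G (gpa (pswap S X1 X2) (ba (dec X2 v) (dec X1 u))) (dc X1 X2 (Dom (Fib H X1) u) (Dom (Fib H X2) v))"
proof -
  have c: "Cod (Fib H X1) u \<in> Obj (Fib H X1)" "Cod (Fib H X2) v \<in> Obj (Fib H X2)"
    "Dom (Fib H X1) u \<in> Obj (Fib H X1)" "Dom (Fib H X2) v \<in> Obj (Fib H X2)"
    using assms by (simp_all add: fib_simps)
  show ?thesis
    using t.sco_nat[of "gpa (Pr1 S X1 X2) (dec X1 u)" "gpa (Pr2 S X1 X2) (dec X2 v)"]
    by (simp add: e_simps assms c)
qed

lemma inv_c:
  assumes "Symmetric \<in> K" "X1 \<in> Obj S" "X2 \<in> Obj S" "A1 \<in> Obj (Fib H X1)" "A2 \<in> Obj (Fib H X2)"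
  shows "Cmp G (gpa (pswap S X1 X2) (dc X2 X1 A2 A1)) (dc X1 X2 A1 A2) = Ide G (emb (Prd S X1 X2) (xob T X1 X2 A1 A2))"
  using t.sco_sco[of "(Pr1 S X1 X2, A1)" "(Pr2 S X1 X2, A2)"] by (simp add: e_simps assms)

lemma m_c:
  assumes "Symmetric \<in> K" "f1 \<in> Arr S" "f2 \<in> Arr S" "A1 \<in> Obj (Fib H (Cod S f1))" "A2 \<in> Obj (Fib H (Cod S f2))"
  shows "Cmp G (gpa (prd_arr S f1 f2) (dc (Cod S f1) (Cod S f2) A1 A2)) (ba (lam f1 A1) (lam f2 A2)) =
    Cmp G (gpa (pswap S (Dom S f1) (Dom S f2)) (ba (lam f2 A2) (lam f1 A1))) (dc (Dom S f1) (Dom S f2) (pbo H f1 A1) (pbo H f2 A2))"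
  using t.sco_nat[of "gpa (Pr1 S (Dom S f1) (Dom S f2)) (lam f1 A1)" "gpa (Pr2 S (Dom S f1) (Dom S f2)) (lam f2 A2)"]
  by (simp add: e_simps assms)

lemma hexagon_ac:
  assumes "Associative \<in> K" "Symmetric \<in> K" "X1 \<in> Obj S" "X2 \<in> Obj S" "X3 \<in> Obj S"
    "A1 \<in> Obj (Fib H X1)" "A2 \<in> Obj (Fib H X2)" "A3 \<in> Obj (Fib H X3)"
  shows "Cmp G (gpa (prd_arr S (pswap S X1 X2) (Ide S X3)) (gpa (passoc S X2 X1 X3) (ba (Ide G (emb X2 A2)) (dc X1 X3 A1 A3))))
       (Cmp G (gpa (prd_arr S (pswap S X1 X2) (Ide S X3)) (da X2 X1 X3 A2 A1 A3)) (ba (dc X1 X2 A1 A2) (Ide G (emb X3 A3)))) =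
     Cmp G (gpa (passoc S X1 X2 X3) (gpa (pswap S X1 (Prd S X2 X3)) (da X2 X3 X1 A2 A3 A1)))
      (Cmp G (gpa (passoc S X1 X2 X3) (dc X1 (Prd S X2 X3) A1 (xob T X2 X3 A2 A3))) (da X1 X2 X3 A1 A2 A3))"
proof -
  let ?p = "Pr1 S (Prd S X1 X2) X3"
  show ?thesis
    using t.hexagon[of "(Cmp S (Pr1 S X1 X2) ?p, A1)" "(Cmp S (Pr2 S X1 X2) ?p, A2)" "(Pr2 S (Prd S X1 X2) X3, A3)"]
    by (simp add: e_simps assms)
qed

lemma da_sas:
  assumes "Associative \<in> K" "X1 \<in> Obj S" "X2 \<in> Obj S" "X3 \<in> Obj S"
    "A1 \<in> Obj (Fib H X1)" "A2 \<in> Obj (Fib H X2)" "A3 \<in> Obj (Fib H X3)"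
  shows "da X1 X2 X3 A1 A2 A3 = sas lift_ext (Cmp S (Pr1 S X1 X2) (Pr1 S (Prd S X1 X2) X3), A1)
    (Cmp S (Pr2 S X1 X2) (Pr1 S (Prd S X1 X2) X3), A2) (Pr2 S (Prd S X1 X2) X3, A3)"
  by (simp add: e_simps assms)

lemma dc_sco:
  assumes "Symmetric \<in> K" "X1 \<in> Obj S" "X2 \<in> Obj S" "A1 \<in> Obj (Fib H X1)" "A2 \<in> Obj (Fib H X2)"
  shows "dc X1 X2 A1 A2 = sco lift_ext (Pr1 S X1 X2, A1) (Pr2 S X1 X2, A2)"
  by (simp add: e_simps assms)

lemmas v_simps = G_Obj_pair gpl_pair gbs_pair vert_arr_only prd_arr_only unit_obj xob_obj pbo_obj pbo_ide emb_def
  bo_pair xto_pair ext_sel(6) xto_simps xta_simps xta_Ide gpa_ba_xta gpa_xta gpl_bo_xto ba_simps bo_simps ba_xta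
  lam_simps(3,4) dec_simps(1,2,3) lam_simps(2)[unfolded emb_def] dec_simps(2,3)[unfolded emb_def]
  t.typ_simps[unfolded ext_sel(1,2)] d_arr d_dom_cod d_dom_cod[unfolded emb_def] prd_arr_def passoc_def pswap_def

lemma unit_sm:
  assumes "Unitary \<in> K" "k \<in> Arr S" "a \<in> Obj G" "gbs a = Cod S k"
  shows "gpa k (ur lift_ext a) = Cmp G (ur lift_ext (gpl k a)) (xta (Ide G (gpl k a)) (sr lift_ext k))"
    "gpa k (ul lift_ext a) = Cmp G (ul lift_ext (gpl k a)) (xta (sr lift_ext k) (Ide G (gpl k a)))"
proof -
  have "sm lift_ext k a (one lift_ext (Cod S k)) = Ide G (Dom G (gpa k (ur lift_ext a)))"
    "sm lift_ext k (one lift_ext (Cod S k)) a = Ide G (Dom G (gpa k (ul lift_ext a)))"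
    using assms by (simp_all add: ext_sel(3) t.typ_simps[unfolded ext_sel(1,2)] vert_arr_only)
  then show "gpa k (ur lift_ext a) = Cmp G (ur lift_ext (gpl k a)) (xta (Ide G (gpl k a)) (sr lift_ext k))"
    "gpa k (ul lift_ext a) = Cmp G (ul lift_ext (gpl k a)) (xta (sr lift_ext k) (Ide G (gpl k a)))"
    using t.ur_sm[of k a] t.ul_sm[of k a] assms by (simp_all add: t.typ_simps vert_arr_only ext_sel(2))
qed

text \<open>The expression for \<open>dr\<close> is stable under pullback, by the compatibility of
  \<open>ur\<close> with pullback and the cocycle condition of the unit section.\<close>

lemma dr_gpa:
  assumes "Unitary \<in> K" "X1 \<in> Obj S" "X2 \<in> Obj S" "A \<in> Obj (Fib H X1)" "k \<in> Arr S" "Cod S k = Prd S X1 X2"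
  shows "gpa k (dr X1 X2 A) = Cmp G (ur lift_ext (Cmp S (Pr1 S X1 X2) k, A))
    (xta (Ide G (Cmp S (Pr1 S X1 X2) k, A)) (sr lift_ext (Cmp S (Pr2 S X1 X2) k)))"
  using assms t.sr_cmp[of "Pr2 S X1 X2" k]
  by (simp add: dr_det v_simps unit_sm(1) flip: xta_Cmp)

lemma dl_gpa:
  assumes "Unitary \<in> K" "X1 \<in> Obj S" "X2 \<in> Obj S" "A \<in> Obj (Fib H X2)" "k \<in> Arr S" "Cod S k = Prd S X1 X2"
  shows "gpa k (dl X1 X2 A) = Cmp G (ul lift_ext (Cmp S (Pr2 S X1 X2) k, A))
    (xta (sr lift_ext (Cmp S (Pr1 S X1 X2) k)) (Ide G (Cmp S (Pr2 S X1 X2) k, A)))"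
  using assms t.sr_cmp[of "Pr1 S X1 X2" k]
  by (simp add: dl_det v_simps unit_sm(2) flip: xta_Cmp)

text \<open>Naturality of the unit constraints when the other factor is an arbitrary arrow
  \<open>s\<close> into the unit object: bifunctoriality lets \<open>u\<close> and \<open>s\<close>
  act one after the other.\<close>

lemma ur_slide:
  assumes "Unitary \<in> K" "u \<in> Arr G" "s \<in> Arr G" "Cod G s = one lift_ext (gbs (Dom G u))" "gbs (Dom G s) = gbs (Dom G u)"
  shows "Cmp G (ur lift_ext (Cod G u)) (xta u s) = Cmp G u (Cmp G (ur lift_ext (Dom G u)) (xta (Ide G (Dom G u)) s))"
    "Cmp G (ul lift_ext (Cod G u)) (xta s u) = Cmp G u (Cmp G (ul lift_ext (Dom G u)) (xta s (Ide G (Dom G u))))"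
proof -
  let ?o = "one lift_ext (gbs (Dom G u))"
  note ty = t.typ_simps[unfolded ext_sel(1,2)] vert_arr_only xta_simps
  have e: "xta u s = Cmp G (xta u (Ide G ?o)) (xta (Ide G (Dom G u)) s)" "xta s u = Cmp G (xta (Ide G ?o) u) (xta s (Ide G (Dom G u)))"
    using assms by (simp_all add: ty flip: xta_Cmp)
  show "Cmp G (ur lift_ext (Cod G u)) (xta u s) = Cmp G u (Cmp G (ur lift_ext (Dom G u)) (xta (Ide G (Dom G u)) s))"
    "Cmp G (ul lift_ext (Cod G u)) (xta s u) = Cmp G u (Cmp G (ul lift_ext (Dom G u)) (xta s (Ide G (Dom G u))))"
    unfolding e using assms tot.reassoc[OF t.ur_nat[of u, unfolded ext_sel(2)], of "xta (Ide G (Dom G u)) s"]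
       tot.reassoc[OF t.ul_nat[of u, unfolded ext_sel(2)], of "xta s (Ide G (Dom G u))"]
    by (simp_all add: ty)
qed

lemma nat_r:
  assumes "Unitary \<in> K" "X1 \<in> Obj S" "X2 \<in> Obj S" "v \<in> Arr (Fib H X1)"
  shows "Cmp G (dr X1 X2 (Cod (Fib H X1) v)) (ba (dec X1 v) (Ide G (emb X2 (sob uT X2)))) =
     Cmp G (gpa (Pr1 S X1 X2) (dec X1 v)) (dr X1 X2 (Dom (Fib H X1) v))"
proof -
  have c: "Cod (Fib H X1) v \<in> Obj (Fib H X1)" "Dom (Fib H X1) v \<in> Obj (Fib H X1)"
    using assms by (simp_all add: fib_simps)
  show ?thesis
    using ur_slide(1)[of "gpa (Pr1 S X1 X2) (dec X1 v)" "sr lift_ext (Pr2 S X1 X2)"]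
    by (simp add: dr_det assms c v_simps flip: xta_Cmp)
qed

lemma nat_l:
  assumes "Unitary \<in> K" "X1 \<in> Obj S" "X2 \<in> Obj S" "v \<in> Arr (Fib H X2)"
  shows "Cmp G (dl X1 X2 (Cod (Fib H X2) v)) (ba (Ide G (emb X1 (sob uT X1))) (dec X2 v)) =
     Cmp G (gpa (Pr2 S X1 X2) (dec X2 v)) (dl X1 X2 (Dom (Fib H X2) v))"
proof -
  have c: "Cod (Fib H X2) v \<in> Obj (Fib H X2)" "Dom (Fib H X2) v \<in> Obj (Fib H X2)"
    using assms by (simp_all add: fib_simps)
  show ?thesis
    using ur_slide(2)[of "gpa (Pr2 S X1 X2) (dec X2 v)" "sr lift_ext (Pr1 S X1 X2)"]
    by (simp add: dl_det assms c v_simps flip: xta_Cmp)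
qed

text \<open>Sliding the unit arrow of one projection out of the product turns both sides into a unit
  constraint at the unit object, preceded by the product of the two unit arrows. There
  \<open>ur\<close> and \<open>ul\<close> agree.\<close>

lemma agree_u:
  assumes "Unitary \<in> K" "X1 \<in> Obj S" "X2 \<in> Obj S"
  shows "Cmp G (sr lift_ext (Pr1 S X1 X2)) (dr X1 X2 (sob uT X1)) = Cmp G (sr lift_ext (Pr2 S X1 X2)) (dl X1 X2 (sob uT X2))"
  using ur_slide(1)[of "sr lift_ext (Pr1 S X1 X2)" "sr lift_ext (Pr2 S X1 X2)"]
    ur_slide(2)[of "sr lift_ext (Pr2 S X1 X2)" "sr lift_ext (Pr1 S X1 X2)"] t.ur_ul[of "Prd S X1 X2"]
  by (simp add: dr_det dl_det assms v_simps)

lemma sr_lam_Cmp: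
  assumes "Unitary \<in> K" "k \<in> Arr S" "l \<in> Arr S" "Cod S l = Dom S k"
  shows "Cmp G (sr lift_ext (Cmp S k l)) (gpa l (lam k (sob uT (Cod S k)))) = Cmp G (sr lift_ext l) (gpa l (dec (Dom S k) (sar uT k)))"
proof -
  have l: "lam k (sob uT (Cod S k)) \<in> Arr G" "Dom G (lam k (sob uT (Cod S k))) = emb (Dom S k) (pbo H k (sob uT (Cod S k)))"
     "Cod G (lam k (sob uT (Cod S k))) = (k, sob uT (Cod S k))"
    using assms by (simp_all add: lam_simps unit_obj vert_arr_only)
  have o: "sob uT (Cod S k) \<in> Obj (Fib H (Cod S k))"
    using assms by (simp add: unit_obj vert_arr_only)
  show ?thesis
    using assms l o sr_lam[of k, symmetric] t.sr_cmp[of k l] by (simp add: v_simps)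
qed

text \<open>The unit arrow along the composite absorbs \<open>lam\<close> in the unit factor by
  \<open>sr_lam_Cmp\<close>; the remaining \<open>lam\<close> in the factor of the object slides
  out.\<close>

lemma m_r:
  assumes "Unitary \<in> K" "f1 \<in> Arr S" "f2 \<in> Arr S" "A1 \<in> Obj (Fib H (Cod S f1))"
  shows "Cmp G (gpa (prd_arr S f1 f2) (dr (Cod S f1) (Cod S f2) A1)) (ba (lam f1 A1) (lam f2 (sob uT (Cod S f2)))) =
    Cmp G (gpa (Pr1 S (Dom S f1) (Dom S f2)) (lam f1 A1)) (Cmp G (dr (Dom S f1) (Dom S f2) (pbo H f1 A1))
      (ba (Ide G (emb (Dom S f1) (pbo H f1 A1))) (dec (Dom S f2) (sar uT f2))))"
proof -
  let ?p = "Pr2 S (Dom S f1) (Dom S f2)"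
  have s: "sar uT f2 \<in> Arr (Fib H (Dom S f2))" "Dom (Fib H (Dom S f2)) (sar uT f2) = pbo H f2 (sob uT (Cod S f2))"
     "Cod (Fib H (Dom S f2)) (sar uT f2) = sob uT (Dom S f2)"
    using assms sar_simps[of f2 "Dom S f2"] by (simp_all add: fib_simps vert_arr_only)
  show ?thesis
    using ur_slide(1)[of "gpa (Pr1 S (Dom S f1) (Dom S f2)) (lam f1 A1)" "Cmp G (sr lift_ext ?p) (gpa ?p (dec (Dom S f2) (sar uT f2)))"]
    by (simp add: dr_det[of "Dom S f1" "Dom S f2"] dr_gpa assms v_simps s sr_lam_Cmp flip: xta_Cmp)
qed

lemma m_l:
  assumes "Unitary \<in> K" "f1 \<in> Arr S" "f2 \<in> Arr S" "A2 \<in> Obj (Fib H (Cod S f2))"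
  shows "Cmp G (gpa (prd_arr S f1 f2) (dl (Cod S f1) (Cod S f2) A2)) (ba (lam f1 (sob uT (Cod S f1))) (lam f2 A2)) =
    Cmp G (gpa (Pr2 S (Dom S f1) (Dom S f2)) (lam f2 A2)) (Cmp G (dl (Dom S f1) (Dom S f2) (pbo H f2 A2))
      (ba (dec (Dom S f1) (sar uT f1)) (Ide G (emb (Dom S f2) (pbo H f2 A2)))))"
proof -
  let ?p = "Pr1 S (Dom S f1) (Dom S f2)"
  have s: "sar uT f1 \<in> Arr (Fib H (Dom S f1))" "Dom (Fib H (Dom S f1)) (sar uT f1) = pbo H f1 (sob uT (Cod S f1))"
     "Cod (Fib H (Dom S f1)) (sar uT f1) = sob uT (Dom S f1)"
    using assms sar_simps[of f1 "Dom S f1"] by (simp_all add: fib_simps vert_arr_only)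
  show ?thesis
    using ur_slide(2)[of "gpa (Pr2 S (Dom S f1) (Dom S f2)) (lam f2 A2)" "Cmp G (sr lift_ext ?p) (gpa ?p (dec (Dom S f1) (sar uT f1)))"]
    by (simp add: dl_det[of "Dom S f1" "Dom S f2"] dl_gpa assms v_simps s sr_lam_Cmp flip: xta_Cmp)
qed

text \<open>In each of the three cases the unit isomorphism brings in a unit arrow of a projection.
  Naturality of associativity moves it to the front, and the law of \<open>lift_ext\<close> relating
  associativity and units applies.\<close>

lemma au:
  assumes "Associative \<in> K" "Unitary \<in> K" "X1 \<in> Obj S" "X2 \<in> Obj S" "X3 \<in> Obj S"
  shows "A2 \<in> Obj (Fib H X2) \<Longrightarrow> A3 \<in> Obj (Fib H X3) \<Longrightarrow>
    Cmp G (gpa (passoc S X1 X2 X3) (dl X1 (Prd S X2 X3) (xob T X2 X3 A2 A3))) (da X1 X2 X3 (sob uT X1) A2 A3) = ba (dl X1 X2 A2) (Ide G (emb X3 A3))"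
   and "A1 \<in> Obj (Fib H X1) \<Longrightarrow> A3 \<in> Obj (Fib H X3) \<Longrightarrow>
    Cmp G (gpa (passoc S X1 X2 X3) (ba (Ide G (emb X1 A1)) (dl X2 X3 A3))) (da X1 X2 X3 A1 (sob uT X2) A3) = ba (dr X1 X2 A1) (Ide G (emb X3 A3))"
   and "A1 \<in> Obj (Fib H X1) \<Longrightarrow> A2 \<in> Obj (Fib H X2) \<Longrightarrow>
    Cmp G (gpa (passoc S X1 X2 X3) (ba (Ide G (emb X1 A1)) (dr X2 X3 A2))) (da X1 X2 X3 A1 A2 (sob uT X3)) = dr (Prd S X1 X2) X3 (xob T X1 X2 A1 A2)"
proof -
  let ?q = "Pr1 S (Prd S X1 X2) X3"
  let ?p1 = "Cmp S (Pr1 S X1 X2) ?q" and ?p2 = "Cmp S (Pr2 S X1 X2) ?q" and ?p3 = "Pr2 S (Prd S X1 X2) X3"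
  let ?o = "one lift_ext (Prd S (Prd S X1 X2) X3)"
  {
    assume A: "A2 \<in> Obj (Fib H X2)" "A3 \<in> Obj (Fib H X3)"
    note n = t.sas_nat[of "sr lift_ext ?p1" "Ide G (?p2, A2)" "Ide G (?p3, A3)", unfolded ext_sel(1,2)]
    note m = t.ul_sas[of "(?p2, A2)" "(?p3, A3)", unfolded ext_sel(1,2)]
    show "Cmp G (gpa (passoc S X1 X2 X3) (dl X1 (Prd S X2 X3) (xob T X2 X3 A2 A3))) (da X1 X2 X3 (sob uT X1) A2 A3) = ba (dl X1 X2 A2) (Ide G (emb X3 A3))"
      using n tot.reassoc[OF m, of "xta (xta (sr lift_ext ?p1) (Ide G (?p2, A2))) (Ide G (?p3, A3))"]
      by (simp add: dl_gpa da_sas assms A v_simps flip: xta_Cmp)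
  next
    assume A: "A1 \<in> Obj (Fib H X1)" "A3 \<in> Obj (Fib H X3)"
    note n = t.sas_nat[of "Ide G (?p1, A1)" "sr lift_ext ?p2" "Ide G (?p3, A3)", unfolded ext_sel(1,2)]
    note m = t.ur_ul_sas[of "(?p1, A1)" "(?p3, A3)", unfolded ext_sel(1,2)]
    have e: "xta (Ide G (?p1, A1)) (Cmp G (ul lift_ext (?p3, A3)) (xta (sr lift_ext ?p2) (Ide G (?p3, A3)))) =
      Cmp G (xta (Ide G (?p1, A1)) (ul lift_ext (?p3, A3))) (xta (Ide G (?p1, A1)) (xta (sr lift_ext ?p2) (Ide G (?p3, A3))))"
      by (simp add: assms A v_simps flip: xta_Cmp)
    have l: "gpa (passoc S X1 X2 X3) (ba (Ide G (emb X1 A1)) (dl X2 X3 A3)) =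
      xta (Ide G (?p1, A1)) (Cmp G (ul lift_ext (?p3, A3)) (xta (sr lift_ext ?p2) (Ide G (?p3, A3))))"
      by (simp add: dl_gpa assms A v_simps del: ba_xta)
    have r: "ba (dr X1 X2 A1) (Ide G (emb X3 A3)) =
      Cmp G (xta (ur lift_ext (?p1, A1)) (Ide G (?p3, A3))) (xta (xta (Ide G (?p1, A1)) (sr lift_ext ?p2)) (Ide G (?p3, A3)))"
      by (simp add: dr_gpa assms A v_simps flip: xta_Cmp)
    show "Cmp G (gpa (passoc S X1 X2 X3) (ba (Ide G (emb X1 A1)) (dl X2 X3 A3))) (da X1 X2 X3 A1 (sob uT X2) A3) = ba (dr X1 X2 A1) (Ide G (emb X3 A3))"
      unfolding l r e using n tot.reassoc[OF m, of "xta (xta (Ide G (?p1, A1)) (sr lift_ext ?p2)) (Ide G (?p3, A3))"]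
      by (simp add: da_sas assms A v_simps)
  next
    assume A: "A1 \<in> Obj (Fib H X1)" "A2 \<in> Obj (Fib H X2)"
    note n = t.sas_nat[of "Ide G (?p1, A1)" "Ide G (?p2, A2)" "sr lift_ext ?p3", unfolded ext_sel(1,2)]
    note m = t.ur_sas[of "(?p1, A1)" "(?p2, A2)", unfolded ext_sel(1,2)]
    have e: "xta (Ide G (?p1, A1)) (Cmp G (ur lift_ext (?p2, A2)) (xta (Ide G (?p2, A2)) (sr lift_ext ?p3))) =
      Cmp G (xta (Ide G (?p1, A1)) (ur lift_ext (?p2, A2))) (xta (Ide G (?p1, A1)) (xta (Ide G (?p2, A2)) (sr lift_ext ?p3)))"
      by (simp add: assms A v_simps flip: xta_Cmp)
    have l: "gpa (passoc S X1 X2 X3) (ba (Ide G (emb X1 A1)) (dr X2 X3 A2)) =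
      xta (Ide G (?p1, A1)) (Cmp G (ur lift_ext (?p2, A2)) (xta (Ide G (?p2, A2)) (sr lift_ext ?p3)))"
      by (simp add: dr_gpa assms A v_simps del: ba_xta)
    show "Cmp G (gpa (passoc S X1 X2 X3) (ba (Ide G (emb X1 A1)) (dr X2 X3 A2))) (da X1 X2 X3 A1 A2 (sob uT X3)) = dr (Prd S X1 X2) X3 (xob T X1 X2 A1 A2)"
      unfolding l e using n tot.reassoc[OF m, of "xta (xta (Ide G (?p1, A1)) (Ide G (?p2, A2))) (sr lift_ext ?p3)"]
      by (simp add: dr_det[of "Prd S X1 X2" X3] da_sas assms A v_simps)
  }
qed

lemma cu:
  assumes "Symmetric \<in> K" "Unitary \<in> K" "X1 \<in> Obj S" "X2 \<in> Obj S" "B \<in> Obj (Fib H X2)"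
  shows "Cmp G (gpa (pswap S X1 X2) (dr X2 X1 B)) (dc X1 X2 (sob uT X1) B) = dl X1 X2 B"
proof -
  let ?p1 = "Pr1 S X1 X2" and ?p2 = "Pr2 S X1 X2"
  note n = t.sco_nat[of "sr lift_ext ?p1" "Ide G (?p2, B)", unfolded ext_sel(1,2)]
  note m = t.ur_sco[of "(?p2, B)"]
  show ?thesis
    using n tot.reassoc[OF m, of "xta (sr lift_ext ?p1) (Ide G (?p2, B))"]
    by (simp add: dr_gpa dl_det dc_sco assms v_simps)
qed

lemma K_external_lifted: "K_external S H K T"
proof -
  have assoc: "external_assoc S H T aT" if K: "Associative \<in> K"
    unfolding external_assoc_def nat_iso3_iff
  proof (intro conjI ballI allI, goal_cases)
    case (4 X1 X2 X3 u v w)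
    then show ?case using nat_a_iff[THEN iffD1, OF K 4 nat_a[OF K 4]] by simp
  next
    case 5
    then show ?case using pentagon_iff[THEN iffD1, OF K 5 pentagon_a[OF K 5]] by simp
  next
    case (6 X1 X2 X3 Y1 Y2 Y3 f1 f2 f3 A1 A2 A3)
    then have s: "X1 = Cod S f1" "X2 = Cod S f2" "X3 = Cod S f3" "Y1 = Dom S f1" "Y2 = Dom S f2" "Y3 = Dom S f3"
      and t: "f1 \<in> Arr S" "f2 \<in> Arr S" "f3 \<in> Arr S" by (auto simp: Hom_iff)
    note r = K t 6(4-6)[unfolded s]
    show ?case unfolding s using m_a_iff[THEN iffD1, OF r m_a[OF r]] by (simp only: Let_def)
  qed (simp_all add: K a_und)
  have comm: "external_comm S H T cT" if K: "Symmetric \<in> K"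
    unfolding external_comm_def nat_iso2_iff
  proof (intro conjI ballI allI, goal_cases)
    case (4 X1 X2 u v)
    then show ?case using nat_c_iff[THEN iffD1, OF K 4 nat_c[OF K 4]] by simp
  next
    case 5
    then show ?case using inv_c_iff[THEN iffD1, OF K 5 inv_c[OF K 5]] by simp
  next
    case (6 X1 X2 Y1 Y2 f1 f2 A1 A2)
    then have s: "X1 = Cod S f1" "X2 = Cod S f2" "Y1 = Dom S f1" "Y2 = Dom S f2"
      and t: "f1 \<in> Arr S" "f2 \<in> Arr S" by (auto simp: Hom_iff)
    note r = K t 6(3-4)[unfolded s]
    show ?case unfolding s using m_c_iff[THEN iffD1, OF r m_c[OF r]] by (simp only: Let_def)
  qed (simp_all add: K c_und)
  have unit: "external_unit S H T uT" if K: "Unitary \<in> K"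
    unfolding external_unit_def nat_iso_iff
  proof (intro conjI ballI allI, goal_cases)
    case 1
    then show ?case by (rule u_section[OF K])
  next
    case (5 X1 X2 v)
    then show ?case using nat_r_iff[THEN iffD1, OF K 5 nat_r[OF K 5]] by simp
  next
    case (9 X1 X2 v)
    then show ?case using nat_l_iff[THEN iffD1, OF K 9 nat_l[OF K 9]] by simp
  next
    case 10
    then show ?case using agree_iff[THEN iffD1, OF K 10 agree_u[OF K 10]] by simp
  next
    case (11 X1 X2 Y1 Y2 f1 f2 A1)
    then have s: "X1 = Cod S f1" "X2 = Cod S f2" "Y1 = Dom S f1" "Y2 = Dom S f2"
      and t: "f1 \<in> Arr S" "f2 \<in> Arr S" by (auto simp: Hom_iff)
    note r = K t 11(3)[unfolded s]
    show ?case unfolding s using m_r_iff[THEN iffD1, OF r m_r[OF r]] by (simp only: Let_def)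
  next
    case (12 X1 X2 Y1 Y2 f1 f2 A2)
    then have s: "X1 = Cod S f1" "X2 = Cod S f2" "Y1 = Dom S f1" "Y2 = Dom S f2"
      and t: "f1 \<in> Arr S" "f2 \<in> Arr S" by (auto simp: Hom_iff)
    note r = K t 12(3)[unfolded s]
    show ?case unfolding s using m_l_iff[THEN iffD1, OF r m_l[OF r]] by (simp only: Let_def)
  qed (simp_all add: K u_und)
  have ac: "external_compat_ac S H T aT cT" if K: "Associative \<in> K" "Symmetric \<in> K"
    unfolding external_compat_ac_def
    using hexagon_iff[THEN iffD1, OF K _ _ _ _ _ _ hexagon_ac[OF K]] by blast
  have au: "external_compat_au S H T aT uT" if K: "Associative \<in> K" "Unitary \<in> K"
    unfolding external_compat_au_def
    using au_iff(1)[THEN iffD1, OF K _ _ _ _ _ au(1)[OF K]] au_iff(2)[THEN iffD1, OF K _ _ _ _ _ au(2)[OF K]]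
      au_iff(3)[THEN iffD1, OF K _ _ _ _ _ au(3)[OF K]] by blast
  have cu: "external_compat_cu S H cT uT" if K: "Symmetric \<in> K" "Unitary \<in> K"
    unfolding external_compat_cu_def using cu_iff[THEN iffD1, OF K _ _ _ cu[OF K]] by blast
  show ?thesis
    unfolding K_external_def using T_base assoc comm unit ac au cu shape by auto
qed

end

section \<open>Equivalences of external structures and equivalences over \<open>G\<close>\<close>

locale external_comparison = fibered_over_products S H + T1: external_structure S H K T1 + T2: external_structure S H K T2
  for S :: "('s, 'f) pcat" and H :: "('s, 'f, 'o, 'a) fib" and K and T1 T2 :: "('s, 'f, 'o, 'a) K_ext" +
  fixes e :: "'s \<Rightarrow> 's \<Rightarrow> 'o \<Rightarrow> 'o \<Rightarrow> 'a" and w :: "'s \<Rightarrow> 'a"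
  assumes e_typed: "X1 \<in> Obj S \<Longrightarrow> X2 \<in> Obj S \<Longrightarrow> A1 \<in> Obj (Fib H X1) \<Longrightarrow> A2 \<in> Obj (Fib H X2) \<Longrightarrow> isoar (Fib H (Prd S X1 X2)) (e X1 X2 A1 A2)"
    "X1 \<in> Obj S \<Longrightarrow> X2 \<in> Obj S \<Longrightarrow> A1 \<in> Obj (Fib H X1) \<Longrightarrow> A2 \<in> Obj (Fib H X2) \<Longrightarrow> Dom (Fib H (Prd S X1 X2)) (e X1 X2 A1 A2) = xob T1 X1 X2 A1 A2"
    "X1 \<in> Obj S \<Longrightarrow> X2 \<in> Obj S \<Longrightarrow> A1 \<in> Obj (Fib H X1) \<Longrightarrow> A2 \<in> Obj (Fib H X2) \<Longrightarrow> Cod (Fib H (Prd S X1 X2)) (e X1 X2 A1 A2) = xob T2 X1 X2 A1 A2"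
    and w_typed: "Unitary \<in> K \<Longrightarrow> X \<in> Obj S \<Longrightarrow> isoar (Fib H X) (w X)"
      "Unitary \<in> K \<Longrightarrow> X \<in> Obj S \<Longrightarrow> Dom (Fib H X) (w X) = sob (the (xunit T1)) X"
      "Unitary \<in> K \<Longrightarrow> X \<in> Obj S \<Longrightarrow> Cod (Fib H X) (w X) = sob (the (xunit T2)) X"
begin

definition E where
  "E X1 X2 A1 A2 = (emb (Prd S X1 X2) (xob T1 X1 X2 A1 A2), e X1 X2 A1 A2, emb (Prd S X1 X2) (xob T2 X1 X2 A1 A2))"

definition W where
  "W X = (emb X (sob T1.uT X), w X, emb X (sob T2.uT X))"

lemmas c_simps = T1.und_all T2.und_all e_typed w_typed E_def W_def

lemma E_simps:
  assumes "X1 \<in> Obj S" "X2 \<in> Obj S" "A1 \<in> Obj (Fib H X1)" "A2 \<in> Obj (Fib H X2)"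
  shows "isoar G (E X1 X2 A1 A2)" "E X1 X2 A1 A2 \<in> Arr G"
    "Dom G (E X1 X2 A1 A2) = (Ide S (Prd S X1 X2), xob T1 X1 X2 A1 A2)"
    "Cod G (E X1 X2 A1 A2) = (Ide S (Prd S X1 X2), xob T2 X1 X2 A1 A2)"
  using assms by (simp_all add: c_simps)

lemma W_simps:
  assumes "Unitary \<in> K" "X \<in> Obj S"
  shows "isoar G (W X)" "W X \<in> Arr G" "Dom G (W X) = (Ide S X, sob T1.uT X)" "Cod G (W X) = (Ide S X, sob T2.uT X)"
  using assms by (simp_all add: c_simps)

text \<open>This and the following equivalences of equations use only the typing of \<open>e\<close>
  and \<open>w\<close>, so they serve both for lifting an equivalence to \<open>G\<close> and for
  reading one off.\<close>

lemma E_nat_iff: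
  assumes "X1 \<in> Obj S" "X2 \<in> Obj S" "u \<in> Arr (Fib H X1)" "v \<in> Arr (Fib H X2)"
  shows "Cmp G (E X1 X2 (Cod (Fib H X1) u) (Cod (Fib H X2) v)) (T1.ba (dec X1 u) (dec X2 v)) =
      Cmp G (T2.ba (dec X1 u) (dec X2 v)) (E X1 X2 (Dom (Fib H X1) u) (Dom (Fib H X2) v)) \<longleftrightarrow>
    Cmp (Fib H (Prd S X1 X2)) (e X1 X2 (Cod (Fib H X1) u) (Cod (Fib H X2) v)) (xar T1 X1 X2 u v) =
      Cmp (Fib H (Prd S X1 X2)) (xar T2 X1 X2 u v) (e X1 X2 (Dom (Fib H X1) u) (Dom (Fib H X2) v))"
  by (simp add: c_simps assms)

lemma E_m_iff:
  assumes "f1 \<in> Arr S" "f2 \<in> Arr S" "A1 \<in> Obj (Fib H (Cod S f1))" "A2 \<in> Obj (Fib H (Cod S f2))"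
  shows "Cmp G (gpa (prd_arr S f1 f2) (E (Cod S f1) (Cod S f2) A1 A2)) (T1.ba (lam f1 A1) (lam f2 A2)) =
      Cmp G (T2.ba (lam f1 A1) (lam f2 A2)) (E (Dom S f1) (Dom S f2) (pbo H f1 A1) (pbo H f2 A2)) \<longleftrightarrow>
    Cmp (Fib H (Prd S (Dom S f1) (Dom S f2))) (pba H (prd_arr S f1 f2) (e (Cod S f1) (Cod S f2) A1 A2)) (xm T1 f1 f2 A1 A2) =
      Cmp (Fib H (Prd S (Dom S f1) (Dom S f2))) (xm T2 f1 f2 A1 A2) (e (Dom S f1) (Dom S f2) (pbo H f1 A1) (pbo H f2 A2))"
  by (simp add: c_simps assms)

lemma E_a_iff:
  assumes "Associative \<in> K" "X1 \<in> Obj S" "X2 \<in> Obj S" "X3 \<in> Obj S" "A1 \<in> Obj (Fib H X1)" "A2 \<in> Obj (Fib H X2)" "A3 \<in> Obj (Fib H X3)"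
  shows "Cmp G (T2.da X1 X2 X3 A1 A2 A3) (Cmp G (E (Prd S X1 X2) X3 (xob T2 X1 X2 A1 A2) A3) (T1.ba (E X1 X2 A1 A2) (Ide G (emb X3 A3)))) =
      Cmp G (gpa (passoc S X1 X2 X3) (E X1 (Prd S X2 X3) A1 (xob T2 X2 X3 A2 A3)))
       (Cmp G (gpa (passoc S X1 X2 X3) (T1.ba (Ide G (emb X1 A1)) (E X2 X3 A2 A3))) (T1.da X1 X2 X3 A1 A2 A3)) \<longleftrightarrow>
    (let Q = Prd S (Prd S X1 X2) X3 in
      Cmp (Fib H Q) (T2.aT X1 X2 X3 A1 A2 A3) (Cmp (Fib H Q) (e (Prd S X1 X2) X3 (xob T2 X1 X2 A1 A2) A3)
         (xar T1 (Prd S X1 X2) X3 (e X1 X2 A1 A2) (Ide (Fib H X3) A3))) =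
      Cmp (Fib H Q) (pba H (passoc S X1 X2 X3) (e X1 (Prd S X2 X3) A1 (xob T2 X2 X3 A2 A3)))
       (Cmp (Fib H Q) (pba H (passoc S X1 X2 X3) (xar T1 X1 (Prd S X2 X3) (Ide (Fib H X1) A1) (e X2 X3 A2 A3))) (T1.aT X1 X2 X3 A1 A2 A3)))"
  by (simp add: c_simps assms Let_def)

lemma E_c_iff:
  assumes "Symmetric \<in> K" "X1 \<in> Obj S" "X2 \<in> Obj S" "A1 \<in> Obj (Fib H X1)" "A2 \<in> Obj (Fib H X2)"
  shows "Cmp G (T2.dc X1 X2 A1 A2) (E X1 X2 A1 A2) = Cmp G (gpa (pswap S X1 X2) (E X2 X1 A2 A1)) (T1.dc X1 X2 A1 A2) \<longleftrightarrow>
    Cmp (Fib H (Prd S X1 X2)) (T2.cT X1 X2 A1 A2) (e X1 X2 A1 A2) =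
      Cmp (Fib H (Prd S X1 X2)) (pba H (pswap S X1 X2) (e X2 X1 A2 A1)) (T1.cT X1 X2 A1 A2)"
  by (simp add: c_simps assms)

lemma E_r_iff:
  assumes "Unitary \<in> K" "X1 \<in> Obj S" "X2 \<in> Obj S" "A \<in> Obj (Fib H X1)"
  shows "T1.dr X1 X2 A = Cmp G (T2.dr X1 X2 A) (Cmp G (E X1 X2 A (sob T2.uT X2)) (T1.ba (Ide G (emb X1 A)) (W X2))) \<longleftrightarrow>
    xur T1.uT X1 X2 A = Cmp (Fib H (Prd S X1 X2)) (xur T2.uT X1 X2 A) (Cmp (Fib H (Prd S X1 X2)) (e X1 X2 A (sob T2.uT X2))
       (xar T1 X1 X2 (Ide (Fib H X1) A) (w X2)))"
  by (simp add: c_simps assms)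

lemma E_l_iff:
  assumes "Unitary \<in> K" "X1 \<in> Obj S" "X2 \<in> Obj S" "A \<in> Obj (Fib H X2)"
  shows "T1.dl X1 X2 A = Cmp G (T2.dl X1 X2 A) (Cmp G (E X1 X2 (sob T2.uT X1) A) (T1.ba (W X1) (Ide G (emb X2 A)))) \<longleftrightarrow>
    xul T1.uT X1 X2 A = Cmp (Fib H (Prd S X1 X2)) (xul T2.uT X1 X2 A) (Cmp (Fib H (Prd S X1 X2)) (e X1 X2 (sob T2.uT X1) A)
       (xar T1 X1 X2 (w X1) (Ide (Fib H X2) A)))"
  by (simp add: c_simps assms)

lemma W_iff:
  assumes "Unitary \<in> K" "k \<in> Arr S"
  shows "Cmp G (sr T2.lift_ext k) (gpa k (W (Cod S k))) = Cmp G (W (Dom S k)) (sr T1.lift_ext k) \<longleftrightarrow>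
    Cmp (Fib H (Dom S k)) (sar T2.uT k) (pba H k (w (Cod S k))) = Cmp (Fib H (Dom S k)) (w (Dom S k)) (sar T1.uT k)"
  by (simp add: c_simps T1.ext_sel T2.ext_sel assms)

definition ee where
  "ee a b = gpa (pair S (fst a) (fst b)) (E (Cod S (fst a)) (Cod S (fst b)) (snd a) (snd b))"

lemmas p_simps = T1.q_simps T2.q_simps T1.ba_xta T2.ba_xta E_simps W_simps

lemma sequiv_of_equivalence:
  assumes e: "is_external_equivalence S H T1 T2 e"
    and w: "Unitary \<in> K \<Longrightarrow> is_section_iso S H T1.uT T2.uT w"
    and wr: "\<And>X1 X2 A. Unitary \<in> K \<Longrightarrow> X1 \<in> Obj S \<Longrightarrow> X2 \<in> Obj S \<Longrightarrow> A \<in> Obj (Fib H X1) \<Longrightarrow>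
      xur T1.uT X1 X2 A = Cmp (Fib H (Prd S X1 X2)) (xur T2.uT X1 X2 A) (Cmp (Fib H (Prd S X1 X2)) (e X1 X2 A (sob T2.uT X2))
       (xar T1 X1 X2 (Ide (Fib H X1) A) (w X2)))"
    and wl: "\<And>X1 X2 A. Unitary \<in> K \<Longrightarrow> X1 \<in> Obj S \<Longrightarrow> X2 \<in> Obj S \<Longrightarrow> A \<in> Obj (Fib H X2) \<Longrightarrow>
      xul T1.uT X1 X2 A = Cmp (Fib H (Prd S X1 X2)) (xul T2.uT X1 X2 A) (Cmp (Fib H (Prd S X1 X2)) (e X1 X2 (sob T2.uT X1) A)
       (xar T1 X1 X2 (w X1) (Ide (Fib H X2) A)))"
  shows "sequiv_map S G gbs gpl gpa K T1.lift_ext T2.lift_ext ee W"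
proof -
  note e' = e[unfolded is_external_equivalence_def nat_iso2_iff]
  have sh: "Associative \<in> K \<Longrightarrow> xassoc T1 = Some T1.aT \<and> xassoc T2 = Some T2.aT" "Symmetric \<in> K \<Longrightarrow> xcomm T1 = Some T1.cT \<and> xcomm T2 = Some T2.cT"
    using T1.K_ext T2.K_ext by (auto simp: K_external_def)
  have en: "Cmp G (E X1 X2 (Cod (Fib H X1) u) (Cod (Fib H X2) v)) (T1.ba (dec X1 u) (dec X2 v)) =
      Cmp G (T2.ba (dec X1 u) (dec X2 v)) (E X1 X2 (Dom (Fib H X1) u) (Dom (Fib H X2) v))"
    if "X1 \<in> Obj S" "X2 \<in> Obj S" "u \<in> Arr (Fib H X1)" "v \<in> Arr (Fib H X2)" for X1 X2 u v
    unfolding E_nat_iff[OF that] by (rule e'[THEN conjunct1, rule_format, THEN conjunct2, rule_format, OF that])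
  have em: "Cmp G (gpa (prd_arr S f1 f2) (E (Cod S f1) (Cod S f2) A1 A2)) (T1.ba (lam f1 A1) (lam f2 A2)) =
      Cmp G (T2.ba (lam f1 A1) (lam f2 A2)) (E (Dom S f1) (Dom S f2) (pbo H f1 A1) (pbo H f2 A2))"
    if "f1 \<in> Arr S" "f2 \<in> Arr S" "A1 \<in> Obj (Fib H (Cod S f1))" "A2 \<in> Obj (Fib H (Cod S f2))" for f1 f2 A1 A2
    unfolding E_m_iff[OF that]
    by (rule e'[THEN conjunct2, THEN conjunct1, rule_format, OF T1.Hom_self[OF that(1)] T1.Hom_self[OF that(2)] that(3,4)])
  have ea: "Cmp G (T2.da X1 X2 X3 A1 A2 A3) (Cmp G (E (Prd S X1 X2) X3 (xob T2 X1 X2 A1 A2) A3) (T1.ba (E X1 X2 A1 A2) (Ide G (emb X3 A3)))) =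
      Cmp G (gpa (passoc S X1 X2 X3) (E X1 (Prd S X2 X3) A1 (xob T2 X2 X3 A2 A3)))
       (Cmp G (gpa (passoc S X1 X2 X3) (T1.ba (Ide G (emb X1 A1)) (E X2 X3 A2 A3))) (T1.da X1 X2 X3 A1 A2 A3))"
    if "Associative \<in> K" "X1 \<in> Obj S" "X2 \<in> Obj S" "X3 \<in> Obj S" "A1 \<in> Obj (Fib H X1)" "A2 \<in> Obj (Fib H X2)" "A3 \<in> Obj (Fib H X3)"
    for X1 X2 X3 A1 A2 A3
    unfolding E_a_iff[OF that]
    by (rule e'[THEN conjunct2, THEN conjunct2, THEN conjunct1, rule_format, OF sh(1)[OF that(1)] that(2-7)])
  have ec: "Cmp G (T2.dc X1 X2 A1 A2) (E X1 X2 A1 A2) = Cmp G (gpa (pswap S X1 X2) (E X2 X1 A2 A1)) (T1.dc X1 X2 A1 A2)"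
    if "Symmetric \<in> K" "X1 \<in> Obj S" "X2 \<in> Obj S" "A1 \<in> Obj (Fib H X1)" "A2 \<in> Obj (Fib H X2)" for X1 X2 A1 A2
    unfolding E_c_iff[OF that]
    by (rule e'[THEN conjunct2, THEN conjunct2, THEN conjunct2, THEN conjunct1, rule_format, OF sh(2)[OF that(1)] that(2-5)])
  note er = E_r_iff[THEN iffD2, OF _ _ _ _ wr] and el = E_l_iff[THEN iffD2, OF _ _ _ _ wl]
  have ws: "Cmp G (sr T2.lift_ext k) (gpa k (W (Cod S k))) = Cmp G (W (Dom S k)) (sr T1.lift_ext k)" if "Unitary \<in> K" "k \<in> Arr S" for k
    unfolding W_iff[OF that] using w[OF that(1)] that by (simp add: is_section_iso_def Hom_iff)
  note Ls = Lam_pair Emb_def Dec_def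
  \<comment> \<open>Naturality of \<open>ee\<close> is assembled as for the constraints:
    \<open>eL\<close> is compatibility with m and \<open>eD\<close> is naturality in a fiber, both
    pulled back along the diagonal.\<close>
  have eL: "Cmp G (ee a b) (T1.xta (Lam a) (Lam b)) = Cmp G (T2.xta (Lam a) (Lam b)) (ee (Emb a) (Emb b))"
    if "a \<in> Obj G" "b \<in> Obj G" "gbs b = gbs a" for a b
  proof -
    obtain f1 A1 f2 A2 where o: "a = (f1, A1)" "b = (f2, A2)" by (cases a; cases b)
    let ?Z = "Dom S f1"
    have s: "f1 \<in> Arr S" "A1 \<in> Obj (Fib H (Cod S f1))" "f2 \<in> Arr S" "A2 \<in> Obj (Fib H (Cod S f2))" "Dom S f2 = ?Z"
      using that by (simp_all add: o G_simps)
    show ?thesis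
      using arg_cong[OF em[of f1 f2 A1 A2], of "gpa (pair S (Ide S ?Z) (Ide S ?Z))"]
      by (simp add: o Ls p_simps ee_def s prd_arr_def)
  qed
  have eD: "Cmp G (ee (Emb (Cod G u)) (Emb (Cod G v))) (T1.xta (Dec u) (Dec v)) =
     Cmp G (T2.xta (Dec u) (Dec v)) (ee (Emb (Dom G u)) (Emb (Dom G v)))"
    if "u \<in> Arr G" "v \<in> Arr G" "gbs (Dom G v) = gbs (Dom G u)" for u v
  proof -
    let ?Z = "gbs (Dom G u)"
    have Z: "?Z \<in> Obj S" using that by (simp add: vert_simps)
    have n: "und v \<in> Arr (Fib H ?Z)" "Dom (Fib H ?Z) (und v) = real (Dom G v)" "Cod (Fib H ?Z) (und v) = real (Cod G v)"
      using und_simps[of v] that by simp_all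
    show ?thesis
      using arg_cong[OF en[of ?Z ?Z "und u" "und v"], of "gpa (pair S (Ide S ?Z) (Ide S ?Z))"]
      by (simp add: p_simps Ls ee_def that Z und_simps n real_obj)
  qed
  have et: "isoar G (ee a b) \<and> Dom G (ee a b) = T1.xto a b \<and> Cod G (ee a b) = T2.xto a b \<and> ee a b \<in> Arr G"
    if "a \<in> Obj G" "b \<in> Obj G" "gbs b = gbs a" for a b
    using that by (cases a; cases b) (simp add: ee_def p_simps isoar_pa)
  show ?thesis
  proof (rule sequiv_map.intro[OF T1.stensor_ext T2.styped_ext sequiv_map_axioms.intro], goal_cases)
    case (4 u v)
    have "Cmp G (ee (Cod G u) (Cod G v)) (T1.xta u v) = Cmp G (T2.xta u v) (ee (Dom G u) (Dom G v))"
    proof (rule tot.nat_extend[OF _ _ eL eL eD])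
      show "Cmp G (T1.xta u v) (T1.xta (Lam (Dom G u)) (Lam (Dom G v))) = Cmp G (T1.xta (Lam (Cod G u)) (Lam (Cod G v))) (T1.xta (Dec u) (Dec v))"
        using 4 by (simp add: T1.L_simps flip: T1.xta_Cmp)
      show "Cmp G (T2.xta u v) (T2.xta (Lam (Dom G u)) (Lam (Dom G v))) = Cmp G (T2.xta (Lam (Cod G u)) (Lam (Cod G v))) (T2.xta (Dec u) (Dec v))"
        using 4 by (simp add: T1.L_simps T2.xta_simps flip: T2.xta_Cmp)
    qed (use 4 in \<open>simp_all add: T1.L_simps T2.L_simps et\<close>)
    then show ?case by (simp add: T1.ext_sel T2.ext_sel)
  next
    case (5 k a b)
    then show ?case by (cases a; cases b) (simp add: ee_def p_simps)
  next
    case (6 a b c)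
    obtain f1 A1 f2 A2 f3 A3 where o: "a = (f1, A1)" "b = (f2, A2)" "c = (f3, A3)" by (cases a; cases b; cases c)
    have s: "f1 \<in> Arr S" "A1 \<in> Obj (Fib H (Cod S f1))" "f2 \<in> Arr S" "A2 \<in> Obj (Fib H (Cod S f2))"
      "f3 \<in> Arr S" "A3 \<in> Obj (Fib H (Cod S f3))" "Dom S f2 = Dom S f1" "Dom S f3 = Dom S f1"
      using 6(2-) by (simp_all add: o G_simps)
    show ?case
      using arg_cong[OF ea[of "Cod S f1" "Cod S f2" "Cod S f3" A1 A2 A3], of "gpa (pair S (pair S f1 f2) f3)"]
      by (simp add: o p_simps ee_def 6(1) s passoc_def)
  next
    case (7 a b)
    obtain f1 A1 f2 A2 where o: "a = (f1, A1)" "b = (f2, A2)" by (cases a; cases b)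
    have s: "f1 \<in> Arr S" "A1 \<in> Obj (Fib H (Cod S f1))" "f2 \<in> Arr S" "A2 \<in> Obj (Fib H (Cod S f2))" "Dom S f2 = Dom S f1"
      using 7(2-) by (simp_all add: o G_simps)
    show ?case
      using arg_cong[OF ec[of "Cod S f1" "Cod S f2" A1 A2], of "gpa (pair S f1 f2)"]
      by (simp add: o p_simps ee_def 7(1) s pswap_def)
  next
    case (11 k)
    then show ?case by (rule ws)
  next
    case (12 a)
    obtain f A where o: "a = (f, A)" by (cases a)
    have s: "f \<in> Arr S" "A \<in> Obj (Fib H (Cod S f))"
      using 12(2-) by (simp_all add: o G_simps)
    show ?case
      using arg_cong[OF er[of "Cod S f" "Dom S f" A], of "gpa (pair S f (Ide S (Dom S f)))"]
      by (simp add: o p_simps ee_def 12(1) s)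
  next
    case (13 a)
    obtain f A where o: "a = (f, A)" by (cases a)
    have s: "f \<in> Arr S" "A \<in> Obj (Fib H (Cod S f))"
      using 13(2-) by (simp_all add: o G_simps)
    show ?case
      using arg_cong[OF el[of "Dom S f" "Cod S f" A], of "gpa (pair S (Ide S (Dom S f)) f)"]
      by (simp add: o p_simps ee_def 13(1) s)
  qed (simp_all add: T1.ext_sel(1) T2.ext_sel(1) et W_simps T1.ext_sel(6) T2.ext_sel(6) emb_def)
qed

text \<open>An equivalence of lifts is determined by its values at pairs of projections, because it
  commutes strictly with pullback. The hypotheses say that \<open>e\<close> and \<open>w\<close> are
  read off there.\<close>

lemma equivalence_of_sequiv:
  assumes s: "sequiv_map S G gbs gpl gpa K T1.lift_ext T2.lift_ext e0 w0"
    and E0: "\<And>X1 X2 A1 A2. X1 \<in> Obj S \<Longrightarrow> X2 \<in> Obj S \<Longrightarrow> A1 \<in> Obj (Fib H X1) \<Longrightarrow> A2 \<in> Obj (Fib H X2) \<Longrightarrow>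
      E X1 X2 A1 A2 = e0 (Pr1 S X1 X2, A1) (Pr2 S X1 X2, A2)"
    and W0: "\<And>X. Unitary \<in> K \<Longrightarrow> X \<in> Obj S \<Longrightarrow> W X = w0 X"
  shows "is_external_equivalence S H T1 T2 e"
proof -
  interpret s: sequiv_map S G gbs gpl gpa K T1.lift_ext T2.lift_ext e0 w0 by (rule s)
  have st: "isoar G (e0 a b) \<and> e0 a b \<in> Arr G \<and> Dom G (e0 a b) = T1.xto a b \<and> Cod G (e0 a b) = T2.xto a b"
    if "a \<in> Obj G" "b \<in> Obj G" "gbs b = gbs a" for a b
    using s.ew_simps that by (simp add: T1.ext_sel T2.ext_sel)
  \<comment> \<open>Both lifts have identities for m, so compatibility with m degenerates to strict
    compatibility with pullback.\<close>
  have sm: "gpa k (e0 a b) = e0 (gpl k a) (gpl k b)"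
    if "k \<in> Arr S" "a \<in> Obj G" "b \<in> Obj G" "gbs a = Cod S k" "gbs b = Cod S k" for k a b
  proof -
    have "sm T1.lift_ext k a b = Ide G (Dom G (gpa k (e0 a b)))" "sm T2.lift_ext k a b = Ide G (Cod G (e0 (gpl k a) (gpl k b)))"
      using that st[of a b] st[of "gpl k a" "gpl k b"] by (simp_all add: T1.ext_sel T2.ext_sel vert_arr_only T1.xto_simps T2.xto_simps)
    then show ?thesis using s.e_sm[OF that] that st[of a b] st[of "gpl k a" "gpl k b"] by (simp add: vert_arr_only T1.xto_simps T2.xto_simps)
  qed
  \<comment> \<open>A pair of objects with base arrows f1, f2 is the pullback of the pair of
    projections along the arrow with components f1 and f2.\<close>
  have e0: "e0 a b = ee a b" if "a \<in> Obj G" "b \<in> Obj G" "gbs b = gbs a" for a b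
  proof -
    obtain f1 A1 f2 A2 where o: "a = (f1, A1)" "b = (f2, A2)" by (cases a; cases b)
    have s: "f1 \<in> Arr S" "A1 \<in> Obj (Fib H (Cod S f1))" "f2 \<in> Arr S" "A2 \<in> Obj (Fib H (Cod S f2))" "Dom S f2 = Dom S f1"
      using that by (simp_all add: o G_simps)
    show ?thesis
      using sm[of "pair S f1 f2" "(Pr1 S (Cod S f1) (Cod S f2), A1)" "(Pr2 S (Cod S f1) (Cod S f2), A2)"]
      by (simp add: o s ee_def E0 G_simps prd_arr_only)
  qed
  note es = p_simps T1.ba_xta T2.ba_xta e0 ee_def passoc_def pswap_def prd_arr_def
  have en: "Cmp G (E X1 X2 (Cod (Fib H X1) u) (Cod (Fib H X2) v)) (T1.ba (dec X1 u) (dec X2 v)) =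
      Cmp G (T2.ba (dec X1 u) (dec X2 v)) (E X1 X2 (Dom (Fib H X1) u) (Dom (Fib H X2) v))"
    if "X1 \<in> Obj S" "X2 \<in> Obj S" "u \<in> Arr (Fib H X1)" "v \<in> Arr (Fib H X2)" for X1 X2 u v
  proof -
    have c: "Cod (Fib H X1) u \<in> Obj (Fib H X1)" "Cod (Fib H X2) v \<in> Obj (Fib H X2)"
      "Dom (Fib H X1) u \<in> Obj (Fib H X1)" "Dom (Fib H X2) v \<in> Obj (Fib H X2)"
      using that by (simp_all add: fib_simps)
    show ?thesis
      using s.e_nat[of "gpa (Pr1 S X1 X2) (dec X1 u)" "gpa (Pr2 S X1 X2) (dec X2 v)"]
      by (simp add: es that c)
  qed
  have em: "Cmp G (gpa (prd_arr S f1 f2) (E (Cod S f1) (Cod S f2) A1 A2)) (T1.ba (lam f1 A1) (lam f2 A2)) =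
      Cmp G (T2.ba (lam f1 A1) (lam f2 A2)) (E (Dom S f1) (Dom S f2) (pbo H f1 A1) (pbo H f2 A2))"
    if "f1 \<in> Arr S" "f2 \<in> Arr S" "A1 \<in> Obj (Fib H (Cod S f1))" "A2 \<in> Obj (Fib H (Cod S f2))" for f1 f2 A1 A2
    using s.e_nat[of "gpa (Pr1 S (Dom S f1) (Dom S f2)) (lam f1 A1)" "gpa (Pr2 S (Dom S f1) (Dom S f2)) (lam f2 A2)"]
    by (simp add: es that)
  have ea: "Cmp G (T2.da X1 X2 X3 A1 A2 A3) (Cmp G (E (Prd S X1 X2) X3 (xob T2 X1 X2 A1 A2) A3) (T1.ba (E X1 X2 A1 A2) (Ide G (emb X3 A3)))) =
      Cmp G (gpa (passoc S X1 X2 X3) (E X1 (Prd S X2 X3) A1 (xob T2 X2 X3 A2 A3)))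
       (Cmp G (gpa (passoc S X1 X2 X3) (T1.ba (Ide G (emb X1 A1)) (E X2 X3 A2 A3))) (T1.da X1 X2 X3 A1 A2 A3))"
    if "Associative \<in> K" "X1 \<in> Obj S" "X2 \<in> Obj S" "X3 \<in> Obj S" "A1 \<in> Obj (Fib H X1)" "A2 \<in> Obj (Fib H X2)" "A3 \<in> Obj (Fib H X3)"
    for X1 X2 X3 A1 A2 A3
    using s.e_sas[of "(Cmp S (Pr1 S X1 X2) (Pr1 S (Prd S X1 X2) X3), A1)" "(Cmp S (Pr2 S X1 X2) (Pr1 S (Prd S X1 X2) X3), A2)" "(Pr2 S (Prd S X1 X2) X3, A3)"]
    by (simp add: es that)
  have ec: "Cmp G (T2.dc X1 X2 A1 A2) (E X1 X2 A1 A2) = Cmp G (gpa (pswap S X1 X2) (E X2 X1 A2 A1)) (T1.dc X1 X2 A1 A2)"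
    if "Symmetric \<in> K" "X1 \<in> Obj S" "X2 \<in> Obj S" "A1 \<in> Obj (Fib H X1)" "A2 \<in> Obj (Fib H X2)" for X1 X2 A1 A2
    using s.e_sco[of "(Pr1 S X1 X2, A1)" "(Pr2 S X1 X2, A2)"] by (simp add: es that)
  have wt: "isoar G (w0 X) \<and> w0 X \<in> Arr G \<and> Dom G (w0 X) = (Ide S X, sob T1.uT X) \<and> Cod G (w0 X) = (Ide S X, sob T2.uT X)"
    if "Unitary \<in> K" "X \<in> Obj S" for X
    using s.ew_simps that by (simp add: T1.ext_sel(6) T2.ext_sel(6) emb_def)
  note rs = T1.G_Obj_pair gpl_pair gbs_pair vert_arr_only prd_arr_only T1.unit_obj T2.unit_obj T1.xob_obj T2.xob_obj pbo_obj pbo_ide emb_def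
    T1.xto_pair T2.xto_pair T1.ext_sel(6) T2.ext_sel(6) T1.xta_simps T2.xta_simps T1.xta_Ide T2.xta_Ide T1.ba_xta T2.ba_xta T1.ba_simps T2.ba_simps T1.bo_pair T2.bo_pair
    s.t1.typ_simps[unfolded T1.ext_sel(1,2)] s.t2.typ_simps[unfolded T2.ext_sel(1,2)] wt st
  have ws: "Cmp G (sr T2.lift_ext k) (gpa k (w0 (Cod S k))) = Cmp G (w0 (Dom S k)) (sr T1.lift_ext k)" if "Unitary \<in> K" "k \<in> Arr S" for k
    using s.w_sr[OF that] .
  \<comment> \<open>The unit isomorphisms over a product are expressed through the lifts by
    \<open>dr_determined\<close>. What remains is the unit law of the equivalence, naturality of
    \<open>e0\<close> at the unit arrow of the second projection, and compatibility of
    \<open>w0\<close> with that unit arrow.\<close>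
  have er: "T1.dr X1 X2 A = Cmp G (T2.dr X1 X2 A) (Cmp G (E X1 X2 A (sob T2.uT X2)) (T1.ba (Ide G (emb X1 A)) (W X2)))"
    if K: "Unitary \<in> K" "X1 \<in> Obj S" "X2 \<in> Obj S" "A \<in> Obj (Fib H X1)" for X1 X2 A
  proof -
    let ?a = "(Pr1 S X1 X2, A)" and ?k = "Pr2 S X1 X2" and ?Y = "Prd S X1 X2"
    have n: "Cmp G (T2.xta (Ide G ?a) (sr T2.lift_ext ?k)) (e0 ?a (?k, sob T2.uT X2)) =
       Cmp G (e0 ?a (Ide S ?Y, sob T2.uT ?Y)) (T1.xta (Ide G ?a) (sr T2.lift_ext ?k))"
      using s.e_nat[of "Ide G ?a" "sr T2.lift_ext ?k"] by (simp add: rs that T1.ext_sel(2) T2.ext_sel(2))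
    have m: "Cmp G (T1.xta (Ide G ?a) (sr T2.lift_ext ?k)) (T1.xta (Ide G ?a) (gpa ?k (w0 X2))) =
      Cmp G (T1.xta (Ide G ?a) (w0 ?Y)) (T1.xta (Ide G ?a) (sr T1.lift_ext ?k))"
      using s.w_sr[of ?k] by (simp add: rs that flip: T1.xta_Cmp)
    show ?thesis
      using s.e_ur[of ?a] tot.reassoc[OF n, of "T1.xta (Ide G ?a) (gpa ?k (w0 X2))"] m
      by (simp add: T1.dr_determined T2.dr_determined E0 W0 rs that T1.ext_sel(2) T2.ext_sel(2))
  qed
  have el: "T1.dl X1 X2 A = Cmp G (T2.dl X1 X2 A) (Cmp G (E X1 X2 (sob T2.uT X1) A) (T1.ba (W X1) (Ide G (emb X2 A))))"
    if K: "Unitary \<in> K" "X1 \<in> Obj S" "X2 \<in> Obj S" "A \<in> Obj (Fib H X2)" for X1 X2 A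
  proof -
    let ?a = "(Pr2 S X1 X2, A)" and ?k = "Pr1 S X1 X2" and ?Y = "Prd S X1 X2"
    have n: "Cmp G (T2.xta (sr T2.lift_ext ?k) (Ide G ?a)) (e0 (?k, sob T2.uT X1) ?a) =
       Cmp G (e0 (Ide S ?Y, sob T2.uT ?Y) ?a) (T1.xta (sr T2.lift_ext ?k) (Ide G ?a))"
      using s.e_nat[of "sr T2.lift_ext ?k" "Ide G ?a"] by (simp add: rs that T1.ext_sel(2) T2.ext_sel(2))
    have m: "Cmp G (T1.xta (sr T2.lift_ext ?k) (Ide G ?a)) (T1.xta (gpa ?k (w0 X1)) (Ide G ?a)) =
      Cmp G (T1.xta (w0 ?Y) (Ide G ?a)) (T1.xta (sr T1.lift_ext ?k) (Ide G ?a))"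
      using s.w_sr[of ?k] by (simp add: rs that flip: T1.xta_Cmp)
    show ?thesis
      using s.e_ul[of ?a] tot.reassoc[OF n, of "T1.xta (gpa ?k (w0 X1)) (Ide G ?a)"] m
      by (simp add: T1.dl_determined T2.dl_determined E0 W0 rs that T1.ext_sel(2) T2.ext_sel(2))
  qed
  have sh: "xassoc T1 = Some a \<Longrightarrow> T1.aT = a \<and> Associative \<in> K" "xassoc T2 = Some a \<Longrightarrow> T2.aT = a \<and> Associative \<in> K"
     "xcomm T1 = Some c \<Longrightarrow> T1.cT = c \<and> Symmetric \<in> K" "xcomm T2 = Some c \<Longrightarrow> T2.cT = c \<and> Symmetric \<in> K"
     "xunit T1 = Some u \<Longrightarrow> T1.uT = u \<and> Unitary \<in> K" "xunit T2 = Some u \<Longrightarrow> T2.uT = u \<and> Unitary \<in> K" for a c u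
    using T1.K_ext T2.K_ext by (auto simp: K_external_def)
  have ws': "is_section_iso S H T1.uT T2.uT w" if "Unitary \<in> K"
    using W_iff[THEN iffD1, OF that] ws[OF that] W0[OF that] w_typed[OF that]
    by (auto simp: is_section_iso_def Iso_iff Hom_iff vert_arr_only)
  show ?thesis
    unfolding is_external_equivalence_def nat_iso2_iff
  proof (intro conjI ballI allI impI, goal_cases)
    case (4 X1 X2 u v)
    show ?case by (rule E_nat_iff[THEN iffD1, OF 4 en[OF 4]])
  next
    case (5 X1 X2 Y1 Y2 f1 f2 A1 A2)
    then have q: "X1 = Cod S f1" "X2 = Cod S f2" "Y1 = Dom S f1" "Y2 = Dom S f2"
      and t: "f1 \<in> Arr S" "f2 \<in> Arr S" by (auto simp: Hom_iff)
    note r = t 5(3,4)[unfolded q]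
    show ?case unfolding q by (rule E_m_iff[THEN iffD1, OF r em[OF r]])
  next
    case (6 a a' X1 X2 X3 A1 A2 A3)
    then have q: "T1.aT = a" "T2.aT = a'" "Associative \<in> K" using sh(1)[of a] sh(2)[of a'] by simp_all
    show ?case using E_a_iff[THEN iffD1, OF q(3) 6(2-7) ea[OF q(3) 6(2-7)]] unfolding q .
  next
    case (7 c c' X1 X2 A1 A2)
    then have q: "T1.cT = c" "T2.cT = c'" "Symmetric \<in> K" using sh(3)[of c] sh(4)[of c'] by simp_all
    show ?case using E_c_iff[THEN iffD1, OF q(3) 7(2-5) ec[OF q(3) 7(2-5)]] unfolding q .
  next
    case (8 u u')
    then have q: "T1.uT = u" "T2.uT = u'" "Unitary \<in> K" using sh(5)[of u] sh(6)[of u'] by simp_all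
    show ?case
      using ws'[OF q(3)] E_r_iff[THEN iffD1, OF q(3) _ _ _ er[OF q(3)]] E_l_iff[THEN iffD1, OF q(3) _ _ _ el[OF q(3)]]
      unfolding q by blast
  qed (simp_all add: e_typed)
qed

end

context fibered_over_products
begin

abbreviation "rel_stens K t1 t2 \<equiv> \<exists>e w. sequiv_map S G gbs gpl gpa K t1 t2 e w"

lemma external_equivalence_iff:
  assumes T1: "K_external S H K T1" and T2: "K_external S H K T2"
  shows "(\<exists>e. is_external_equivalence S H T1 T2 e) \<longleftrightarrow> rel_stens K (external_base.lift_ext S H T1) (external_base.lift_ext S H T2)"
proof -
  interpret T1: external_structure S H K T1 by unfold_locales fact
  interpret T2: external_structure S H K T2 by unfold_locales fact
  show ?thesis
  proof
    assume "\<exists>e. is_external_equivalence S H T1 T2 e"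
    then obtain e where e: "is_external_equivalence S H T1 T2 e" by blast
    have "Unitary \<in> K \<Longrightarrow> xunit T1 = Some T1.uT \<and> xunit T2 = Some T2.uT"
      using T1 T2 by (auto simp: K_external_def)
    then have "\<exists>w. Unitary \<in> K \<longrightarrow> is_section_iso S H T1.uT T2.uT w \<and>
        (\<forall>X1\<in>Obj S. \<forall>X2\<in>Obj S. \<forall>A\<in>Obj (Fib H X1). xur T1.uT X1 X2 A = Cmp (Fib H (Prd S X1 X2)) (xur T2.uT X1 X2 A)
          (Cmp (Fib H (Prd S X1 X2)) (e X1 X2 A (sob T2.uT X2)) (xar T1 X1 X2 (Ide (Fib H X1) A) (w X2)))) \<and>
        (\<forall>X1\<in>Obj S. \<forall>X2\<in>Obj S. \<forall>A\<in>Obj (Fib H X2). xul T1.uT X1 X2 A = Cmp (Fib H (Prd S X1 X2)) (xul T2.uT X1 X2 A)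
          (Cmp (Fib H (Prd S X1 X2)) (e X1 X2 (sob T2.uT X1) A) (xar T1 X1 X2 (w X1) (Ide (Fib H X2) A))))"
      using e[unfolded is_external_equivalence_def, THEN conjunct2, THEN conjunct2, THEN conjunct2, THEN conjunct2, rule_format]
      by blast
    then obtain w where w: "Unitary \<in> K \<Longrightarrow> is_section_iso S H T1.uT T2.uT w"
      "\<And>X1 X2 A. Unitary \<in> K \<Longrightarrow> X1 \<in> Obj S \<Longrightarrow> X2 \<in> Obj S \<Longrightarrow> A \<in> Obj (Fib H X1) \<Longrightarrow> xur T1.uT X1 X2 A = Cmp (Fib H (Prd S X1 X2)) (xur T2.uT X1 X2 A)
          (Cmp (Fib H (Prd S X1 X2)) (e X1 X2 A (sob T2.uT X2)) (xar T1 X1 X2 (Ide (Fib H X1) A) (w X2)))"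
      "\<And>X1 X2 A. Unitary \<in> K \<Longrightarrow> X1 \<in> Obj S \<Longrightarrow> X2 \<in> Obj S \<Longrightarrow> A \<in> Obj (Fib H X2) \<Longrightarrow> xul T1.uT X1 X2 A = Cmp (Fib H (Prd S X1 X2)) (xul T2.uT X1 X2 A)
          (Cmp (Fib H (Prd S X1 X2)) (e X1 X2 (sob T2.uT X1) A) (xar T1 X1 X2 (w X1) (Ide (Fib H X2) A)))"
      by blast
    interpret external_comparison S H K T1 T2 e w
      by unfold_locales (use e[unfolded is_external_equivalence_def nat_iso2_iff, THEN conjunct1] w(1) in \<open>auto simp: is_section_iso_def Iso_iff\<close>)
    show "rel_stens K T1.lift_ext T2.lift_ext"
      using sequiv_of_equivalence[OF e w] by blast
  next
    assume "rel_stens K T1.lift_ext T2.lift_ext"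
    then obtain e0 w0 where s: "sequiv_map S G gbs gpl gpa K T1.lift_ext T2.lift_ext e0 w0" by blast
    interpret s: sequiv_map S G gbs gpl gpa K T1.lift_ext T2.lift_ext e0 w0 by (rule s)
    \<comment> \<open>The external equivalence consists of the components of \<open>e0\<close> at
      the two projections of a product.\<close>
    define e where "e X1 X2 A1 A2 = und (e0 (Pr1 S X1 X2, A1) (Pr2 S X1 X2, A2))" for X1 X2 A1 A2
    define w where "w X = und (w0 X)" for X
    have e: "e0 (Pr1 S X1 X2, A1) (Pr2 S X1 X2, A2) = (emb (Prd S X1 X2) (xob T1 X1 X2 A1 A2), e X1 X2 A1 A2, emb (Prd S X1 X2) (xob T2 X1 X2 A1 A2))"
      if "X1 \<in> Obj S" "X2 \<in> Obj S" "A1 \<in> Obj (Fib H X1)" "A2 \<in> Obj (Fib H X2)" for X1 X2 A1 A2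
      using s.e_dom[of "(Pr1 S X1 X2, A1)" "(Pr2 S X1 X2, A2)"] s.e_cod[of "(Pr1 S X1 X2, A1)" "(Pr2 S X1 X2, A2)"] that
      by (intro prod_eqI) (simp_all add: e_def T1.G_Obj_pair gbs_pair prd_simps T1.ext_sel T2.ext_sel T1.xto_pair T2.xto_pair emb_def G_proj)
    have w: "w0 X = (emb X (sob T1.uT X), w X, emb X (sob T2.uT X))" if "Unitary \<in> K" "X \<in> Obj S" for X
      using s.w_dom[of X] s.w_cod[of X] that
      by (intro prod_eqI) (simp_all add: w_def T1.ext_sel T2.ext_sel G_proj)
    have et: "isoar (Fib H (Prd S X1 X2)) (e X1 X2 A1 A2) \<and> Dom (Fib H (Prd S X1 X2)) (e X1 X2 A1 A2) = xob T1 X1 X2 A1 A2 \<and>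
       Cod (Fib H (Prd S X1 X2)) (e X1 X2 A1 A2) = xob T2 X1 X2 A1 A2"
      if "X1 \<in> Obj S" "X2 \<in> Obj S" "A1 \<in> Obj (Fib H X1)" "A2 \<in> Obj (Fib H X2)" for X1 X2 A1 A2
      using s.e_iso[of "(Pr1 S X1 X2, A1)" "(Pr2 S X1 X2, A2)"] e[OF that] that
      by (simp add: emb_def T1.b_simps T2.ext_simps)
    have wt: "isoar (Fib H X) (w X) \<and> Dom (Fib H X) (w X) = sob T1.uT X \<and> Cod (Fib H X) (w X) = sob T2.uT X" if "Unitary \<in> K" "X \<in> Obj S" for X
      using s.w_iso[OF that] w[OF that] that
      by (simp add: emb_def T1.b_simps T1.unit_obj T2.unit_obj)
    interpret external_comparison S H K T1 T2 e w
      by unfold_locales (use et wt in auto)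
    have "is_external_equivalence S H T1 T2 e"
      by (rule equivalence_of_sequiv[OF s]) (simp_all add: E_def W_def e w)
    then show "\<exists>e. is_external_equivalence S H T1 T2 e" by blast
  qed
qed

end

section \<open>The construction from internal to external structures\<close>

text \<open>The shape of the argument that pulls the compatibility of an equivalence with the associativity
  constraint back along an arrow of the base: \<open>N\<close>, \<open>M\<close>, \<open>P\<close>, \<open>Q\<close> and \<open>S\<close>, \<open>P'\<close> are built from isomorphisms \<open>m\<close>.\<close>

lemma (in category) transport_square:
  assumes "Cmp C D T0 = Cmp C U0 (Cmp C V0 A0)" "Cmp C S T1 = Cmp C T0 N" "Cmp C A0 (Cmp C N M) = Cmp C P (Cmp C Q A)"
    "Cmp C V0 P = Cmp C P' V1" "Cmp C U0 P' = U" "Cmp C T1 M = T" "Cmp C V1 Q = V"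
    and t: "D \<in> Arr C" "T0 \<in> Arr C" "U0 \<in> Arr C" "V0 \<in> Arr C" "A0 \<in> Arr C" "S \<in> Arr C" "T1 \<in> Arr C" "N \<in> Arr C"
      "M \<in> Arr C" "P \<in> Arr C" "Q \<in> Arr C" "A \<in> Arr C" "P' \<in> Arr C" "V1 \<in> Arr C"
      "Dom C D = Cod C T0" "Dom C U0 = Cod C V0" "Dom C V0 = Cod C A0" "Dom C S = Cod C T1" "Dom C T0 = Cod C N"
      "Dom C A0 = Cod C N" "Dom C N = Cod C M" "Dom C P = Cod C Q" "Dom C Q = Cod C A" "Dom C V0 = Cod C P"
      "Dom C P' = Cod C V1" "Dom C U0 = Cod C P'" "Dom C T1 = Cod C M" "Dom C V1 = Cod C Q" "Dom C D = Cod C S"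
  shows "Cmp C D (Cmp C S T) = Cmp C U (Cmp C V A)"
proof -
  note s = Cmp_arr Cmp_dom Cmp_cod
  have "Cmp C D (Cmp C S T) = Cmp C D (Cmp C (Cmp C S T1) M)"
    using t by (simp add: s Cmp_assoc flip: assms(6))
  also have "\<dots> = Cmp C (Cmp C D T0) (Cmp C N M)"
    using t unfolding assms(2) by (simp add: s Cmp_assoc)
  also have "\<dots> = Cmp C U0 (Cmp C V0 (Cmp C A0 (Cmp C N M)))"
    using t unfolding assms(1) by (simp add: s Cmp_assoc)
  also have "\<dots> = Cmp C U0 (Cmp C (Cmp C V0 P) (Cmp C Q A))"
    using t unfolding assms(3) by (simp add: s Cmp_assoc)
  also have "\<dots> = Cmp C (Cmp C U0 P') (Cmp C (Cmp C V1 Q) A)"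
    using t unfolding assms(4) by (simp add: s Cmp_assoc)
  finally show ?thesis unfolding assms(5,7) .
qed

text \<open>The cocycle condition for the identity makes this isomorphism idempotent.\<close>

lemma (in stensor) sm_Ide:
  assumes "a \<in> Obj G" "b \<in> Obj G" "bs a = X" "bs b = X"
  shows "sm t (Ide S X) a b = Ide G (to t a b)"
proof -
  let ?m = "sm t (Ide S X) a b"
  have X: "X \<in> Obj S" using assms by (auto simp: bs_obj)
  have m: "isoar G ?m" "Dom G ?m = to t a b" "Cod G ?m = to t a b"
    using assms X by (simp_all add: vert_simps ten_simps)
  have "Cmp G ?m ?m = ?m"
    using sm_cmp[of "Ide S X" "Ide S X" a b] assms X m by (simp add: vert_simps ten_simps)
  also have "\<dots> = Cmp G ?m (Ide G (to t a b))"
    using m by (simp add: tot.cat_simps)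
  finally have eq: "Cmp G ?m ?m = Cmp G ?m (Ide G (to t a b))" .
  show ?thesis
    by (rule tot.Cmp_left_cancel[OF m(1) _ _ _ _ eq]) (use assms m in \<open>simp_all add: vert_simps ten_simps\<close>)
qed

context fibered_over_products
begin

text \<open>Shows how connection isomorphisms remain visible in \<open>G\<close>: embedding (g f)^*A
  directly, or through g^*A and f^*g^*A, differs by exactly the connection isomorphism.\<close>

lemma lam_Cmp:
  assumes "f \<in> Arr S" "g \<in> Arr S" "Dom S g = Cod S f" "A \<in> Obj (Fib H (Cod S g))"
  shows "Cmp G (gpa f (lam g A)) (Cmp G (lam f (pbo H g A)) (dec (Dom S f) (conn H f g A))) = lam (Cmp S g f) A"
  using assms by (simp add: lam_def dec_def emb_def G_simps fib_simps cat_simps)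

lemma dec_pba:
  assumes "f \<in> Arr S" "u \<in> Arr (Fib H (Cod S f))"
  shows "Cmp G (lam f (Cod (Fib H (Cod S f)) u)) (dec (Dom S f) (pba H f u)) =
    Cmp G (gpa f (dec (Cod S f) u)) (lam f (Dom (Fib H (Cod S f)) u))"
  using assms by (simp add: lam_def dec_def emb_def G_simps fib_simps cat_simps)

end

section \<open>The data of E T expressed in \<open>G\<close>\<close>

context internal_structure
begin

interpretation L: stensor S G gbs gpl gpa K "lift_int T"
  by (rule stensor_lift)

abbreviation "tL \<equiv> lift_int T"
abbreviation "xE \<equiv> constr_E S H T"

lemma xE_sel:
  "xob xE X1 X2 A1 A2 = tob T (Prd S X1 X2) (pbo H (Pr1 S X1 X2) A1) (pbo H (Pr2 S X1 X2) A2)"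
  "xar xE X1 X2 u1 u2 = tar T (Prd S X1 X2) (pba H (Pr1 S X1 X2) u1) (pba H (Pr2 S X1 X2) u2)"
  "xm xE = E_m S H T"
  "xassoc xE = map_option (E_assoc S H T) (tassoc T)" "xcomm xE = map_option (E_comm S H T) (tcomm T)"
  "xunit xE = map_option (E_unit S H T) (tunit T)"
  by (simp_all add: constr_E_def E_ob_def E_ar_def)

lemma to_xob:
  assumes "X1 \<in> Obj S" "X2 \<in> Obj S"
  shows "to tL (Pr1 S X1 X2, A1) (Pr2 S X1 X2, A2) = emb (Prd S X1 X2) (xob xE X1 X2 A1 A2)"
  using assms by (simp add: lift_sel xE_sel emb_def G_simps prd_simps)

lemma dec_xar:
  assumes "X1 \<in> Obj S" "X2 \<in> Obj S" "u \<in> Arr (Fib H X1)" "v \<in> Arr (Fib H X2)"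
  shows "ta tL (gpa (Pr1 S X1 X2) (dec X1 u)) (gpa (Pr2 S X1 X2) (dec X2 v)) = dec (Prd S X1 X2) (xar xE X1 X2 u v)"
  using assms by (simp add: xE_sel dec_def emb_def lift_simps prd_simps)

definition mE where
  "mE f1 f2 A1 A2 = (emb (Prd S (Dom S f1) (Dom S f2)) (xob xE (Dom S f1) (Dom S f2) (pbo H f1 A1) (pbo H f2 A2)), xm xE f1 f2 A1 A2,
     (prd_arr S f1 f2, xob xE (Cod S f1) (Cod S f2) A1 A2))"

text \<open>Each \<open>ident\<close> in the definition of m for E T falls into two halves: the
  inverse connection isomorphism is the pullback of a \<open>lam\<close>, and the other connection
  isomorphism belongs to \<open>sm tL\<close>.\<close>

lemma mE_eq:
  assumes "f1 \<in> Arr S" "f2 \<in> Arr S" "A1 \<in> Obj (Fib H (Cod S f1))" "A2 \<in> Obj (Fib H (Cod S f2))"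
  shows "mE f1 f2 A1 A2 = Cmp G (sm tL (prd_arr S f1 f2) (Pr1 S (Cod S f1) (Cod S f2), A1) (Pr2 S (Cod S f1) (Cod S f2), A2))
    (ta tL (gpa (Pr1 S (Dom S f1) (Dom S f2)) (lam f1 A1)) (gpa (Pr2 S (Dom S f1) (Dom S f2)) (lam f2 A2)))"
  using assms by (simp add: mE_def xE_sel E_m_def Let_def ident_def lam_def emb_def lift_simps prd_simps flip: tar_Cmp)

lemmas l_simps = G_Obj gpl_pair gbs_pair vert_arr_only prd_arr_only emb_def lam_simps(1,3,4) lam_simps(2)[unfolded emb_def]
  dec_simps(1) dec_simps(2,3)[unfolded emb_def] pbo_obj pbo_ide pba_simps conn_simps L.ten_simps isoar_pa tot.isoar_Cmp

lemma mE_simps: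
  assumes "f1 \<in> Arr S" "f2 \<in> Arr S" "A1 \<in> Obj (Fib H (Cod S f1))" "A2 \<in> Obj (Fib H (Cod S f2))"
  shows "isoar G (mE f1 f2 A1 A2)"
  using assms by (simp add: mE_eq l_simps)

lemma mE_nat:
  assumes "f1 \<in> Arr S" "f2 \<in> Arr S" "u \<in> Arr (Fib H (Cod S f1))" "v \<in> Arr (Fib H (Cod S f2))"
  shows "Cmp G (mE f1 f2 (Cod (Fib H (Cod S f1)) u) (Cod (Fib H (Cod S f2)) v)) (dec (Prd S (Dom S f1) (Dom S f2)) (xar xE (Dom S f1) (Dom S f2) (pba H f1 u) (pba H f2 v))) =
    Cmp G (gpa (prd_arr S f1 f2) (dec (Prd S (Cod S f1) (Cod S f2)) (xar xE (Cod S f1) (Cod S f2) u v)))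
      (mE f1 f2 (Dom (Fib H (Cod S f1)) u) (Dom (Fib H (Cod S f2)) v))"
proof -
  have c: "Cod (Fib H (Cod S f1)) u \<in> Obj (Fib H (Cod S f1))" "Cod (Fib H (Cod S f2)) v \<in> Obj (Fib H (Cod S f2))"
    "Dom (Fib H (Cod S f1)) u \<in> Obj (Fib H (Cod S f1))" "Dom (Fib H (Cod S f2)) v \<in> Obj (Fib H (Cod S f2))"
    using assms by (simp_all add: fib_simps cat_simps)
  let ?p = "Pr1 S (Dom S f1) (Dom S f2)" and ?q = "Pr2 S (Dom S f1) (Dom S f2)"
  let ?p' = "Pr1 S (Cod S f1) (Cod S f2)" and ?q' = "Pr2 S (Cod S f1) (Cod S f2)"
  let ?l = "ta tL (gpa ?p (lam f1 (Dom (Fib H (Cod S f1)) u))) (gpa ?q (lam f2 (Dom (Fib H (Cod S f2)) v)))"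
  have "Cmp G (ta tL (gpa ?p (lam f1 (Cod (Fib H (Cod S f1)) u))) (gpa ?q (lam f2 (Cod (Fib H (Cod S f2)) v))))
      (ta tL (gpa ?p (dec (Dom S f1) (pba H f1 u))) (gpa ?q (dec (Dom S f2) (pba H f2 v)))) =
     Cmp G (ta tL (gpa (Cmp S f1 ?p) (dec (Cod S f1) u)) (gpa (Cmp S f2 ?q) (dec (Cod S f2) v))) ?l"
    using assms c arg_cong[OF dec_pba[of f1 u], of "gpa ?p"] arg_cong[OF dec_pba[of f2 v], of "gpa ?q"]
    by (simp add: l_simps flip: L.ta_Cmp)
  moreover have "Cmp G (sm tL (prd_arr S f1 f2) (?p', Cod (Fib H (Cod S f1)) u) (?q', Cod (Fib H (Cod S f2)) v))
      (Cmp G (ta tL (gpa (Cmp S f1 ?p) (dec (Cod S f1) u)) (gpa (Cmp S f2 ?q) (dec (Cod S f2) v))) ?l) =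
     Cmp G (gpa (prd_arr S f1 f2) (ta tL (gpa ?p' (dec (Cod S f1) u)) (gpa ?q' (dec (Cod S f2) v))))
      (Cmp G (sm tL (prd_arr S f1 f2) (?p', Dom (Fib H (Cod S f1)) u) (?q', Dom (Fib H (Cod S f2)) v)) ?l)"
    using assms c tot.reassoc[OF L.sm_nat[of "prd_arr S f1 f2" "gpa ?p' (dec (Cod S f1) u)" "gpa ?q' (dec (Cod S f2) v)"], of ?l]
    by (simp add: l_simps)
  ultimately show ?thesis
    using assms c by (simp add: mE_eq l_simps flip: dec_xar)
qed

text \<open>The cocycle condition of \<open>sm\<close>, combined with \<open>lam_Cmp\<close> in each
  of the two factors.\<close>

lemma mE_cocycle:
  assumes "f1 \<in> Arr S" "f2 \<in> Arr S" "g1 \<in> Arr S" "g2 \<in> Arr S" "Dom S g1 = Cod S f1" "Dom S g2 = Cod S f2"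
    "A1 \<in> Obj (Fib H (Cod S g1))" "A2 \<in> Obj (Fib H (Cod S g2))"
  shows "mE (Cmp S g1 f1) (Cmp S g2 f2) A1 A2 = Cmp G (gpa (prd_arr S f1 f2) (mE g1 g2 A1 A2))
    (Cmp G (mE f1 f2 (pbo H g1 A1) (pbo H g2 A2)) (dec (Prd S (Dom S f1) (Dom S f2)) (xar xE (Dom S f1) (Dom S f2) (conn H f1 g1 A1) (conn H f2 g2 A2))))"
proof -
  have cn: "conn H f1 g1 A1 \<in> Arr (Fib H (Dom S f1))" "conn H f2 g2 A2 \<in> Arr (Fib H (Dom S f2))"
    using assms by (simp_all add: fib_simps cat_simps)
  let ?p = "Pr1 S (Dom S f1) (Dom S f2)" and ?q = "Pr2 S (Dom S f1) (Dom S f2)" and ?F = "prd_arr S f1 f2"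
  let ?p' = "Pr1 S (Cod S f1) (Cod S f2)" and ?q' = "Pr2 S (Cod S f1) (Cod S f2)"
  let ?d = "Cmp G (ta tL (gpa ?p (lam f1 (pbo H g1 A1))) (gpa ?q (lam f2 (pbo H g2 A2)))) (ta tL (gpa ?p (dec (Dom S f1) (conn H f1 g1 A1))) (gpa ?q (dec (Dom S f2) (conn H f2 g2 A2))))"
  let ?u = "ta tL (gpa ?p' (lam g1 A1)) (gpa ?q' (lam g2 A2))" and ?u' = "ta tL (gpa (Cmp S f1 ?p) (lam g1 A1)) (gpa (Cmp S f2 ?q) (lam g2 A2))"
  have d: "?d \<in> Arr G" "Cod G ?d = to tL (Cmp S f1 ?p, pbo H g1 A1) (Cmp S f2 ?q, pbo H g2 A2)"
    using assms cn by (simp_all add: l_simps)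
  have n: "Cmp G (gpa ?F ?u) (Cmp G (sm tL ?F (?p', pbo H g1 A1) (?q', pbo H g2 A2)) ?d) =
     Cmp G (sm tL ?F (Cmp S g1 ?p', A1) (Cmp S g2 ?q', A2)) (Cmp G ?u' ?d)"
    using assms cn d tot.reassoc[OF L.sm_nat[of ?F "gpa ?p' (lam g1 A1)" "gpa ?q' (lam g2 A2)", symmetric], of ?d]
    by (simp add: l_simps)
  have e: "Cmp G ?u' ?d = ta tL (gpa ?p (lam (Cmp S g1 f1) A1)) (gpa ?q (lam (Cmp S g2 f2) A2))"
    using assms cn arg_cong[OF lam_Cmp[of f1 g1 A1], of "gpa ?p"] arg_cong[OF lam_Cmp[of f2 g2 A2], of "gpa ?q"]
    by (simp add: l_simps flip: L.ta_Cmp)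
  have dx: "dec (Prd S (Dom S f1) (Dom S f2)) (xar xE (Dom S f1) (Dom S f2) (conn H f1 g1 A1) (conn H f2 g2 A2)) =
     ta tL (gpa ?p (dec (Dom S f1) (conn H f1 g1 A1))) (gpa ?q (dec (Dom S f2) (conn H f2 g2 A2)))"
    using assms cn by (simp add: dec_xar vert_arr_only)
  have F: "prd_arr S (Cmp S g1 f1) (Cmp S g2 f2) = Cmp S (prd_arr S g1 g2) ?F"
    using assms by (simp add: prd_arr_Cmp)
  show ?thesis
    using n[unfolded e] L.sm_cmp[of "prd_arr S g1 g2" ?F "(Pr1 S (Cod S g1) (Cod S g2), A1)" "(Pr2 S (Cod S g1) (Cod S g2), A2)"] assms cn
    by (simp add: mE_eq F dx l_simps)
qed

lemma external_tensor_E: "external_tensor S H xE"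
proof -
  have o: "xob xE X1 X2 A1 A2 \<in> Obj (Fib H (Prd S X1 X2))" if "X1 \<in> Obj S" "X2 \<in> Obj S" "A1 \<in> Obj (Fib H X1)" "A2 \<in> Obj (Fib H X2)" for X1 X2 A1 A2
    using that by (simp add: xE_sel int_simps fib_simps prd_simps)
  have a: "xar xE X1 X2 u v \<in> Arr (Fib H (Prd S X1 X2)) \<and>
     Dom (Fib H (Prd S X1 X2)) (xar xE X1 X2 u v) = xob xE X1 X2 (Dom (Fib H X1) u) (Dom (Fib H X2) v) \<and>
     Cod (Fib H (Prd S X1 X2)) (xar xE X1 X2 u v) = xob xE X1 X2 (Cod (Fib H X1) u) (Cod (Fib H X2) v)"
    if "X1 \<in> Obj S" "X2 \<in> Obj S" "u \<in> Arr (Fib H X1)" "v \<in> Arr (Fib H X2)" for X1 X2 u v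
    using that by (simp add: xE_sel int_simps fib_simps prd_simps)
  have aI: "xar xE X1 X2 (Ide (Fib H X1) A1) (Ide (Fib H X2) A2) = Ide (Fib H (Prd S X1 X2)) (xob xE X1 X2 A1 A2)"
    if "X1 \<in> Obj S" "X2 \<in> Obj S" "A1 \<in> Obj (Fib H X1)" "A2 \<in> Obj (Fib H X2)" for X1 X2 A1 A2
    using that by (simp add: xE_sel int_simps fib_simps prd_simps)
  have aC: "xar xE X1 X2 (Cmp (Fib H X1) u' u) (Cmp (Fib H X2) v' v) = Cmp (Fib H (Prd S X1 X2)) (xar xE X1 X2 u' v') (xar xE X1 X2 u v)"
    if "X1 \<in> Obj S" "X2 \<in> Obj S" "u \<in> Arr (Fib H X1)" "v \<in> Arr (Fib H X2)" "u' \<in> Arr (Fib H X1)" "v' \<in> Arr (Fib H X2)"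
      "Dom (Fib H X1) u' = Cod (Fib H X1) u" "Dom (Fib H X2) v' = Cod (Fib H X2) v" for X1 X2 u v u' v'
    using that by (simp add: xE_sel int_simps fib_simps prd_simps tar_Cmp)
  have m: "isoar (Fib H (Prd S (Dom S f1) (Dom S f2))) (xm xE f1 f2 A1 A2) \<and>
      Dom (Fib H (Prd S (Dom S f1) (Dom S f2))) (xm xE f1 f2 A1 A2) = xob xE (Dom S f1) (Dom S f2) (pbo H f1 A1) (pbo H f2 A2) \<and>
      Cod (Fib H (Prd S (Dom S f1) (Dom S f2))) (xm xE f1 f2 A1 A2) = pbo H (prd_arr S f1 f2) (xob xE (Cod S f1) (Cod S f2) A1 A2)"
    if "f1 \<in> Arr S" "f2 \<in> Arr S" "A1 \<in> Obj (Fib H (Cod S f1))" "A2 \<in> Obj (Fib H (Cod S f2))" for f1 f2 A1 A2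
    using mE_simps[OF that] that by (simp add: mE_def emb_def G_simps G_isoar o fib_simps prd_simps)
  have mn: "Cmp (Fib H (Prd S (Dom S f1) (Dom S f2))) (xm xE f1 f2 (Cod (Fib H (Cod S f1)) u) (Cod (Fib H (Cod S f2)) v))
      (xar xE (Dom S f1) (Dom S f2) (pba H f1 u) (pba H f2 v)) =
     Cmp (Fib H (Prd S (Dom S f1) (Dom S f2))) (pba H (prd_arr S f1 f2) (xar xE (Cod S f1) (Cod S f2) u v))
       (xm xE f1 f2 (Dom (Fib H (Cod S f1)) u) (Dom (Fib H (Cod S f2)) v))"
    if "f1 \<in> Arr S" "f2 \<in> Arr S" "u \<in> Arr (Fib H (Cod S f1))" "v \<in> Arr (Fib H (Cod S f2))" for f1 f2 u v
    using mE_nat[OF that] that by (simp add: mE_def dec_def emb_def G_simps o a m fib_simps prd_simps)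
  have mc: "Cmp (Fib H (Prd S (Dom S f1) (Dom S f2))) (conn H (prd_arr S f1 f2) (prd_arr S g1 g2) (xob xE (Cod S g1) (Cod S g2) A B))
        (xm xE (Cmp S g1 f1) (Cmp S g2 f2) A B) =
     Cmp (Fib H (Prd S (Dom S f1) (Dom S f2))) (pba H (prd_arr S f1 f2) (xm xE g1 g2 A B))
       (Cmp (Fib H (Prd S (Dom S f1) (Dom S f2))) (xm xE f1 f2 (pbo H g1 A) (pbo H g2 B))
         (xar xE (Dom S f1) (Dom S f2) (conn H f1 g1 A) (conn H f2 g2 B)))"
    if "f1 \<in> Arr S" "f2 \<in> Arr S" "g1 \<in> Arr S" "g2 \<in> Arr S" "Dom S g1 = Cod S f1" "Dom S g2 = Cod S f2"
    "A \<in> Obj (Fib H (Cod S g1))" "B \<in> Obj (Fib H (Cod S g2))" for f1 f2 g1 g2 A B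
    using mE_cocycle[OF that] that m[of g1 g2 A B] by (simp add: mE_def dec_def emb_def G_simps o a m fib_simps prd_simps)
  show ?thesis
    unfolding external_tensor_def frozen_iff using o a aI aC m mn mc by auto
qed

interpretation X: external_base S H "constr_E S H T"
  by unfold_locales (rule external_tensor_E)

lemma shape: "tassoc T \<noteq> None \<longleftrightarrow> Associative \<in> K" "tcomm T \<noteq> None \<longleftrightarrow> Symmetric \<in> K" "tunit T \<noteq> None \<longleftrightarrow> Unitary \<in> K"
  using K_int by (auto simp: K_internal_def)

lemma xE_constraints:
  "Associative \<in> K \<Longrightarrow> X.aT = E_assoc S H T aT" "Symmetric \<in> K \<Longrightarrow> X.cT = E_comm S H T cT"
  "Unitary \<in> K \<Longrightarrow> X.uT = E_unit S H T uT"
  using shape by (auto simp: xE_sel)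

text \<open>All connection isomorphisms in the definition of the constraint are absorbed by
  \<open>sm\<close> and its inverse. The arrow \<open>pair S p1 (pair S p2 p3)\<close> is the
  associativity isomorphism of the base, and \<open>pair S p2 p3\<close> is the projection to the
  last two factors.\<close>

lemma da_E:
  assumes "Associative \<in> K" "X1 \<in> Obj S" "X2 \<in> Obj S" "X3 \<in> Obj S" "A1 \<in> Obj (Fib H X1)" "A2 \<in> Obj (Fib H X2)" "A3 \<in> Obj (Fib H X3)"
  shows "X.da X1 X2 X3 A1 A2 A3 = (let q = Pr1 S (Prd S X1 X2) X3; p1 = Cmp S (Pr1 S X1 X2) q; p2 = Cmp S (Pr2 S X1 X2) q; p3 = Pr2 S (Prd S X1 X2) X3 in
    Cmp G (sm tL (pair S p1 (pair S p2 p3)) (Pr1 S X1 (Prd S X2 X3), A1) (Pr2 S X1 (Prd S X2 X3), xob xE X2 X3 A2 A3))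
    (Cmp G (ta tL (Ide G (p1, A1)) (sm tL (pair S p2 p3) (Pr1 S X2 X3, A2) (Pr2 S X2 X3, A3)))
    (Cmp G (sas tL (p1, A1) (p2, A2) (p3, A3)) (ta tL (Inv G (sm tL q (Pr1 S X1 X2, A1) (Pr2 S X1 X2, A2))) (Ide G (p3, A3))))))"
proof -
  let ?Q = "Prd S (Prd S X1 X2) X3" and ?q = "Pr1 S (Prd S X1 X2) X3"
  let ?p1 = "Cmp S (Pr1 S X1 X2) ?q" and ?p2 = "Cmp S (Pr2 S X1 X2) ?q" and ?p3 = "Pr2 S (Prd S X1 X2) X3"
  have e1: "tar T ?Q (Ide (Fib H ?Q) (pbo H ?p1 A1)) (Cmp (Fib H ?Q) (tm T (pair S ?p2 ?p3) (pbo H (Pr1 S X2 X3) A2) (pbo H (Pr2 S X2 X3) A3))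
        (tar T ?Q (conn H (pair S ?p2 ?p3) (Pr1 S X2 X3) A2) (conn H (pair S ?p2 ?p3) (Pr2 S X2 X3) A3))) =
     Cmp (Fib H ?Q) (tar T ?Q (Ide (Fib H ?Q) (pbo H ?p1 A1)) (tm T (pair S ?p2 ?p3) (pbo H (Pr1 S X2 X3) A2) (pbo H (Pr2 S X2 X3) A3)))
        (tar T ?Q (Ide (Fib H ?Q) (pbo H ?p1 A1)) (tar T ?Q (conn H (pair S ?p2 ?p3) (Pr1 S X2 X3) A2) (conn H (pair S ?p2 ?p3) (Pr2 S X2 X3) A3)))"
    using assms by (simp add: lift_simps prd_simps flip: tar_Cmp)
  have e2: "tar T ?Q (Cmp (Fib H ?Q) (tar T ?Q (Inv (Fib H ?Q) (conn H ?q (Pr1 S X1 X2) A1)) (Inv (Fib H ?Q) (conn H ?q (Pr2 S X1 X2) A2)))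
        (Inv (Fib H ?Q) (tm T ?q (pbo H (Pr1 S X1 X2) A1) (pbo H (Pr2 S X1 X2) A2)))) (Ide (Fib H ?Q) (pbo H ?p3 A3)) =
     Cmp (Fib H ?Q) (tar T ?Q (tar T ?Q (Inv (Fib H ?Q) (conn H ?q (Pr1 S X1 X2) A1)) (Inv (Fib H ?Q) (conn H ?q (Pr2 S X1 X2) A2))) (Ide (Fib H ?Q) (pbo H ?p3 A3)))
        (tar T ?Q (Inv (Fib H ?Q) (tm T ?q (pbo H (Pr1 S X1 X2) A1) (pbo H (Pr2 S X1 X2) A2))) (Ide (Fib H ?Q) (pbo H ?p3 A3)))"
    using assms by (simp add: lift_simps prd_simps flip: tar_Cmp)
  show ?thesis
    using assms
    by (simp add: X.da_def xE_constraints E_assoc_def E_ob_def xE_sel(1) passoc_def Let_def emb_def lift_simps prd_simps e1 e2)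
qed

text \<open>The construction applies connection isomorphisms before the commutativity constraint.
  Naturality moves them behind it, where they form part of \<open>sm\<close>.\<close>

lemma dc_E:
  assumes "Symmetric \<in> K" "X1 \<in> Obj S" "X2 \<in> Obj S" "A1 \<in> Obj (Fib H X1)" "A2 \<in> Obj (Fib H X2)"
  shows "X.dc X1 X2 A1 A2 = Cmp G (sm tL (pair S (Pr2 S X1 X2) (Pr1 S X1 X2)) (Pr1 S X2 X1, A2) (Pr2 S X2 X1, A1))
    (sco tL (Pr1 S X1 X2, A1) (Pr2 S X1 X2, A2))"
  using assms comm_nat[of "Prd S X1 X2" "conn H (pswap S X1 X2) (Pr2 S X2 X1) A1" "conn H (pswap S X1 X2) (Pr1 S X2 X1) A2"]
  by (simp add: X.dc_def xE_constraints E_comm_def E_ob_def xE_sel(1) pswap_def Let_def emb_def lift_simps prd_simps)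

lemma dr_E:
  assumes "Unitary \<in> K" "X1 \<in> Obj S" "X2 \<in> Obj S"
  shows "A \<in> Obj (Fib H X1) \<Longrightarrow> X.dr X1 X2 A = Cmp G (ur tL (Pr1 S X1 X2, A)) (ta tL (Ide G (Pr1 S X1 X2, A)) (sr tL (Pr2 S X1 X2)))"
    "A \<in> Obj (Fib H X2) \<Longrightarrow> X.dl X1 X2 A = Cmp G (ul tL (Pr2 S X1 X2, A)) (ta tL (sr tL (Pr1 S X1 X2)) (Ide G (Pr2 S X1 X2, A)))"
  using assms by (simp_all add: X.dr_def X.dl_def xE_constraints E_unit_def E_ob_def xE_sel(1) Let_def emb_def lift_simps prd_simps)

lemma sr_E: "Unitary \<in> K \<Longrightarrow> k \<in> Arr S \<Longrightarrow> sr X.lift_ext k = sr tL k" "Unitary \<in> K \<Longrightarrow> one X.lift_ext Z = one tL Z"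
  by (simp_all add: X.ext_sel xE_constraints E_unit_def lift_sel emb_def gpl_pair vert_arr_only)

lemmas k_simps = G_Obj[of "(f, A)" for f A, simplified] gpl_pair gbs_pair vert_arr_only prd_arr_only emb_def lam_simps(3,4) lam_simps(2)[unfolded emb_def]
  dec_simps(1) dec_simps(2,3)[unfolded emb_def] pbo_obj pbo_ide pba_simps L.typ_simps L.ta_Ide to_xob[unfolded emb_def] X.xob_obj X.xto_pair

lemmas i_simps = k_simps L.ten_simps isoar_pa tot.isoar_Cmp tot.isoar_Ide tot.isoar_Inv tot.Inv_arr tot.Inv_dom tot.Inv_cod tot.isoar_arr

lemma typed_E: "external_typed S H xE K"
proof (unfold_locales, goal_cases)
  case (1 X1 X2 X3 A1 A2 A3)
  then show ?case by (simp add: da_E Let_def i_simps)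
next
  case (2 X1 X2 A1 A2)
  then show ?case by (simp add: dc_E i_simps)
next
  case 3
  then show ?case using T_unit by (simp add: internal_unit_def is_section_def xE_constraints E_unit_def)
next
  case (4 X1 X2 A1)
  then show ?case by (simp add: dr_E i_simps)
next
  case (5 X1 X2 A2)
  then show ?case by (simp add: dr_E i_simps)
qed

text \<open>The equivalence from \<open>T\<close> to \<open>E T\<close>: the isomorphism \<open>m\<close> for the arrow whose components are the base
  arrows of \<open>a\<close> and \<open>b\<close>.\<close>

definition eE where
  "eE a b = sm tL (pair S (fst a) (fst b)) (Pr1 S (Cod S (fst a)) (Cod S (fst b)), snd a) (Pr2 S (Cod S (fst a)) (Cod S (fst b)), snd b)"

lemma ba_lam:
  assumes "f1 \<in> Arr S" "f2 \<in> Arr S" "A1 \<in> Obj (Fib H (Cod S f1))" "A2 \<in> Obj (Fib H (Cod S f2))"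
  shows "X.ba (lam f1 A1) (lam f2 A2) = mE f1 f2 A1 A2"
  using assms by (simp add: lam_def emb_def mE_def X.b_simps)

lemma ba_dec:
  assumes "X1 \<in> Obj S" "X2 \<in> Obj S" "u \<in> Arr (Fib H X1)" "v \<in> Arr (Fib H X2)"
  shows "X.ba (dec X1 u) (dec X2 v) = ta tL (gpa (Pr1 S X1 X2) (dec X1 u)) (gpa (Pr2 S X1 X2) (dec X2 v))"
  unfolding dec_xar[OF assms] using assms by (simp add: dec_def emb_def X.b_simps)

lemma eE_simps:
  assumes "a \<in> Obj G" "b \<in> Obj G" "gbs b = gbs a"
  shows "isoar G (eE a b)" "eE a b \<in> Arr G" "Dom G (eE a b) = to tL a b" "Cod G (eE a b) = X.xto a b"
  using assms by (cases a; cases b; simp add: eE_def k_simps L.sm_iso)+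

text \<open>This is the cocycle condition of m for the arrow with components f1, f2, preceded by
  \<open>k\<close>.\<close>

lemma eE_sm:
  assumes "k \<in> Arr S" "a \<in> Obj G" "b \<in> Obj G" "gbs a = Cod S k" "gbs b = Cod S k"
  shows "Cmp G (gpa k (eE a b)) (sm tL k a b) = eE (gpl k a) (gpl k b)"
proof -
  obtain f1 A1 f2 A2 where o: "a = (f1, A1)" "b = (f2, A2)" by (cases a; cases b)
  have s: "f1 \<in> Arr S" "A1 \<in> Obj (Fib H (Cod S f1))" "f2 \<in> Arr S" "A2 \<in> Obj (Fib H (Cod S f2))" "Dom S f1 = Cod S k" "Dom S f2 = Cod S k"
    using assms(2-) by (simp_all add: o G_simps)
  let ?p = "(Pr1 S (Cod S f1) (Cod S f2), A1)" and ?q = "(Pr2 S (Cod S f1) (Cod S f2), A2)"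
  have "sm tL (Cmp S (pair S f1 f2) k) ?p ?q = Cmp G (gpa k (sm tL (pair S f1 f2) ?p ?q)) (sm tL k (gpl (pair S f1 f2) ?p) (gpl (pair S f1 f2) ?q))"
    using assms(1) s by (intro L.sm_cmp) (simp_all add: k_simps)
  then show ?thesis using assms(1) s by (simp add: o eE_def gpl_pair prd_arr_only)
qed

text \<open>By \<open>ba_lam\<close> the product of two arrows \<open>Lam\<close> in the lift of E T
  is the diagonal pullback of the isomorphism m of E T. Written out by \<open>mE_eq\<close>, the
  claim becomes naturality and the cocycle condition of m for \<open>T\<close>.\<close>

lemma eE_Lam:
  assumes "a \<in> Obj G" "b \<in> Obj G" "gbs b = gbs a"
  shows "Cmp G (eE a b) (ta tL (Lam a) (Lam b)) = Cmp G (X.xta (Lam a) (Lam b)) (eE (Emb a) (Emb b))"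
proof -
  obtain f1 A1 f2 A2 where o: "a = (f1, A1)" "b = (f2, A2)" by (cases a; cases b)
  let ?Z = "Dom S f1"
  have s: "f1 \<in> Arr S" "A1 \<in> Obj (Fib H (Cod S f1))" "f2 \<in> Arr S" "A2 \<in> Obj (Fib H (Cod S f2))" "Dom S f2 = ?Z"
    using assms by (simp_all add: o G_simps)
  let ?D = "pair S (Ide S ?Z) (Ide S ?Z)" and ?F = "pair S (Cmp S f1 (Pr1 S ?Z ?Z)) (Cmp S f2 (Pr2 S ?Z ?Z))"
  let ?u = "gpa (Pr1 S ?Z ?Z) (lam f1 A1)" and ?v = "gpa (Pr2 S ?Z ?Z) (lam f2 A2)"
  have "X.xta (Lam a) (Lam b) = gpa ?D (mE f1 f2 A1 A2)"
    using s by (simp add: X.xta_def o Lam_pair lam_simps gbs_pair emb_simps ba_lam diag_def fib_simps cat_simps)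
  also have "\<dots> = Cmp G (gpa ?D (sm tL ?F (Pr1 S (Cod S f1) (Cod S f2), A1) (Pr2 S (Cod S f1) (Cod S f2), A2))) (gpa ?D (ta tL ?u ?v))"
    using s by (simp add: mE_eq k_simps prd_arr_def)
  finally have x: "X.xta (Lam a) (Lam b) =
    Cmp G (gpa ?D (sm tL ?F (Pr1 S (Cod S f1) (Cod S f2), A1) (Pr2 S (Cod S f1) (Cod S f2), A2))) (gpa ?D (ta tL ?u ?v))" .
  show ?thesis
    unfolding x
    using L.sm_nat[of ?D ?u ?v] L.sm_cmp[of ?F ?D "(Pr1 S (Cod S f1) (Cod S f2), A1)" "(Pr2 S (Cod S f1) (Cod S f2), A2)"] s
    by (simp add: o Lam_pair Emb_def real_pair eE_def k_simps)
qed

lemma eE_Dec: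
  assumes "u \<in> Arr G" "v \<in> Arr G" "gbs (Dom G v) = gbs (Dom G u)"
  shows "Cmp G (eE (Emb (Cod G u)) (Emb (Cod G v))) (ta tL (Dec u) (Dec v)) =
     Cmp G (X.xta (Dec u) (Dec v)) (eE (Emb (Dom G u)) (Emb (Dom G v)))"
proof -
  let ?Z = "gbs (Dom G u)"
  have Z: "?Z \<in> Obj S" using assms by (simp add: vert_simps)
  have n: "und v \<in> Arr (Fib H ?Z)" "Dom (Fib H ?Z) (und v) = real (Dom G v)" "Cod (Fib H ?Z) (und v) = real (Cod G v)"
    using und_simps[of v] assms by simp_all
  have o: "Dom G u \<in> Obj G" "Dom G v \<in> Obj G" using assms by (simp_all add: tot.dom_obj)
  let ?D = "pair S (Ide S ?Z) (Ide S ?Z)"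
  let ?u = "gpa (Pr1 S ?Z ?Z) (Dec u)" and ?v = "gpa (Pr2 S ?Z ?Z) (Dec v)"
  have x: "X.xta (Dec u) (Dec v) = gpa ?D (ta tL ?u ?v)"
    using assms Z n by (simp add: X.xta_def Dec_def dec_simps emb_simps ba_dec diag_def und_simps real_obj o)
  show ?thesis
    unfolding x using L.sm_nat[of ?D ?u ?v] assms Z n by (simp add: Dec_def Emb_def eE_def k_simps und_simps real_obj)
qed

lemma eE_nat:
  assumes "u \<in> Arr G" "v \<in> Arr G" "gbs (Dom G v) = gbs (Dom G u)"
  shows "Cmp G (eE (Cod G u) (Cod G v)) (ta tL u v) = Cmp G (X.xta u v) (eE (Dom G u) (Dom G v))"
proof -
  note s = Lam_simps Emb_simps Dec_simps vert_arr_only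
  have b: "gbs (Cod G v) = gbs (Dom G u)" "gbs (Cod G u) = gbs (Dom G u)" using assms by (simp_all add: s)
  have l: "Cmp G (ta tL u v) (ta tL (Lam (Dom G u)) (Lam (Dom G v))) = Cmp G (ta tL (Lam (Cod G u)) (Lam (Cod G v))) (ta tL (Dec u) (Dec v))"
    using assms b by (simp add: s Lam_square flip: L.ta_Cmp)
  have x: "Cmp G (X.xta u v) (X.xta (Lam (Dom G u)) (Lam (Dom G v))) = Cmp G (X.xta (Lam (Cod G u)) (Lam (Cod G v))) (X.xta (Dec u) (Dec v))"
    using assms b by (simp add: s Lam_square flip: X.xta_Cmp)
  show ?thesis
    by (rule tot.nat_extend[OF l x eE_Lam eE_Lam eE_Dec])
      (use assms b in \<open>simp_all add: s L.typ_simps L.isoar_ta eE_simps X.xta_simps X.xto_simps\<close>)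
qed

interpretation XT: external_typed S H "constr_E S H T" K
  by (rule typed_E)

text \<open>The arrow whose components are the two projections is the identity, and m for an
  identity is an identity.\<close>

lemma eE_Ide:
  assumes "X1 \<in> Obj S" "X2 \<in> Obj S" "A1 \<in> Obj (Fib H X1)" "A2 \<in> Obj (Fib H X2)"
  shows "eE (Pr1 S X1 X2, A1) (Pr2 S X1 X2, A2) = Ide G (to tL (Pr1 S X1 X2, A1) (Pr2 S X1 X2, A2))"
  using assms by (simp add: eE_def k_simps L.sm_Ide)

lemmas o_simps = vert_arr_only L.typ_simps L.ta_Ide eE_simps X.xto_simps

lemma eE_pull:
  assumes "a \<in> Obj G" "b \<in> Obj G" "gbs a = Cod S h" "gbs b = Cod S h" "h \<in> Arr S" "eE a b = Ide G (to tL a b)"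
  shows "eE (gpl h a) (gpl h b) = sm tL h a b"
  using eE_sm[of h a b] assms by (simp add: o_simps)

text \<open>Reduces the compatibility with associativity at objects pulled back along
  \<open>h\<close> to the equation \<open>e\<close> over the codomain of \<open>h\<close>. It will
  be used over a triple product, where \<open>d\<close> is the constraint of E T and the equation
  can be read off its definition.\<close>

lemma sas_pull:
  assumes K: "Associative \<in> K" and ob: "a \<in> Obj G" "b \<in> Obj G" "c \<in> Obj G" "gbs a = Cod S h" "gbs b = Cod S h" "gbs c = Cod S h" "h \<in> Arr S"
    and i: "eE (X.xto a b) c = Ide G (to tL (X.xto a b) c)" and d: "d \<in> Arr G" "Dom G d = to tL (X.xto a b) c"
    and e: "Cmp G d (ta tL (eE a b) (Ide G c)) = Cmp G (eE a (X.xto b c)) (Cmp G (ta tL (Ide G a) (eE b c)) (sas tL a b c))"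
  shows "Cmp G (gpa h d) (Cmp G (eE (X.xto (gpl h a) (gpl h b)) (gpl h c)) (ta tL (eE (gpl h a) (gpl h b)) (Ide G (gpl h c)))) =
    Cmp G (eE (gpl h a) (X.xto (gpl h b) (gpl h c))) (Cmp G (ta tL (Ide G (gpl h a)) (eE (gpl h b) (gpl h c))) (sas tL (gpl h a) (gpl h b) (gpl h c)))"
proof -
  have x: "X.xto (gpl h a) (gpl h b) = gpl h (X.xto a b)" "X.xto (gpl h b) (gpl h c) = gpl h (X.xto b c)"
    using ob by (simp_all add: o_simps)
  have xo: "X.xto a b \<in> Obj G" "X.xto b c \<in> Obj G" "gbs (X.xto a b) = Cod S h" "gbs (X.xto b c) = Cod S h"
    using ob by (simp_all add: o_simps)
  note os = vert_arr_only L.typ_simps L.ta_Ide eE_simps x xo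
  have s: "eE (X.xto (gpl h a) (gpl h b)) (gpl h c) = sm tL h (X.xto a b) c"
    unfolding x using ob xo i by (intro eE_pull) simp_all
  note [simp] = ob d xo K
  show ?thesis
    unfolding s
  proof (rule tot.transport_square)
    show "Cmp G (gpa h d) (gpa h (ta tL (eE a b) (Ide G c))) = Cmp G (gpa h (eE a (X.xto b c))) (Cmp G (gpa h (ta tL (Ide G a) (eE b c))) (gpa h (sas tL a b c)))"
      using arg_cong[OF e, of "gpa h"] by (simp add: os)
    show "Cmp G (sm tL h (X.xto a b) c) (ta tL (gpa h (eE a b)) (Ide G (gpl h c))) = Cmp G (gpa h (ta tL (eE a b) (Ide G c))) (sm tL h (to tL a b) c)"
      using L.sm_nat[of h "eE a b" "Ide G c"] by (simp add: os)
    show "Cmp G (gpa h (sas tL a b c)) (Cmp G (sm tL h (to tL a b) c) (ta tL (sm tL h a b) (Ide G (gpl h c)))) =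
      Cmp G (sm tL h a (to tL b c)) (Cmp G (ta tL (Ide G (gpl h a)) (sm tL h b c)) (sas tL (gpl h a) (gpl h b) (gpl h c)))"
      by (rule L.sas_sm) simp_all
    show "Cmp G (gpa h (ta tL (Ide G a) (eE b c))) (sm tL h a (to tL b c)) = Cmp G (sm tL h a (X.xto b c)) (ta tL (Ide G (gpl h a)) (gpa h (eE b c)))"
      using L.sm_nat[of h "Ide G a" "eE b c"] by (simp add: os)
    show "Cmp G (gpa h (eE a (X.xto b c))) (sm tL h a (X.xto b c)) = eE (gpl h a) (X.xto (gpl h b) (gpl h c))"
      unfolding x by (rule eE_sm) simp_all
    show "Cmp G (ta tL (gpa h (eE a b)) (Ide G (gpl h c))) (ta tL (sm tL h a b) (Ide G (gpl h c))) = ta tL (eE (gpl h a) (gpl h b)) (Ide G (gpl h c))"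
      by (simp add: os eE_sm flip: L.ta_Cmp)
    show "Cmp G (ta tL (Ide G (gpl h a)) (gpa h (eE b c))) (ta tL (Ide G (gpl h a)) (sm tL h b c)) = ta tL (Ide G (gpl h a)) (eE (gpl h b) (gpl h c))"
      by (simp add: os eE_sm flip: L.ta_Cmp)
  qed (simp_all add: os)
qed

lemma sco_pull:
  assumes K: "Symmetric \<in> K" and ob: "a \<in> Obj G" "b \<in> Obj G" "gbs a = Cod S h" "gbs b = Cod S h" "h \<in> Arr S"
    and i: "eE a b = Ide G (to tL a b)"
  shows "Cmp G (gpa h (Cmp G (eE b a) (sco tL a b))) (eE (gpl h a) (gpl h b)) = Cmp G (eE (gpl h b) (gpl h a)) (sco tL (gpl h a) (gpl h b))"
  unfolding eE_pull[OF ob i]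
  using L.sco_sm[OF K ob(5,1-4)] tot.reassoc[OF eE_sm[OF ob(5,2,1,4,3)], of "sco tL (gpl h a) (gpl h b)"] K ob
  by (simp add: o_simps)

text \<open>The intended \<open>k\<close> is the projection of a product to the unit factor and
  \<open>h\<close> the arrow with components a base arrow f and an identity, so that
  \<open>h\<close> is a section of \<open>k\<close>. The unit arrows along \<open>h\<close> and
  \<open>k\<close> cancel by the cocycle condition.\<close>

lemma ur_pull:
  assumes K: "Unitary \<in> K" and ob: "a \<in> Obj G" "gbs a = Dom S k" "k \<in> Arr S" "Cod S h = Dom S k" "h \<in> Arr S" "Cmp S k h = Ide S (Dom S h)" "Cod S k = Dom S h"
  shows "eE a (gpl k (one tL (Cod S k))) = Ide G (to tL a (gpl k (one tL (Cod S k)))) \<Longrightarrow>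
      Cmp G (gpa h (Cmp G (ur tL a) (ta tL (Ide G a) (sr tL k)))) (eE (gpl h a) (one tL (Dom S h))) = ur tL (gpl h a)"
    "eE (gpl k (one tL (Cod S k))) a = Ide G (to tL (gpl k (one tL (Cod S k))) a) \<Longrightarrow>
      Cmp G (gpa h (Cmp G (ul tL a) (ta tL (sr tL k) (Ide G a)))) (eE (one tL (Dom S h)) (gpl h a)) = ul tL (gpl h a)"
proof -
  let ?o = "gpl k (one tL (Cod S k))"
  note [simp] = ob K
  note os = vert_arr_only L.typ_simps L.ta_Ide
  have o: "gpl h ?o = one tL (Dom S h)" by (simp add: os)
  have "Dom S h \<in> Obj S" by (simp add: os)
  then have "sr tL (Ide S (Dom S h)) = Ide G (one tL (Dom S h))"
    using XT.sr_Ide[of "Dom S h"] by (simp add: sr_E vert_arr_only)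
  then have s: "Cmp G (sr tL h) (gpa h (sr tL k)) = Ide G (one tL (Dom S h))"
    using L.sr_cmp[of k h] by simp
  {
    assume i: "eE a ?o = Ide G (to tL a ?o)"
    have e: "eE (gpl h a) (one tL (Dom S h)) = sm tL h a ?o"
      unfolding o[symmetric] using i by (intro eE_pull) (simp_all add: os)
    have "Cmp G (gpa h (ta tL (Ide G a) (sr tL k))) (sm tL h a ?o) = Cmp G (sm tL h a (one tL (Dom S k))) (ta tL (Ide G (gpl h a)) (gpa h (sr tL k)))"
      using L.sm_nat[of h "Ide G a" "sr tL k"] by (simp add: os)
    then show "Cmp G (gpa h (Cmp G (ur tL a) (ta tL (Ide G a) (sr tL k)))) (eE (gpl h a) (one tL (Dom S h))) = ur tL (gpl h a)"
      unfolding e using tot.reassoc[OF L.ur_sm[of h a], of "ta tL (Ide G (gpl h a)) (gpa h (sr tL k))"] s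
      by (simp add: os flip: L.ta_Cmp)
  next
    assume i: "eE ?o a = Ide G (to tL ?o a)"
    have e: "eE (one tL (Dom S h)) (gpl h a) = sm tL h ?o a"
      unfolding o[symmetric] using i by (intro eE_pull) (simp_all add: os)
    have "Cmp G (gpa h (ta tL (sr tL k) (Ide G a))) (sm tL h ?o a) = Cmp G (sm tL h (one tL (Dom S k)) a) (ta tL (gpa h (sr tL k)) (Ide G (gpl h a)))"
      using L.sm_nat[of h "sr tL k" "Ide G a"] by (simp add: os)
    then show "Cmp G (gpa h (Cmp G (ul tL a) (ta tL (sr tL k) (Ide G a)))) (eE (one tL (Dom S h)) (gpl h a)) = ul tL (gpl h a)"
      unfolding e using tot.reassoc[OF L.ul_sm[of h a], of "ta tL (gpa h (sr tL k)) (Ide G (gpl h a))"] s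
      by (simp add: os flip: L.ta_Cmp)
  }
qed

text \<open>The case of the triple product. Here \<open>eE a b\<close> is m for the projection to
  the first two factors, and it cancels against the inverse of this m with which the constraint of E
  T begins.\<close>

lemma da_eE:
  assumes "Associative \<in> K" "X1 \<in> Obj S" "X2 \<in> Obj S" "X3 \<in> Obj S" "A1 \<in> Obj (Fib H X1)" "A2 \<in> Obj (Fib H X2)" "A3 \<in> Obj (Fib H X3)"
    and a: "a = (Cmp S (Pr1 S X1 X2) (Pr1 S (Prd S X1 X2) X3), A1)" "b = (Cmp S (Pr2 S X1 X2) (Pr1 S (Prd S X1 X2) X3), A2)" "c = (Pr2 S (Prd S X1 X2) X3, A3)"
  shows "Cmp G (X.da X1 X2 X3 A1 A2 A3) (ta tL (eE a b) (Ide G c)) = Cmp G (eE a (X.xto b c)) (Cmp G (ta tL (Ide G a) (eE b c)) (sas tL a b c))"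
proof -
  let ?m = "sm tL (Pr1 S (Prd S X1 X2) X3) (Pr1 S X1 X2, A1) (Pr2 S X1 X2, A2)"
  have m: "isoar G ?m" "?m \<in> Arr G" "Dom G ?m = to tL a b" "Cod G ?m = X.xto a b" "gbs (to tL a b) = gbs c" "c \<in> Obj G" "to tL a b \<in> Obj G"
    "a \<in> Obj G" "b \<in> Obj G" "gbs a = gbs c" "gbs b = gbs c" "gbs (X.xto a b) = gbs c"
    using assms by (simp_all add: k_simps L.sm_iso)
  have "Cmp G (ta tL (Inv G ?m) (Ide G c)) (ta tL ?m (Ide G c)) = Ide G (to tL (to tL a b) c)"
    using m by (simp add: L.ta_Ide tot.cat_simps flip: L.ta_Cmp)
  moreover have "ta tL (Inv G ?m) (Ide G c) \<in> Arr G" "Dom G (ta tL (Inv G ?m) (Ide G c)) = to tL (X.xto a b) c"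
     "Cod G (ta tL (Inv G ?m) (Ide G c)) = to tL (to tL a b) c" "ta tL ?m (Ide G c) \<in> Arr G" "Cod G (ta tL ?m (Ide G c)) = to tL (X.xto a b) c"
    using m by (simp_all add: L.typ_simps tot.cat_simps)
  ultimately show ?thesis
    using assms by (simp add: da_E Let_def eE_def k_simps)
qed

text \<open>The comparison of units is the identity because E keeps the unit section. Compatibility
  with associativity, commutativity and units is checked over a product of the codomains and pulled
  back from there.\<close>

lemma sequiv_E: "sequiv_map S G gbs gpl gpa K tL X.lift_ext eE (\<lambda>X. Ide G (one tL X))"
proof (rule sequiv_map.intro[OF stensor_lift XT.styped_ext sequiv_map_axioms.intro], goal_cases)
  case (4 u v)
  then show ?case by (simp add: X.ext_sel eE_nat)
next
  case (5 k a b)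
  then show ?case using eE_sm[of k a b] by (simp add: X.ext_sel o_simps)
next
  case (6 a b c)
  obtain f1 A1 f2 A2 f3 A3 where o: "a = (f1, A1)" "b = (f2, A2)" "c = (f3, A3)" by (cases a; cases b; cases c)
  have s: "f1 \<in> Arr S" "A1 \<in> Obj (Fib H (Cod S f1))" "f2 \<in> Arr S" "A2 \<in> Obj (Fib H (Cod S f2))"
    "f3 \<in> Arr S" "A3 \<in> Obj (Fib H (Cod S f3))" "Dom S f2 = Dom S f1" "Dom S f3 = Dom S f1"
    using 6(2-) by (simp_all add: o G_simps)
  let ?X1 = "Cod S f1" and ?X2 = "Cod S f2" and ?X3 = "Cod S f3" and ?h = "pair S (pair S f1 f2) f3"
  let ?q = "Pr1 S (Prd S ?X1 ?X2) ?X3"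
  \<comment> \<open>These objects over the triple product have the three projections as base arrows;
    their pullbacks along \<open>?h\<close> are the given objects.\<close>
  let ?a = "(Cmp S (Pr1 S ?X1 ?X2) ?q, A1)" and ?b = "(Cmp S (Pr2 S ?X1 ?X2) ?q, A2)" and ?c = "(Pr2 S (Prd S ?X1 ?X2) ?X3, A3)"
  have g: "gpl ?h ?a = a" "gpl ?h ?b = b" "gpl ?h ?c = c" "X.xto ?a ?b = (?q, xob xE ?X1 ?X2 A1 A2)"
    using s by (simp_all add: o k_simps)
  have x: "xob xE ?X1 ?X2 A1 A2 \<in> Obj (Fib H (Prd S ?X1 ?X2))" using s by (simp add: k_simps)
  have "Cmp G (gpa ?h (X.da ?X1 ?X2 ?X3 A1 A2 A3)) (Cmp G (eE (X.xto a b) c) (ta tL (eE a b) (Ide G c))) =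
      Cmp G (eE a (X.xto b c)) (Cmp G (ta tL (Ide G a) (eE b c)) (sas tL a b c))"
    using sas_pull[OF 6(1), of ?a ?b ?c ?h "X.da ?X1 ?X2 ?X3 A1 A2 A3", unfolded g(1-3)]
      eE_Ide[of "Prd S ?X1 ?X2" ?X3 "xob xE ?X1 ?X2 A1 A2" A3] da_eE[OF 6(1), of ?X1 ?X2 ?X3 A1 A2 A3 ?a ?b ?c] s x
    by (simp add: g(4) G_Obj gbs_pair vert_arr_only prd_arr_only XT.d_arr 6(1) XT.d_dom_cod to_xob)
  then show ?case by (simp add: X.ext_sel o)
next
  case (7 a b)
  obtain f1 A1 f2 A2 where o: "a = (f1, A1)" "b = (f2, A2)" by (cases a; cases b)
  have s: "f1 \<in> Arr S" "A1 \<in> Obj (Fib H (Cod S f1))" "f2 \<in> Arr S" "A2 \<in> Obj (Fib H (Cod S f2))" "Dom S f2 = Dom S f1"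
    using 7(2-) by (simp_all add: o G_simps)
  let ?X1 = "Cod S f1" and ?X2 = "Cod S f2" and ?h = "pair S f1 f2"
  let ?a = "(Pr1 S ?X1 ?X2, A1)" and ?b = "(Pr2 S ?X1 ?X2, A2)"
  have g: "gpl ?h ?a = a" "gpl ?h ?b = b" using s by (simp_all add: o k_simps)
  have "X.dc ?X1 ?X2 A1 A2 = Cmp G (eE ?b ?a) (sco tL ?a ?b)"
    using s 7(1) by (simp add: dc_E eE_def prd_arr_only)
  then show ?case
    using sco_pull[OF 7(1), of ?a ?b ?h, unfolded g] eE_Ide[of ?X1 ?X2 A1 A2] s
    by (simp add: X.ext_sel o G_Obj gbs_pair vert_arr_only prd_arr_only)
next
  case (8 Y)
  then show ?case by (simp add: L.typ_simps tot.isoar_Ide)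
next
  case (9 Y)
  then show ?case by (simp add: L.typ_simps vert_arr_only)
next
  case (10 Y)
  then show ?case by (simp add: L.typ_simps vert_arr_only sr_E)
next
  case (11 k)
  then show ?case by (simp add: L.typ_simps vert_arr_only sr_E)
next
  case (12 a)
  obtain f A where o: "a = (f, A)" by (cases a)
  have s: "f \<in> Arr S" "A \<in> Obj (Fib H (Cod S f))"
    using 12(2-) by (simp_all add: o G_simps)
  let ?Z = "Dom S f" and ?h = "pair S f (Ide S (Dom S f))"
  let ?a = "(Pr1 S (Cod S f) ?Z, A)" and ?k = "Pr2 S (Cod S f) ?Z"
  have g: "gpl ?h ?a = a" using s by (simp add: o k_simps)
  have u: "sob uT ?Z \<in> Obj (Fib H ?Z)" "gpl ?k (one tL ?Z) = (?k, sob uT ?Z)" using s 12(1) by (simp_all add: unit_obj vert_arr_only prd_arr_only lift_sel gpl_pair)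
  have "eE ?a (gpl ?k (one tL (Cod S ?k))) = Ide G (to tL ?a (gpl ?k (one tL (Cod S ?k))))"
    using eE_Ide[of "Cod S f" ?Z A "sob uT ?Z"] s u by (simp add: vert_arr_only prd_arr_only)
  then have m: "Cmp G (gpa ?h (X.dr (Cod S f) ?Z A)) (eE a (one tL ?Z)) = ur tL a"
    using ur_pull(1)[OF 12(1), of ?a ?k ?h, unfolded g] s 12(1) by (simp add: XT.G_Obj_pair gbs_pair vert_arr_only prd_arr_only dr_E(1))
  have "Cmp G (eE a (one tL ?Z)) (ta tL (Ide G a) (Ide G (one tL ?Z))) = eE a (one tL ?Z)"
    using 12 s by (simp add: o L.typ_simps L.ta_Ide eE_simps gbs_pair tot.Cmp_Ide dom_obj)
  then show ?case
    using m s 12(1) by (simp add: o X.ext_sel(8) gbs_pair sr_E)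
next
  case (13 a)
  obtain f A where o: "a = (f, A)" by (cases a)
  have s: "f \<in> Arr S" "A \<in> Obj (Fib H (Cod S f))"
    using 13(2-) by (simp_all add: o G_simps)
  let ?Z = "Dom S f" and ?h = "pair S (Ide S (Dom S f)) f"
  let ?a = "(Pr2 S ?Z (Cod S f), A)" and ?k = "Pr1 S ?Z (Cod S f)"
  have g: "gpl ?h ?a = a" using s by (simp add: o k_simps)
  have u: "sob uT ?Z \<in> Obj (Fib H ?Z)" "gpl ?k (one tL ?Z) = (?k, sob uT ?Z)" using s 13(1) by (simp_all add: unit_obj vert_arr_only prd_arr_only lift_sel gpl_pair)
  have "eE (gpl ?k (one tL (Cod S ?k))) ?a = Ide G (to tL (gpl ?k (one tL (Cod S ?k))) ?a)"
    using eE_Ide[of ?Z "Cod S f" "sob uT ?Z" A] s u by (simp add: vert_arr_only prd_arr_only)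
  then have m: "Cmp G (gpa ?h (X.dl ?Z (Cod S f) A)) (eE (one tL ?Z) a) = ul tL a"
    using ur_pull(2)[OF 13(1), of ?a ?k ?h, unfolded g] s 13(1) by (simp add: XT.G_Obj_pair gbs_pair vert_arr_only prd_arr_only dr_E(2))
  have "Cmp G (eE (one tL ?Z) a) (ta tL (Ide G (one tL ?Z)) (Ide G a)) = eE (one tL ?Z) a"
    using 13 s by (simp add: o L.typ_simps L.ta_Ide eE_simps gbs_pair tot.Cmp_Ide dom_obj)
  then show ?case
    using m s 13(1) by (simp add: o X.ext_sel(9) gbs_pair sr_E)
qed (simp_all add: X.ext_sel eE_simps)

lemma K_external_E: "K_external S H K xE"
proof -
  interpret e: sequiv_map S G gbs gpl gpa K tL X.lift_ext eE "\<lambda>X. Ide G (one tL X)"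
    by (rule sequiv_E)
  interpret t: stensor S G gbs gpl gpa K X.lift_ext
    by (rule e.transport)
  note os = vert_arr_only L.typ_simps L.ta_Ide eE_simps X.xto_simps XT.G_Obj_pair gbs_pair prd_arr_only
  interpret lifted_external S H xE K
  proof (unfold_locales, goal_cases)
    \<comment> \<open>The unit law of the equivalence expresses \<open>ur tL\<close> through
      \<open>ur X.lift_ext\<close> and \<open>eE\<close>. Naturality of \<open>eE\<close> at the
      unit arrow then moves \<open>eE\<close> to a pair of projections, where it is an
      identity.\<close>
    case (4 X1 X2 A)
    let ?a = "(Pr1 S X1 X2, A)" and ?k = "Pr2 S X1 X2"
    let ?o = "gpl ?k (one tL X2)" and ?Y = "Prd S X1 X2"
    have o: "?o = (?k, sob uT X2)" using 4 by (simp add: lift_sel gpl_pair prd_arr_only)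
    have "eE ?a ?o = Ide G (to tL ?a ?o)" unfolding o using 4 by (intro eE_Ide) (simp_all add: unit_obj)
    then have "Cmp G (eE ?a (one tL ?Y)) (ta tL (Ide G ?a) (sr tL ?k)) = X.xta (Ide G ?a) (sr tL ?k)"
      using eE_nat[of "Ide G ?a" "sr tL ?k"] eE_simps(4)[of ?a ?o] 4 by (simp add: os X.xta_simps)
    moreover have "ur tL ?a = Cmp G (ur X.lift_ext ?a) (eE ?a (one tL ?Y))"
      using e.e_ur[of ?a] 4 by (simp add: os sr_E)
    ultimately show ?case
      using 4 e.t2.ur_dom[of ?a] by (simp add: dr_E sr_E os e.t2.ur_arr X.ext_sel(1))
  next
    case (5 X1 X2 A)
    let ?a = "(Pr2 S X1 X2, A)" and ?k = "Pr1 S X1 X2"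
    let ?o = "gpl ?k (one tL X1)" and ?Y = "Prd S X1 X2"
    have o: "?o = (?k, sob uT X1)" using 5 by (simp add: lift_sel gpl_pair prd_arr_only)
    have "eE ?o ?a = Ide G (to tL ?o ?a)" unfolding o using 5 by (intro eE_Ide) (simp_all add: unit_obj)
    then have "Cmp G (eE (one tL ?Y) ?a) (ta tL (sr tL ?k) (Ide G ?a)) = X.xta (sr tL ?k) (Ide G ?a)"
      using eE_nat[of "sr tL ?k" "Ide G ?a"] eE_simps(4)[of ?o ?a] 5 by (simp add: os X.xta_simps)
    moreover have "ul tL ?a = Cmp G (ul X.lift_ext ?a) (eE (one tL ?Y) ?a)"
      using e.e_ul[of ?a] 5 by (simp add: os sr_E)
    ultimately show ?case
      using 5 e.t2.ul_dom[of ?a] by (simp add: dr_E sr_E os e.t2.ul_arr X.ext_sel(1))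
  qed (use shape in \<open>simp_all add: xE_sel\<close>)
  show ?thesis by (rule K_external_lifted)
qed

end

section \<open>The construction from external to internal structures\<close>

context external_structure
begin

interpretation t: stensor S G gbs gpl gpa K lift_ext
  by (rule stensor_ext)

abbreviation "iJ \<equiv> constr_I S H T"
abbreviation "tJ \<equiv> lift_int (constr_I S H T)"

lemma shape: "xassoc T \<noteq> None \<longleftrightarrow> Associative \<in> K" "xcomm T \<noteq> None \<longleftrightarrow> Symmetric \<in> K" "xunit T \<noteq> None \<longleftrightarrow> Unitary \<in> K"
  using K_ext by (auto simp: K_external_def)

lemma iJ_sel:
  "tob iJ X A B = pbo H (diag S X) (xob T X X A B)" "tar iJ X u v = pba H (diag S X) (xar T X X u v)" "tm iJ = I_m S H T"
  by (simp_all add: constr_I_def I_ob_def I_ar_def)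

lemma iJ_constraints:
  "Associative \<in> K \<Longrightarrow> the (tassoc iJ) = I_assoc S H T aT" "Symmetric \<in> K \<Longrightarrow> the (tcomm iJ) = I_comm S H T cT"
  "Unitary \<in> K \<Longrightarrow> the (tunit iJ) = I_unit S H uT"
  using shape by (auto simp: constr_I_def)

lemmas j_simps = lift_sel iJ_sel iJ_constraints diag_def diag3_def Let_def und_all

text \<open>The lift of I T sees an object of \<open>G\<close> only through what it stands for. Its
  product is therefore the product of the external lift at embedded objects, embedded once
  more.\<close>

lemma to_Emb:
  assumes "a \<in> Obj G" "b \<in> Obj G" "gbs b = gbs a"
  shows "to tJ a b = Emb (xto (Emb a) (Emb b))"
  using assms by (cases a; cases b; simp add: Emb_def j_simps xto_pair)

lemma ta_Dec:
  assumes "u \<in> Arr G" "v \<in> Arr G" "gbs (Dom G v) = gbs (Dom G u)"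
  shows "ta tJ u v = Dec (xta (Dec u) (Dec v))"
  using assms by (elim G_arr_cases) (simp add: Emb_def Dec_def j_simps xto_pair xta_def)

text \<open>The inverse of the equivalence from \<open>T\<close> to \<open>I T\<close>.\<close>

definition sJ where
  "sJ a b = Cmp G (xta (Lam a) (Lam b)) (Lam (xto (Emb a) (Emb b)))"

lemma Emb_Emb: "a \<in> Obj G \<Longrightarrow> Emb (Emb a) = Emb a" "a \<in> Obj G \<Longrightarrow> Lam (Emb a) = Ide G (Emb a)"
  by (cases a; simp add: Emb_def Lam_def emb_def G_simps lam_def fib_simps cat_simps)+

lemmas s_simps = vert_arr_only Lam_simps Emb_simps Dec_simps xto_simps xta_simps xta_Ide Emb_Emb

lemma to_J:
  assumes "a \<in> Obj G" "b \<in> Obj G" "gbs b = gbs a"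
  shows "to tJ a b \<in> Obj G" "gbs (to tJ a b) = gbs a" "Lam (to tJ a b) = Ide G (to tJ a b)" "Emb (to tJ a b) = to tJ a b"
    "to tJ (Emb a) b = to tJ a b" "to tJ a (Emb b) = to tJ a b"
  using assms by (simp_all add: to_Emb s_simps)

lemma sJ_simps:
  assumes "a \<in> Obj G" "b \<in> Obj G" "gbs b = gbs a"
  shows "isoar G (sJ a b)" "sJ a b \<in> Arr G" "Dom G (sJ a b) = to tJ a b" "Cod G (sJ a b) = xto a b"
  using assms by (simp_all add: sJ_def to_Emb s_simps xta_isoar tot.isoar_Cmp)

lemma ta_J:
  assumes "u \<in> Arr G" "v \<in> Arr G" "gbs (Dom G v) = gbs (Dom G u)"
  shows "ta tJ u v \<in> Arr G" "Dom G (ta tJ u v) = to tJ (Dom G u) (Dom G v)" "Cod G (ta tJ u v) = to tJ (Cod G u) (Cod G v)"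
  using assms by (simp_all add: ta_Dec to_Emb s_simps)

lemma sJ_nat:
  assumes "u \<in> Arr G" "v \<in> Arr G" "gbs (Dom G v) = gbs (Dom G u)"
  shows "Cmp G (sJ (Cod G u) (Cod G v)) (ta tJ u v) = Cmp G (xta u v) (sJ (Dom G u) (Dom G v))"
proof -
  have b: "gbs (Cod G v) = gbs (Dom G u)" "gbs (Cod G u) = gbs (Dom G u)" using assms by (simp_all add: s_simps)
  have "Cmp G (xta (Lam (Cod G u)) (Lam (Cod G v))) (xta (Dec u) (Dec v)) = Cmp G (xta u v) (xta (Lam (Dom G u)) (Lam (Dom G v)))"
    using assms b by (simp add: s_simps Lam_square flip: xta_Cmp)
  from tot.reassoc[OF this, of "Lam (xto (Emb (Dom G u)) (Emb (Dom G v)))"] show ?thesis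
    using assms b Lam_square[of "xta (Dec u) (Dec v)", symmetric] by (simp add: sJ_def ta_Dec s_simps)
qed

text \<open>Separates the part coming from m, carried by the arrows \<open>Lam\<close>, from the
  comparison at embedded objects, where everything can be computed from the definition of I.\<close>

lemma sJ_split:
  assumes "a \<in> Obj G" "b \<in> Obj G" "gbs b = gbs a"
  shows "sJ a b = Cmp G (xta (Lam a) (Lam b)) (sJ (Emb a) (Emb b))"
  using assms by (simp add: sJ_def s_simps)

text \<open>At embedded objects the factor coming from m is an identity, so that only an identity of
  the fiber, seen as \<open>lam\<close> of the diagonal, remains.\<close>

lemma sJ_emb:
  assumes "X \<in> Obj S" "A \<in> Obj (Fib H X)" "B \<in> Obj (Fib H X)"
  shows "sJ (emb X A) (emb X B) = lam (diag S X) (xob T X X A B)"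
proof -
  have e: "Emb (emb X A) = emb X A" "Emb (emb X B) = emb X B" "Lam (emb X A) = Ide G (emb X A)" "Lam (emb X B) = Ide G (emb X B)"
    using assms by (simp_all add: Emb_def emb_simps Lam_def emb_proj lam_Ide) (simp_all add: emb_def)
  show ?thesis
    using assms by (simp add: sJ_def e s_simps emb_simps) (simp add: emb_def xto_pair Lam_pair vert_arr_only diag_def)
qed

definition mJ where
  "mJ k A B = (emb (Dom S k) (tob iJ (Dom S k) (pbo H k A) (pbo H k B)), tm iJ k A B, (k, tob iJ (Cod S k) A B))"

lemma mJ_typed:
  assumes "k \<in> Arr S" "A \<in> Obj (Fib H (Cod S k))" "B \<in> Obj (Fib H (Cod S k))"
  shows "isoar G (mJ k A B)"
    "tm iJ k A B \<in> Arr (Fib H (Dom S k))" "Dom (Fib H (Dom S k)) (tm iJ k A B) = tob iJ (Dom S k) (pbo H k A) (pbo H k B)"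
  using assms by (simp_all add: mJ_def I_m_def ident_def j_simps)

text \<open>The definition of m for I T written in \<open>G\<close>: the product of the two arrows
  \<open>lam k\<close> is m of the external structure, and the two remaining arrows
  \<open>lam\<close> stand for the identification along the diagonals.\<close>

lemma mJ_eq:
  assumes "k \<in> Arr S" "A \<in> Obj (Fib H (Cod S k))" "B \<in> Obj (Fib H (Cod S k))"
  shows "Cmp G (gpa k (lam (diag S (Cod S k)) (xob T (Cod S k) (Cod S k) A B))) (mJ k A B) =
    Cmp G (xta (lam k A) (lam k B)) (lam (diag S (Dom S k)) (xob T (Dom S k) (Dom S k) (pbo H k A) (pbo H k B)))"
  using assms by (simp add: mJ_def I_m_def ident_def j_simps xta_def)

text \<open>The connection isomorphism from (f k)^*A to k^*f^*A, as an arrow of \<open>G\<close>. It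
  isolates the correction by which \<open>sm\<close> of the lift differs from m of I T at the
  objects \<open>real a\<close>.\<close>

definition kJ where
  "kJ k a = (gpl k a, conn H k (fst a) (snd a), emb (Dom S k) (pbo H k (real a)))"

lemma kJ_simps:
  assumes "k \<in> Arr S" "a \<in> Obj G" "gbs a = Cod S k"
  shows "isoar G (kJ k a)" "kJ k a \<in> Arr G" "Dom G (kJ k a) = gpl k a" "Cod G (kJ k a) = emb (Dom S k) (pbo H k (real a))"
    "Cmp G (gpa k (Lam a)) (Cmp G (lam k (real a)) (kJ k a)) = Ide G (gpl k a)"
  using assms by (cases a; simp add: kJ_def j_simps Lam_def real_def)+

lemma sm_J:
  assumes "k \<in> Arr S" "a \<in> Obj G" "b \<in> Obj G" "gbs a = Cod S k" "gbs b = Cod S k"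
  shows "sm tJ k a b = Cmp G (mJ k (real a) (real b)) (ta tJ (kJ k a) (kJ k b))"
  using assms by (cases a; cases b; simp add: kJ_def mJ_def j_simps real_def I_m_def ident_def)

lemma sm_J_typed:
  assumes "k \<in> Arr S" "a \<in> Obj G" "b \<in> Obj G" "gbs a = Cod S k" "gbs b = Cod S k"
  shows "sm tJ k a b \<in> Arr G" "Dom G (sm tJ k a b) = to tJ (gpl k a) (gpl k b)" "Cod G (sm tJ k a b) = gpl k (to tJ a b)"
proof -
  have r: "real a \<in> Obj (Fib H (Cod S k))" "real b \<in> Obj (Fib H (Cod S k))" using assms by (simp_all add: real_obj)
  note m = mJ_typed[OF assms(1) r]
  have d: "Dom G (mJ k (real a) (real b)) = to tJ (emb (Dom S k) (pbo H k (real a))) (emb (Dom S k) (pbo H k (real b)))"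
    using assms r by (simp add: mJ_def G_proj(1) lift_sel emb_simps fib_simps cat_simps) (simp add: emb_def)
  show "sm tJ k a b \<in> Arr G"
    using m d assms r by (simp add: sm_J kJ_simps ta_J tot.Cmp_arr tot.isoar_arr vert_arr_only)
  show "Dom G (sm tJ k a b) = to tJ (gpl k a) (gpl k b)" "Cod G (sm tJ k a b) = gpl k (to tJ a b)"
    by (simp_all add: lift_sel G_proj(1,2))
qed

text \<open>At embedded objects this is \<open>mJ_eq\<close>. The arrows left over, namely
  \<open>Lam\<close> pulled back, \<open>lam k\<close> and the connection isomorphism
  \<open>kJ\<close>, compose to identities in each factor.\<close>

lemma sJ_sm:
  assumes "k \<in> Arr S" "a \<in> Obj G" "b \<in> Obj G" "gbs a = Cod S k" "gbs b = Cod S k"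
  shows "Cmp G (gpa k (sJ a b)) (sm tJ k a b) = sJ (gpl k a) (gpl k b)"
proof -
  let ?ra = "real a" and ?rb = "real b" and ?ea = "emb (Dom S k) (pbo H k (real a))" and ?eb = "emb (Dom S k) (pbo H k (real b))"
  have r: "?ra \<in> Obj (Fib H (Cod S k))" "?rb \<in> Obj (Fib H (Cod S k))" using assms by (simp_all add: real_obj)
  have pr: "pbo H k ?ra \<in> Obj (Fib H (Dom S k))" "pbo H k ?rb \<in> Obj (Fib H (Dom S k))" "Dom S k \<in> Obj S" "Cod S k \<in> Obj S"
    using assms r by (simp_all add: fib_simps cat_simps)
  have s0: "sJ (Emb a) (Emb b) = lam (diag S (Cod S k)) (xob T (Cod S k) (Cod S k) ?ra ?rb)"
    using sJ_emb[of "Cod S k" ?ra ?rb] assms r pr by (simp add: Emb_def)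
  have l: "lam k ?ra \<in> Arr G" "Dom G (lam k ?ra) = ?ea" "Cod G (lam k ?ra) = gpl k (Emb a)"
    "lam k ?rb \<in> Arr G" "Dom G (lam k ?rb) = ?eb" "Cod G (lam k ?rb) = gpl k (Emb b)"
    using assms r pr by (simp_all add: lam_simps Emb_def emb_simps)
  have m: "mJ k ?ra ?rb \<in> Arr G" "Dom G (mJ k ?ra ?rb) = to tJ ?ea ?eb" "Cod G (mJ k ?ra ?rb) = gpl k (to tJ a b)"
    using mJ_typed[of k ?ra ?rb] assms r pr
    by (simp_all add: tot.isoar_arr) (simp_all add: mJ_def G_proj(1,2) lift_sel emb_def gbs_pair real_pair gpl_pair vert_arr_only pbo_ide)
  note os = s_simps kJ_simps ta_J sJ_simps emb_simps to_J
  have q: "Cmp G (mJ k ?ra ?rb) (ta tJ (kJ k a) (kJ k b)) \<in> Arr G" "Cod G (Cmp G (mJ k ?ra ?rb) (ta tJ (kJ k a) (kJ k b))) = gpl k (to tJ a b)"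
    using assms m pr by (simp_all add: os)
  have M: "Cmp G (gpa k (sJ (Emb a) (Emb b))) (mJ k ?ra ?rb) = Cmp G (xta (lam k ?ra) (lam k ?rb)) (sJ ?ea ?eb)"
    unfolding s0 sJ_emb[OF pr(3,1,2)] using assms r by (intro mJ_eq)
  have "Cmp G (gpa k (sJ a b)) (sm tJ k a b) = Cmp G (xta (gpa k (Lam a)) (gpa k (Lam b))) (Cmp G (Cmp G (gpa k (sJ (Emb a) (Emb b))) (mJ k ?ra ?rb)) (ta tJ (kJ k a) (kJ k b)))"
    using assms m q pr sJ_split[of a b] by (simp add: sm_J os gpa_xta)
  also have "\<dots> = Cmp G (xta (gpa k (Lam a)) (gpa k (Lam b))) (Cmp G (xta (lam k ?ra) (lam k ?rb)) (Cmp G (sJ ?ea ?eb) (ta tJ (kJ k a) (kJ k b))))"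
    unfolding M using assms m l pr by (simp add: os)
  also have "Cmp G (sJ ?ea ?eb) (ta tJ (kJ k a) (kJ k b)) = Cmp G (xta (kJ k a) (kJ k b)) (sJ (gpl k a) (gpl k b))"
    using sJ_nat[of "kJ k a" "kJ k b"] assms by (simp add: os)
  also have "Cmp G (xta (gpa k (Lam a)) (gpa k (Lam b))) (Cmp G (xta (lam k ?ra) (lam k ?rb)) (Cmp G (xta (kJ k a) (kJ k b)) (sJ (gpl k a) (gpl k b)))) =
     Cmp G (Cmp G (xta (gpa k (Lam a)) (gpa k (Lam b))) (Cmp G (xta (lam k ?ra) (lam k ?rb)) (xta (kJ k a) (kJ k b)))) (sJ (gpl k a) (gpl k b))"
    using assms m l pr by (simp add: os)
  also have "Cmp G (xta (gpa k (Lam a)) (gpa k (Lam b))) (Cmp G (xta (lam k ?ra) (lam k ?rb)) (xta (kJ k a) (kJ k b))) =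
     Ide G (xto (gpl k a) (gpl k b))"
    using assms l pr by (simp add: os flip: xta_Cmp)
  finally show ?thesis using assms by (simp add: os)
qed

text \<open>For embedded objects every \<open>sJ\<close> is a \<open>lam\<close>, hence an identity
  over the fibers, and the square is the definition of the associativity constraint of I T. The two
  occurrences of m in that definition come from the products of a \<open>lam\<close> with an
  identity.\<close>

lemma aJ_emb:
  assumes "Associative \<in> K" "X \<in> Obj S" "A \<in> Obj (Fib H X)" "B \<in> Obj (Fib H X)" "C \<in> Obj (Fib H X)"
    and abc: "a = emb X A" "b = emb X B" "c = emb X C"
  shows "isoar G (sas tJ a b c)"
    "Cmp G (sas lift_ext a b c) (Cmp G (xta (sJ a b) (Ide G c)) (sJ (to tJ a b) c)) = Cmp G (xta (Ide G a) (sJ b c)) (Cmp G (sJ a (to tJ b c)) (sas tJ a b c))"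
proof -
  have t: "to tJ a b = emb X (tob iJ X A B)" "to tJ b c = emb X (tob iJ X B C)" "tob iJ X A B \<in> Obj (Fib H X)" "tob iJ X B C \<in> Obj (Fib H X)"
    using assms by (simp_all add: j_simps)
  show "isoar G (sas tJ a b c)"
    using assms by (simp add: j_simps I_assoc_def ident_def)
  have s: "sJ a b = lam (diag S X) (xob T X X A B)" "sJ b c = lam (diag S X) (xob T X X B C)"
    "sJ (to tJ a b) c = lam (diag S X) (xob T X X (tob iJ X A B) C)" "sJ a (to tJ b c) = lam (diag S X) (xob T X X A (tob iJ X B C))"
    unfolding t(1,2)[unfolded abc] abc using assms t(3,4) by (simp_all add: sJ_emb)
  show "Cmp G (sas lift_ext a b c) (Cmp G (xta (sJ a b) (Ide G c)) (sJ (to tJ a b) c)) = Cmp G (xta (Ide G a) (sJ b c)) (Cmp G (sJ a (to tJ b c)) (sas tJ a b c))"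
    unfolding s using assms by (simp add: ext_sel j_simps I_assoc_def ident_def xta_def passoc_def)
qed

lemma cJ_emb:
  assumes "Symmetric \<in> K" "X \<in> Obj S" "A \<in> Obj (Fib H X)" "B \<in> Obj (Fib H X)"
    and ab: "a = emb X A" "b = emb X B"
  shows "isoar G (sco tJ a b)" "Cmp G (sco lift_ext a b) (sJ a b) = Cmp G (sJ b a) (sco tJ a b)"
proof -
  show "isoar G (sco tJ a b)"
    using assms by (simp add: j_simps I_comm_def pswap_def)
  have s: "sJ a b = lam (diag S X) (xob T X X A B)" "sJ b a = lam (diag S X) (xob T X X B A)"
    unfolding ab using assms by (simp_all add: sJ_emb)
  show "Cmp G (sco lift_ext a b) (sJ a b) = Cmp G (sJ b a) (sco tJ a b)"
    unfolding s using assms by (simp add: ext_sel j_simps I_comm_def pswap_def)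
qed

lemma uJ_emb:
  assumes "Unitary \<in> K" "X \<in> Obj S" "A \<in> Obj (Fib H X)" and a: "a = emb X A"
  shows "Cmp G (ur lift_ext a) (sJ a (one lift_ext X)) = ur tJ a" "Cmp G (ul lift_ext a) (sJ (one lift_ext X) a) = ul tJ a"
proof -
  have s: "sJ a (one lift_ext X) = lam (diag S X) (xob T X X A (sob uT X))" "sJ (one lift_ext X) a = lam (diag S X) (xob T X X (sob uT X) A)"
    unfolding a ext_sel using assms by (simp_all add: sJ_emb unit_obj)
  show "Cmp G (ur lift_ext a) (sJ a (one lift_ext X)) = ur tJ a" "Cmp G (ul lift_ext a) (sJ (one lift_ext X) a) = ul tJ a"
    unfolding s using assms by (simp_all add: ext_sel j_simps I_unit_def)
qed

lemma J_units: "Unitary \<in> K \<Longrightarrow> one tJ X = one lift_ext X" "Unitary \<in> K \<Longrightarrow> k \<in> Arr S \<Longrightarrow> sr tJ k = sr lift_ext k"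
  by (simp_all add: lift_sel iJ_constraints ext_sel I_unit_def emb_def gpl_pair vert_arr_only)

lemma Emb_emb: "a \<in> Obj G \<Longrightarrow> gbs a = X \<Longrightarrow> Emb a = emb X (real a)"
  by (simp add: Emb_def)

lemma J_Emb:
  assumes "a \<in> Obj G" "b \<in> Obj G" "c \<in> Obj G" "gbs b = gbs a" "gbs c = gbs a"
  shows "sas tJ (Emb a) (Emb b) (Emb c) = sas tJ a b c" "sco tJ (Emb a) (Emb b) = sco tJ a b"
  using assms by (cases a; cases b; cases c; simp add: lift_sel Emb_def emb_def G_simps fib_simps cat_simps)+

text \<open>The constraint of the lift of I T depends only on the embedded objects. Both comparison
  composites factor through the product of the three arrows \<open>Lam\<close>, and naturality of
  \<open>sas lift_ext\<close> at these arrows extends the embedded case.\<close>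

lemma sas_J:
  assumes K: "Associative \<in> K" and ob: "a \<in> Obj G" "b \<in> Obj G" "c \<in> Obj G" "gbs b = gbs a" "gbs c = gbs a"
  shows "isoar G (sas tJ a b c)" "Dom G (sas tJ a b c) = to tJ (to tJ a b) c" "Cod G (sas tJ a b c) = to tJ a (to tJ b c)"
    "Cmp G (sas lift_ext a b c) (Cmp G (xta (sJ a b) (Ide G c)) (sJ (to tJ a b) c)) = Cmp G (xta (Ide G a) (sJ b c)) (Cmp G (sJ a (to tJ b c)) (sas tJ a b c))"
proof -
  let ?X = "gbs a"
  have r: "?X \<in> Obj S" "real a \<in> Obj (Fib H ?X)" "real b \<in> Obj (Fib H ?X)" "real c \<in> Obj (Fib H ?X)"
    using ob by (simp_all add: bs_obj real_obj)
  have e: "Emb a = emb ?X (real a)" "Emb b = emb ?X (real b)" "Emb c = emb ?X (real c)"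
    using ob by (simp_all add: Emb_emb)
  note ab = aJ_emb[OF K r e, unfolded J_Emb[OF ob]]
  show i: "isoar G (sas tJ a b c)" by (rule ab(1))
  show d: "Dom G (sas tJ a b c) = to tJ (to tJ a b) c" "Cod G (sas tJ a b c) = to tJ a (to tJ b c)"
    by (simp_all add: lift_sel G_proj(1,2))
  note [simp] = K ob i tot.isoar_arr[OF i] d
  note os = s_simps sJ_simps to_J t.typ_simps[unfolded ext_sel(1,2)]
  \<comment> \<open>Products formed in the lift of I T are already embedded, so their
    \<open>Lam\<close> is an identity and only the \<open>Lam\<close> of the third object is split
    off.\<close>
  have L: "Cmp G (xta (sJ a b) (Ide G c)) (sJ (to tJ a b) c) =
      Cmp G (xta (xta (Lam a) (Lam b)) (Lam c)) (Cmp G (xta (sJ (Emb a) (Emb b)) (Ide G (Emb c))) (sJ (to tJ a b) (Emb c)))"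
  proof -
    have "sJ (to tJ a b) c = Cmp G (xta (Ide G (to tJ a b)) (Lam c)) (sJ (to tJ a b) (Emb c))"
      using sJ_split[of "to tJ a b" c] by (simp add: os)
    moreover have "Cmp G (xta (sJ a b) (Ide G c)) (xta (Ide G (to tJ a b)) (Lam c)) = Cmp G (xta (xta (Lam a) (Lam b)) (Lam c)) (xta (sJ (Emb a) (Emb b)) (Ide G (Emb c)))"
      using sJ_split[of a b] by (simp add: os flip: xta_Cmp)
    from tot.reassoc[OF this, of "sJ (to tJ a b) (Emb c)"]
    have "Cmp G (xta (sJ a b) (Ide G c)) (Cmp G (xta (Ide G (to tJ a b)) (Lam c)) (sJ (to tJ a b) (Emb c))) =
      Cmp G (xta (xta (Lam a) (Lam b)) (Lam c)) (Cmp G (xta (sJ (Emb a) (Emb b)) (Ide G (Emb c))) (sJ (to tJ a b) (Emb c)))"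
      by (simp add: os)
    ultimately show ?thesis by simp
  qed
  have R: "Cmp G (xta (Ide G a) (sJ b c)) (sJ a (to tJ b c)) =
      Cmp G (xta (Lam a) (xta (Lam b) (Lam c))) (Cmp G (xta (Ide G (Emb a)) (sJ (Emb b) (Emb c))) (sJ (Emb a) (to tJ b c)))"
  proof -
    have "sJ a (to tJ b c) = Cmp G (xta (Lam a) (Ide G (to tJ b c))) (sJ (Emb a) (to tJ b c))"
      using sJ_split[of a "to tJ b c"] by (simp add: os)
    moreover have "Cmp G (xta (Ide G a) (sJ b c)) (xta (Lam a) (Ide G (to tJ b c))) = Cmp G (xta (Lam a) (xta (Lam b) (Lam c))) (xta (Ide G (Emb a)) (sJ (Emb b) (Emb c)))"
      using sJ_split[of b c] by (simp add: os flip: xta_Cmp)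
    from tot.reassoc[OF this, of "sJ (Emb a) (to tJ b c)"]
    have "Cmp G (xta (Ide G a) (sJ b c)) (Cmp G (xta (Lam a) (Ide G (to tJ b c))) (sJ (Emb a) (to tJ b c))) =
      Cmp G (xta (Lam a) (xta (Lam b) (Lam c))) (Cmp G (xta (Ide G (Emb a)) (sJ (Emb b) (Emb c))) (sJ (Emb a) (to tJ b c)))"
      by (simp add: os)
    ultimately show ?thesis by simp
  qed
  have n: "Cmp G (sas lift_ext a b c) (xta (xta (Lam a) (Lam b)) (Lam c)) = Cmp G (xta (Lam a) (xta (Lam b) (Lam c))) (sas lift_ext (Emb a) (Emb b) (Emb c))"
    using t.sas_nat[of "Lam a" "Lam b" "Lam c"] by (simp add: os ext_sel(2))
  have ab2: "Cmp G (sas lift_ext (Emb a) (Emb b) (Emb c)) (Cmp G (xta (sJ (Emb a) (Emb b)) (Ide G (Emb c))) (sJ (to tJ a b) (Emb c))) =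
      Cmp G (xta (Ide G (Emb a)) (sJ (Emb b) (Emb c))) (Cmp G (sJ (Emb a) (to tJ b c)) (sas tJ a b c))"
    using ab(2) by (simp add: os)
  have "Cmp G (sas lift_ext a b c) (Cmp G (xta (sJ a b) (Ide G c)) (sJ (to tJ a b) c)) =
     Cmp G (xta (Lam a) (xta (Lam b) (Lam c))) (Cmp G (sas lift_ext (Emb a) (Emb b) (Emb c)) (Cmp G (xta (sJ (Emb a) (Emb b)) (Ide G (Emb c))) (sJ (to tJ a b) (Emb c))))"
    unfolding L using tot.reassoc[OF n, of "Cmp G (xta (sJ (Emb a) (Emb b)) (Ide G (Emb c))) (sJ (to tJ a b) (Emb c))"] by (simp add: os)
  also have "\<dots> = Cmp G (Cmp G (xta (Ide G a) (sJ b c)) (sJ a (to tJ b c))) (sas tJ a b c)"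
    unfolding ab2 R by (simp add: os)
  also have "\<dots> = Cmp G (xta (Ide G a) (sJ b c)) (Cmp G (sJ a (to tJ b c)) (sas tJ a b c))"
    by (simp add: os)
  finally show "Cmp G (sas lift_ext a b c) (Cmp G (xta (sJ a b) (Ide G c)) (sJ (to tJ a b) c)) = Cmp G (xta (Ide G a) (sJ b c)) (Cmp G (sJ a (to tJ b c)) (sas tJ a b c))" .
qed

lemma sco_J:
  assumes K: "Symmetric \<in> K" and ob: "a \<in> Obj G" "b \<in> Obj G" "gbs b = gbs a"
  shows "isoar G (sco tJ a b)" "Dom G (sco tJ a b) = to tJ a b" "Cod G (sco tJ a b) = to tJ b a"
    "Cmp G (sco lift_ext a b) (sJ a b) = Cmp G (sJ b a) (sco tJ a b)"
proof -
  let ?X = "gbs a"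
  have r: "?X \<in> Obj S" "real a \<in> Obj (Fib H ?X)" "real b \<in> Obj (Fib H ?X)"
    using ob by (simp_all add: bs_obj real_obj)
  have e: "Emb a = emb ?X (real a)" "Emb b = emb ?X (real b)"
    using ob by (simp_all add: Emb_emb)
  note ab = cJ_emb[OF K r e, unfolded J_Emb(2)[OF ob(1,2,2,3,3)]]
  show i: "isoar G (sco tJ a b)" by (rule ab(1))
  show d: "Dom G (sco tJ a b) = to tJ a b" "Cod G (sco tJ a b) = to tJ b a"
    using ob by (simp_all add: lift_sel G_proj(1,2))
  note [simp] = K ob i tot.isoar_arr[OF i] d
  note os = s_simps sJ_simps to_J t.typ_simps[unfolded ext_sel(1,2)]
  have n: "Cmp G (sco lift_ext a b) (xta (Lam a) (Lam b)) = Cmp G (xta (Lam b) (Lam a)) (sco lift_ext (Emb a) (Emb b))"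
    using t.sco_nat[of "Lam a" "Lam b"] by (simp add: os ext_sel(2))
  show "Cmp G (sco lift_ext a b) (sJ a b) = Cmp G (sJ b a) (sco tJ a b)"
    using sJ_split[of a b] sJ_split[of b a] tot.reassoc[OF n, of "sJ (Emb a) (Emb b)"] ab(2) by (simp add: os)
qed

text \<open>Since the unit objects are embedded, only the \<open>Lam\<close> of \<open>a\<close> is
  involved. The equations also yield the typing of the unit constraints of the lift of I T.\<close>

lemma uJ:
  assumes K: "Unitary \<in> K" and ob: "a \<in> Obj G"
  shows "Cmp G (ur lift_ext a) (sJ a (one lift_ext (gbs a))) = ur tJ a" "Cmp G (ul lift_ext a) (sJ (one lift_ext (gbs a)) a) = ul tJ a"
proof -
  let ?X = "gbs a" and ?o = "one lift_ext (gbs a)"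
  have r: "?X \<in> Obj S" "real a \<in> Obj (Fib H ?X)" using ob by (simp_all add: bs_obj real_obj)
  have e: "Emb a = emb ?X (real a)" using ob by (simp add: Emb_emb)
  note ab = uJ_emb[OF K r e]
  have u: "ur tJ a = Cmp G (Lam a) (ur tJ (Emb a))" "ul tJ a = Cmp G (Lam a) (ul tJ (Emb a))"
    using K ob by (cases a; simp add: Emb_def Lam_def I_unit_def j_simps)+
  note [simp] = K ob r(1)
  note os = s_simps sJ_simps to_J t.typ_simps[unfolded ext_sel(1,2)]
  have o: "Emb ?o = ?o" "Lam ?o = Ide G ?o"
    using r K unit_obj[of ?X] by (simp_all add: ext_sel(6) Emb_def emb_simps Lam_def emb_proj lam_Ide) (simp_all add: emb_def)
  show "Cmp G (ur lift_ext a) (sJ a ?o) = ur tJ a"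
    using sJ_split[of a ?o] tot.reassoc[OF t.ur_nat[of "Lam a", unfolded ext_sel(2)], of "sJ (Emb a) ?o"] ab(1) by (simp add: os u o)
  show "Cmp G (ul lift_ext a) (sJ ?o a) = ul tJ a"
    using sJ_split[of ?o a] tot.reassoc[OF t.ul_nat[of "Lam a", unfolded ext_sel(2)], of "sJ ?o (Emb a)"] ab(2) by (simp add: os u o)
qed

lemma ur_J:
  assumes "Unitary \<in> K" "a \<in> Obj G"
  shows "ur tJ a \<in> Arr G" "ul tJ a \<in> Arr G"
  unfolding uJ[OF assms, symmetric] using assms
  by (simp_all add: s_simps sJ_simps t.typ_simps[unfolded ext_sel(1,2)])

lemma styped_J: "styped S G gbs gpl gpa K tJ"
proof (unfold_locales, goal_cases)
  case (6 k a b)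
  then show ?case by (rule sm_J_typed)
next
  case (7 k a b)
  then show ?case by (rule sm_J_typed)
next
  case (8 k a b)
  then show ?case by (rule sm_J_typed)
next
  case (9 a b c)
  then show ?case using sas_J(1) by (simp add: tot.isoar_arr)
next
  case (10 a b c)
  then show ?case by (rule sas_J)
next
  case (11 a b c)
  then show ?case by (rule sas_J)
next
  case (20 k l)
  then show ?case using t.sr_cmp[of k l] by (simp add: J_units vert_arr_only)
next
  case (22 a)
  then show ?case by (simp add: lift_sel G_proj(1,2))
next
  case (25 a)
  then show ?case by (simp add: lift_sel G_proj(1,2))
next
  case (23 a)
  then show ?case by (simp add: lift_sel G_proj(1,2))
next
  case (26 a)
  then show ?case by (simp add: lift_sel G_proj(1,2))
qed (simp_all add: to_J ta_J sco_J J_units t.typ_simps ur_J tot.isoar_arr)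

text \<open>The direction is forced: the laws are known for \<open>lift_ext\<close> and are to be
  transported to \<open>tJ\<close>. Hence the inverses of \<open>sJ\<close>, whose squares are
  obtained from those of \<open>sJ\<close> by \<open>Inv_square\<close>.\<close>

lemma sequiv_I: "sequiv_map S G gbs gpl gpa K lift_ext tJ (\<lambda>a b. Inv G (sJ a b)) (\<lambda>X. Ide G (one lift_ext X))"
proof -
  interpret J: styped S G gbs gpl gpa K tJ by (rule styped_J)
  note os = vert_arr_only xto_simps xta_simps xta_Ide sJ_simps t.typ_simps[unfolded ext_sel(1,2)] J.typ_simps
    tot.Inv_arr tot.Inv_dom tot.Inv_cod tot.isoar_Inv
  have iv: "xta (Inv G u) (Inv G v) = Inv G (xta u v)" if "isoar G u" "isoar G v" "gbs (Dom G v) = gbs (Dom G u)" for u v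
    using t.Inv_ta[of u v] that by (simp add: ext_sel(2))
  show ?thesis
  proof (rule sequiv_map.intro[OF stensor_ext styped_J sequiv_map_axioms.intro], goal_cases)
    case (4 u v)
    then show ?case
      using tot.Inv_square[of "sJ (Dom G u) (Dom G v)" "sJ (Cod G u) (Cod G v)" "ta tJ u v" "xta u v"] sJ_nat[of u v]
      by (simp add: os ext_sel(2))
  next
    case (5 k a b)
    have i: "isoar G (gpa k (sJ a b))" "gpa k (Inv G (sJ a b)) = Inv G (gpa k (sJ a b))"
      using 5 by (simp_all add: os isoar_pa Inv_pa)
    have "Cmp G (gpa k (Inv G (sJ a b))) (Ide G (gpl k (xto a b))) = gpa k (Inv G (sJ a b))"
      using 5 i by (simp add: os tot.Cmp_Ide)
    moreover have "gpa k (Inv G (sJ a b)) = Cmp G (sm tJ k a b) (Inv G (sJ (gpl k a) (gpl k b)))"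
      using tot.Inv_square[of "sJ (gpl k a) (gpl k b)" "gpa k (sJ a b)" "sm tJ k a b" "Ide G (gpl k (xto a b))"] 5 i sJ_sm[of k a b]
      by (simp add: os)
    ultimately show ?case by (simp add: ext_sel(3))
  next
    case (6 a b c)
    let ?P = "Cmp G (xta (sJ a b) (Ide G c)) (sJ (to tJ a b) c)" and ?Q = "Cmp G (xta (Ide G a) (sJ b c)) (sJ a (to tJ b c))"
    have x: "isoar G (xta (sJ a b) (Ide G c))" "isoar G (xta (Ide G a) (sJ b c))"
      "xta (Inv G (sJ a b)) (Ide G c) = Inv G (xta (sJ a b) (Ide G c))" "xta (Ide G a) (Inv G (sJ b c)) = Inv G (xta (Ide G a) (sJ b c))"
      using 6 iv[of "sJ a b" "Ide G c"] iv[of "Ide G a" "sJ b c"] by (simp_all add: os xta_isoar tot.isoar_Ide tot.Inv_Ide)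
    have i: "isoar G ?P" "isoar G ?Q" "Inv G ?P = Cmp G (Inv G (sJ (to tJ a b) c)) (xta (Inv G (sJ a b)) (Ide G c))"
      "Inv G ?Q = Cmp G (Inv G (sJ a (to tJ b c))) (xta (Ide G a) (Inv G (sJ b c)))"
      using 6 x by (simp_all add: os tot.isoar_Cmp tot.Inv_of_Cmp)
    have "Cmp G (sas tJ a b c) (Inv G ?P) = Cmp G (Inv G ?Q) (sas lift_ext a b c)"
      using 6 i(1,2) sas_J[of a b c] by (intro tot.Inv_square) (simp_all add: os)
    then show ?case
      unfolding i ext_sel(2) using 6 x by (simp add: os)
  next
    case (7 a b)
    then show ?case
      using sco_J[of a b] by (intro tot.Inv_square) (simp_all add: os)
  next
    case (12 a)
    have d: "isoar G (sJ a (one lift_ext (gbs a)))" using 12 by (simp add: os)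
    have "Cmp G (ur tJ a) (Inv G (sJ a (one lift_ext (gbs a)))) = ur lift_ext a"
      unfolding uJ[OF 12, symmetric] using 12 d by (simp add: os tot.Cmp_Inv)
    then show ?case using 12 by (simp add: os ext_sel(2) J_units)
  next
    case (13 a)
    have d: "isoar G (sJ (one lift_ext (gbs a)) a)" using 13 by (simp add: os)
    have "Cmp G (ul tJ a) (Inv G (sJ (one lift_ext (gbs a)) a)) = ul lift_ext a"
      unfolding uJ[OF 13, symmetric] using 13 d by (simp add: os tot.Cmp_Inv)
    then show ?case using 13 by (simp add: os ext_sel(2) J_units)
  qed (simp_all add: os ext_sel(1) J_units tot.isoar_Ide)
qed

lemma K_internal_I: "K_internal S H K iJ"
proof -
  interpret e: sequiv_map S G gbs gpl gpa K lift_ext tJ "\<lambda>a b. Inv G (sJ a b)" "\<lambda>X. Ide G (one lift_ext X)"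
    by (rule sequiv_I)
  interpret u: stensor S G gbs gpl gpa K tJ
    by (rule e.transport)
  interpret J: lifted_structure S H K iJ
    by unfold_locales (use shape mJ_typed in \<open>auto simp: constr_I_def\<close>)
  show ?thesis by (rule J.K_internal_lifted)
qed

end

section \<open>Equivalence classes\<close>

text \<open>The image of a class under \<open>F\<close> need not be a whole class; saturation under
  \<open>s\<close> completes it to one, and it does not go beyond the class because \<open>F\<close>
  preserves the relations.\<close>

lemma induced_class:
  assumes "equiv A r" "equiv B s" "x \<in> A" "\<And>x y. (x, y) \<in> r \<Longrightarrow> (F x, F y) \<in> s"
  shows "induced s F (r `` {x}) = s `` {F x}"
proof
  show "induced s F (r `` {x}) \<subseteq> s `` {F x}"
    using assms(4) equivE[OF assms(2)] by (auto simp: induced_def elim: transE)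
  show "s `` {F x} \<subseteq> induced s F (r `` {x})"
    using equiv_class_self[OF assms(1,3)] by (auto simp: induced_def)
qed

text \<open>Half of the statement about inverse bijections. The other half is the same lemma with
  the two sides exchanged.\<close>

lemma induced_inverse:
  assumes r: "equiv A r" and s: "equiv B s" and F: "\<And>x y. (x, y) \<in> r \<Longrightarrow> (F x, F y) \<in> s" "\<And>x. x \<in> A \<Longrightarrow> F x \<in> B"
    and J: "\<And>x y. (x, y) \<in> s \<Longrightarrow> (J x, J y) \<in> r" and i: "\<And>x. x \<in> A \<Longrightarrow> (x, J (F x)) \<in> r"
  shows "\<forall>c\<in>A // r. induced s F c \<in> B // s \<and> induced r J (induced s F c) = c"
proof
  fix c assume "c \<in> A // r"
  then obtain x where x: "x \<in> A" "c = r `` {x}" by (auto elim: quotientE)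
  have 1: "induced s F c = s `` {F x}" unfolding x(2) by (rule induced_class[OF r s x(1) F(1)])
  have "induced r J (s `` {F x}) = r `` {J (F x)}" by (rule induced_class[OF s r F(2)[OF x(1)] J])
  also have "\<dots> = c" unfolding x(2) using equiv_class_eq[OF r i[OF x(1)]] by simp
  finally show "induced s F c \<in> B // s \<and> induced r J (induced s F c) = c"
    unfolding 1 using quotientI[OF F(2)[OF x(1)]] by simp
qed

section \<open>Both notions of equivalence as one relation on tensor structures over
  \<open>G\<close>\<close>

context fibered_over_products
begin

lemma rel_stens_sym: "rel_stens K t1 t2 \<Longrightarrow> rel_stens K t2 t1"
  using sequiv_map.sequiv_map_sym by blast

lemma rel_stens_trans: "rel_stens K t1 t2 \<Longrightarrow> rel_stens K t2 t3 \<Longrightarrow> rel_stens K t1 t3"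
  using sequiv_map_trans by blast

text \<open>With this and its external counterpart, internal and external structures are compared by
  one relation over \<open>G\<close>. Reflexivity, symmetry and transitivity are inherited from
  \<open>sequiv_map\<close>.\<close>

lemma internal_equivalence_iff:
  "(T, T') \<in> internal_equivalence S H K \<longleftrightarrow> K_internal S H K T \<and> K_internal S H K T' \<and> rel_stens K (lift_int T) (lift_int T')"
  unfolding internal_equivalence_def using sequiv_lift equivalence_of_sequiv_lift by blast

lemma external_equivalence_iff':
  "(T, T') \<in> external_equivalence S H K \<longleftrightarrow> K_external S H K T \<and> K_external S H K T' \<and>
    rel_stens K (external_base.lift_ext S H T) (external_base.lift_ext S H T')"
  unfolding external_equivalence_def using external_equivalence_iff by blast

lemma rel_E:
  assumes "K_internal S H K T"
  shows "K_external S H K (constr_E S H T)" "rel_stens K (lift_int T) (external_base.lift_ext S H (constr_E S H T))"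
    "rel_stens K (lift_int T) (lift_int T)"
proof -
  interpret internal_structure S H K T by unfold_locales fact
  show "K_external S H K (constr_E S H T)" by (rule K_external_E)
  show "rel_stens K (lift_int T) (external_base.lift_ext S H (constr_E S H T))" using sequiv_E by blast
  show "rel_stens K (lift_int T) (lift_int T)" using stensor.sequiv_map_refl[OF stensor_lift] by blast
qed

lemma rel_I:
  assumes "K_external S H K T"
  shows "K_internal S H K (constr_I S H T)" "rel_stens K (external_base.lift_ext S H T) (lift_int (constr_I S H T))"
    "rel_stens K (external_base.lift_ext S H T) (external_base.lift_ext S H T)"
proof -
  interpret external_structure S H K T by unfold_locales fact
  show "K_internal S H K (constr_I S H T)" by (rule K_internal_I)
  show "rel_stens K (external_base.lift_ext S H T) (lift_int (constr_I S H T))" using sequiv_I by blast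
  show "rel_stens K (external_base.lift_ext S H T) (external_base.lift_ext S H T)" using stensor.sequiv_map_refl[OF stensor_ext] by blast
qed

text \<open>Over \<open>G\<close> there is the chain E T, T, T', E T' of equivalent
  structures.\<close>

lemma equivalence_E:
  "(T, T') \<in> internal_equivalence S H K \<Longrightarrow> (constr_E S H T, constr_E S H T') \<in> external_equivalence S H K"
  unfolding internal_equivalence_iff external_equivalence_iff' by (meson rel_E rel_stens_sym rel_stens_trans)

lemma equivalence_I:
  "(T, T') \<in> external_equivalence S H K \<Longrightarrow> (constr_I S H T, constr_I S H T') \<in> internal_equivalence S H K"
  unfolding internal_equivalence_iff external_equivalence_iff' by (meson rel_I rel_stens_sym rel_stens_trans)

text \<open>Over \<open>G\<close> the structure T is equivalent to E T, and E T to I (E T).\<close>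

lemma equivalence_IE: "K_internal S H K T \<Longrightarrow> (T, constr_I S H (constr_E S H T)) \<in> internal_equivalence S H K"
  unfolding internal_equivalence_iff by (meson rel_E rel_I rel_stens_trans)

lemma equivalence_EI: "K_external S H K T \<Longrightarrow> (T, constr_E S H (constr_I S H T)) \<in> external_equivalence S H K"
  unfolding external_equivalence_iff' by (meson rel_E rel_I rel_stens_trans)

lemma equiv_internal: "equiv (Collect (K_internal S H K)) (internal_equivalence S H K)"
proof (rule equivI)
  show "internal_equivalence S H K \<subseteq> Collect (K_internal S H K) \<times> Collect (K_internal S H K)"
    by (auto simp: internal_equivalence_def)
  show "refl_on (Collect (K_internal S H K)) (internal_equivalence S H K)"
    by (auto simp: refl_on_def internal_equivalence_iff dest: rel_E(3))
  show "sym (internal_equivalence S H K)"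
    by (rule symI) (use rel_stens_sym in \<open>auto simp: internal_equivalence_iff\<close>)
  show "trans (internal_equivalence S H K)"
    by (rule transI, unfold internal_equivalence_iff) (meson rel_stens_trans)
qed

lemma equiv_external: "equiv (Collect (K_external S H K)) (external_equivalence S H K)"
proof (rule equivI)
  show "external_equivalence S H K \<subseteq> Collect (K_external S H K) \<times> Collect (K_external S H K)"
    by (auto simp: external_equivalence_def)
  show "refl_on (Collect (K_external S H K)) (external_equivalence S H K)"
    by (auto simp: refl_on_def external_equivalence_iff' dest: rel_I(3))
  show "sym (external_equivalence S H K)"
    by (rule symI) (use rel_stens_sym in \<open>auto simp: external_equivalence_iff'\<close>)
  show "trans (external_equivalence S H K)"
    by (rule transI, unfold external_equivalence_iff') (meson rel_stens_trans)
qed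

end

theorem theorem6p1:
  fixes S :: "('s, 'f) pcat" and H :: "('s, 'f, 'o, 'a) fib" and K :: "tensor_property set"
  assumes "category_with_binary_products S" and "fibered_category S H"
  shows
    "let ints = Collect (K_internal S H K); exts = Collect (K_external S H K);
         ri = internal_equivalence S H K; re = external_equivalence S H K;
         E = constr_E S H; I = constr_I S H
     in (\<forall>T\<in>ints. E T \<in> exts) \<and> (\<forall>T\<in>exts. I T \<in> ints) \<and>
        equiv ints ri \<and> equiv exts re \<and>
        (\<forall>(T, T')\<in>ri. (E T, E T') \<in> re) \<and> (\<forall>(T, T')\<in>re. (I T, I T') \<in> ri) \<and>
        bij_betw (induced re E) (ints // ri) (exts // re) \<and>
        bij_betw (induced ri I) (exts // re) (ints // ri) \<and>
        (\<forall>c\<in>ints // ri. induced ri I (induced re E c) = c) \<and>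
        (\<forall>c\<in>exts // re. induced re E (induced ri I c) = c)"
proof -
  interpret fibered_over_products S H
    using assms by (rule fibered_over_products.intro)
  let ?ints = "Collect (K_internal S H K)" and ?exts = "Collect (K_external S H K)"
  let ?ri = "internal_equivalence S H K" and ?re = "external_equivalence S H K"
  let ?E = "constr_E S H" and ?I = "constr_I S H"
  have E: "\<forall>c\<in>?ints // ?ri. induced ?re ?E c \<in> ?exts // ?re \<and> induced ?ri ?I (induced ?re ?E c) = c"
    by (rule induced_inverse[OF equiv_internal equiv_external])
      (use equivalence_E equivalence_I equivalence_IE rel_E(1) in auto)
  have I: "\<forall>c\<in>?exts // ?re. induced ?ri ?I c \<in> ?ints // ?ri \<and> induced ?re ?E (induced ?ri ?I c) = c"
    by (rule induced_inverse[OF equiv_external equiv_internal])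
      (use equivalence_E equivalence_I equivalence_EI rel_I(1) in auto)
  have "bij_betw (induced ?re ?E) (?ints // ?ri) (?exts // ?re)" "bij_betw (induced ?ri ?I) (?exts // ?re) (?ints // ?ri)"
    using E I by (intro bij_betw_byWitness[where f' = "induced ?ri ?I"] bij_betw_byWitness[where f' = "induced ?re ?E"]; blast)+
  then show ?thesis
    unfolding Let_def using E I equiv_internal equiv_external
    by (intro conjI ballI) (auto intro: equivalence_E equivalence_I rel_E(1) rel_I(1))
qed

end
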